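(* Let $Q$ be a quiver whose underlying graph is a simply-laced Dynkin diagram $\Delta$, let $k$ be an algebraically closed field, and let $\mathcal C=D^b(kQ)/F$ be the cluster category. The map $\psi_Q$ is a bijection between $\operatorname{ind}\mathcal C$ and the set of isomorphism classes of indecomposable $k\widetilde Q$-modules (i.e. indecomposable decorated representations). It follows that $\gamma_Q:=\mathbf{sdim}\circ\psi_Q$ is a bijection between $\operatorname{ind}\mathcal C$ and $\Phi_{\geq-1}$ (and thus induces a bijection between $\operatorname{ind}\mathcal C$ and the set of cluster variables of the cluster algebra of type $\Delta$).
   Context: Cluster category: let $\mathcal D=D^b(kQ)$, with shift $[1]$ and Auslander–Reiten translation $\tau$, and $F=\tau^{-1}[1]$. $\mathcal C=\mathcal D/F$ has as objects the $F$-orbits $\widetilde X$ of objects of $\mathcal D$, with $\operatorname{Hom}_{\mathcal C}(\widetilde X,\widetilde Y)=\coprod_{i\in\mathbb Z}\operatorname{Hom}_{\mathcal D}(F^iX,Y)$. $\operatorname{ind}\mathcal C$ is the set of isomorphism classes of indecomposable objects. $\Phi$ is the root system of type $\Delta$ with simple roots $\alpha_i$, and $\Phi_{\geq-1}$ is the set of positive roots together with the negative simple roots. Decorated representations: $\widetilde Q$ is the quiver obtained from $Q$ by adding a disjoint copy $\{i_-:i\in Q_0\}$ of its vertex set $Q_0$, with no arrows incident to the new vertices; $S_i^-$ is the simple $k\widetilde Q$-module at $i_-$. A $k\widetilde Q$-module is $M=M^+\coprod V$ with $M^+=\coprod_{i\in Q_0}M_i^+$ a $kQ$-module and $V=\coprod_{i\in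 Q_0} V_i$ a $Q_0$-graded vector space, and $\mathbf{sdim}(M)=\sum_i\dim(M_i^+)\alpha_i-\sum_i\dim(V_i)\alpha_i$. By Gabriel's Theorem $\mathbf{sdim}$ parametrises the indecomposable $k\widetilde Q$-modules by $\Phi_{\geq-1}$. Map $\psi_Q$: each object of $\operatorname{ind}\mathcal C$ can be written $\widetilde X$ with either (1) $X=M^+$ an indecomposable $kQ$-module, or (2) $X=P_i[1]$, with $P_i$ the indecomposable projective $kQ$-module at $i\in Q_0$. Put $\psi_Q(\widetilde X)=M^+$ in case (1) and $\psi_Q(\widetilde X)=S_i^-$ in case (2). The cluster variables of the (coefficient-free) Fomin–Zelevinsky cluster algebra of type $\Delta$ are in 1–1 correspondence with $\Phi_{\geq-1}$ by Fomin–Zelevinsky; this correspondence is the one used in the last assertion. *)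

theory Defs
  imports
    "Graph_Theory.Digraph"
    "Jordan_Normal_Form.Matrix"
    "HOL-Algebra.FiniteProduct"
    "HOL-Computational_Algebra.Polynomial"
    "HOL-Library.Poly_Mapping"
    "HOL-Library.FuncSet"
begin

section \<open>Linear categories\<close>

text \<open>
  Hom-sets of distinct pairs of objects are disjoint in all instances below, because a morphism
  is a triple of its source, its target and the actual data.
\<close>

record ('o, 'm, 'k) lincat =
  Ob  :: "'o set"
  Hom :: "'o \<Rightarrow> 'o \<Rightarrow> 'm set"
  Cmp :: "'m \<Rightarrow> 'm \<Rightarrow> 'm"  \<comment> \<open>\<open>Cmp C g f\<close> is \<open>g\<close> after \<open>f\<close>\<close>
  Idn :: "'o \<Rightarrow> 'm"
  Zer :: "'o \<Rightarrow> 'o \<Rightarrow> 'm"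
  Add :: "'m \<Rightarrow> 'm \<Rightarrow> 'm"
  Scl :: "'k \<Rightarrow> 'm \<Rightarrow> 'm"

definition all_mors :: "('o, 'm, 'k) lincat \<Rightarrow> 'm set" where
  "all_mors C = (\<Union>X\<in>Ob C. \<Union>Y\<in>Ob C. Hom C X Y)"

definition iso_obj :: "('o, 'm, 'k) lincat \<Rightarrow> 'o \<Rightarrow> 'o \<Rightarrow> bool" where
  "iso_obj C X Y \<longleftrightarrow>
     (\<exists>f\<in>Hom C X Y. \<exists>g\<in>Hom C Y X. Cmp C g f = Idn C X \<and> Cmp C f g = Idn C Y)"

definition iso_class :: "('o, 'm, 'k) lincat \<Rightarrow> 'o \<Rightarrow> 'o set" where
  "iso_class C X = {Y \<in> Ob C. iso_obj C X Y}"

definition zero_obj :: "('o, 'm, 'k) lincat \<Rightarrow> 'o \<Rightarrow> bool" where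
  "zero_obj C X \<longleftrightarrow> Idn C X = Zer C X X"

definition is_direct_sum :: "('o, 'm, 'k) lincat \<Rightarrow> 'o \<Rightarrow> 'o \<Rightarrow> 'o \<Rightarrow> bool" where
  "is_direct_sum C X Y Z \<longleftrightarrow>
     (\<exists>i\<in>Hom C Y X. \<exists>j\<in>Hom C Z X. \<exists>p\<in>Hom C X Y. \<exists>q\<in>Hom C X Z.
        Cmp C p i = Idn C Y \<and> Cmp C q j = Idn C Z \<and>
        Cmp C q i = Zer C Y Z \<and> Cmp C p j = Zer C Z Y \<and>
        Add C (Cmp C i p) (Cmp C j q) = Idn C X)"

definition indecomposable :: "('o, 'm, 'k) lincat \<Rightarrow> 'o \<Rightarrow> bool" where
  "indecomposable C X \<longleftrightarrow> X \<in> Ob C \<and> \<not> zero_obj C X \<and>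
     (\<forall>Y\<in>Ob C. \<forall>Z\<in>Ob C. is_direct_sum C X Y Z \<longrightarrow> zero_obj C Y \<or> zero_obj C Z)"

definition ind :: "('o, 'm, 'k) lincat \<Rightarrow> 'o set set" where
  "ind C = iso_class C ` {X. indecomposable C X}"

type_synonym ('o, 'm) lfunctor = "('o \<Rightarrow> 'o) \<times> ('m \<Rightarrow> 'm)"

definition linear_automorphism :: "('o, 'm, 'k) lincat \<Rightarrow> ('o, 'm) lfunctor \<Rightarrow> bool" where
  "linear_automorphism C F \<longleftrightarrow>
     bij_betw (fst F) (Ob C) (Ob C) \<and>
     (\<forall>X\<in>Ob C. snd F (Idn C X) = Idn C (fst F X)) \<and>
     (\<forall>X\<in>Ob C. \<forall>Y\<in>Ob C. bij_betw (snd F) (Hom C X Y) (Hom C (fst F X) (fst F Y))) \<and>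
     (\<forall>X\<in>Ob C. \<forall>Y\<in>Ob C. \<forall>Z\<in>Ob C. \<forall>f\<in>Hom C X Y. \<forall>g\<in>Hom C Y Z.
        snd F (Cmp C g f) = Cmp C (snd F g) (snd F f)) \<and>
     (\<forall>X\<in>Ob C. \<forall>Y\<in>Ob C. \<forall>f\<in>Hom C X Y. \<forall>g\<in>Hom C X Y. \<forall>a.
        snd F (Add C f g) = Add C (snd F f) (snd F g) \<and> snd F (Scl C a f) = Scl C a (snd F f))"

definition linear_functional :: "('o, 'm, 'k::field) lincat \<Rightarrow> 'o \<Rightarrow> 'o \<Rightarrow> ('m \<Rightarrow> 'k) \<Rightarrow> bool" where
  "linear_functional C X Y l \<longleftrightarrow>
     (\<forall>f\<in>Hom C X Y. \<forall>g\<in>Hom C X Y. \<forall>a.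
        l (Add C f g) = l f + l g \<and> l (Scl C a f) = a * l f)"

text \<open>
  \<open>F\<close> is a Serre functor: there are linear bijections from \<open>Hom(Y, F X)\<close> to the dual space of
  \<open>Hom(X, Y)\<close>, natural in \<open>X\<close> and \<open>Y\<close>. The value at \<open>f\<close> of the functional belonging to \<open>g\<close> is
  \<open>\<eta> X Y f g\<close>.
\<close>

definition serre_functor :: "('o, 'm, 'k::field) lincat \<Rightarrow> ('o, 'm) lfunctor \<Rightarrow> bool" where
  "serre_functor C F \<longleftrightarrow> linear_automorphism C F \<and>
     (\<exists>\<eta> :: 'o \<Rightarrow> 'o \<Rightarrow> 'm \<Rightarrow> 'm \<Rightarrow> 'k.
       (\<forall>X\<in>Ob C. \<forall>Y\<in>Ob C.
          (\<forall>g\<in>Hom C Y (fst F X). linear_functional C X Y (\<lambda>f. \<eta> X Y f g)) \<and>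
          (\<forall>f\<in>Hom C X Y. linear_functional C Y (fst F X) (\<eta> X Y f)) \<and>
          (\<forall>l. linear_functional C X Y l \<longrightarrow>
             (\<exists>!g. g \<in> Hom C Y (fst F X) \<and> (\<forall>f\<in>Hom C X Y. \<eta> X Y f g = l f)))) \<and>
       (\<forall>X\<in>Ob C. \<forall>Y\<in>Ob C. \<forall>Y'\<in>Ob C.
          \<forall>f\<in>Hom C X Y. \<forall>h\<in>Hom C Y Y'. \<forall>g\<in>Hom C Y' (fst F X).
            \<eta> X Y' (Cmp C h f) g = \<eta> X Y f (Cmp C g h)) \<and>
       (\<forall>X'\<in>Ob C. \<forall>X\<in>Ob C. \<forall>Y\<in>Ob C.
          \<forall>h\<in>Hom C X' X. \<forall>f\<in>Hom C X Y. \<forall>g\<in>Hom C Y (fst F X').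
            \<eta> X' Y (Cmp C f h) g = \<eta> X Y f (Cmp C (snd F h) g)))"

section \<open>Orbit categories\<close>

definition int_iter :: "'x set \<Rightarrow> ('x \<Rightarrow> 'x) \<Rightarrow> int \<Rightarrow> 'x \<Rightarrow> 'x" where
  "int_iter A g i = (if i \<ge> 0 then g ^^ nat i else inv_into A g ^^ nat (- i))"

definition obj_pow :: "('o, 'm, 'k) lincat \<Rightarrow> ('o, 'm) lfunctor \<Rightarrow> int \<Rightarrow> 'o \<Rightarrow> 'o" where
  "obj_pow C F = int_iter (Ob C) (fst F)"

definition mor_pow :: "('o, 'm, 'k) lincat \<Rightarrow> ('o, 'm) lfunctor \<Rightarrow> int \<Rightarrow> 'm \<Rightarrow> 'm" where
  "mor_pow C F = int_iter (all_mors C) (snd F)"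

definition functor_orbit :: "('o, 'm, 'k) lincat \<Rightarrow> ('o, 'm) lfunctor \<Rightarrow> 'o \<Rightarrow> 'o set" where
  "functor_orbit C F X = range (\<lambda>i. obj_pow C F i X)"

definition rep_of :: "'o set \<Rightarrow> 'o" where
  "rep_of U = (SOME X. X \<in> U)"

definition hom_monoid :: "('o, 'm, 'k) lincat \<Rightarrow> 'o \<Rightarrow> 'o \<Rightarrow> 'm monoid" where
  "hom_monoid C X Y = \<lparr>carrier = Hom C X Y, monoid.mult = Add C, one = Zer C X Y\<rparr>"

text \<open>
  The objects are the \<open>F\<close>-orbits. A morphism from the orbit of \<open>X\<close> to the orbit of \<open>Y\<close> is a
  finitely supported family \<open>u\<close> with \<open>u i \<in> Hom(F^i X, Y)\<close>, where \<open>X\<close> and \<open>Y\<close> are chosen once and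
  for all in their orbits. The composite of \<open>u\<close> and \<open>w\<close> has \<open>n\<close>-th component
  \<open>\<Sum>i. w (n - i) \<circ> F^(n - i) (u i)\<close>.
\<close>

definition orbit_category ::
  "('o, 'm, 'k::field) lincat \<Rightarrow> ('o, 'm) lfunctor \<Rightarrow>
   ('o set, 'o set \<times> 'o set \<times> (int \<Rightarrow> 'm), 'k) lincat" where
  "orbit_category C F = \<lparr>
     Ob = functor_orbit C F ` Ob C,
     Hom = (\<lambda>U V. {(U, V, u) | u.
        (\<forall>i. u i \<in> Hom C (obj_pow C F i (rep_of U)) (rep_of V)) \<and>
        finite {i. u i \<noteq> Zer C (obj_pow C F i (rep_of U)) (rep_of V)}}),
     Cmp = (\<lambda>(_, W, w) (U, V, u). (U, W, \<lambda>n.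
        finprod (hom_monoid C (obj_pow C F n (rep_of U)) (rep_of W))
          (\<lambda>i. Cmp C (w (n - i)) (mor_pow C F (n - i) (u i)))
          {i. u i \<noteq> Zer C (obj_pow C F i (rep_of U)) (rep_of V)})),
     Idn = (\<lambda>U. (U, U, \<lambda>i. if i = 0 then Idn C (rep_of U)
                            else Zer C (obj_pow C F i (rep_of U)) (rep_of U))),
     Zer = (\<lambda>U V. (U, V, \<lambda>i. Zer C (obj_pow C F i (rep_of U)) (rep_of V))),
     Add = (\<lambda>(U, V, u) (_, _, w). (U, V, \<lambda>i. Add C (u i) (w i))),
     Scl = (\<lambda>a (U, V, u). (U, V, \<lambda>i. Scl C a (u i)))\<rparr>"

section \<open>Representations of a quiver\<close>

text \<open>
  A finite-dimensional module over the path algebra is a representation: a dimension at each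
  vertex and a matrix for each arrow, acting on column vectors. Dimensions vanish off the vertex
  set, so a family of matrices indexed by all of \<open>'v\<close> carries no information there.
\<close>

type_synonym ('v, 'a, 'k) rep = "('v \<Rightarrow> nat) \<times> ('a \<Rightarrow> 'k mat)"

definition reps :: "('v, 'a) pre_digraph \<Rightarrow> ('v, 'a, 'k::field) rep set" where
  "reps Q = {M. (\<forall>v. v \<notin> verts Q \<longrightarrow> fst M v = 0) \<and> snd M \<in> extensional (arcs Q) \<and>
     (\<forall>a\<in>arcs Q. snd M a \<in> carrier_mat (fst M (head Q a)) (fst M (tail Q a)))}"

definition rep_maps ::
  "('v, 'a) pre_digraph \<Rightarrow> ('v, 'a, 'k::field) rep \<Rightarrow> ('v, 'a, 'k) rep \<Rightarrow> ('v \<Rightarrow> 'k mat) set" where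
  "rep_maps Q M N = {f. (\<forall>v. f v \<in> carrier_mat (fst N v) (fst M v)) \<and>
     (\<forall>a\<in>arcs Q. f (head Q a) * snd M a = snd N a * f (tail Q a))}"

type_synonym ('v, 'a, 'k) rep_mor = "('v, 'a, 'k) rep \<times> ('v, 'a, 'k) rep \<times> ('v \<Rightarrow> 'k mat)"

definition rep_category ::
  "('v, 'a) pre_digraph \<Rightarrow> (('v, 'a, 'k::field) rep, ('v, 'a, 'k) rep_mor, 'k) lincat" where
  "rep_category Q = \<lparr>
     Ob = reps Q,
     Hom = (\<lambda>M N. {(M, N, f) | f. f \<in> rep_maps Q M N}),
     Cmp = (\<lambda>(_, L, g) (M, _, f). (M, L, \<lambda>v. g v * f v)),
     Idn = (\<lambda>M. (M, M, \<lambda>v. 1\<^sub>m (fst M v))),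
     Zer = (\<lambda>M N. (M, N, \<lambda>v. 0\<^sub>m (fst N v) (fst M v))),
     Add = (\<lambda>(M, N, f) (_, _, g). (M, N, \<lambda>v. f v + g v)),
     Scl = (\<lambda>a (M, N, f). (M, N, \<lambda>v. a \<cdot>\<^sub>m f v))\<rparr>"

definition zero_rep :: "('v, 'a) pre_digraph \<Rightarrow> ('v, 'a, 'k::field) rep" where
  "zero_rep Q = (\<lambda>v. 0, restrict (\<lambda>a. 0\<^sub>m 0 0) (arcs Q))"

definition simple_rep :: "('v, 'a) pre_digraph \<Rightarrow> 'v \<Rightarrow> ('v, 'a, 'k::field) rep" where
  "simple_rep Q i = (let d = (\<lambda>v. if v = i then 1 else 0)
     in (d, restrict (\<lambda>a. 0\<^sub>m (d (head Q a)) (d (tail Q a))) (arcs Q)))"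

definition rep_surj :: "('v, 'a, 'k::field) rep \<Rightarrow> ('v, 'a, 'k) rep \<Rightarrow> ('v \<Rightarrow> 'k mat) \<Rightarrow> bool" where
  "rep_surj M N f \<longleftrightarrow>
     (\<forall>v. \<forall>y\<in>carrier_vec (fst N v). \<exists>x\<in>carrier_vec (fst M v). f v *\<^sub>v x = y)"

definition projective_rep :: "('v, 'a) pre_digraph \<Rightarrow> ('v, 'a, 'k::field) rep \<Rightarrow> bool" where
  "projective_rep Q P \<longleftrightarrow> P \<in> reps Q \<and>
     (\<forall>M\<in>reps Q. \<forall>N\<in>reps Q. \<forall>p\<in>rep_maps Q M N. \<forall>f\<in>rep_maps Q P N.
        rep_surj M N p \<longrightarrow> (\<exists>g\<in>rep_maps Q P M. (\<lambda>v. p v * g v) = f))"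

text \<open>\<open>P\<close> is a copy of \<open>P_i\<close>: indecomposable projective and mapping onto the simple module at \<open>i\<close>.\<close>

definition is_indec_projective_at ::
  "('v, 'a) pre_digraph \<Rightarrow> 'v \<Rightarrow> ('v, 'a, 'k::field) rep \<Rightarrow> bool" where
  "is_indec_projective_at Q i P \<longleftrightarrow>
     indecomposable (rep_category Q) P \<and> projective_rep Q P \<and>
     (\<exists>f\<in>rep_maps Q P (simple_rep Q i). rep_surj P (simple_rep Q i) f)"

section \<open>The bounded derived category\<close>

type_synonym ('v, 'a, 'k) cpx = "(int \<Rightarrow> ('v, 'a, 'k) rep) \<times> (int \<Rightarrow> 'v \<Rightarrow> 'k mat)"

definition cdim :: "('v, 'a, 'k) cpx \<Rightarrow> int \<Rightarrow> 'v \<Rightarrow> nat" where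
  "cdim X i v = fst (fst X i) v"

definition complexes :: "('v, 'a) pre_digraph \<Rightarrow> ('v, 'a, 'k::field) cpx set" where
  "complexes Q = {X.
     (\<forall>i. fst X i \<in> reps Q) \<and>
     (\<forall>i. snd X i \<in> rep_maps Q (fst X i) (fst X (i + 1))) \<and>
     (\<forall>i v. snd X (i + 1) v * snd X i v = 0\<^sub>m (cdim X (i + 2) v) (cdim X i v)) \<and>
     finite {i. \<exists>v. cdim X i v \<noteq> 0}}"

type_synonym ('v, 'k) cmap = "int \<Rightarrow> 'v \<Rightarrow> 'k mat"

definition chain_maps ::
  "('v, 'a) pre_digraph \<Rightarrow> ('v, 'a, 'k::field) cpx \<Rightarrow> ('v, 'a, 'k) cpx \<Rightarrow> ('v, 'k) cmap set" where
  "chain_maps Q X Y = {f.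
     (\<forall>i. f i \<in> rep_maps Q (fst X i) (fst Y i)) \<and>
     (\<forall>i v. f (i + 1) v * snd X i v = snd Y i v * f i v)}"

definition cmap_comp :: "('v, 'k::field) cmap \<Rightarrow> ('v, 'k) cmap \<Rightarrow> ('v, 'k) cmap" where
  "cmap_comp g f = (\<lambda>i v. g i v * f i v)"

definition homotopic ::
  "('v, 'a) pre_digraph \<Rightarrow> ('v, 'a, 'k::field) cpx \<Rightarrow> ('v, 'a, 'k) cpx \<Rightarrow>
   ('v, 'k) cmap \<Rightarrow> ('v, 'k) cmap \<Rightarrow> bool" where
  "homotopic Q X Y f g \<longleftrightarrow>
     (\<exists>h. (\<forall>i. h i \<in> rep_maps Q (fst X i) (fst Y (i - 1))) \<and>
          (\<forall>i v. f i v - g i v = snd Y (i - 1) v * h i v + h (i + 1) v * snd X i v))"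

definition cocycles :: "('v, 'a, 'k::field) cpx \<Rightarrow> int \<Rightarrow> 'v \<Rightarrow> 'k vec set" where
  "cocycles X i v = {x \<in> carrier_vec (cdim X i v). snd X i v *\<^sub>v x = 0\<^sub>v (cdim X (i + 1) v)}"

definition coboundaries :: "('v, 'a, 'k::field) cpx \<Rightarrow> int \<Rightarrow> 'v \<Rightarrow> 'k vec set" where
  "coboundaries X i v = (\<lambda>y. snd X (i - 1) v *\<^sub>v y) ` carrier_vec (cdim X (i - 1) v)"

text \<open>Injectivity and surjectivity of the induced map on cohomology, at each degree and vertex.\<close>

definition quasi_iso ::
  "('v, 'a, 'k::field) cpx \<Rightarrow> ('v, 'a, 'k) cpx \<Rightarrow> ('v, 'k) cmap \<Rightarrow> bool" where
  "quasi_iso X Y f \<longleftrightarrow> (\<forall>i v.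
     (\<forall>x\<in>cocycles X i v. f i v *\<^sub>v x \<in> coboundaries Y i v \<longrightarrow> x \<in> coboundaries X i v) \<and>
     (\<forall>y\<in>cocycles Y i v. \<exists>x\<in>cocycles X i v. y - f i v *\<^sub>v x \<in> coboundaries Y i v))"

text \<open>
  A morphism from \<open>X\<close> to \<open>Y\<close> in the derived category is a class of roofs \<open>(Z, s, f)\<close>, where \<open>s\<close> is
  a quasi-isomorphism from \<open>Z\<close> to \<open>X\<close> and \<open>f\<close> is a chain map from \<open>Z\<close> to \<open>Y\<close>; it stands for the
  fraction \<open>f \<circ> s^(-1)\<close> in the localisation of the homotopy category.
\<close>

type_synonym ('v, 'a, 'k) roof = "('v, 'a, 'k) cpx \<times> ('v, 'k) cmap \<times> ('v, 'k) cmap"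

definition roofs ::
  "('v, 'a) pre_digraph \<Rightarrow> ('v, 'a, 'k::field) cpx \<Rightarrow> ('v, 'a, 'k) cpx \<Rightarrow> ('v, 'a, 'k) roof set" where
  "roofs Q X Y = {(Z, s, f). Z \<in> complexes Q \<and> s \<in> chain_maps Q Z X \<and> quasi_iso Z X s \<and>
     f \<in> chain_maps Q Z Y}"

definition roof_rel ::
  "('v, 'a) pre_digraph \<Rightarrow> ('v, 'a, 'k::field) cpx \<Rightarrow> ('v, 'a, 'k) cpx \<Rightarrow>
   (('v, 'a, 'k) roof \<times> ('v, 'a, 'k) roof) set" where
  "roof_rel Q X Y = {((Z, s, f), (Z', s', f')).
     (Z, s, f) \<in> roofs Q X Y \<and> (Z', s', f') \<in> roofs Q X Y \<and>
     (\<exists>W\<in>complexes Q. \<exists>u\<in>chain_maps Q W Z. \<exists>u'\<in>chain_maps Q W Z'.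
        quasi_iso W X (cmap_comp s u) \<and>
        homotopic Q W X (cmap_comp s u) (cmap_comp s' u') \<and>
        homotopic Q W Y (cmap_comp f u) (cmap_comp f' u'))}"

definition roof_class ::
  "('v, 'a) pre_digraph \<Rightarrow> ('v, 'a, 'k::field) cpx \<Rightarrow> ('v, 'a, 'k) cpx \<Rightarrow>
   ('v, 'a, 'k) roof \<Rightarrow> ('v, 'a, 'k) roof set" where
  "roof_class Q X Y r = roof_rel Q X Y `` {r}"

type_synonym ('v, 'a, 'k) D_mor = "('v, 'a, 'k) cpx \<times> ('v, 'a, 'k) cpx \<times> ('v, 'a, 'k) roof set"

text \<open>
  Two classes are composed by completing \<open>f\<close> and the quasi-isomorphism \<open>t\<close> of the second roof to a
  square commuting up to homotopy, and added after passing to a common denominator.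
\<close>

definition derived_category ::
  "('v, 'a) pre_digraph \<Rightarrow> (('v, 'a, 'k::field) cpx, ('v, 'a, 'k) D_mor, 'k) lincat" where
  "derived_category Q = \<lparr>
     Ob = complexes Q,
     Hom = (\<lambda>X Y. {(X, Y, c) | c. c \<in> roofs Q X Y // roof_rel Q X Y}),
     Cmp = (\<lambda>(Y, L, d) (X, _, c). (X, L,
        \<Union> {roof_class Q X L (V, cmap_comp s u, cmap_comp g w) | V s u g w.
             \<exists>Z f Z' t. (Z, s, f) \<in> c \<and> (Z', t, g) \<in> d \<and> V \<in> complexes Q \<and>
               u \<in> chain_maps Q V Z \<and> w \<in> chain_maps Q V Z' \<and> quasi_iso V Z u \<and>
               homotopic Q V Y (cmap_comp f u) (cmap_comp t w)})),
     Idn = (\<lambda>X. (X, X, roof_class Q X X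
        (X, \<lambda>i v. 1\<^sub>m (cdim X i v), \<lambda>i v. 1\<^sub>m (cdim X i v)))),
     Zer = (\<lambda>X Y. (X, Y, roof_class Q X Y
        (X, \<lambda>i v. 1\<^sub>m (cdim X i v), \<lambda>i v. 0\<^sub>m (cdim Y i v) (cdim X i v)))),
     Add = (\<lambda>(X, Y, c) (_, _, d). (X, Y,
        \<Union> {roof_class Q X Y (Z, s, \<lambda>i v. f i v + g i v) | Z s f g.
             (Z, s, f) \<in> c \<and> (Z, s, g) \<in> d})),
     Scl = (\<lambda>a (X, Y, c). (X, Y,
        \<Union> {roof_class Q X Y (Z, s, \<lambda>i v. a \<cdot>\<^sub>m f i v) | Z s f. (Z, s, f) \<in> c}))\<rparr>"

definition shift_cpx :: "('v, 'a, 'k::field) cpx \<Rightarrow> ('v, 'a, 'k) cpx" where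
  "shift_cpx X = (\<lambda>i. fst X (i + 1), \<lambda>i v. - snd X (i + 1) v)"

definition shift_roof :: "('v, 'a, 'k::field) roof \<Rightarrow> ('v, 'a, 'k) roof" where
  "shift_roof = (\<lambda>(Z, s, f). (shift_cpx Z, \<lambda>i. s (i + 1), \<lambda>i. f (i + 1)))"

definition shift_mor :: "('v, 'a, 'k::field) D_mor \<Rightarrow> ('v, 'a, 'k) D_mor" where
  "shift_mor = (\<lambda>(X, Y, c). (shift_cpx X, shift_cpx Y, shift_roof ` c))"

definition stalk :: "('v, 'a) pre_digraph \<Rightarrow> ('v, 'a, 'k::field) rep \<Rightarrow> ('v, 'a, 'k) cpx" where
  "stalk Q M = (let X = (\<lambda>i::int. if i = 0 then M else zero_rep Q)
     in (X, \<lambda>i v. 0\<^sub>m (fst (X (i + 1)) v) (fst (X i) v)))"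

section \<open>The cluster category\<close>

type_synonym ('v, 'a, 'k) D_functor = "(('v, 'a, 'k) cpx, ('v, 'a, 'k) D_mor) lfunctor"

text \<open>
  \<open>\<tau>\<close> is an Auslander-Reiten translation if \<open>\<tau>\<close> followed by \<open>[1]\<close> is a Serre functor, i.e. if
  \<open>Hom(Y, (\<tau> X)[1])\<close> is naturally dual to \<open>Hom(X, Y)\<close>. This determines \<open>\<tau>\<close> up to natural
  isomorphism; as usual when orbits are formed, \<open>\<tau>\<close> is taken to be an automorphism and not just
  an autoequivalence.
\<close>

definition AR_translation ::
  "('v, 'a) pre_digraph \<Rightarrow> ('v, 'a, 'k::field) D_functor \<Rightarrow> bool" where
  "AR_translation Q \<tau> \<longleftrightarrow>
     linear_automorphism (derived_category Q) \<tau> \<and>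
     serre_functor (derived_category Q) (shift_cpx \<circ> fst \<tau>, shift_mor \<circ> snd \<tau>)"

definition cluster_functor ::
  "('v, 'a) pre_digraph \<Rightarrow> ('v, 'a, 'k::field) D_functor \<Rightarrow> ('v, 'a, 'k) D_functor" where
  "cluster_functor Q \<tau> =
     (inv_into (complexes Q) (fst \<tau>) \<circ> shift_cpx,
      inv_into (all_mors (derived_category Q)) (snd \<tau>) \<circ> shift_mor)"

type_synonym ('v, 'a, 'k) C_obj = "('v, 'a, 'k) cpx set"
type_synonym ('v, 'a, 'k) C_mor =
  "('v, 'a, 'k) C_obj \<times> ('v, 'a, 'k) C_obj \<times> (int \<Rightarrow> ('v, 'a, 'k) D_mor)"

definition cluster_category ::
  "('v, 'a) pre_digraph \<Rightarrow> ('v, 'a, 'k::field) D_functor \<Rightarrow>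
   (('v, 'a, 'k) C_obj, ('v, 'a, 'k) C_mor, 'k) lincat" where
  "cluster_category Q \<tau> = orbit_category (derived_category Q) (cluster_functor Q \<tau>)"

definition tilde ::
  "('v, 'a) pre_digraph \<Rightarrow> ('v, 'a, 'k::field) D_functor \<Rightarrow> ('v, 'a, 'k) cpx \<Rightarrow> ('v, 'a, 'k) C_obj" where
  "tilde Q \<tau> = functor_orbit (derived_category Q) (cluster_functor Q \<tau>)"

section \<open>Decorated representations\<close>

text \<open>\<open>Inl i\<close> is the vertex \<open>i\<close> of the original quiver, and \<open>Inr i\<close> is the new vertex \<open>i_-\<close>.\<close>

definition decorated_quiver :: "('v, 'a) pre_digraph \<Rightarrow> ('v + 'v, 'a) pre_digraph" where
  "decorated_quiver Q = \<lparr>verts = verts Q <+> verts Q, arcs = arcs Q,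
     tail = Inl \<circ> tail Q, head = Inl \<circ> head Q\<rparr>"

definition as_decorated :: "('v, 'a, 'k) rep \<Rightarrow> ('v + 'v, 'a, 'k) rep" where
  "as_decorated M = (case_sum (fst M) (\<lambda>_. 0), snd M)"

definition neg_simple :: "('v, 'a) pre_digraph \<Rightarrow> 'v \<Rightarrow> ('v + 'v, 'a, 'k::field) rep" where
  "neg_simple Q i = simple_rep (decorated_quiver Q) (Inr i)"

text \<open>The element \<open>\<Sum>i. c i * \<alpha>_i\<close> of the root lattice is represented by the function \<open>c\<close>.\<close>

definition sdim :: "('v + 'v, 'a, 'k) rep \<Rightarrow> 'v \<Rightarrow> int" where
  "sdim M = (\<lambda>i. int (fst M (Inl i)) - int (fst M (Inr i)))"

definition sdim_class :: "('v + 'v, 'a, 'k) rep set \<Rightarrow> 'v \<Rightarrow> int" where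
  "sdim_class m = sdim (SOME M. M \<in> m)"

definition psi_rel ::
  "('v, 'a) pre_digraph \<Rightarrow> ('v, 'a, 'k::field) D_functor \<Rightarrow>
   ('v, 'a, 'k) C_obj set \<Rightarrow> ('v + 'v, 'a, 'k) rep set \<Rightarrow> bool" where
  "psi_rel Q \<tau> c m \<longleftrightarrow>
     (\<exists>M. indecomposable (rep_category Q) M \<and>
        c = iso_class (cluster_category Q \<tau>) (tilde Q \<tau> (stalk Q M)) \<and>
        m = iso_class (rep_category (decorated_quiver Q)) (as_decorated M)) \<or>
     (\<exists>i\<in>verts Q. \<exists>P. is_indec_projective_at Q i P \<and>
        c = iso_class (cluster_category Q \<tau>) (tilde Q \<tau> (shift_cpx (stalk Q P))) \<and>
        m = iso_class (rep_category (decorated_quiver Q)) (neg_simple Q i))"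

definition psi ::
  "('v, 'a) pre_digraph \<Rightarrow> ('v, 'a, 'k::field) D_functor \<Rightarrow>
   ('v, 'a, 'k) C_obj set \<Rightarrow> ('v + 'v, 'a, 'k) rep set" where
  "psi Q \<tau> c = (THE m. psi_rel Q \<tau> c m)"

definition gamma ::
  "('v, 'a) pre_digraph \<Rightarrow> ('v, 'a, 'k::field) D_functor \<Rightarrow> ('v, 'a, 'k) C_obj set \<Rightarrow> 'v \<Rightarrow> int" where
  "gamma Q \<tau> = sdim_class \<circ> psi Q \<tau>"

section \<open>Dynkin diagrams and root systems\<close>

datatype dynkin = DynA nat | DynD nat | DynE nat

fun dynkin_rank :: "dynkin \<Rightarrow> nat" where
  "dynkin_rank (DynA n) = n"
| "dynkin_rank (DynD n) = n"
| "dynkin_rank (DynE n) = n"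

fun valid_dynkin :: "dynkin \<Rightarrow> bool" where
  "valid_dynkin (DynA n) \<longleftrightarrow> n \<ge> 1"
| "valid_dynkin (DynD n) \<longleftrightarrow> n \<ge> 4"
| "valid_dynkin (DynE n) \<longleftrightarrow> n \<in> {6, 7, 8}"

text \<open>
  The vertices are \<open>1, ..., n\<close>. In types D and E the vertices \<open>1, ..., n - 1\<close> form a chain, and \<open>n\<close>
  is attached to \<open>n - 2\<close> and to \<open>3\<close>, respectively.
\<close>

fun dynkin_edges :: "dynkin \<Rightarrow> nat set set" where
  "dynkin_edges (DynA n) = {{i, i + 1} | i. 1 \<le> i \<and> i + 1 \<le> n}"
| "dynkin_edges (DynD n) = insert {n - 2, n} {{i, i + 1} | i. 1 \<le> i \<and> i + 1 \<le> n - 1}"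
| "dynkin_edges (DynE n) = insert {3, n} {{i, i + 1} | i. 1 \<le> i \<and> i + 1 \<le> n - 1}"

definition edge_count :: "('v, 'a) pre_digraph \<Rightarrow> 'v \<Rightarrow> 'v \<Rightarrow> nat" where
  "edge_count Q u v = card {a \<in> arcs Q. {tail Q a, head Q a} = {u, v}}"

text \<open>The case \<open>u = v\<close> excludes loops.\<close>

definition underlying_graph_is :: "('v, 'a) pre_digraph \<Rightarrow> dynkin \<Rightarrow> bool" where
  "underlying_graph_is Q \<Delta> \<longleftrightarrow>
     (\<exists>h. bij_betw h (verts Q) {1..dynkin_rank \<Delta>} \<and>
        (\<forall>u\<in>verts Q. \<forall>v\<in>verts Q.
           edge_count Q u v = (if {h u, h v} \<in> dynkin_edges \<Delta> then 1 else 0)))"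

text \<open>
  The simple roots of the root system of the underlying graph of \<open>Q\<close> are labelled by the vertices
  of \<open>Q\<close>, and \<open>Q\<close> enters only through its underlying graph.
\<close>

definition cartan :: "('v, 'a) pre_digraph \<Rightarrow> 'v \<Rightarrow> 'v \<Rightarrow> int" where
  "cartan Q u v = (if u = v then 2 else - int (edge_count Q u v))"

definition simple_root :: "'v \<Rightarrow> 'v \<Rightarrow> int" where
  "simple_root i = (\<lambda>v. if v = i then 1 else 0)"

definition reflection :: "('v, 'a) pre_digraph \<Rightarrow> 'v \<Rightarrow> ('v \<Rightarrow> int) \<Rightarrow> ('v \<Rightarrow> int)" where
  "reflection Q i c = (\<lambda>v. c v - (\<Sum>j\<in>verts Q. cartan Q i j * c j) * simple_root i v)"

inductive_set roots :: "('v, 'a) pre_digraph \<Rightarrow> ('v \<Rightarrow> int) set" for Q where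
  simple: "i \<in> verts Q \<Longrightarrow> simple_root i \<in> roots Q"
| reflect: "c \<in> roots Q \<Longrightarrow> i \<in> verts Q \<Longrightarrow> reflection Q i c \<in> roots Q"

definition almost_positive_roots :: "('v, 'a) pre_digraph \<Rightarrow> ('v \<Rightarrow> int) set" where
  "almost_positive_roots Q =
     {c \<in> roots Q. \<forall>v. c v \<ge> 0} \<union> {\<lambda>v. - simple_root i v | i. i \<in> verts Q}"

section \<open>Cluster algebras of finite type\<close>

type_synonym 'v mpoly = "('v \<Rightarrow>\<^sub>0 nat) \<Rightarrow>\<^sub>0 rat"

definition polys_in :: "'v set \<Rightarrow> 'v mpoly set" where
  "polys_in V = {p. \<forall>m\<in>Poly_Mapping.keys p. Poly_Mapping.keys m \<subseteq> V}"

definition poly_at :: "('v \<Rightarrow> 'f::field_char_0) \<Rightarrow> 'v mpoly \<Rightarrow> 'f" where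
  "poly_at x p = (\<Sum>m\<in>Poly_Mapping.keys p. of_rat (Poly_Mapping.lookup p m) *
     (\<Prod>v\<in>Poly_Mapping.keys m. x v ^ Poly_Mapping.lookup m v))"

text \<open>\<open>'f\<close> is the field of rational functions over the rationals in the variables \<open>x v\<close>, \<open>v \<in> V\<close>.\<close>

definition free_generating :: "'v set \<Rightarrow> ('v \<Rightarrow> 'f::field_char_0) \<Rightarrow> bool" where
  "free_generating V x \<longleftrightarrow>
     (\<forall>p\<in>polys_in V. poly_at x p = 0 \<longrightarrow> p = 0) \<and>
     (\<forall>y. \<exists>p\<in>polys_in V. \<exists>q\<in>polys_in V. q \<noteq> 0 \<and> y = poly_at x p / poly_at x q)"

type_synonym ('v, 'f) seed = "('v \<Rightarrow> 'f) \<times> ('v \<Rightarrow> 'v \<Rightarrow> int)"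

definition mutate :: "'v set \<Rightarrow> 'v \<Rightarrow> ('v, 'f::field_char_0) seed \<Rightarrow> ('v, 'f) seed" where
  "mutate V k = (\<lambda>(x, B).
     (x(k := ((\<Prod>i\<in>{i\<in>V. B i k > 0}. x i ^ nat (B i k)) +
              (\<Prod>i\<in>{i\<in>V. B i k < 0}. x i ^ nat (- B i k))) / x k),
      \<lambda>i j. if i = k \<or> j = k then - B i j
            else B i j + (\<bar>B i k\<bar> * B k j + B i k * \<bar>B k j\<bar>) div 2))"

inductive_set seeds :: "'v set \<Rightarrow> ('v, 'f::field_char_0) seed \<Rightarrow> ('v, 'f) seed set" for V S where
  initial: "S \<in> seeds V S"
| mutation: "T \<in> seeds V S \<Longrightarrow> k \<in> V \<Longrightarrow> mutate V k T \<in> seeds V S"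

definition cluster_variables :: "'v set \<Rightarrow> ('v, 'f::field_char_0) seed \<Rightarrow> 'f set" where
  "cluster_variables V S = {fst T v | T v. T \<in> seeds V S \<and> v \<in> V}"

text \<open>
  The initial seed of Fomin and Zelevinsky for the cluster algebra whose type is the underlying
  graph of \<open>Q\<close>: the Cartan counterpart of \<open>B\<close> is the Cartan matrix, and every vertex is a source
  or a sink. The orientation of \<open>Q\<close> plays no role here.
\<close>

definition FZ_initial_seed :: "('v, 'a) pre_digraph \<Rightarrow> ('v, 'f::field_char_0) seed \<Rightarrow> bool" where
  "FZ_initial_seed Q S \<longleftrightarrow> free_generating (verts Q) (fst S) \<and>
     (\<forall>i\<in>verts Q. \<forall>j\<in>verts Q. snd S i j = - snd S j i) \<and>
     (\<forall>i\<in>verts Q. \<forall>j\<in>verts Q. i \<noteq> j \<longrightarrow> \<bar>snd S i j\<bar> = - cartan Q i j) \<and>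
     (\<forall>i\<in>verts Q. \<forall>j\<in>verts Q. \<forall>k\<in>verts Q. snd S i j * snd S i k \<ge> 0)"

text \<open>
  The correspondence of Fomin and Zelevinsky sends \<open>\<alpha> = \<Sum>i. \<alpha>\<^sub>i \<alpha>_i\<close> to the cluster variable with
  denominator \<open>\<Prod>i. x\<^sub>i ^ \<alpha>\<^sub>i\<close>, the numerator being an integer polynomial with nonzero constant term.
\<close>

definition FZ_correspondence ::
  "('v, 'a) pre_digraph \<Rightarrow> ('v, 'f::field_char_0) seed \<Rightarrow> (('v \<Rightarrow> int) \<Rightarrow> 'f) \<Rightarrow> bool" where
  "FZ_correspondence Q S \<kappa> \<longleftrightarrow>
     bij_betw \<kappa> (almost_positive_roots Q) (cluster_variables (verts Q) S) \<and>
     (\<forall>\<alpha>\<in>almost_positive_roots Q. \<exists>p\<in>polys_in (verts Q).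
        (\<forall>m. Poly_Mapping.lookup p m \<in> \<int>) \<and> Poly_Mapping.lookup p 0 \<noteq> 0 \<and>
        \<kappa> \<alpha> = poly_at (fst S) p / (\<Prod>v\<in>verts Q. fst S v powi \<alpha> v))"

end

theory Submission
 imports Defs "HOL-Library.Function_Algebras" "Jordan_Normal_Form.Char_Poly"
begin

text \<open>
  Over a quiver with positive definite Euler form an indecomposable representation is a brick
  without self-extensions. It is therefore determined by its dimension vector, and the vectors that
  occur are the positive roots. Since path algebras are hereditary, every complex is isomorphic to
  its cohomology, so the indecomposable objects of the derived category are the bricks \<open>M[n]\<close>. The
  Serre functor maps \<open>P[n]\<close> to some \<open>L[n]\<close> if \<open>P\<close> is projective, and \<open>M[n]\<close> to some \<open>L[n + 1]\<close>
  otherwise. Hence every orbit of \<open>F\<close> on them contains exactly one isomorphism class of the form \<open>M\<close>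
  or \<open>P\<^sub>i[1]\<close>. Finally \<open>Hom(F\<^sup>i X, X) = 0\<close> for \<open>i > 0\<close>, so that an idempotent of an orbit
  is governed by its component in degree \<open>0\<close>, and orbits of bricks stay indecomposable.
\<close>

text \<open>Three obstacles shape the proof. The derived category is given by classes of roofs of
  matrix complexes, so even its axioms have to be earned. Its Hom sets are computed by the total
  complex whose terms are the vertexwise and the arrowwise Hom spaces of two complexes; weak maps
  are the 0-cocycles there. Existence of a representation whose dimension vector is a prescribed
  root is usually obtained by counting dimensions of orbits; here dim End is minimised over all
  representations with that vector, because replacing a direct sum by a nonsplit extension strictly
  lowers it. Finally, \<tau> is known only through Serre duality. Applied to vanishing Hom spaces,
  duality fixes the degree of SX. Since S = [1]\<tau> satisfies S(FX) = X[2], the degree along an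
  F-orbit rises by 2 when a shifted projective is reached and by 1 otherwise. Such a sequence either
  hits 0 or jumps from -1 to 1, and never both: this is the fundamental domain. The same
  monotonicity makes Hom from F^i X to X vanish for i > 0.\<close>

abbreviation (input) iff_ascii (infixr "<->" 25) where "A <-> B == A = B"

section \<open>Linear operators on sequences\<close>

text \<open>
  Matrices of all sizes are embedded into the unital ring of linear endomorphisms of the space of
  sequences. An \<open>m \<times> n\<close> matrix becomes an element of the corner \<open>E m * R * E n\<close>, where \<open>E n\<close> is the
  projection to the first \<open>n\<close> coordinates; products become associative without side conditions.
\<close>

typedef (overloaded) 'k lop = "{g :: (nat => 'k::field) => nat => 'k.
  (ALL x y. g (x + y) = g x + g y) & (ALL c x. g (%i. c*x i) = (%i. c*g x i))}"
 morphisms app Lop by (rule exI[of _ "%x. x"]) simp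

lemma app_add [simp]: "app f (x + y) = app f x + app f y" using app[of f] by blast

lemma app_scale [simp]: "app f (%i. c*x i) = (%i. c*app f x i)" using app[of f] by blast

lemma app_zero [simp]: "app f 0 = 0" using app_scale[of f 0 "0"] by (simp add: zero_fun_def)

lemma app_Lop: assumes "!!x y. g (x + y) = g x + g y" "!!c x. g (%i. c*x i) = (%i. c*g x i)" shows "app (Lop g) = g"
 using assms by (intro Lop_inverse) simp

lemma lop_eqI: "(!!x. app f x = app g x) ==> f = g" by (metis app_inject ext)

instantiation lop :: (field) ring_1
begin
definition "0 = Lop (%x. 0)"
definition "1 = Lop (%x. x)"
definition "f + g = Lop (%x. app f x + app g x)"
definition "- f = Lop (%x. - app f x)"
definition "f - g = Lop (%x. app f x - app g x)"
definition "f*g = Lop (%x. app f (app g x))"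

lemma app_0 [simp]: "app 0 x = 0" unfolding zero_lop_def by (subst app_Lop) (auto simp: zero_fun_def)
lemma app_1 [simp]: "app 1 x = x" unfolding one_lop_def by (subst app_Lop) auto
lemma app_plus [simp]: "app (f + g) x = app f x + app g x"
 unfolding plus_lop_def by (subst app_Lop) (simp_all only: app_add app_scale, auto simp: algebra_simps fun_eq_iff)
lemma app_uminus [simp]: "app (- f) x = - app f x"
 unfolding uminus_lop_def by (subst app_Lop) (simp_all only: app_add app_scale, auto simp: algebra_simps fun_eq_iff)
lemma app_minus [simp]: "app (f - g) x = app f x - app g x"
 unfolding minus_lop_def by (subst app_Lop) (simp_all only: app_add app_scale, auto simp: algebra_simps fun_eq_iff)
lemma app_times [simp]: "app (f*g) x = app f (app g x)" unfolding times_lop_def by (subst app_Lop) auto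

instance proof
 have "app (0 :: 'a lop) (%_. 1) ~= app 1 (%_. 1)" by (simp add: fun_eq_iff)
 then show "(0 :: 'a lop) ~= 1" by metis
next
 fix a b :: "'a lop"
 have "app a (- x) = - app a x" for x proof -
  have "app a (- x + x) = app a (- x) + app a x" by (rule app_add)
  then show ?thesis by (simp add: eq_neg_iff_add_eq_0)
 qed
qed (auto intro!: lop_eqI simp: algebra_simps)
end

lemma app_neg [simp]: "app a (- x) = - app a x" proof -
 have "app a (- x + x) = app a (- x) + app a x" by (rule app_add)
 then show ?thesis by (simp add: eq_neg_iff_add_eq_0)
qed

lemma app_diff [simp]: "app a (x - y) = app a x - app a y" using app_add[of a x "- y"] by simp

text \<open>Scalars act through a separate operation, because the ring of operators carries no
  scalar action of its own. With it the families of operators become the vector space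
  \<open>fam\<close> below.\<close>

definition sm :: "'k::field => 'k lop => 'k lop" where
 "sm c f = Lop (%x i. c*app f x i)"

lemma app_sm [simp]: "app (sm c f) x = (%i. c*app f x i)" unfolding sm_def by (subst app_Lop) (auto simp: algebra_simps fun_eq_iff)

lemma sm_simps [simp]: "sm c f*g = sm c (f*g)" "f*sm c g = sm c (f*g)" "sm 1 f = f" "sm 0 f = 0" "sm c 0 = 0" "sm a (sm b f) = sm (a*b) f"
 by (auto intro!: lop_eqI simp: zero_fun_def algebra_simps)

lemma sm_distrib: "sm c (f + g) = sm c f + sm c g" "sm c (f - g) = sm c f - sm c g" "sm (a + b) f = sm a f + sm b f"
 "sm (a - b) f = sm a f - sm b f" "sm c (- f) = - sm c f" "sm (- c) f = - sm c f" by (auto intro!: lop_eqI simp: fun_eq_iff algebra_simps)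

text \<open>Turns an equation for a two-letter word into a rewrite rule that also fires at the head
  of a longer right-nested word. Together with \<open>mult.assoc\<close> this normalises composites
  of maps.\<close>

lemma massoc: "(a::'a::semigroup_mult)*b = c ==> a*(b*w) = c*w" by (simp add: mult.assoc[symmetric])

definition E where
 "E n = Lop (%x i. if i < n then x i else 0)"

lemma app_E: "app (E n) x = (%i. if i < n then x i else 0)" unfolding E_def by (subst app_Lop) (auto simp: fun_eq_iff)

lemma E_mult: "E m*E n = E (min m n)" by (auto intro!: lop_eqI simp: app_E fun_eq_iff)

lemma E_idem [simp]: "E n*E n = E n" by (simp add: E_mult)
lemma E_idem' [simp]: "E n*(E n*x) = E n*x" by (simp add: mult.assoc[symmetric])
lemma E_0 [simp]: "E 0 = 0" by (auto intro!: lop_eqI simp: app_E fun_eq_iff)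

lemma E_inj [simp]: "E m = (E n :: 'k::field lop) <-> m = n" proof
 assume *: "E m = (E n :: 'k lop)"
 have "app (E m :: 'k lop) (%_. 1) i = app (E n :: 'k lop) (%_. 1) i" for i using*by simp
 then have "i < m <-> i < n" for i :: nat unfolding app_E by (metis zero_neq_one)
 then show "m = n" by (metis linorder_neqE_nat less_irrefl)
qed simp

lemma E_eq_0 [simp]: "E n = 0 <-> n = 0" using E_inj[of n 0] by (simp del: E_inj)

definition HV where
 "HV m n = {f. E m*f = f & f*E n = f}"

lemma HVD: assumes "f : HV m n" shows "E m*f = f" "f*E n = f" "E m*(f*x) = f*x" "f*(E n*x) = f*x"
 using assms by (auto simp: HV_def mult.assoc[symmetric])

lemma HVI: "E m*f = f ==> f*E n = f ==> f : HV m n" by (simp add: HV_def)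

lemma HV_E [simp, intro]: "E n : HV n n" by (simp add: HV_def)
lemma HV_0 [simp, intro]: "0 : HV m n" by (simp add: HV_def)
lemma HV_add [intro]: "f : HV m n ==> g : HV m n ==> f + g : HV m n" by (simp add: HV_def algebra_simps)
lemma HV_diff [intro]: "f : HV m n ==> g : HV m n ==> f - g : HV m n" by (simp add: HV_def algebra_simps)
lemma HV_uminus [intro]: "f : HV m n ==> - f : HV m n" by (simp add: HV_def)
lemma HV_sm [intro]: "f : HV m n ==> sm c f : HV m n" by (simp add: HV_def)
lemma HV_mult [intro]: "f : HV l m ==> g : HV m n ==> f*g : HV l n" by (rule HVI) (auto simp: HVD mult.assoc)

lemma HV_0l: "f : HV 0 n ==> f = 0" by (auto simp: HV_def)
lemma HV_0r: "f : HV m 0 ==> f = 0" by (auto simp: HV_def)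

definition uv :: "nat => nat => 'k::field" where "uv j = (%i. if i = j then 1 else 0)"

lemma app_E_uv: "app (E n) (uv j) = (if j < n then uv j else 0)" by (auto simp: app_E uv_def fun_eq_iff)

lemma app_sum: "app (sum f A) x = (\<Sum>i\<in>A. app (f i) x)" by (induction A rule: infinite_finite_induct) auto

lemma app_sum_right: "app f (sum x A) = (\<Sum>i\<in>A. app f (x i))" proof (induction A rule: infinite_finite_induct)
 case (insert a F)
 then show ?case by (metis app_add sum.insert)
qed (metis app_zero sum.infinite, metis app_zero sum.empty)

lemma sum_fun_apply: "(sum f A) i = (\<Sum>a\<in>A. f a i)" for f :: "'x => 'i => 'k::comm_monoid_add"
 by (induction A rule: infinite_finite_induct) auto

lemma E_expand: "app (E n) x = (\<Sum>j<n. (%i. x j*uv j i))" by (auto simp: app_E uv_def fun_eq_iff sum_fun_apply if_distrib sum.delta cong: if_cong)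

lemma lop_eq_uv: assumes "f*E n = f" "g*E n = g" "!!j. j < n ==> app f (uv j) = app g (uv j)" shows "f = g" proof (rule lop_eqI)
 fix x
 have "app f x = app f (app (E n) x)" by (metis app_times assms(1))
 also have "... = app g (app (E n) x)" by (simp add: E_expand app_sum_right assms(3))
 also have "... = app g x" by (metis app_times assms(2))
 finally show "app f x = app g x" .
qed

text \<open>The rank-one operator with image vector \<open>y\<close> and coordinate functional
  number \<open>m\<close>; for \<open>y = uv r\<close> it is a matrix unit.\<close>

definition rk1 where
 "rk1 y m = Lop (%x i. x m*y i)"

lemma app_rk1: "app (rk1 y m) x = (%i. x m*y i)" unfolding rk1_def by (subst app_Lop) (auto simp: algebra_simps fun_eq_iff)

lemma mult_rk1: "f*rk1 y m = rk1 (app f y) m" by (auto intro!: lop_eqI simp: app_rk1)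

lemma rk1_mult_rk1: "rk1 y m*rk1 z n = sm (z m) (rk1 y n)" by (auto intro!: lop_eqI simp: app_rk1 algebra_simps)

lemma rk1_mult_E: "rk1 y m*E n = (if m < n then rk1 y m else 0)" by (auto intro!: lop_eqI simp: app_rk1 app_E fun_eq_iff)

lemma rk1_HV: "app (E m) y = y ==> j < n ==> rk1 y j : HV m n" by (simp add: HV_def mult_rk1 rk1_mult_E)

lemma E_Suc: "E (Suc n) = E n + rk1 (uv n) n" by (auto intro!: lop_eqI simp: app_rk1 app_E fun_eq_iff uv_def less_Suc_eq)

lemma rk1_mult_low: assumes "E m*f = f" shows "rk1 y m*f = 0" proof -
 have "rk1 y m*f = rk1 y m*E m*f" by (metis assms mult.assoc)
 then show ?thesis by (simp add: rk1_mult_E)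
qed

lemma low_mult_rk1: assumes "f*E m = f" shows "f*rk1 (uv m) j = 0" proof -
 have "f*rk1 (uv m) j = f*(E m*rk1 (uv m) j)" by (metis assms mult.assoc)
 also have "E m*rk1 (uv m) j = (0::'a lop)" by (simp add: mult_rk1 app_E_uv) (auto intro!: lop_eqI simp: app_rk1 fun_eq_iff)
 finally show ?thesis by simp
qed

text \<open>Induction over the columns. The new column \<open>y\<close> either lies in the span of
  the old ones, which is tested by \<open>B*B'\<close> fixing \<open>y\<close>, and then only
  \<open>C\<close> grows; or it is independent and the rank rises by one. Generalised inverses and
  split idempotents follow from this, and from these the images, kernels and summands of
  representations.\<close>

theorem rank_factorization: fixes f :: "'k::field lop" assumes "f : HV m n"
 shows "EX r B C B' C'. B : HV m r & C : HV r n & B' : HV r m & C' : HV n r &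
  f = B*C & B'*B = E r & C*C' = E r" using assms proof (induction n arbitrary: f)
 case 0
 then have "f = 0" by (simp add: HV_0r)
 then show ?case by (intro exI[of _ 0]) auto
next
 case (Suc n)
 have Ef: "E m*f = f" "f*E (Suc n) = f" using Suc.prems by (auto simp: HV_def)
 have "f*E n : HV m n" using Ef(1) by (intro HVI) (simp_all add: mult.assoc, simp add: mult.assoc[symmetric])
 from Suc.IH[OF this] obtain r B C B' C' where
  h: "B : HV m r" "C : HV r n" "B' : HV r m" "C' : HV n r" "f*E n = B*C" "B'*B = E r" "C*C' = E r" by blast
 define y where "y = app f (uv n)"
 have Ey: "app (E m) y = y" unfolding y_def by (metis Ef(1) app_times)
 have fy: "f = B*C + rk1 y n" proof -
  have "f = f*(E n + rk1 (uv n) n)" using Ef(2) by (simp add: E_Suc)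
  then show ?thesis by (simp add: distrib_left h(5) mult_rk1 y_def)
 qed
 note ld = HVD[OF h(1)] HVD[OF h(2)] HVD[OF h(3)] HVD[OF h(4)]
 have CS: "C : HV r (Suc n)" "C' : HV (Suc n) r" proof -
  have "C*E (Suc n) = C*E n*E (Suc n)" by (simp add: ld)
  also have "... = C*(E n*E (Suc n))" by (simp only: mult.assoc)
  also have "E n*E (Suc n) = (E n :: 'k lop)" by (simp add: E_mult)
  finally show "C : HV r (Suc n)" by (intro HVI) (simp_all add: ld)
  have "E (Suc n)*C' = E (Suc n)*E n*C'" by (simp add: ld mult.assoc)
  also have "E (Suc n)*E n = (E n :: 'k lop)" by (simp add: E_mult)
  finally show "C' : HV (Suc n) r" by (intro HVI) (simp_all add: ld)
 qed
 have nC': "rk1 z n*C' = 0" for z by (rule rk1_mult_low) (simp add: ld)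
 show ?case proof (cases "app (B*B') y = y")
  case True
  define C1 where "C1 = C + rk1 (app B' y) n"
  have "C1 : HV r (Suc n)" unfolding C1_def proof (rule HV_add[OF CS(1)], rule HVI)
   show "E r*rk1 (app B' y) n = rk1 (app B' y) n" by (metis HVD(1) app_times h(3) mult_rk1)
  qed (simp add: rk1_mult_E)
  moreover have "f = B*C1" using True by (simp add: C1_def distrib_left mult_rk1 fy)
  moreover have "C1*C' = E r" by (simp add: C1_def distrib_right h(7) nC')
  ultimately show ?thesis using h(1,3,6) CS(2) by blast
 next
  case False
  then have "y - app (B*B') y ~= 0" by auto
 then obtain l where l: "(y - app (B*B') y) l ~= 0" by (metis ext zero_fun_apply)
  define w where "w = (y - app (B*B') y) l"
  text \<open>A functional vanishing on the image of \<open>B\<close> with value 1 at \<open>y\<close>, followed by \<open>e\<^sub>r\<close>.\<close>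
  define L where "L z = sm (1 / w) (rk1 z l*(E m - B*B'))" for z
  have lm: "l < m" proof (rule ccontr)
   assume "~ l < m"
   moreover have "app (E m) (y - app (B*B') y) = y - app (B*B') y" using Ey by (metis HVD(3) app_diff app_times h(1))
   ultimately show False using l by (metis app_E)
  qed
  have LB: "L z*B = 0" for z by (simp add: L_def left_diff_distrib ld h(6) mult.assoc)
  have Ly: "app (L z) y = z" for z using l by (simp add: L_def app_rk1 Ey w_def left_diff_distrib[symmetric])
  have L_HV: "L z : HV k m" if "app (E k) z = z" for z k unfolding L_def by (rule HV_sm, rule HVI, auto simp: mult.assoc[symmetric] mult_rk1 that)
    (simp add: mult.assoc right_diff_distrib left_diff_distrib ld)
  define B1 where "B1 = B + rk1 y r"
  \<comment> \<open>\<open>L z\<close> kills \<open>B\<close> and sends \<open>y\<close> to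
    \<open>z\<close>. Subtracting \<open>B'*L y\<close> makes the old retraction vanish on
    \<open>y\<close>, and \<open>L (uv r)\<close> sends \<open>y\<close> to the new basis
    vector.\<close>
  define B2 where "B2 = B' - B'*L y + L (uv r)"
  define C1 where "C1 = C + rk1 (uv r) n"
  define C2 where "C2 = C' + rk1 (uv n) r"
  have up: "E (Suc r)*E r = (E r :: 'k lop)" "E r*E (Suc r) = (E r :: 'k lop)" by (simp_all add: E_mult)
  have HVup: "x : HV (Suc r) k" if "x : HV r k" for x :: "'k lop" and k using that by (metis HVD(1,2) HVI mult.assoc up(1))
  have HVup': "x : HV k (Suc r)" if "x : HV k r" for x :: "'k lop" and k using that by (metis HVD(1,2) HVI mult.assoc up(2))
  have "B1 : HV m (Suc r)" unfolding B1_def by (rule HV_add[OF HVup'[OF h(1)]]) (rule rk1_HV[OF Ey], simp)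
  moreover have "B2 : HV (Suc r) m" unfolding B2_def by (intro HV_add HV_diff HV_mult[of _ _ m] HVup h L_HV Ey) (simp add: app_E_uv)
  moreover have "C1 : HV (Suc r) (Suc n)" unfolding C1_def by (rule HV_add[OF HVup[OF CS(1)]]) (rule rk1_HV, simp_all add: app_E_uv)
  moreover have "C2 : HV (Suc n) (Suc r)" unfolding C2_def by (rule HV_add[OF HVup'[OF CS(2)]]) (rule rk1_HV, simp_all add: app_E_uv)
  moreover have "f = B1*C1" proof -
   have "rk1 y r*C = 0" by (rule rk1_mult_low) (simp add: ld)
   moreover have "B*rk1 (uv r) n = 0" by (rule low_mult_rk1) (simp add: ld)
   ultimately show ?thesis by (simp add: B1_def C1_def algebra_simps rk1_mult_rk1 fy) (simp add: uv_def)
  qed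
  moreover have "B2*B1 = E (Suc r)" by (simp add: B1_def B2_def algebra_simps LB h(6) mult_rk1 Ly E_Suc)
  moreover have "C1*C2 = E (Suc r)" proof -
   have "C*rk1 (uv n) r = 0" by (rule low_mult_rk1) (simp add: ld)
   then show ?thesis by (simp add: C1_def C2_def algebra_simps h(7) nC' rk1_mult_rk1 E_Suc) (simp add: uv_def)
  qed
  ultimately show ?thesis by blast
 qed
qed

text \<open>Von Neumann regularity, with \<open>C'*B'\<close> as the generalised inverse. It later
  yields one-sided inverses of injective and surjective maps and the contractions of
  complexes.\<close>

corollary gen_inverse: fixes f :: "'k::field lop" assumes "f : HV m n"
 obtains g where "g : HV n m" "f*(g*f) = f" proof -
 obtain r B C B' C' where
  h: "B : HV m r" "C : HV r n" "B' : HV r m" "C' : HV n r" "f = B*C" "B'*B = E r" "C*C' = E r" using rank_factorization[OF assms] by blast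
 have "f*(C'*B'*f) = f" by (simp add: h(5) mult.assoc massoc[OF h(6)] massoc[OF h(7)] HVD[OF h(1)] HVD[OF h(2)])
 then show thesis using h(3,4) that HV_mult by metis
qed

corollary split_idempotent: fixes e :: "'k::field lop" assumes "e : HV n n" "e*e = e"
 obtains r s p where "s : HV n r" "p : HV r n" "s*p = e" "p*s = E r" proof -
 obtain r B C B' C' where
  h: "B : HV n r" "C : HV r n" "B' : HV r n" "C' : HV n r" "e = B*C" "B'*B = E r" "C*C' = E r" using rank_factorization[OF assms(1)] by blast
 \<comment> \<open>With \<open>e = B*C\<close>, cancelling \<open>B\<close> on the left and
   \<open>C\<close> on the right in \<open>e*e = e\<close> leaves \<open>C*B = E r\<close>, so the
   factorisation itself splits \<open>e\<close>.\<close>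
 have "C*B = B'*(e*e)*C'" by (simp add: h(5) mult.assoc massoc[OF h(6)] h(7) HVD[OF h(2)] HVD[OF h(1)])
 also have "... = E r" by (simp add: assms(2)) (simp add: h(5) mult.assoc massoc[OF h(6)] h(7) HVD[OF h(2)])
 finally show thesis using h that by blast
qed

lemma bij_inverse: fixes f :: "'k::field lop" assumes f: "f : HV m n" and inj: "!!x. app (E n) x = x ==> app f x = 0 ==> x = 0"
  and surj: "!!y. app (E m) y = y ==> EX x. app f x = y"
 obtains g where "g : HV n m" "g*f = E n" "f*g = E m" proof -
 obtain g where g: "g : HV n m" "f*(g*f) = f" by (rule gen_inverse[OF f])
 note ld = HVD[OF f] HVD[OF g(1)]
 have "g*f = E n" proof (rule lop_eqI)
  fix x
  have "app (E n - g*f) x = 0" proof (rule inj)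
   show "app (E n) (app (E n - g*f) x) = app (E n - g*f) x" unfolding app_times[symmetric] by (simp add: right_diff_distrib ld del: app_times)
   show "app f (app (E n - g*f) x) = 0" unfolding app_times[symmetric] by (simp add: right_diff_distrib ld g(2) del: app_times)
  qed
  then show "app (g*f) x = app (E n) x" by simp
 qed
 moreover have "f*g = E m" proof (rule lop_eqI)
  fix y :: "nat => 'k"
  have "app (E m) (app (E m) y) = app (E m) y" by (metis E_idem app_times)
  then obtain x where x: "app f x = app (E m) y" using surj by blast
  have "app (f*g) y = app (f*(g*E m)) y" by (simp add: ld del: app_times)
  also have "... = app f (app g (app (E m) y))" by simp
  also have "... = app (f*(g*f)) x" by (simp add: x)
  finally show "app (f*g) y = app (E m) y" using g(2) x by simp
 qed
 ultimately show thesis using g(1) that by blast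
qed

section \<open>Translation between matrices and operators\<close>

definition op :: "'k::field mat => 'k lop" where
 "op A = Lop (%x i. if i < dim_row A then \<Sum>j<dim_col A. A $$ (i, j)*x j else 0)"

lemma app_op: "app (op A) x = (%i. if i < dim_row A then \<Sum>j<dim_col A. A $$ (i, j)*x j else 0)" unfolding op_def
 by (subst app_Lop) (auto simp: fun_eq_iff algebra_simps sum.distrib sum_distrib_left)

lemma app_op_uv: "app (op A) (uv j) i = (if i < dim_row A & j < dim_col A then A $$ (i, j) else 0)" proof -
 have "(\<Sum>l<dim_col A. A $$ (i, l)*uv j l) = (\<Sum>l<dim_col A. if j = l then A $$ (i, l) else 0)" by (intro sum.cong) (auto simp: uv_def)
 then show ?thesis by (simp add: app_op)
qed

lemma op_HV: "op A : HV (dim_row A) (dim_col A)" by (intro HVI lop_eqI) (auto simp: app_op app_E fun_eq_iff)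

lemma op_carrier [intro]: "A : carrier_mat m n ==> op A : HV m n" using op_HV[of A] by auto

lemma lop_eq_uv_HV: assumes "f : HV m n" "g : HV m n" "!!i j. i < m ==> j < n ==> app f (uv j) i = app g (uv j) i" shows "f = g"
proof (rule lop_eq_uv[of _ n])
 fix j assume j: "j < n"
 have "app h (uv j) i = (if i < m then app h (uv j) i else 0)" if "h : HV m n" for h and i :: nat using HVD(1)[OF that] by (metis app_E app_times)
 with assms j show "app f (uv j) = app g (uv j)" by (metis ext)
qed (use assms in \<open>auto simp: HV_def\<close>)

definition mt :: "nat => nat => 'k::field lop => 'k mat" where
 "mt m n f = mat m n (%(i, j). app f (uv j) i)"

lemma mt_carrier [simp, intro]: "mt m n f : carrier_mat m n" by (simp add: mt_def)

lemma op_mt: "f : HV m n ==> op (mt m n f) = f" by (rule lop_eq_uv_HV[of _ m n]) (auto simp: app_op_uv mt_def intro: op_carrier)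

lemma mt_op: "A : carrier_mat m n ==> mt m n (op A) = A" by (rule eq_matI) (auto simp: mt_def app_op_uv)

lemma op_inject: "A : carrier_mat m n ==> B : carrier_mat m n ==> op A = op B <-> A = B" by (metis mt_op)

lemma op_times: assumes "A : carrier_mat l m" "B : carrier_mat m n" shows "op (A*B) = op A*op B" proof (rule lop_eqI, rule ext)
 fix x :: "nat => 'a" and i
 have "(\<Sum>j<n. (\<Sum>q<m. A $$ (i, q)*B $$ (q, j))*x j) = (\<Sum>q<m. A $$ (i, q)*(\<Sum>j<n. B $$ (q, j)*x j))"
  unfolding sum_distrib_left sum_distrib_right mult.assoc by (rule sum.swap)
 then show "app (op (A*B)) x i = app (op A*op B) x i" using assms by (simp add: app_op scalar_prod_def lessThan_atLeast0 cong: if_cong)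
qed

lemma op_plus: "A : carrier_mat m n ==> B : carrier_mat m n ==> op (A + B) = op A + op B"
 by (rule lop_eq_uv_HV[of _ m n]) (auto simp: app_op_uv intro!: op_carrier HV_add)

lemma op_minus: "A : carrier_mat m n ==> B : carrier_mat m n ==> op (A - B) = op A - op B"
 by (rule lop_eq_uv_HV[of _ m n]) (auto simp: app_op_uv intro!: op_carrier HV_diff)

lemma op_smult: "op (c \<cdot>\<^sub>m A) = sm c (op A)"
 by (rule lop_eq_uv_HV[of _ "dim_row A" "dim_col A"]) (auto simp: app_op_uv intro!: op_carrier HV_sm)

lemma op_one [simp]: "op (1\<^sub>m n) = E n" by (rule lop_eq_uv_HV[of _ n n]) (auto simp: app_op_uv app_E_uv, auto simp: uv_def intro!: op_carrier)

lemma op_zero [simp]: "op (0\<^sub>m m n) = 0" by (rule lop_eq_uv_HV[of _ m n]) (auto simp: app_op_uv intro!: op_carrier)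

lemma mt_times: "f : HV l m ==> g : HV m n ==> mt l m f*mt m n g = mt l n (f*g)"
 using mt_op[OF mult_carrier_mat[OF mt_carrier[of l m f] mt_carrier[of m n g]]] by (simp add: op_times[of _ l m _ n] op_mt)

lemma mt_E [simp]: "mt n n (E n) = 1\<^sub>m n" by (metis mt_op one_carrier_mat op_one)

lemma left_inverse_square: assumes "B : HV n n" "B' : HV n n" "B'*B = E n" shows "B*B' = E n" proof -
 have "mt n n B'*mt n n B = 1\<^sub>m n" by (simp add: mt_times assms)
 then have "mt n n B*mt n n B' = 1\<^sub>m n" by (rule mat_mult_left_right_inverse[rotated 2]) simp_all
 then have "op (mt n n B*mt n n B') = E n" by simp
 then show ?thesis by (simp add: mt_times assms op_mt HV_mult[OF assms(1,2)])
qed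

lemma HV_mono: assumes "f : HV m n" "m <= m'" "n <= n'" shows "f : HV m' n'" proof (rule HVI)
 have "E m'*E m = (E m :: 'a lop)" "E n*E n' = (E n :: 'a lop)" using assms(2,3) by (simp_all add: E_mult min_def)
 then have "E m'*(E m*f) = E m*f" "f*E n*E n' = f*E n" by (simp_all only: mult.assoc[symmetric]) (simp only: mult.assoc)
 then show "E m'*f = f" "f*E n' = f" by (simp_all add: HVD[OF assms(1)])
qed

text \<open>If \<open>r\<close> exceeded \<open>m\<close>, padding by zeros to size \<open>r\<close>
  would make \<open>B\<close> invertible on both sides, although its rows from \<open>m\<close> on
  vanish.\<close>

lemma left_inv_le: assumes "B : HV m r" "B' : HV r m" "B'*B = E r" shows "r <= m" proof (rule ccontr)
 assume "~ r <= m"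
 then have BB: "B*B' = E r" by (intro left_inverse_square[OF HV_mono[OF assms(1)] HV_mono[OF assms(2)] assms(3)]) simp_all
 then have "E m*E r = (E r :: 'a lop)" using HVD(3)[OF assms(1), of B'] by simp
 with \<open>~ r <= m\<close> show False by (simp add: E_mult)
qed

lemma left_inverse_dim_eq: assumes "B : HV m r" "B' : HV r m" "B'*B = E r" "m <= r" shows "m = r" "B*B' = E m" proof -
 show "m = r" using left_inv_le[OF assms(1-3)] assms(4) by simp
 then show "B*B' = E m" using assms(1-3) left_inverse_square[of B m B'] by simp
qed

definition sq :: "'k::field vec => nat => 'k" where
 "sq v = (%i. if i < dim_vec v then v $ i else 0)"

lemma sq_inject: "v : carrier_vec n ==> w : carrier_vec n ==> sq v = sq w <-> v = w" by (auto simp: sq_def fun_eq_iff intro!: eq_vecI)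

lemma sq_range: "(EX v:carrier_vec n. sq v = x) <-> app (E n) x = x" proof
 assume *: "app (E n) x = x"
 then have "sq (vec n x) = x" by (auto simp: sq_def app_E fun_eq_iff) (metis (full_types))
 then show "EX v:carrier_vec n. sq v = x" by (metis vec_carrier)
qed (auto simp: sq_def app_E)

lemma sq_carrier: "v : carrier_vec n ==> app (E n) (sq v) = sq v" using sq_range by blast

lemma sq_mult_mat_vec: "A : carrier_mat m n ==> v : carrier_vec n ==> sq (A *\<^sub>v v) = app (op A) (sq v)"
 by (auto simp: sq_def app_op fun_eq_iff scalar_prod_def lessThan_atLeast0 intro!: sum.cong)

lemma sq_zero [simp]: "sq (0\<^sub>v n) = 0" by (auto simp: sq_def fun_eq_iff)

lemma sq_minus: "v : carrier_vec n ==> w : carrier_vec n ==> sq (v - w) = sq v - sq w" by (auto simp: sq_def fun_eq_iff)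

section \<open>Representations\<close>

definition ar where
 "ar M a = op (snd M a)"

text \<open>Families are indexed by the whole vertex type, so composition of morphisms is literally
  the pointwise product in a function ring and needs no notation of its own. Identities become the
  idempotents \<open>rid\<close>.\<close>

definition rhom ::
 "('v, 'a) pre_digraph => ('v, 'a, 'k::field) rep => ('v, 'a, 'k) rep => ('v => 'k lop) set" where
 "rhom Q M N = {f. (ALL v. f v : HV (fst N v) (fst M v)) &
   (ALL a:arcs Q. f (head Q a)*ar M a = ar N a*f (tail Q a))}"

definition rid :: "('v, 'a, 'k::field) rep => 'v => 'k lop" where
 "rid M = (%v. E (fst M v))"

definition mkrep :: "('v, 'a) pre_digraph => ('v => nat) => ('a => 'k::field lop) => ('v, 'a, 'k) rep" where
 "mkrep Q d A = (d, restrict (%a. mt (d (head Q a)) (d (tail Q a)) (A a)) (arcs Q))"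

definition mtf :: "('v, 'a, 'k::field) rep => ('v, 'a, 'k) rep => ('v => 'k lop) => 'v => 'k mat" where
 "mtf N M f = (%v. mt (fst N v) (fst M v) (f v))"

lemma ar_HV: "M : reps Q ==> a : arcs Q ==> ar M a : HV (fst M (head Q a)) (fst M (tail Q a))" by (auto simp: reps_def ar_def)

lemma fst_mkrep [simp]: "fst (mkrep Q d A) = d" by (simp add: mkrep_def)

lemma mkrep_reps: "(!!v. v ~: verts Q ==> d v = 0) ==> mkrep Q d A : reps Q" by (auto simp: reps_def mkrep_def)

lemma ar_mkrep: "a : arcs Q ==> A a : HV (d (head Q a)) (d (tail Q a)) ==> ar (mkrep Q d A) a = A a" by (simp add: ar_def mkrep_def op_mt)

lemma rhomI: "(!!v. f v : HV (fst N v) (fst M v)) ==>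
  (!!a. a : arcs Q ==> f (head Q a)*ar M a = ar N a*f (tail Q a)) ==> f : rhom Q M N" by (simp add: rhom_def)

lemma rhom_HV: "f : rhom Q M N ==> f v : HV (fst N v) (fst M v)" by (simp add: rhom_def)

lemma rhom_ar: "f : rhom Q M N ==> a : arcs Q ==> f (head Q a)*ar M a = ar N a*f (tail Q a)" by (simp add: rhom_def)

lemma rid_rhom [simp, intro]: "M : reps Q ==> rid M : rhom Q M M" by (auto intro!: rhomI simp: rid_def HVD[OF ar_HV])

lemma rhom_mult [intro]: "f : rhom Q M N ==> g : rhom Q L M ==> f*g : rhom Q L N"
 by (rule rhomI) (auto intro: HV_mult dest: rhom_HV simp: mult.assoc rhom_ar massoc[OF rhom_ar])

lemma rhom_add [intro]: "f : rhom Q M N ==> g : rhom Q M N ==> f + g : rhom Q M N" by (auto simp: rhom_def algebra_simps intro!: HV_add)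
lemma rhom_diff [intro]: "f : rhom Q M N ==> g : rhom Q M N ==> f - g : rhom Q M N" by (auto simp: rhom_def algebra_simps intro!: HV_diff)
lemma rhom_0 [simp, intro]: "0 : rhom Q M N" by (auto simp: rhom_def)
lemma rhom_sm [intro]: "f : rhom Q M N ==> (%v. sm c (f v)) : rhom Q M N" by (auto simp: rhom_def intro!: HV_sm)

lemma rid_left: "f : rhom Q M N ==> rid N*f = f" by (auto simp: rid_def fun_eq_iff HVD(1)[OF rhom_HV])
lemma rid_right: "f : rhom Q M N ==> f*rid M = f" by (auto simp: rid_def fun_eq_iff HVD(2)[OF rhom_HV])
lemma rid_idem [simp]: "rid M*rid M = rid M" by (auto simp: rid_def fun_eq_iff)

lemma rep_maps_op: "M : reps Q ==> N : reps Q ==> f : rep_maps Q M N ==> (%v. op (f v)) : rhom Q M N" proof (rule rhomI)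
 fix a assume as: "M : reps Q" "N : reps Q" "f : rep_maps Q M N" "a : arcs Q"
 let ?h = "head Q a" and ?t = "tail Q a"
 have c: "snd M a : carrier_mat (fst M ?h) (fst M ?t)" "snd N a : carrier_mat (fst N ?h) (fst N ?t)" using as by (auto simp: reps_def)
 have m: "f v : carrier_mat (fst N v) (fst M v)" for v using as by (simp add: rep_maps_def)
 have "f ?h*snd M a = snd N a*f ?t" using as by (simp add: rep_maps_def)
 then show "op (f ?h)*ar M a = ar N a*op (f ?t)" by (simp add: ar_def op_times[OF m c(1), symmetric] op_times[OF c(2) m, symmetric])
qed (auto simp: rep_maps_def)

lemma op_mtf: "f : rhom Q M N ==> op (mtf N M f v) = f v" by (auto simp: mtf_def intro!: op_mt dest: rhom_HV)

lemma mtf_maps: "M : reps Q ==> N : reps Q ==> f : rhom Q M N ==> mtf N M f : rep_maps Q M N" unfolding rep_maps_def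
proof (intro CollectI conjI allI ballI)
 fix a assume as: "M : reps Q" "N : reps Q" "f : rhom Q M N" "a : arcs Q"
 let ?h = "head Q a" and ?t = "tail Q a"
 have c: "snd M a : carrier_mat (fst M ?h) (fst M ?t)" "snd N a : carrier_mat (fst N ?h) (fst N ?t)" using as by (auto simp: reps_def)
 have m: "mtf N M f v : carrier_mat (fst N v) (fst M v)" for v by (simp add: mtf_def)
 have "op (mtf N M f ?h*snd M a) = op (snd N a*mtf N M f ?t)"
  using as(3,4) by (simp add: op_times[OF m c(1)] op_times[OF c(2) m] op_mtf[OF as(3)] rhom_ar ar_def[symmetric])
 then show "mtf N M f ?h*snd M a = snd N a*mtf N M f ?t" using op_inject[OF mult_carrier_mat[OF m c(1)] mult_carrier_mat[OF c(2) m]] by simp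
qed (auto simp: mtf_def)

lemma mtf_mult: "f : rhom Q M N ==> g : rhom Q L M ==> mtf N M f v*mtf M L g v = mtf N L (f*g) v"
 by (auto simp: mtf_def intro!: mt_times dest: rhom_HV)

lemma mtf_rid: "mtf M M (rid M) v = 1\<^sub>m (fst M v)" by (simp add: mtf_def rid_def)

lemma rep_category_simps [simp]: "Ob (rep_category Q) = reps Q" "Hom (rep_category Q) M N = {(M, N, f) | f. f : rep_maps Q M N}"
 "Cmp (rep_category Q) (N, L, g) (M, N, f) = (M, L, %v. g v*f v)" "Idn (rep_category Q) M = (M, M, %v. 1\<^sub>m (fst M v))"
 "Zer (rep_category Q) M N = (M, N, %v. 0\<^sub>m (fst N v) (fst M v))" "Add (rep_category Q) (M, N, f) (M, N, f') = (M, N, %v. f v + f' v)"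
 by (simp_all add: rep_category_def)

definition riso where
 "riso Q M N <-> (EX f:rhom Q M N. EX g:rhom Q N M. g*f = rid M & f*g = rid N)"

text \<open>Indecomposability through idempotent endomorphisms, the form in which it is used and
  produced everywhere; \<open>indec_rep_iff\<close> links it to the categorical definition.\<close>

definition rindec where
 "rindec Q M <-> M : reps Q & (EX v. fst M v ~= 0) &
   (ALL e:rhom Q M M. e*e = e --> e = 0 \<or> e = rid M)"

lemma rid_eq_0: "rid M = 0 <-> (ALL v. fst M v = 0)" by (auto simp: rid_def fun_eq_iff)

lemma riso_sym: "riso Q M N ==> riso Q N M" by (auto simp: riso_def)

lemma riso_refl: "M : reps Q ==> riso Q M M" unfolding riso_def by (intro bexI[of _ "rid M"]) auto

lemma riso_trans: assumes "riso Q L M" "riso Q M N" shows "riso Q L N" proof -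
 obtain f g f' g' where h: "f : rhom Q L M" "g : rhom Q M L" "g*f = rid L" "f*g = rid M"
  "f' : rhom Q M N" "g' : rhom Q N M" "g'*f' = rid M" "f'*g' = rid N" using assms unfolding riso_def by blast
 have "(g*g')*(f'*f) = g*((g'*f')*f)" "(f'*f)*(g*g') = f'*((f*g)*g')" by (simp_all add: mult.assoc)
 then have "(g*g')*(f'*f) = rid L" "(f'*f)*(g*g') = rid N" using h by (simp_all add: rid_left[OF h(1)] rid_left[OF h(6)])
 then show ?thesis unfolding riso_def using h by (metis rhom_mult)
qed

lemma riso_dim: assumes "riso Q M N" shows "fst M = fst N" proof
 fix v
 obtain f g where h: "f : rhom Q M N" "g : rhom Q N M" "g*f = rid M" "f*g = rid N" using assms unfolding riso_def by blast
 have "g v*f v = E (fst M v)" "f v*g v = E (fst N v)" using fun_cong[OF h(3), of v] fun_cong[OF h(4), of v] by (simp_all add: rid_def)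
 then show "fst M v = fst N v" using left_inv_le rhom_HV[OF h(1)] rhom_HV[OF h(2)] by (metis order_antisym)
qed

lemma iso_obj_rep_iff: assumes "M : reps Q" "N : reps Q" shows "iso_obj (rep_category Q) M N <-> riso Q M N" proof
 assume "iso_obj (rep_category Q) M N"
 then obtain f g where h: "f : rep_maps Q M N" "g : rep_maps Q N M"
  "(%v. g v*f v) = (%v. 1\<^sub>m (fst M v))" "(%v. f v*g v) = (%v. 1\<^sub>m (fst N v))" by (auto simp: iso_obj_def)
 have c: "f v : carrier_mat (fst N v) (fst M v)" "g v : carrier_mat (fst M v) (fst N v)" for v using h(1,2) by (auto simp: rep_maps_def)
 have "(%v. op (g v))*(%v. op (f v)) = rid M" "(%v. op (f v))*(%v. op (g v)) = rid N" using fun_cong[OF h(3)] fun_cong[OF h(4)]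
  by (auto simp: fun_eq_iff rid_def op_times[OF c(2) c(1), symmetric] op_times[OF c(1) c(2), symmetric])
 then show "riso Q M N" unfolding riso_def using rep_maps_op assms h(1,2) by blast
next
 assume "riso Q M N"
 then obtain f g where h: "f : rhom Q M N" "g : rhom Q N M" "g*f = rid M" "f*g = rid N" unfolding riso_def by blast
 have "(%v. mtf M N g v*mtf N M f v) = (%v. 1\<^sub>m (fst M v))" "(%v. mtf N M f v*mtf M N g v) = (%v. 1\<^sub>m (fst N v))"
  using mtf_mult[OF h(1,2)] mtf_mult[OF h(2,1)] h(3,4) by (simp_all add: mtf_rid)
 then show "iso_obj (rep_category Q) M N" unfolding iso_obj_def by (intro bexI[of _ "(M, N, mtf N M f)"] bexI[of _ "(N, M, mtf M N g)"])
   (auto intro: mtf_maps assms h)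
qed

text \<open>Images, kernels and summands are first found vertex by vertex with no regard to the
  arrows; sandwiching the arrows of \<open>M\<close> between \<open>p\<close> and \<open>s\<close>
  then makes the spaces a representation. Whether \<open>s\<close> or \<open>p\<close> is a morphism
  has to be checked in each case.\<close>

lemma rep_transport: assumes M: "M : reps Q" and d: "!!v. v ~: verts Q ==> d v = 0"
  and s: "!!v. s v : HV (fst M v) (d v)" and p: "!!v. p v : HV (d v) (fst M v)"
 obtains N where "N : reps Q" "fst N = d" "!!a. a : arcs Q ==> ar N a = p (head Q a)*(ar M a*s (tail Q a))" proof
 let ?A = "%a. p (head Q a)*(ar M a*s (tail Q a))"
 show "mkrep Q d ?A : reps Q" using d by (rule mkrep_reps)
 show "ar (mkrep Q d ?A) a = ?A a" if "a : arcs Q" for a using that by (rule ar_mkrep) (intro HV_mult[OF p] HV_mult[OF ar_HV s] M that)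
qed simp

lemma rep_split: assumes M: "M : reps Q" and e: "e : rhom Q M M" "e*e = e"
 obtains N s p where "N : reps Q" "s : rhom Q N M" "p : rhom Q M N" "s*p = e" "p*s = rid N" proof -
 have "EX r s p. s : HV (fst M v) r & p : HV r (fst M v) & s*p = e v & p*s = E r" for v
  using split_idempotent[OF rhom_HV[OF e(1)]] fun_cong[OF e(2), of v] by (metis times_fun_apply)
 then obtain d s p where h: "!!v. s v : HV (fst M v) (d v)" "!!v. p v : HV (d v) (fst M v)" "!!v. s v*p v = e v" "!!v. p v*s v = E (d v)" by metis
 have d0: "d v = 0" if "v ~: verts Q" for v using left_inv_le[OF h(1,2,4), of v] M that by (auto simp: reps_def)
 obtain N where N: "N : reps Q" "fst N = d" "!!a. a : arcs Q ==> ar N a = p (head Q a)*(ar M a*s (tail Q a))"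
  using rep_transport[OF M d0 h(1) h(2)] by blast
 have es: "e v*s v = s v" "p v*e v = p v" for v by (simp_all add: h(3)[symmetric] mult.assoc h(4) massoc[OF h(4)] HVD[OF h(1)] HVD[OF h(2)])
 have "s : rhom Q N M" proof (rule rhomI)
  fix a assume a: "a : arcs Q"
  have "s (head Q a)*ar N a = e (head Q a)*ar M a*s (tail Q a)" by (simp add: N(3)[OF a] massoc[OF h(3)] mult.assoc)
  then show "s (head Q a)*ar N a = ar M a*s (tail Q a)" by (simp add: rhom_ar[OF e(1) a] mult.assoc es)
 qed (simp add: N(2) h)
 moreover have "p : rhom Q M N" proof (rule rhomI)
  fix a assume a: "a : arcs Q"
  have "ar N a*p (tail Q a) = p (head Q a)*(ar M a*e (tail Q a))" by (simp add: N(3)[OF a] h(3) mult.assoc)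
  then show "p (head Q a)*ar M a = ar N a*p (tail Q a)" by (simp add: rhom_ar[OF e(1) a, symmetric] mult.assoc[symmetric] es)
 qed (simp add: N(2) h)
 moreover have "s*p = e" "p*s = rid N" using h(3,4) by (auto simp: fun_eq_iff rid_def N(2))
 ultimately show thesis using N(1) that by blast
qed

definition summand where
 "summand Q M A s p <-> A : reps Q & s : rhom Q A M & p : rhom Q M A & p*s = rid A"

definition direct_sum where
 "direct_sum Q M A B i j p q <-> summand Q M A i p & summand Q M B j q & q*i = 0 & p*j = 0 & i*p + j*q = rid M"

lemma direct_sumD: assumes "direct_sum Q M A B i j p q"
 shows "A : reps Q" "B : reps Q" "i : rhom Q A M" "p : rhom Q M A" "j : rhom Q B M" "q : rhom Q M B"
  "p*i = rid A" "q*j = rid B" "q*i = 0" "p*j = 0" "i*p + j*q = rid M" using assms by (simp_all add: direct_sum_def summand_def)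

lemma split_rep: assumes M: "M : reps Q" and e: "e : rhom Q M M" "e*e = e"
 obtains A B i j p q where "direct_sum Q M A B i j p q" "i*p = e" proof -
 have e': "rid M - e : rhom Q M M" "(rid M - e)*(rid M - e) = rid M - e" using M e by (auto simp: algebra_simps rid_left[OF e(1)] rid_right[OF e(1)])
 obtain N s p where N: "N : reps Q" "s : rhom Q N M" "p : rhom Q M N" "s*p = e" "p*s = rid N" using rep_split[OF M e] by blast
 obtain N' s' p' where N': "N' : reps Q" "s' : rhom Q N' M" "p' : rhom Q M N'" "s'*p' = rid M - e" "p'*s' = rid N'" using rep_split[OF M e'] by blast
 have "p'*s = (p'*s')*p'*s*(p*s)" by (simp add: N' N rid_left[OF N'(3)] rid_right[OF N(2)] mult.assoc)
 also have "... = p'*((s'*p')*(s*p))*s" by (simp add: mult.assoc)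
 also have "... = 0" by (simp add: N' N left_diff_distrib e(2) rid_left[OF e(1)])
 finally have 1: "p'*s = 0" .
 have "p*s' = (p*s)*p*s'*(p'*s')" by (simp add: N' N rid_left[OF N(3)] rid_right[OF N'(2)] mult.assoc)
 also have "... = p*((s*p)*(s'*p'))*s'" by (simp add: mult.assoc)
 also have "... = 0" by (simp add: N' N right_diff_distrib e(2) rid_right[OF e(1)])
 finally have 2: "p*s' = 0" .
 have "direct_sum Q M N N' s s' p p'" using N N' 1 2 by (simp add: direct_sum_def summand_def)
 then show thesis using that N(4) by blast
qed

text \<open>\<open>s*p\<close> is an idempotent, and it is nonzero because \<open>p*(s*p)*s\<close>
  is the identity of the nonzero \<open>N\<close>. So a nonzero retract of an indecomposable is all
  of it.\<close>

lemma rindec_splitD: assumes M: "rindec Q M" and N: "N : reps Q" "fst N v ~= 0" and s: "s : rhom Q N M" and p: "p : rhom Q M N" and ps: "p*s = rid N"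
 shows "s*p = rid M" proof -
 have "(s*p)*(s*p) = s*((p*s)*p)" by (simp add: mult.assoc)
 then have "(s*p)*(s*p) = s*p" by (simp add: ps rid_left[OF p])
 then have "s*p = 0 \<or> s*p = rid M" using M s p by (auto simp: rindec_def)
 moreover have "s*p ~= 0" proof
  assume "s*p = 0"
  moreover have "rid N = p*(s*p)*s" by (simp add: ps[symmetric] mult.assoc[symmetric])
   (simp add: ps mult.assoc)
  ultimately have "rid N = 0" by simp
  then show False using N(2) by (simp add: rid_eq_0)
 qed
 ultimately show ?thesis by simp
qed

lemma zero_obj_rep: "zero_obj (rep_category Q) N <-> (ALL v. fst N v = 0)"
 for N :: "('v, 'a, 'k::field) rep" proof -
 have "1\<^sub>m n = (0\<^sub>m n n :: 'k mat) <-> n = 0" for n using op_inject[of "1\<^sub>m n" n n "0\<^sub>m n n :: 'k mat"] by simp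
 then show ?thesis by (simp add: zero_obj_def fun_eq_iff)
qed

lemma indec_rep_iff: "indecomposable (rep_category Q) M <-> rindec Q M" proof
 assume ind: "indecomposable (rep_category Q) M"
 then have M: "M : reps Q" by (simp add: indecomposable_def)
 have zero: "zero_obj (rep_category Q) N <-> rid N = 0" for N :: "('a, 'b, 'c) rep" by (simp add: zero_obj_rep rid_eq_0)
 show "rindec Q M" unfolding rindec_def proof (intro conjI ballI impI M)
  show "EX v. fst M v ~= 0" using ind zero rid_eq_0[of M] by (auto simp: indecomposable_def)
 next
  fix e assume e: "e : rhom Q M M" "e*e = e"
  obtain N N' s s' p p' where d: "direct_sum Q M N N' s s' p p'" "s*p = e" by (rule split_rep[OF M e])
  note d' = direct_sumD[OF d(1)]
  note N = d'(1,3,4) d(2) d'(7) and N' = d'(2,5,6,8)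
  have N'4: "s'*p' = rid M - e" using d'(11) d(2) by (simp add: algebra_simps)
  have e': "rid M - e : rhom Q M M" using M e by auto
  have mtf0: "mtf A B (0 :: 'a => 'c lop) v = 0\<^sub>m (fst A v) (fst B v)" for A B v by (auto simp: mtf_def mt_def intro!: eq_matI)
  have "is_direct_sum (rep_category Q) M N N'" unfolding is_direct_sum_def proof (intro bexI conjI)
   show "Add (rep_category Q)
     (Cmp (rep_category Q) (N, M, mtf M N s) (M, N, mtf N M p))
     (Cmp (rep_category Q) (N', M, mtf M N' s') (M, N', mtf N' M p')) = Idn (rep_category Q) M" proof -
    have "mtf M M e v + mtf M M (rid M - e) v = 1\<^sub>m (fst M v)" for v proof -
     have "op (mtf M M e v + mtf M M (rid M - e) v) = op (1\<^sub>m (fst M v))"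
      by (simp add: op_plus[of _ "fst M v" "fst M v"] mtf_def op_mt rhom_HV[OF e(1)] rhom_HV[OF e', simplified])
       (simp add: rid_def)
     then show ?thesis by (subst (asm) op_inject[of _ "fst M v" "fst M v"]) (auto simp: mtf_def)
    qed
    then show ?thesis by (simp add: mtf_mult[OF N(2,3)] mtf_mult[OF N'(2,3)] N(4) N'4)
   qed
  qed (auto intro!: mtf_maps M N N' simp: mtf_mult[OF N(3,2)] mtf_mult[OF N'(3,2)]
    mtf_mult[OF N'(3) N(2)] mtf_mult[OF N(3) N'(2)] N(5) N'(4) mtf_rid d'(9,10) mtf0)
  then have "rid N = 0 \<or> rid N' = 0" using ind N(1) N'(1) zero unfolding indecomposable_def by auto
  then show "e = 0 \<or> e = rid M" proof
   assume "rid N = 0"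
   then have "e = 0" using N(4) rid_left[OF N(3)] by auto
   then show ?thesis ..
  next
   assume "rid N' = 0"
   then have "rid M - e = 0" using N'4 rid_left[OF N'(3)] by auto
   then show ?thesis by simp
  qed
 qed
next
 assume M: "rindec Q M"
 then have MQ: "M : reps Q" by (simp add: rindec_def)
 note zero = zero_obj_rep[of Q]
 show "indecomposable (rep_category Q) M" unfolding indecomposable_def proof (intro conjI ballI impI)
  show "M : Ob (rep_category Q)" using MQ by simp
  show "~ zero_obj (rep_category Q) M" using M by (auto simp: zero rindec_def)
 next
  fix Y Z assume YZ: "Y : Ob (rep_category Q)" "Z : Ob (rep_category Q)"
   and sum: "is_direct_sum (rep_category Q) M Y Z"
  then obtain i j p q where h: "i : rep_maps Q Y M" "j : rep_maps Q Z M" "p : rep_maps Q M Y" "q : rep_maps Q M Z"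
   "(%v. p v*i v) = (%v. 1\<^sub>m (fst Y v))" "(%v. q v*j v) = (%v. 1\<^sub>m (fst Z v))" "(%v. p v*j v) = (%v. 0\<^sub>m (fst Y v) (fst Z v))"
   by (auto simp: is_direct_sum_def)
  have c: "i v : carrier_mat (fst M v) (fst Y v)" "j v : carrier_mat (fst M v) (fst Z v)"
   "p v : carrier_mat (fst Y v) (fst M v)" "q v : carrier_mat (fst Z v) (fst M v)" for v using h(1-4) by (auto simp: rep_maps_def)
  let ?i = "%v. op (i v)" and ?j = "%v. op (j v)" and ?p = "%v. op (p v)" and ?q = "%v. op (q v)"
  have o: "?i : rhom Q Y M" "?j : rhom Q Z M" "?p : rhom Q M Y" "?q : rhom Q M Z" using YZ MQ h by (auto intro: rep_maps_op)
  have r: "?p*?i = rid Y" "?q*?j = rid Z" "?p*?j = 0" using fun_cong[OF h(5)] fun_cong[OF h(6)] fun_cong[OF h(7)]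
   by (auto simp: fun_eq_iff rid_def op_times[OF c(3) c(1), symmetric] op_times[OF c(4) c(2), symmetric]
    op_times[OF c(3) c(2), symmetric])
  show "zero_obj (rep_category Q) Y \<or> zero_obj (rep_category Q) Z" proof (rule ccontr)
   assume "~ (zero_obj (rep_category Q) Y \<or> zero_obj (rep_category Q) Z)"
   then obtain v w where "fst Y v ~= 0" "fst Z w ~= 0" by (auto simp: zero)
   then have "?i*?p = rid M" using rindec_splitD[OF M _ _ o(1,3) r(1)] YZ by auto
   then have "?j = ?i*(?p*?j)" using rid_left[OF o(2)] by (simp add: mult.assoc[symmetric])
   then have "?j = 0" by (simp add: r)
   then have "rid Z = 0" using r(2) by simp
   with \<open>fst Z w ~= 0\<close> show False by (simp add: rid_eq_0)
  qed
 qed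
qed

lemma iso_class_rep: "M : reps Q ==> iso_class (rep_category Q) M = {N : reps Q. riso Q M N}" by (auto simp: iso_class_def iso_obj_rep_iff)

lemma iso_class_rep_iff: assumes "M : reps Q" "N : reps Q" shows "iso_class (rep_category Q) M = iso_class (rep_category Q) N <-> riso Q M N" proof
 show "riso Q M N" if "iso_class (rep_category Q) M = iso_class (rep_category Q) N"
  using that assms riso_refl[OF assms(2)] by (auto simp: iso_class_rep)
 show "iso_class (rep_category Q) M = iso_class (rep_category Q) N" if "riso Q M N" unfolding iso_class_rep[OF assms(1)] iso_class_rep[OF assms(2)]
  using riso_trans[OF that] riso_trans[OF riso_sym[OF that]] by blast
qed

section \<open>Dimensions of spaces of homomorphisms\<close>

context vector_space_pair begin

text \<open>The ambient spaces of operator families are infinite dimensional, hence the form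
  relative to a subspace \<open>U\<close> of a finite span. The proof joins a basis of the kernel to
  lifts of a basis of the image.\<close>

lemma rank_nullity_on: assumes lf: "Vector_Spaces.linear s1 s2 f" and U: "vs1.subspace U" "U <= vs1.span B0" "finite B0"
 shows "vs1.dim U = vs2.dim (f ` U) + vs1.dim {x : U. f x = 0}" proof -
 interpret f: Vector_Spaces.linear s1 s2 f by (rule lf)
 let ?K = "{x : U. f x = 0}"
 have subK: "vs1.subspace ?K" using U(1) by (auto simp: vs1.subspace_def f.add f.scale)
 obtain BK where BK: "BK <= ?K" "vs1.independent BK" "?K <= vs1.span BK" "card BK = vs1.dim ?K" by (rule vs1.basis_exists)
 obtain BI where BI: "BI <= f ` U" "vs2.independent BI" "f ` U <= vs2.span BI" "card BI = vs2.dim (f ` U)" by (rule vs2.basis_exists)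
 have "ALL b:BI. EX x. x : U & f x = b" using BI(1) by blast
 from bchoice[OF this] obtain g where g: "!!b. b : BI ==> g b : U & f (g b) = b" by blast
 let ?C = "g ` BI"
 have fC: "f ` ?C = BI" "inj_on f ?C" "inj_on g BI" using g by (auto simp: image_image inj_on_def) metis
 have fin: "finite BK" using vs1.independent_span_bound[OF U(3) BK(2)] BK(1) U(2) by blast
 have "f ` U <= vs2.span (f ` B0)" using U(2) f.span_image[of B0] by blast
 then have finI: "finite BI" using vs2.independent_span_bound[OF _ BI(2)] BI(1) U(3) by blast
 have disj: "BK \<inter> ?C = {}" proof -
  have "f x = 0" if "x : BK" for x using BK(1) that by blast
  moreover have "0 ~: BI" using vs2.dependent_zero BI(2) by (rule contrapos_nn[rotated])
  then have "f x ~= 0" if "x : ?C" for x using fC(1) that by (metis imageI)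
  ultimately show ?thesis by (meson disjoint_iff)
 qed
 have "vs1.independent (BK \<union> ?C)" proof (rule vs1.independent_if_scalars_zero)
  show "finite (BK \<union> ?C)" using fin finI by simp
  fix c x assume 0: "(\<Sum>x\<in>BK \<union> ?C. s1 (c x) x) = 0" and x: "x : BK \<union> ?C"
  have split: "(\<Sum>x\<in>BK. s1 (c x) x) + (\<Sum>x\<in>?C. s1 (c x) x) = 0"
   using 0 unfolding sum.union_disjoint[OF fin finite_imageI[OF finI] disj] .
  have "f (\<Sum>x\<in>BK. s1 (c x) x) = 0" unfolding f.sum using BK(1) by (intro sum.neutral) (auto simp: f.scale)
  then have "f (\<Sum>x\<in>?C. s1 (c x) x) = 0" using arg_cong[OF split, of f] by (simp add: f.add f.zero)
  then have "(\<Sum>b\<in>BI. s2 (c (g b)) b) = 0" unfolding f.sum sum.reindex[OF fC(3)] o_def using g by (simp add: f.scale)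
  from vs2.independentD[OF BI(2) finI subset_refl this] have cI: "c (g b) = 0" if "b : BI" for b using that .
  then have "(\<Sum>x\<in>?C. s1 (c x) x) = 0" by (intro sum.neutral) auto
  then have "(\<Sum>x\<in>BK. s1 (c x) x) = 0" using split by simp
  from vs1.independentD[OF BK(2) fin subset_refl this] have "c b = 0" if "b : BK" for b using that .
  with cI x show "c x = 0" by auto
 qed
 moreover have "BK \<union> ?C <= U" using BK(1) g by auto
 moreover have "U <= vs1.span (BK \<union> ?C)" proof
  fix x assume x: "x : U"
  have "f x : f ` vs1.span ?C" using BI(3) x f.span_image[of ?C] fC(1) by auto
  then obtain y where y: "y : vs1.span ?C" "f x = f y" by blast
  have "y : U" using y(1) vs1.span_minimal[OF _ U(1), of ?C] g by blast
  then have "x - y : ?K" using x y(2) vs1.subspace_diff[OF U(1)] by (simp add: f.diff)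
  then have "(x - y) + y : vs1.span (BK \<union> ?C)" using BK(3) y(1) vs1.span_mono[of BK "BK \<union> ?C"] vs1.span_mono[of ?C "BK \<union> ?C"]
   by (intro vs1.span_add) auto
  then show "x : vs1.span (BK \<union> ?C)" by simp
 qed
 ultimately have "vs1.dim U = card (BK \<union> ?C)" by (metis vs1.basis_card_eq_dim)
 then show ?thesis using card_Un_disjoint[OF fin _ disj] finI card_image[OF fC(3)] BK(4) BI(4) by simp
qed

end

interpretation fam: vector_space "%(c::'k::field) (f::'i => 'k lop) i. sm c (f i)" by unfold_locales (auto simp: fun_eq_iff sm_distrib)

interpretation famp: vector_space_pair "%(c::'k::field) (f::'i => 'k lop) i. sm c (f i)" "%(c::'k::field) (f::'j => 'k lop) i. sm c (f i)" ..

abbreviation lin :: "(('i => 'k::field lop) => ('j => 'k lop)) => bool" where "lin == Vector_Spaces.linear (%c f i. sm c (f i)) (%c f i. sm c (f i))"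

lemma linI: assumes "!!f g. F (f + g) = F f + F g" "!!c f. F (%i. sm c (f i)) = (%i. sm c (F f i))" shows "lin F"
 unfolding Vector_Spaces.linear_iff by (intro conjI fam.vector_space_axioms allI assms)

definition findim where
 "findim T <-> (EX B. finite B & T <= fam.span B)"

lemma findim_subset: "findim T ==> S <= T ==> findim S" by (auto simp: findim_def)

lemma dim_mono: assumes "findim T" "S <= T" shows "fam.dim S <= fam.dim T" proof -
 obtain B where B: "B <= T" "fam.independent B" "T <= fam.span B" "card B = fam.dim T" by (rule fam.basis_exists)
 moreover have "finite B" using assms(1) fam.independent_span_bound[OF _ B(2)] B(1) by (auto simp: findim_def)
 ultimately show ?thesis using fam.dim_le_card[of S B] assms(2) by auto
qed

lemma findim_dim_strict_mono: assumes "findim T" "S <= T" "fam.subspace S" "x : T" "x ~: S" shows "fam.dim S < fam.dim T" proof -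
 obtain B where B: "B <= S" "fam.independent B" "S <= fam.span B" "card B = fam.dim S" by (rule fam.basis_exists)
 have "x ~: fam.span B" using fam.span_minimal[OF B(1) assms(3)] assms(5) by blast
 then have i: "fam.independent (insert x B)" "x ~: B" using B(2) fam.independent_insertI fam.span_base by auto
 have sub: "insert x B <= T" using B(1) assms(2,4) by auto
 have "finite (insert x B)" using assms(1) fam.independent_span_bound[OF _ i(1)] sub by (auto simp: findim_def)
 then have "card (insert x B) = Suc (fam.dim S)" using i(2) B(4) by simp
 moreover have "fam.dim (insert x B) = card (insert x B)" by (rule fam.dim_eq_card_independent[OF i(1)])
 ultimately show ?thesis using dim_mono[OF assms(1) sub] by simp
qed

lemma dim_le_of_inj: assumes lf: "lin f" and U: "fam.subspace U" "findim U" and T: "f ` U <= T" "findim T" and inj: "!!x. x : U ==> f x = 0 ==> x = 0"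
 shows "fam.dim U <= fam.dim T" proof -
 obtain B0 where B0: "finite B0" "U <= fam.span B0" using U(2) by (auto simp: findim_def)
 have "{x : U. f x = 0} <= fam.span {}" using inj by auto
 from fam.dim_le_card[OF this] have "fam.dim {x : U. f x = 0} = 0" by simp
 then show ?thesis using famp.rank_nullity_on[OF lf U(1) B0(2,1)] dim_mono[OF T(2,1)] by simp
qed

text \<open>The condition off \<open>J\<close> makes the space finite dimensional for finite
  \<open>J\<close>, whatever the index type; its dimension is then the sum of the
  \<open>m i*n i\<close>.\<close>

definition HVF where
 "HVF J m n = {f. (ALL i:J. f i : HV (m i) (n i)) & (ALL i. i ~: J --> f i = 0)}"

lemma subspace_HVF: "fam.subspace (HVF J m n)" by (auto simp: fam.subspace_def HVF_def intro!: HV_add HV_sm)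

lemma app_rk1_uv: "app (rk1 (uv r) c) (uv c') r' = (if r = r' & c = c' then 1 else 0)" by (auto simp: app_rk1 uv_def)

lemma HV_expand: assumes "f : HV m n" shows "f = (\<Sum>r<m. \<Sum>c<n. sm (app f (uv c) r) (rk1 (uv r) c))" proof (rule lop_eq_uv_HV[OF assms])
 have sumHV: "finite A ==> (!!x. x : A ==> g x : HV m n) ==> sum g A : HV m n"
  for A and g :: "nat => 'a lop" by (induction A rule: finite_induct) auto
 show "(\<Sum>r<m. \<Sum>c<n. sm (app f (uv c) r) (rk1 (uv r) c)) : HV m n" by (intro sumHV HV_sm rk1_HV) (auto simp: app_E_uv)
 fix i j assume ij: "i < m" "j < n"
 have "app (\<Sum>r<m. \<Sum>c<n. sm (app f (uv c) r) (rk1 (uv r) c)) (uv j) i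
   = (\<Sum>r<m. \<Sum>c<n. app f (uv c) r*app (rk1 (uv r) c) (uv j) i)" by (simp add: app_sum sum_fun_apply)
 also have "... = (\<Sum>r<m. \<Sum>c<n. if c = j then (if r = i then app f (uv c) r else 0) else 0)" by (intro sum.cong) (auto simp: app_rk1_uv)
 also have "... = app f (uv j) i" using ij by (simp add: sum.delta)
 finally show "app f (uv j) i = app (\<Sum>r<m. \<Sum>c<n. sm (app f (uv c) r) (rk1 (uv r) c)) (uv j) i" ..
qed

lemma dim_HVF: assumes J: "finite (J :: 'i set)" shows "fam.dim (HVF J m n :: ('i => 'k::field lop) set) = (\<Sum>i\<in>J. m i*n i)"
  and "findim (HVF J m n :: ('i => 'k::field lop) set)" proof -
 define u :: "'i \<times> nat \<times> nat => 'i => 'k lop" where "u = (%(i, r, c) i'. if i' = i then rk1 (uv r) c else 0)"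
 define S where "S = (SIGMA i:J. {..<m i} \<times> {..<n i})"
 have finS: "finite S" using J by (auto simp: S_def)
 have coeff: "app (u (i, r, c) i') (uv c') r' = (if (i, r, c) = (i', r', c') then 1 else 0)" for i r c i' r' c' by (auto simp: u_def app_rk1_uv)
 have inj: "inj_on u S" proof (rule inj_onI)
  fix x y assume "x : S" "y : S" and eq: "u x = u y"
  obtain i r c where x: "x = (i, r, c)" by (cases x)
  have "app (u x i) (uv c) r = app (u y i) (uv c) r" by (simp add: eq)
  then show "x = y" by (cases y) (auto simp: x coeff split: if_splits)
 qed
 have ind: "fam.independent (u ` S)" proof (rule fam.independent_if_scalars_zero)
  fix f x assume 0: "(\<Sum>x\<in>u ` S. (%i. sm (f x) (x i))) = 0" and "x : u ` S"
  then obtain i r c where x: "x = u (i, r, c)" "(i, r, c) : S" by auto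
  have "0 = app ((\<Sum>x\<in>u ` S. (%i. sm (f x) (x i))) i) (uv c) r" by (simp add: 0)
  also have "... = (\<Sum>y\<in>S. f (u y)*app (u y i) (uv c) r)" by (simp add: sum_fun_apply app_sum sum.reindex[OF inj])
  also have "... = (\<Sum>y\<in>S. if y = (i, r, c) then f (u y) else 0)" by (intro sum.cong refl) (auto simp: coeff split: if_splits)
  also have "... = f x" using x finS by (simp add: sum.delta)
  finally show "f x = 0" by simp
 qed (use finS in simp)
 have sub: "u ` S <= HVF J m n" by (auto simp: S_def u_def HVF_def intro!: rk1_HV simp: app_E_uv)
 have span: "HVF J m n <= fam.span (u ` S)" proof
  fix f :: "'i => 'k lop" assume f: "f : HVF J m n"
  have "f = (\<Sum>x\<in>S. (%i. sm (app (f (fst x)) (uv (snd (snd x))) (fst (snd x))) (u x i)))" proof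
   fix i
   show "f i = (\<Sum>x\<in>S. (%i. sm (app (f (fst x)) (uv (snd (snd x))) (fst (snd x))) (u x i))) i" proof (cases "i : J")
    case True
    have "(\<Sum>x\<in>S. (%i. sm (app (f (fst x)) (uv (snd (snd x))) (fst (snd x))) (u x i))) i
     = (\<Sum>j\<in>J. \<Sum>rc\<in>{..<m j} \<times> {..<n j}. sm (app (f j) (uv (snd rc)) (fst rc)) (u (j, rc) i))"
     unfolding sum_fun_apply S_def using J by (subst sum.Sigma) (auto simp: case_prod_beta)
    also have "... = (\<Sum>j\<in>J. if j = i then
      (\<Sum>rc\<in>{..<m j} \<times> {..<n j}. sm (app (f j) (uv (snd rc)) (fst rc)) (u (j, rc) i)) else 0)"
     by (intro sum.cong) (auto simp: u_def case_prod_beta)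
    also have "... = (\<Sum>rc\<in>{..<m i} \<times> {..<n i}. sm (app (f i) (uv (snd rc)) (fst rc)) (u (i, rc) i))"
     using True J by (simp add: sum.delta)
    also have "... = (\<Sum>r<m i. \<Sum>c<n i. sm (app (f i) (uv c) r) (rk1 (uv r) c))"
     by (subst sum.cartesian_product) (auto simp: u_def intro!: sum.cong)
    also have "... = f i" using f True HV_expand[of "f i" "m i" "n i"] by (simp add: HVF_def)
    finally show ?thesis by simp
   next
    case False
    then show ?thesis using f unfolding sum_fun_apply by (subst sum.neutral) (auto simp: HVF_def S_def u_def)
   qed
  qed
  also have "... : fam.span (u ` S)" by (intro fam.span_sum fam.span_scale fam.span_base) auto
  finally show "f : fam.span (u ` S)" .
 qed
 have "card S = (\<Sum>i\<in>J. m i*n i)" unfolding S_def using J by (subst card_SigmaI) auto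
 then show "fam.dim (HVF J m n :: ('i => 'k lop) set) = (\<Sum>i\<in>J. m i*n i)" using fam.dim_unique[OF sub span ind] card_image[OF inj] by simp
 show "findim (HVF J m n :: ('i => 'k lop) set)" unfolding findim_def using finS span by blast
qed

section \<open>Hom, Ext and the Euler form\<close>

locale quiver = fin_digraph Q for Q :: "('v, 'a) pre_digraph"
begin

abbreviation hd where "hd == head Q"
abbreviation tl where "tl == tail Q"
abbreviation Cpx where "Cpx == complexes Q"
abbreviation Q0 where "Q0 == verts Q"
abbreviation Q1 where "Q1 == arcs Q"
abbreviation Rep where "Rep == reps Q"
abbreviation DQ where "DQ == derived_category Q"
abbreviation rhm where "rhm == rhom Q"

definition dv :: "('v, 'a, 'k) rep => 'v => int" where "dv M v = int (fst M v)"

definition eform :: "('v => int) => ('v => int) => int" where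
 "eform x y = (\<Sum>v\<in>Q0. x v*y v) - (\<Sum>a\<in>Q1. x (tl a)*y (hd a))"

lemma dim_outside: "M : Rep ==> v ~: Q0 ==> fst M v = 0" by (auto simp: reps_def)

text \<open>The differential of the two-term complex from vertexwise to arrowwise maps that the
  standard projective resolution of \<open>M\<close> gives: its kernel is Hom(M, N), its cokernel is
  the first Ext group.\<close>

definition cob :: "('v, 'a, 'k::field) rep => ('v, 'a, 'k) rep => ('v => 'k lop) => 'a => 'k lop" where
 "cob M N h = (%a. if a : Q1 then h (hd a)*ar M a - ar N a*h (tl a) else 0)"

definition vhom :: "('v, 'a, 'k::field) rep => ('v, 'a, 'k) rep => ('v => 'k lop) set" where
 "vhom M N = HVF (Q0) (fst N) (fst M)"

definition ahom :: "('v, 'a, 'k::field) rep => ('v, 'a, 'k) rep => ('a => 'k lop) set" where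
 "ahom M N = HVF (Q1) (%a. fst N (hd a)) (%a. fst M (tl a))"

text \<open>Vanishing of the first Ext group. A family \<open>pz\<close> is the off-diagonal block
  of an extension of \<open>M\<close> by \<open>N\<close>, and a solution \<open>h\<close> is a
  change of basis that removes the block, i.e. splits the extension.\<close>

definition Ext0 :: "('v, 'a, 'k::field) rep => ('v, 'a, 'k) rep => bool" where
 "Ext0 M N <-> (ALL pz. (ALL a:Q1. pz a : HV (fst N (hd a)) (fst M (tl a))) -->
   (EX h. (ALL v. h v : HV (fst N v) (fst M v)) &
    (ALL a:Q1. pz a = h (hd a)*ar M a - ar N a*h (tl a))))"

definition hom :: "('v, 'a, 'k::field) rep => ('v, 'a, 'k) rep => nat" where
 "hom M N = fam.dim (rhm M N)"

lemma vhom_iff: assumes "M : Rep" "N : Rep" shows "h : vhom M N <-> (ALL v. h v : HV (fst N v) (fst M v))" proof -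
 have "h v : HV (fst N v) (fst M v) <-> h v = 0" if "v ~: Q0" for v using HV_0l[of "h v" "fst M v"] dim_outside[OF assms(2) that] by auto
 then show ?thesis unfolding vhom_def HVF_def by auto
qed

lemma lin_cob: "lin (cob M N)" by (rule linI) (auto simp: cob_def fun_eq_iff algebra_simps sm_distrib)

lemma cob_ahom: assumes "M : Rep" "N : Rep" shows "cob M N ` vhom M N <= ahom M N" proof
 fix pz assume "pz : cob M N ` vhom M N"
 then obtain h where h: "pz = cob M N h" "!!v. h v : HV (fst N v) (fst M v)" using assms vhom_iff by blast
 then show "pz : ahom M N" using HV_mult[OF h(2) ar_HV[OF assms(1)]] HV_mult[OF ar_HV[OF assms(2)] h(2)]
  by (auto simp: ahom_def HVF_def cob_def intro!: HV_diff)
qed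

lemma rhom_eq: "M : Rep ==> N : Rep ==> rhm M N = {h : vhom M N. cob M N h = 0}" by (auto simp: vhom_iff rhom_def cob_def fun_eq_iff split: if_splits)

lemma Ext0_iff: fixes M :: "('v, 'a, 'k::field) rep" assumes "M : Rep" "N : Rep" shows "Ext0 M N <-> cob M N ` vhom M N = ahom M N" proof
 assume E: "Ext0 M N"
 have "ahom M N <= cob M N ` vhom M N" proof
  fix pz assume p: "pz : ahom M N"
  then obtain h where h: "ALL v. h v : HV (fst N v) (fst M v)" "ALL a:Q1. pz a = h (hd a)*ar M a - ar N a*h (tl a)"
   using E unfolding Ext0_def ahom_def HVF_def by blast
  then have "pz = cob M N h" using p by (auto simp: ahom_def HVF_def cob_def fun_eq_iff)
  then show "pz : cob M N ` vhom M N" using h(1) vhom_iff[OF assms] by blast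
 qed
 then show "cob M N ` vhom M N = ahom M N" using cob_ahom[OF assms] by blast
next
 assume eq: "cob M N ` vhom M N = ahom M N"
 show "Ext0 M N" unfolding Ext0_def proof (intro allI impI)
  fix pz :: "'a => 'k lop"
  assume p: "ALL a:Q1. pz a : HV (fst N (hd a)) (fst M (tl a))"
  then have "(%a. if a : Q1 then pz a else 0) : cob M N ` vhom M N" unfolding eq by (auto simp: ahom_def HVF_def)
  then obtain h where h: "h : vhom M N" "(%a. if a : Q1 then pz a else 0) = cob M N h" by blast
  have "pz a = h (hd a)*ar M a - ar N a*h (tl a)" if "a : Q1" for a using fun_cong[OF h(2), of a] that by (simp add: cob_def)
  then show "EX h. (ALL v. h v : HV (fst N v) (fst M v)) &
    (ALL a:Q1. pz a = h (hd a)*ar M a - ar N a*h (tl a))" using h(1) vhom_iff[OF assms] by blast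
 qed
qed

lemma findim_vhom: "findim (vhom M N)" "findim (ahom M N)" unfolding vhom_def ahom_def by (simp_all add: dim_HVF(2))

lemma subspace_vhom: "fam.subspace (vhom M N)" "fam.subspace (ahom M N)" unfolding vhom_def ahom_def by (rule subspace_HVF)+

lemma subspace_rhom: "fam.subspace (rhm M N)" by (auto simp: fam.subspace_def intro!: rhom_add rhom_sm)

lemma findim_rhom: "M : Rep ==> N : Rep ==> findim (rhm M N)" by (rule findim_subset[OF findim_vhom(1)[of M N]]) (auto simp: rhom_eq)

text \<open>The dimension of the cokernel of \<open>cob\<close>. The truncated subtraction is
  harmless, since \<open>cob_ahom\<close> puts the image inside \<open>ahom M N\<close>.\<close>

definition ext :: "('v, 'a, 'k::field) rep => ('v, 'a, 'k) rep => nat" where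
 "ext M N = fam.dim (ahom M N) - fam.dim (cob M N ` vhom M N)"

lemma ext_eq_0_iff: assumes "M : Rep" "N : Rep" shows "ext M N = 0 <-> Ext0 M N" proof
 assume "Ext0 M N" then show "ext M N = 0" by (simp add: ext_def Ext0_iff[OF assms])
next
 assume 0: "ext M N = 0"
 have sub: "fam.subspace (cob M N ` vhom M N)" by (rule famp.linear_subspace_image[OF lin_cob subspace_vhom(1)])
 show "Ext0 M N" proof (rule ccontr)
  assume "~ Ext0 M N"
  then obtain pz where "pz : ahom M N" "pz ~: cob M N ` vhom M N" using Ext0_iff[OF assms] cob_ahom[OF assms] by blast
  from findim_dim_strict_mono[OF findim_vhom(2) cob_ahom[OF assms] sub this] 0
  show False by (simp add: ext_def)
 qed
qed

text \<open>Rank-nullity for \<open>cob\<close>: both sides are the Euler characteristic of the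
  two-term complex.\<close>

theorem euler_form: assumes "M : Rep" "N : Rep" shows "int (hom M N) - int (ext M N) = eform (dv M) (dv N)" proof -
 obtain B0 where B0: "finite B0" "vhom M N <= fam.span B0" using findim_vhom(1)[of M N] by (auto simp: findim_def)
 have "fam.dim (vhom M N) = fam.dim (cob M N ` vhom M N) + hom M N" using famp.rank_nullity_on[OF lin_cob subspace_vhom(1) B0(2,1)]
  by (simp add: hom_def rhom_eq[OF assms])
 moreover have "fam.dim (cob M N ` vhom M N) <= fam.dim (ahom M N)" by (rule dim_mono[OF findim_vhom(2) cob_ahom[OF assms]])
 ultimately have "int (hom M N) - int (ext M N) = int (fam.dim (vhom M N)) - int (fam.dim (ahom M N))" by (simp add: ext_def)
 then show ?thesis by (simp add: vhom_def ahom_def dim_HVF(1) eform_def dv_def mult.commute)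
qed

lemma hom_le: assumes "M : Rep" "N : Rep" "M' : Rep" "N' : Rep" "lin F"
  "!!f. f : rhm M N ==> F f : rhm M' N'" "!!f. f : rhm M N ==> F f = 0 ==> f = 0"
 shows "hom M N <= hom M' N'" unfolding hom_def using assms by (intro dim_le_of_inj[OF assms(5) subspace_rhom findim_rhom _ findim_rhom]) auto

text \<open>Dimension count along a left exact sequence: \<open>F\<close> is the map induced on Hom
  spaces, and \<open>G\<close> embeds the kernel of \<open>F\<close>. A morphism \<open>t\<close>
  missed by \<open>F\<close> makes the estimate strict.\<close>

lemma hom_le_add: assumes "M : Rep" "N : Rep" "M' : Rep" "N' : Rep" "L : Rep" "L' : Rep" "lin F" "lin G" "!!f. f : rhm M N ==> F f : rhm M' N'"
  "!!f. f : rhm M N ==> F f = 0 ==> G f : rhm L L'" "!!f. f : rhm M N ==> F f = 0 ==> G f = 0 ==> f = 0"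
 shows "hom M N <= hom M' N' + hom L L'" and "t : rhm M' N' ==> t ~: F ` rhm M N ==> hom M N < hom M' N' + hom L L'" proof -
 let ?K = "{x : rhm M N. F x = 0}"
 obtain B0 where B0: "finite B0" "rhm M N <= fam.span B0" using findim_rhom[OF assms(1,2)] by (auto simp: findim_def)
 note rn = famp.rank_nullity_on[OF assms(7) subspace_rhom B0(2,1)]
 interpret F: Vector_Spaces.linear "%c f i. sm c (f i)" "%c f i. sm c (f i)" F by (rule assms(7))
 have sK: "fam.subspace ?K" using subspace_rhom[of M N] by (auto simp: fam.subspace_def F.add F.scale)
 have fK: "findim ?K" by (rule findim_subset[OF findim_rhom[OF assms(1,2)]]) auto
 have k: "fam.dim ?K <= hom L L'" unfolding hom_def using assms(10,11) by (intro dim_le_of_inj[OF assms(8) sK fK _ findim_rhom[OF assms(5,6)]]) auto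
 have FU: "F ` rhm M N <= rhm M' N'" using assms(9) by blast
 have "fam.dim (F ` rhm M N) <= hom M' N'" unfolding hom_def by (rule dim_mono[OF findim_rhom[OF assms(3,4)] FU])
 then show "hom M N <= hom M' N' + hom L L'" using rn k by (simp add: hom_def)
 assume t: "t : rhm M' N'" "t ~: F ` rhm M N"
 have "fam.dim (F ` rhm M N) < hom M' N'" unfolding hom_def by (rule findim_dim_strict_mono[OF findim_rhom[OF assms(3,4)] FU
     famp.linear_subspace_image[OF assms(7) subspace_rhom] t])
 then show "hom M N < hom M' N' + hom L L'" using rn k by (simp add: hom_def)
qed

lemma hom_ge_add: assumes "M : Rep" "N : Rep" "L : Rep" "L' : Rep" "lin F" "lin G" "rhm M' N' <= F ` rhm M N"
  "!!f. f : rhm L L' ==> G f : rhm M N & F (G f) = 0" "!!f. f : rhm L L' ==> G f = 0 ==> f = 0"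
 shows "hom M' N' + hom L L' <= hom M N" proof -
 let ?K = "{x : rhm M N. F x = 0}"
 obtain B0 where B0: "finite B0" "rhm M N <= fam.span B0" using findim_rhom[OF assms(1,2)] by (auto simp: findim_def)
 note rn = famp.rank_nullity_on[OF assms(5) subspace_rhom B0(2,1)]
 have fK: "findim ?K" by (rule findim_subset[OF findim_rhom[OF assms(1,2)]]) auto
 have "hom L L' <= fam.dim ?K" unfolding hom_def
  using assms(8,9) by (intro dim_le_of_inj[OF assms(6) subspace_rhom findim_rhom[OF assms(3,4)] _ fK]) auto
 moreover have "F ` rhm M N <= fam.span (F ` B0)" using B0(2) famp.linear_span_image[OF assms(5)] by blast
 then have "findim (F ` rhm M N)" unfolding findim_def using B0(1) by blast
 then have "hom M' N' <= fam.dim (F ` rhm M N)" unfolding hom_def using assms(7) by (rule dim_mono)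
 ultimately show ?thesis using rn by (simp add: hom_def)
qed

lemma lin_left: "lin (%f. g*f)" and lin_right: "lin (%f. f*g)" by (rule linI; auto simp: fun_eq_iff algebra_simps)+

end

section \<open>Gabriel's theorem\<close>

text \<open>As operators on sequences, the inclusion of the first \<open>a\<close> coordinates and
  the projection back to them are the same element \<open>E a\<close>; only the corners in which
  they are read differ.\<close>

definition emb1 where "emb1 a b = E a"
definition emb2 where
 "emb2 a b = Lop (%x i. if a <= i & i < a + b then x (i - a) else 0)"
definition prj1 where "prj1 a b = E a"
definition prj2 where "prj2 a b = Lop (%x i. if i < b then x (i + a) else 0)"

lemma direct_sum_ops: "(emb1 a b :: 'k::field lop) : HV (a + b) a" "(emb2 a b :: 'k lop) : HV (a + b) b"
 "(prj1 a b :: 'k lop) : HV a (a + b)" "(prj2 a b :: 'k lop) : HV b (a + b)"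
 "prj1 a b*emb1 a b = (E a :: 'k lop)" "prj2 a b*emb2 a b = (E b :: 'k lop)" "prj1 a b*emb2 a b = (0 :: 'k lop)" "prj2 a b*emb1 a b = (0 :: 'k lop)"
 "emb1 a b*prj1 a b + emb2 a b*prj2 a b = (E (a + b) :: 'k lop)" proof -
 have "app (emb2 a b) x = (%i. if a <= i & i < a + b then x (i - a) else 0)"
  "app (prj2 a b) x = (%i. if i < b then x (i + a) else 0)" for x :: "nat => 'x::field"
  unfolding emb2_def prj2_def by (subst app_Lop; auto simp: fun_eq_iff)+
 note sp = this emb1_def prj1_def app_E fun_eq_iff
 show "(emb1 a b :: 'k lop) : HV (a + b) a" "(emb2 a b :: 'k lop) : HV (a + b) b"
  "(prj1 a b :: 'k lop) : HV a (a + b)" "(prj2 a b :: 'k lop) : HV b (a + b)" by (auto intro!: HVI lop_eqI simp: sp)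
 show "prj1 a b*emb1 a b = (E a :: 'k lop)" "prj2 a b*emb2 a b = (E b :: 'k lop)"
  "prj1 a b*emb2 a b = (0 :: 'k lop)" "prj2 a b*emb1 a b = (0 :: 'k lop)" "emb1 a b*prj1 a b + emb2 a b*prj2 a b = (E (a + b) :: 'k lop)"
  by (auto intro!: lop_eqI simp: sp)
qed

text \<open>Algebraic closedness enters the theory of endomorphism rings here, through a root of the
  characteristic polynomial.\<close>

lemma eigenvector_exists: fixes f :: "'k::alg_closed_field lop" assumes f: "f : HV n n" and n: "n ~= 0"
 obtains c x where "x ~= 0" "app (E n) x = x" "app f x = (%i. c*x i)" proof -
 let ?A = "mt n n f"
 have A: "?A : carrier_mat n n" by simp
 have "degree (char_poly ?A) > 0" using degree_monic_char_poly[OF A] n by simp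
 then obtain c where "poly (char_poly ?A) c = 0" using alg_closed_imp_poly_has_root by blast
 then obtain w where w: "w : carrier_vec n" "w ~= 0\<^sub>v n" "?A *\<^sub>v w = c \<cdot>\<^sub>v w"
  using eigenvalue_root_char_poly[OF A] A by (auto simp: eigenvalue_def eigenvector_def)
 have "sq w ~= sq (0\<^sub>v n)" using w(1,2) sq_inject[OF w(1), of "0\<^sub>v n"] by simp
 then have "sq w ~= 0" by simp
 moreover have "app f (sq w) = (%i. c*sq w i)" proof -
  have "app f (sq w) = sq (c \<cdot>\<^sub>v w)" using sq_mult_mat_vec[OF A w(1)] w(3) by (simp add: op_mt f)
  also have "... = (%i. c*sq w i)" by (auto simp: sq_def fun_eq_iff)
  finally show ?thesis .
 qed
 ultimately show thesis using that sq_carrier[OF w(1)] by blast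
qed

text \<open>Vertexwise linear maps that need not commute with the arrows. Sections of epimorphisms
  and retractions of monomorphisms always exist in this class, so injectivity and surjectivity are
  expressed by one-sided inverses from \<open>VH\<close>.\<close>

definition VH :: "('v, 'a, 'k::field) rep => ('v, 'a, 'k) rep => ('v => 'k lop) set" where
 "VH M N = {f. ALL v. f v : HV (fst N v) (fst M v)}"

lemma VH_mult: "f : VH M N ==> g : VH L M ==> f*g : VH L N" by (auto simp: VH_def)
lemma VH_add: "f : VH M N ==> g : VH M N ==> f + g : VH M N" by (auto simp: VH_def)
lemma VH_diff: "f : VH M N ==> g : VH M N ==> f - g : VH M N" by (auto simp: VH_def)
lemma VH_uminus: "f : VH M N ==> - f : VH M N" by (auto simp: VH_def)
lemma rhom_VH: "f : rhom Q M N ==> f : VH M N" by (simp add: VH_def rhom_def)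
lemma VHD: assumes "f : VH M N" shows "rid N*f = f" "f*rid M = f" using assms HVD(1,2) unfolding VH_def rid_def fun_eq_iff times_fun_apply by blast+
lemma VH_rid: "f : VH M N ==> rid N*(f*x) = f*x" "f : VH M N ==> f*(rid M*x) = f*x" by (simp_all add: mult.assoc[symmetric] VHD)
lemma VH_at: "f : VH M N ==> f v : HV (fst N v) (fst M v)" by (simp add: VH_def)

lemma rhom_inverse: assumes f: "f : rhom Q M N" and g: "g : VH N M" "g*f = rid M" "f*g = rid N" and MN: "M : reps Q" "N : reps Q"
 shows "g : rhom Q N M" proof (rule rhomI)
 show "g v : HV (fst M v) (fst N v)" for v using g(1) by (simp add: VH_def)
 fix a assume a: "a : arcs Q"
 have gf: "g v*f v = E (fst M v)" "f v*g v = E (fst N v)" for v using fun_cong[OF g(2), of v] fun_cong[OF g(3), of v] by (simp_all add: rid_def)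
 have "g (head Q a)*ar N a = g (head Q a)*(ar N a*(f (tail Q a)*g (tail Q a)))" by (simp add: gf HVD[OF ar_HV[OF MN(2) a]])
 also have "... = (g (head Q a)*f (head Q a))*(ar M a*g (tail Q a))" by (simp add: mult.assoc massoc[OF rhom_ar[OF f a]])
 also have "... = ar M a*g (tail Q a)" by (simp add: gf HVD[OF ar_HV[OF MN(1) a]])
 finally show "g (head Q a)*ar N a = ar M a*g (tail Q a)" .
qed

context quiver begin

definition td :: "('v, 'a, 'k::field) rep => nat" where
 "td M = (\<Sum>v\<in>Q0. fst M v)"

lemma mono_td: assumes MN: "M : Rep" "N : Rep" and s: "s : VH N M" "s' : VH M N" "s'*s = rid N"
 shows "td N <= td M" "td M <= td N ==> s*s' = rid M" "fst N v <= fst M v" proof -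
 have ss: "s' v*s v = E (fst N v)" for v using fun_cong[OF s(3), of v] by (simp add: rid_def)
 have le: "fst N v <= fst M v" for v using left_inv_le[OF VH_at[OF s(1)] VH_at[OF s(2)] ss] .
 then show "fst N v <= fst M v" "td N <= td M" unfolding td_def by (auto intro: sum_mono)
 assume "td M <= td N"
 then have "(\<Sum>v\<in>Q0. fst M v - fst N v) = 0" using le by (simp add: td_def sum_subtractf_nat)
 then have "fst M v <= fst N v" if "v : Q0" for v using that by simp
 then have "fst M v <= fst N v" for v using dim_outside[OF MN(1), of v] by (cases "v : Q0") auto
 then have "s v*s' v = E (fst M v)" for v using left_inverse_dim_eq(2)[OF VH_at[OF s(1)] VH_at[OF s(2)] ss] by blast
 then show "s*s' = rid M" by (auto simp: rid_def fun_eq_iff)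
qed

text \<open>Rank factorisation at every vertex; the arrows of \<open>N\<close> restrict to the
  image, and \<open>p\<close> and \<open>i\<close> then commute with arrows because \<open>i\<close>
  is \<open>f\<close> after a vertexwise section and \<open>p\<close> is \<open>f\<close> followed
  by a retraction.\<close>

lemma image_fact: assumes MN: "M : Rep" "N : Rep" and f: "f : rhm M N"
 obtains I p i p' i' where "I : Rep" "p : rhm M I" "i : rhm I N" "p' : VH I M" "i' : VH N I" "f = i*p" "p*p' = rid I" "i'*i = rid I" proof -
 have "ALL v. EX r B C B' C'. B : HV (fst N v) r & C : HV r (fst M v) & B' : HV r (fst N v) & C' : HV (fst M v) r &
  f v = B*C & B'*B = E r & C*C' = E r" by (intro allI rank_factorization[OF rhom_HV[OF f]])
 then obtain d i p i' p' where h: "!!v. i v : HV (fst N v) (d v)" "!!v. p v : HV (d v) (fst M v)"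
  "!!v. i' v : HV (d v) (fst N v)" "!!v. p' v : HV (fst M v) (d v)" "!!v. f v = i v*p v" "!!v. i' v*i v = E (d v)" "!!v. p v*p' v = E (d v)"
  unfolding choice_iff by blast
 have d0: "d v = 0" if "v ~: Q0" for v using left_inv_le[OF h(1,3,6), of v] dim_outside[OF MN(2) that] by simp
 obtain I where I: "I : Rep" "fst I = d" "!!a. a : Q1 ==> ar I a = i' (hd a)*(ar N a*i (tl a))" using rep_transport[OF MN(2) d0 h(1) h(3)] by blast
 have fp: "i v = f v*p' v" for v by (simp add: h(5) mult.assoc h(7) HVD[OF h(1)])
 have iI: "i' v*f v = p v" for v by (simp add: h(5) massoc[OF h(6)] HVD[OF h(2)])
 have 1: "i (hd a)*ar I a = ar N a*i (tl a)" if a: "a : Q1" for a proof -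
  have "ar N a*i (tl a) = f (hd a)*(ar M a*p' (tl a))" by (simp add: fp massoc[OF rhom_ar[OF f a]] mult.assoc[symmetric] rhom_ar[OF f a])
  moreover have "i (hd a)*(i' (hd a)*f (hd a)) = f (hd a)" by (simp only: iI h(5)[symmetric])
  ultimately show ?thesis by (simp add: I(3)[OF a]) (metis mult.assoc)
 qed
 have 2: "p (hd a)*ar M a = ar I a*p (tl a)" if a: "a : Q1" for a proof -
  have "ar I a*p (tl a) = i' (hd a)*(ar N a*f (tl a))" by (simp add: I(3)[OF a] mult.assoc h(5))
  also have "... = p (hd a)*ar M a" by (simp add: rhom_ar[OF f a, symmetric] massoc[OF iI])
  finally show ?thesis ..
 qed
 show thesis proof (rule that[OF I(1)])
  show "p : rhm M I" by (rule rhomI) (simp_all add: I(2) h(2) 2)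
  show "i : rhm I N" by (rule rhomI) (simp_all add: I(2) h(1) 1)
  show "p' : VH I M" "i' : VH N I" by (simp_all add: VH_def I(2) h)
  show "f = i*p" "p*p' = rid I" "i'*i = rid I" by (auto simp: fun_eq_iff rid_def I(2) h)
 qed
qed

text \<open>The kernel is the image of the vertexwise idempotent \<open>rid M - p'*p\<close>. This
  idempotent is in general not a morphism, but its image is stable under the arrows because
  \<open>p\<close> is one.\<close>

lemma kernel_exists: assumes MN: "M : Rep" "N : Rep" and p: "p : rhm M N" "p' : VH N M" "p*p' = rid N"
 obtains K k k' where "K : Rep" "k : rhm K M" "k' : VH M K" "k'*k = rid K" "k*k' = rid M - p'*p" "p*k = 0" proof -
 have pp: "p v*p' v = E (fst N v)" for v using fun_cong[OF p(3), of v] by (simp add: rid_def)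
 have P: "p v : HV (fst N v) (fst M v)" "p' v : HV (fst M v) (fst N v)" for v using VH_at[OF rhom_VH[OF p(1)]] VH_at[OF p(2)] by auto
 let ?e = "%v. E (fst M v) - p' v*p v"
 have eHV: "?e v : HV (fst M v) (fst M v)" for v by (intro HV_diff HV_mult[OF P(2) P(1)] HV_E)
 have eid: "?e v*?e v = ?e v" for v by (simp add: algebra_simps massoc[OF pp] HVD[OF P(1)] HVD[OF P(2)])
 have "ALL v. EX r s q. s : HV (fst M v) r & q : HV r (fst M v) & s*q = ?e v & q*s = E r" by (rule allI, rule split_idempotent[OF eHV eid]) blast
 then obtain d k k' where h: "!!v. k v : HV (fst M v) (d v)" "!!v. k' v : HV (d v) (fst M v)"
  "!!v. k v*k' v = ?e v" "!!v. k' v*k v = E (d v)" unfolding choice_iff by blast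
 have d0: "d v = 0" if "v ~: Q0" for v using left_inv_le[OF h(1,2,4), of v] dim_outside[OF MN(1) that] by simp
 obtain K where K: "K : Rep" "fst K = d" "!!a. a : Q1 ==> ar K a = k' (hd a)*(ar M a*k (tl a))" using rep_transport[OF MN(1) d0 h(1) h(2)] by blast
 have pk: "p v*k v = 0" for v proof -
  have "p v*k v = p v*(k v*k' v)*k v" by (simp add: mult.assoc h(4) HVD[OF h(1)])
  also have "... = 0" unfolding h(3) by (simp add: algebra_simps massoc[OF pp] HVD[OF P(1)])
  finally show ?thesis .
 qed
 have "k : rhm K M" proof (rule rhomI)
  fix a assume a: "a : Q1"
  have "k (hd a)*ar K a = ?e (hd a)*(ar M a*k (tl a))" by (simp add: K(3)[OF a] massoc[OF h(3)])
  also have "... = ar M a*k (tl a) - p' (hd a)*((p (hd a)*ar M a)*k (tl a))" by (simp add: algebra_simps HVD[OF ar_HV[OF MN(1) a]])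
  also have "... = ar M a*k (tl a)" by (simp add: rhom_ar[OF p(1) a] mult.assoc pk)
  finally show "k (hd a)*ar K a = ar M a*k (tl a)" .
 qed (simp add: K(2) h)
 from that[OF K(1) this, of k'] show thesis by (auto simp: VH_def K(2) h rid_def fun_eq_iff pk)
qed

lemma Ext0E: assumes "Ext0 M N" "!!a. a : Q1 ==> pz a : HV (fst N (hd a)) (fst M (tl a))"
 obtains h where "h : VH M N" "!!a. a : Q1 ==> pz a = h (hd a)*ar M a - ar N a*h (tl a)" proof -
 from assms(1)[unfolded Ext0_def, rule_format, OF assms(2)] obtain h where "(ALL v. h v : HV (fst N v) (fst M v)) &
   (ALL a:Q1. pz a = h (hd a)*ar M a - ar N a*h (tl a))" ..
 then show thesis using that[of h] by (simp add: VH_def)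
qed

lemma Ext0I: fixes M N :: "('v, 'a, 'k::field) rep" assumes "!!pz. (!!a. a : Q1 ==> pz a : HV (fst N (hd a)) (fst M (tl a))) ==>
  EX h:VH M N. ALL a:Q1. pz a = h (hd a)*ar M a - ar N a*h (tl a)"
 shows "Ext0 M N" unfolding Ext0_def proof (intro allI impI)
 fix pz :: "'a => 'k lop" assume "ALL a:Q1. pz a : HV (fst N (hd a)) (fst M (tl a))"
 then obtain h where "h : VH M N" "ALL a:Q1. pz a = h (hd a)*ar M a - ar N a*h (tl a)" using assms[of pz] by auto
 then show "EX h. (ALL v. h v : HV (fst N v) (fst M v)) &
   (ALL a:Q1. pz a = h (hd a)*ar M a - ar N a*h (tl a))" by (intro exI[of _ h]) (simp add: VH_def)
qed

text \<open>\<open>Ext\<^sup>1\<close> is right exact in both variables, because path algebras are hereditary.\<close>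

lemma Ext0_sub: fixes X Y I :: "('v, 'a, 'k::field) rep" assumes E: "Ext0 X Y" and i: "i : rhm I X" "i' : VH X I" "i'*i = rid I" shows "Ext0 I Y"
proof (rule Ext0I)
 fix pz :: "'a => 'k lop" assume pz: "!!a. a : Q1 ==> pz a : HV (fst Y (hd a)) (fst I (tl a))"
 obtain h where h: "h : VH X Y" "!!a. a : Q1 ==> pz a*i' (tl a) = h (hd a)*ar X a - ar Y a*h (tl a)"
  by (rule Ext0E[OF E, of "%a. pz a*i' (tl a)"]) (auto intro: HV_mult pz VH_at[OF i(2)])
 have ii: "i' v*i v = E (fst I v)" for v using fun_cong[OF i(3), of v] by (simp add: rid_def)
 show "EX h:VH I Y. ALL a:Q1. pz a = h (hd a)*ar I a - ar Y a*h (tl a)" proof (intro bexI[of _ "h*i"] ballI)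
  fix a assume a: "a : Q1"
  have "pz a = pz a*i' (tl a)*i (tl a)" by (simp add: mult.assoc ii HVD[OF pz[OF a]])
  also have "... = h (hd a)*(ar X a*i (tl a)) - ar Y a*(h (tl a)*i (tl a))" unfolding h(2)[OF a] by (simp add: algebra_simps)
  finally show "pz a = (h*i) (hd a)*ar I a - ar Y a*(h*i) (tl a)" by (simp add: rhom_ar[OF i(1) a, symmetric] mult.assoc)
 qed (rule VH_mult[OF h(1) rhom_VH[OF i(1)]])
qed

lemma Ext0_quot: fixes X Y J :: "('v, 'a, 'k::field) rep" assumes E: "Ext0 X Y" and e: "e : rhm Y J" "e' : VH J Y" "e*e' = rid J" shows "Ext0 X J"
proof (rule Ext0I)
 fix pz :: "'a => 'k lop" assume pz: "!!a. a : Q1 ==> pz a : HV (fst J (hd a)) (fst X (tl a))"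
 obtain h where h: "h : VH X Y" "!!a. a : Q1 ==> e' (hd a)*pz a = h (hd a)*ar X a - ar Y a*h (tl a)"
  by (rule Ext0E[OF E, of "%a. e' (hd a)*pz a"]) (auto intro: HV_mult pz VH_at[OF e(2)])
 have ee: "e v*e' v = E (fst J v)" for v using fun_cong[OF e(3), of v] by (simp add: rid_def)
 show "EX h:VH X J. ALL a:Q1. pz a = h (hd a)*ar X a - ar J a*h (tl a)" proof (intro bexI[of _ "e*h"] ballI)
  fix a assume a: "a : Q1"
  have "pz a = e (hd a)*(e' (hd a)*pz a)" by (simp add: massoc[OF ee] HVD[OF pz[OF a]])
  also have "... = e (hd a)*h (hd a)*ar X a - (e (hd a)*ar Y a)*h (tl a)" unfolding h(2)[OF a] by (simp add: algebra_simps)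
  finally show "pz a = (e*h) (hd a)*ar X a - ar J a*(e*h) (tl a)" by (simp add: rhom_ar[OF e(1) a] mult.assoc)
 qed (rule VH_mult[OF rhom_VH[OF e(1)] h(1)])
qed

text \<open>A nontrivial idempotent \<open>e\<close> of \<open>K\<close> splits \<open>u\<close>
  into \<open>e*u\<close> and its complement, not both zero. Descending into a part where
  \<open>u\<close> survives lowers the total dimension.\<close>

lemma rindec_summand: assumes "K : Rep" "u : VH I K" "u ~= 0"
 obtains N s r where "rindec Q N" "s : rhm N K" "r : rhm K N" "r*s = rid N" "r*u ~= 0" using assms
proof (induction "td K" arbitrary: K u thesis rule: less_induct)
 case less
 note K = less.prems(2) and u = less.prems(3,4)
 have "EX v. fst K v ~= 0" proof (rule ccontr)
  assume "~ (EX v. fst K v ~= 0)"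
  then have "rid K = 0" by (simp add: rid_eq_0)
  then show False using VHD(1)[OF u(1)] u(2) by simp
 qed
 show ?case proof (cases "rindec Q K")
  case True
  then show thesis using less.prems(1)[of K "rid K" "rid K"] K u by (simp add: VHD(1)[OF u(1)])
 next
  case False
  then obtain e where e: "e : rhm K K" "e*e = e" "e ~= 0" "e ~= rid K" using K \<open>EX v. fst K v ~= 0\<close> by (auto simp: rindec_def)
  have step: thesis if f: "f : rhm K K" "f*f = f" "f ~= rid K" "f*u ~= 0" for f proof -
   obtain A s p where A: "A : Rep" "s : rhm A K" "p : rhm K A" "s*p = f" "p*s = rid A" using rep_split[OF K f(1,2)] by blast
   have "td A < td K" using mono_td(2)[OF K A(1) rhom_VH[OF A(2)] rhom_VH[OF A(3)] A(5)] A(4) f(3) by force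
   moreover have "p*u ~= 0" using f(4) A(4) by (auto simp: mult.assoc)
   ultimately obtain N s' r' where "rindec Q N" "s' : rhm N A" "r' : rhm A N" "r'*s' = rid N" "r'*(p*u) ~= 0"
    using less.hyps[of A "p*u"] A(1) VH_mult[OF rhom_VH[OF A(3)] u(1)] by blast
   moreover from this have "(r'*p)*(s*s') = rid N" by (simp add: mult.assoc massoc[OF A(5)] VHD(1)[OF rhom_VH])
   ultimately show thesis using less.prems(1)[of N "s*s'" "r'*p"] A by (auto simp: mult.assoc)
  qed
  show thesis proof (cases "e*u = 0")
   case True
   have "(rid K - e)*u = u" using True by (simp add: left_diff_distrib VHD(1)[OF u(1)])
   moreover have "(rid K - e)*(rid K - e) = rid K - e" using e by (simp add: algebra_simps rid_left[OF e(1)] rid_right[OF e(1)])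
   ultimately show thesis using step[of "rid K - e"] K e u(2) by auto
  qed (use step e in blast)
 qed
qed

lemma hom_pos_iff: assumes "M : Rep" "N : Rep" shows "hom M N >= 1 <-> (EX f:rhm M N. f ~= 0)" proof
 assume 1: "hom M N >= 1"
 show "EX f:rhm M N. f ~= 0" proof (rule ccontr)
  assume "~ ?thesis"
  then have "rhm M N <= fam.span {}" by auto
  from fam.dim_le_card[OF this] 1 show False by (simp add: hom_def)
 qed
next
 assume "EX f:rhm M N. f ~= 0"
 then obtain f where f: "f : rhm M N" "f ~= 0" by blast
 have "fam.dim {f} = card {f}" by (rule fam.dim_eq_card_independent) (simp add: f)
 moreover have "fam.dim {f} <= hom M N" unfolding hom_def using f(1) by (intro dim_mono[OF findim_rhom[OF assms]]) simp
 ultimately show "hom M N >= 1" by simp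
qed

lemma eform_diff: "eform (%v. x v - y v) z = eform x z - eform y z" "eform z (%v. x v - y v) = eform z x - eform z y"
 by (simp_all add: eform_def algebra_simps sum_subtractf)

lemma eform_add: "eform (%v. x v + y v) z = eform x z + eform y z" "eform z (%v. x v + y v) = eform z x + eform z y"
 by (simp_all add: eform_def algebra_simps sum.distrib)

end

section \<open>Indecomposable representations are bricks\<close>

locale pos_quiver = quiver Q for Q :: "('v, 'a) pre_digraph" +
 assumes eform_pos: "!!x. EX v:verts Q. x v ~= 0 ==> eform x x >= 1"
begin

definition scalar_endos where
 "scalar_endos M <-> (ALL f:rhm M M. EX c. f = (%v. sm c (rid M v)))"

lemma hom_scalar_endos: assumes "M : Rep" "EX v. fst M v ~= 0" "scalar_endos M" shows "hom M M = 1" proof -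
 have "rid M ~= 0" using assms(2) by (simp add: rid_eq_0)
 have "rhm M M <= fam.span {rid M}" using assms(3) by (auto simp: scalar_endos_def intro: fam.span_scale[OF fam.span_base])
 then show ?thesis unfolding hom_def by (intro fam.dim_unique[of "{rid M}"]) (use assms(1) \<open>rid M ~= 0\<close> in auto)
qed

text \<open>With one-dimensional endomorphism ring the Euler form gives 1 - \<open>ext M M\<close>,
  and positivity forces this to be at least 1.\<close>

lemma brick_rigid: assumes "M : Rep" "EX v. fst M v ~= 0" "scalar_endos M" shows "Ext0 M M" "eform (dv M) (dv M) = 1" proof -
 obtain v where v: "fst M v ~= 0" using assms(2) by blast
 moreover have "v : Q0" using v dim_outside[OF assms(1), of v] by (rule contrapos_np)
 ultimately have "eform (dv M) (dv M) >= 1" by (intro eform_pos bexI[of _ v]) (simp_all add: dv_def)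
 then have "ext M M = 0" using euler_form[OF assms(1,1)] hom_scalar_endos[OF assms] by simp
 then show "Ext0 M M" "eform (dv M) (dv M) = 1" using euler_form[OF assms(1,1)] hom_scalar_endos[OF assms] ext_eq_0_iff[OF assms(1,1)] by simp_all
qed

text \<open>The core of the brick theorem. \<open>i*p\<close> is a nonzero noninvertible
  endomorphism whose image \<open>I\<close> has least dimension. Minimality gives
  \<open>p*i = 0\<close> and then embeds \<open>I\<close> in an indecomposable summand
  \<open>N\<close> of the kernel \<open>K\<close>. As \<open>N\<close> is rigid by induction,
  extensions of \<open>I\<close> by \<open>N\<close> split, which makes \<open>N\<close> a proper
  summand of \<open>M\<close>.\<close>

lemma minimal_endo_contradiction: fixes M :: "('v, 'a, 'k::field) rep" assumes M: "rindec Q M"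
  and IH: "!!N :: ('v, 'a, 'k) rep. td N < td M ==> rindec Q N ==> Ext0 N N" and I: "I : Rep" "p : rhm M I" "p' : VH I M" "p*p' = rid I"
   "i : rhm I M" "i' : VH M I" "i'*i = rid I"
  and nz: "i*p ~= 0" and ninv: "~ (EX u:VH M M. u*(i*p) = rid M)"
  and min: "!!J b b' c c'. J : Rep ==> c : rhm M J ==> c' : VH J M ==> c*c' = rid J ==>
   b : rhm J M ==> b' : VH M J ==> b'*b = rid J ==> b*c ~= 0 ==>
   ~ (EX u:VH M M. u*(b*c) = rid M) ==> td I <= td J"
 shows False proof -
 have MQ: "M : Rep" using M by (simp add: rindec_def)
 note V = rhom_VH[OF I(2)] I(3) rhom_VH[OF I(5)] I(6)
 have I0: "EX v. fst I v ~= 0" proof (rule ccontr)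
  assume "~ ?thesis"
  then have "rid I = 0" by (simp add: rid_eq_0)
  then have "p = 0" using VHD(1)[OF V(1)] by simp
  with nz show False by simp
 qed
 \<comment> \<open>Otherwise the square of \<open>i*p\<close> is a nonzero noninvertible
   endomorphism factoring through the image \<open>J\<close> of \<open>p*i\<close>. Minimality makes
   \<open>p*i\<close> invertible, so \<open>I\<close> is a summand of \<open>M\<close>, hence all of
   \<open>M\<close>, and \<open>i*p\<close> would be invertible.\<close>
 have pi: "p*i = 0" proof (rule ccontr)
  assume g0: "p*i ~= 0"
  have g: "p*i : rhm I I" using I by blast
  obtain J c b c' b' where J: "J : Rep" "c : rhm I J" "b : rhm J I" "c' : VH J I" "b' : VH I J" "p*i = b*c" "c*c' = rid J" "b'*b = rid J"
   by (rule image_fact[OF I(1,1) g])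
  have eq: "(i*b)*(c*p) = i*p*(i*p)" by (simp add: mult.assoc massoc[OF J(6)[symmetric]])
  have "td I <= td J" proof (rule min)
   show "J : Rep" "c*p : rhm M J" "i*b : rhm J M" using J I by blast+
   show "p'*c' : VH J M" "b'*i' : VH M J" using VH_mult V J by blast+
   show "c*p*(p'*c') = rid J" by (simp add: mult.assoc massoc[OF I(4)] VHD(1)[OF J(4)] J(7))
   show "b'*i'*(i*b) = rid J" by (simp add: mult.assoc massoc[OF I(7)] VHD(1)[OF rhom_VH[OF J(3)]] J(8))
   show "i*b*(c*p) ~= 0" proof
    assume "i*b*(c*p) = 0"
    then have "i'*(i*p*(i*p))*p' = 0" using eq by simp
    then have "p*i = 0" by (simp add: mult.assoc massoc[OF I(7)] I(4) VH_rid[OF V(1)] VHD(2)[OF V(3)])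
    with g0 show False ..
   qed
   show "~ (EX u:VH M M. u*(i*b*(c*p)) = rid M)" proof
    assume "EX u:VH M M. u*(i*b*(c*p)) = rid M"
    then obtain u where "u : VH M M" "u*(i*b*(c*p)) = rid M" by blast
    then have "(u*(i*p))*(i*p) = rid M" "u*(i*p) : VH M M" unfolding eq using VH_mult[OF _ VH_mult[OF V(3) V(1)]] by (auto simp: mult.assoc)
    then show False using ninv by blast
   qed
  qed
  then have "b*b' = rid I" by (rule mono_td(2)[OF I(1) J(1) rhom_VH[OF J(3)] J(5,8)])
  moreover have c'c: "c'*c = rid I" using \<open>td I <= td J\<close> by (rule mono_td(2)[OF I(1) J(1,4) rhom_VH[OF J(2)] J(7)])
  define G where "G = c'*b'"
  have G: "G : VH I I" unfolding G_def using J VH_mult by blast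
  have GG: "G*(p*i) = rid I" "(p*i)*G = rid I" unfolding G_def J(6) using \<open>b*b' = rid I\<close> c'c
   by (simp_all add: mult.assoc massoc[OF J(8)] massoc[OF J(7)] VHD(1)[OF rhom_VH[OF J(2)]] VHD(1)[OF J(5)])
  have Gr: "G : rhm I I" by (rule rhom_inverse[OF g G GG I(1,1)])
  obtain v where v: "fst I v ~= 0" using I0 by blast
  have "i*(G*p) = rid M" using I(2) Gr GG(1) by (intro rindec_splitD[OF M I(1) v I(5)]) (auto simp: mult.assoc)
  then have "(i*(G*i'))*(i*p) = rid M" by (simp add: mult.assoc massoc[OF I(7)] VH_rid[OF V(1)] VHD(1)[OF V(1)])
  then show False using ninv VH_mult[OF V(3) VH_mult[OF G V(4)]] by blast
 qed
 \<comment> \<open>By \<open>p*i = 0\<close> the image lies in the kernel of \<open>p\<close>;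
   \<open>u\<close> below is the resulting inclusion of \<open>I\<close> into
   \<open>K\<close>.\<close>
 obtain K k k' where K: "K : Rep" "k : rhm K M" "k' : VH M K" "k'*k = rid K" "k*k' = rid M - p'*p" "p*k = 0" by (rule kernel_exists[OF MQ I(1,2,3,4)])
 have ki: "k*(k'*i) = i" by (simp add: mult.assoc[symmetric] K(5) left_diff_distrib VHD(1)[OF V(3)]) (simp add: mult.assoc pi)
 define u where "u = k'*i"
 have u: "u : VH I K" "u ~= 0" using VH_mult[OF K(3) V(3)] ki nz by (auto simp: u_def)
 obtain N s r where N: "rindec Q N" "s : rhm N K" "r : rhm K N" "r*s = rid N" "r*u ~= 0" by (rule rindec_summand[OF K(1) u])
 have NQ: "N : Rep" using N(1) by (simp add: rindec_def)
 have ur: "u : rhm I K" proof (rule rhomI)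
  show "u v : HV (fst K v) (fst I v)" for v using u(1) by (simp add: VH_def)
  fix a assume a: "a : Q1"
  have kk: "k' v*k v = E (fst K v)" for v using fun_cong[OF K(4), of v] by (simp add: rid_def)
  have ku: "k v*u v = i v" for v using fun_cong[OF ki, of v] by (simp add: u_def)
  have "u (hd a)*ar I a = k' (hd a)*(ar M a*i (tl a))" by (simp add: u_def mult.assoc rhom_ar[OF I(5) a])
  also have "... = k' (hd a)*((ar M a*k (tl a))*u (tl a))" by (simp add: mult.assoc ku)
  also have "... = ar K a*u (tl a)" by (simp add: rhom_ar[OF K(2) a, symmetric] mult.assoc massoc[OF kk] HVD[OF ar_HV[OF K(1) a]])
  finally show "u (hd a)*ar I a = ar K a*u (tl a)" .
 qed
 have ruI: "r*u : rhm I N" using N(3) ur by blast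
 obtain J c b c' b' where J: "J : Rep" "c : rhm I J" "b : rhm J N" "c' : VH J I" "b' : VH N J" "r*u = b*c" "c*c' = rid J" "b'*b = rid J"
  by (rule image_fact[OF I(1) NQ ruI])
 have sV: "s : VH N K" "r : VH K N" "k : VH K M" "b : VH J N" "c : VH I J" using rhom_VH N K J by blast+
 \<comment> \<open>Minimality is applied to the endomorphism of \<open>M\<close> that passes through
   \<open>I\<close>, \<open>J\<close>, \<open>N\<close> and \<open>K\<close>. It is not invertible
   because it kills \<open>i\<close>. The outcome is that \<open>I\<close> maps injectively to
   \<open>N\<close>.\<close>
 have "td I <= td J" proof (rule min)
  let ?b = "k*(s*b)"
  show "J : Rep" "c*p : rhm M J" "?b : rhm J M" using J I K N by blast+
  show "p'*c' : VH J M" "b'*(r*k') : VH M J" using VH_mult V J sV K by metis+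
  show "c*p*(p'*c') = rid J" by (simp add: mult.assoc massoc[OF I(4)] VHD(1)[OF J(4)] J(7))
  show "b'*(r*k')*?b = rid J" by (simp add: mult.assoc massoc[OF K(4)] VH_rid[OF sV(1)] massoc[OF N(4)] VHD(1)[OF sV(4)] J(8))
  show "?b*(c*p) ~= 0" proof
   assume "?b*(c*p) = 0"
   then have "r*(k'*(?b*(c*p)))*p' = 0" by simp
   then have "b*c = 0" by (simp add: mult.assoc massoc[OF K(4)] VH_rid[OF sV(1)] massoc[OF N(4)] VH_rid[OF sV(4)] I(4)
      VHD(2)[OF sV(5)])
   with N(5) J(6) show False by simp
  qed
  show "~ (EX u:VH M M. u*(?b*(c*p)) = rid M)" proof
   assume "EX u:VH M M. u*(?b*(c*p)) = rid M"
   then obtain w where w: "w*(?b*(c*p)) = rid M" by blast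
   have "p*i = 0" by (rule pi)
   have "rid M*i = w*(?b*(c*(p*i)))" by (simp add: w[symmetric] mult.assoc)
   then have "i = 0" by (simp add: pi VHD(1)[OF V(3)])
   with nz show False by simp
  qed
 qed
 then have c'c: "c'*c = rid I" by (rule mono_td(2)[OF I(1) J(1,4) sV(5) J(7)])
 have "(c'*b')*(r*u) = rid I" by (simp add: J(6) mult.assoc massoc[OF J(8)] VHD(1)[OF sV(5)] c'c)
 moreover have "p ~= 0" using nz by auto
 have NM: "td N < td M" proof (rule ccontr)
  assume "~ td N < td M"
  then have "(k*s)*(r*k') = rid M" using K N by (intro mono_td(2)[OF MQ NQ]) (auto intro!: VH_mult[of _ K] sV
     simp: mult.assoc massoc[OF K(4)] VH_rid[OF sV(1)] VHD(1)[OF sV(1)])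
  then have "p*((k*s)*(r*k')) = p" by (simp add: VHD(2)[OF V(1)])
  then have "p = 0" by (simp add: mult.assoc[symmetric] K(6))
  with \<open>p ~= 0\<close> show False ..
 qed
 ultimately have EIN: "Ext0 I N" using Ext0_sub[OF IH[OF NM N(1)] ruI VH_mult[OF J(4,5)]] by blast
 \<comment> \<open>A vertexwise extension of \<open>r\<close> from \<open>K\<close> to
   \<open>M\<close>. Its defect \<open>\<delta>\<close> vanishes on \<open>K\<close>, so it is a
   cocycle for extensions of \<open>I\<close> by \<open>N\<close>; solving it by \<open>h\<close>
   turns \<open>\<rho>\<close> into a morphism that retracts \<open>M\<close> onto \<open>N\<close>.
   Then \<open>N\<close> would be all of \<open>M\<close>, although \<open>p\<close> kills
   it.\<close>
 define \<rho> where "\<rho> = r*k'"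
 have \<rho>: "\<rho> : VH M N" "\<rho>*k = r" unfolding \<rho>_def using VH_mult[OF sV(2) K(3)] by (simp_all add: mult.assoc K(4) VHD(2)[OF sV(2)])
 have at: "\<rho> v*k v = r v" "p v*k v = 0" "p v*p' v = E (fst I v)" "k v*k' v = E (fst M v) - p' v*p v" for v
  using fun_cong[OF \<rho>(2), of v] fun_cong[OF K(6), of v] fun_cong[OF I(4), of v] fun_cong[OF K(5), of v] by (simp_all add: rid_def)
 define \<delta> where "\<delta> a = \<rho> (hd a)*ar M a - ar N a*\<rho> (tl a)" for a
 have \<delta>HV: "\<delta> a : HV (fst N (hd a)) (fst M (tl a))" if a: "a : Q1" for a unfolding \<delta>_def
  by (intro HV_diff HV_mult[OF VH_at[OF \<rho>(1)] ar_HV[OF MQ a]] HV_mult[OF ar_HV[OF NQ a] VH_at[OF \<rho>(1)]])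
 have \<delta>p: "\<delta> a*(p' (tl a)*p (tl a)) = \<delta> a" if a: "a : Q1" for a proof -
  have "\<delta> a*k (tl a) = \<rho> (hd a)*(k (hd a)*ar K a) - ar N a*r (tl a)" by (simp add: \<delta>_def algebra_simps at rhom_ar[OF K(2) a])
  also have "... = 0" by (simp add: massoc[OF at(1)] rhom_ar[OF N(3) a])
  finally have "\<delta> a*(k (tl a)*k' (tl a)) = 0" by (simp add: mult.assoc[symmetric])
  then show ?thesis by (simp add: at right_diff_distrib HVD[OF \<delta>HV[OF a]])
 qed
 obtain h where h: "h : VH I N" "!!a. a : Q1 ==> \<delta> a*p' (tl a) = h (hd a)*ar I a - ar N a*h (tl a)"
  by (rule Ext0E[OF EIN, of "%a. \<delta> a*p' (tl a)"]) (auto intro: HV_mult[OF \<delta>HV] VH_at[OF V(2)])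
 have "\<rho> - h*p : rhm M N" proof (rule rhomI)
  show "(\<rho> - h*p) v : HV (fst N v) (fst M v)" for v using VH_diff[OF \<rho>(1) VH_mult[OF h(1) V(1)]] by (simp add: VH_def)
  fix a assume a: "a : Q1"
  have "\<delta> a = (\<delta> a*p' (tl a))*p (tl a)" using \<delta>p[OF a] by (simp add: mult.assoc)
  also have "... = h (hd a)*(ar I a*p (tl a)) - ar N a*(h (tl a)*p (tl a))" unfolding h(2)[OF a] by (simp add: algebra_simps)
  finally show "(\<rho> - h*p) (hd a)*ar M a = ar N a*(\<rho> - h*p) (tl a)" by (simp add: \<delta>_def rhom_ar[OF I(2) a, symmetric] algebra_simps)
 qed
 moreover have "(\<rho> - h*p)*(k*s) = rid N" by (simp add: left_diff_distrib mult.assoc massoc[OF \<rho>(2)] massoc[OF K(6)] N(4))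
 moreover obtain v where "fst N v ~= 0" using N(1) by (auto simp: rindec_def)
 moreover have "k*s : rhm N M" using K N by blast
 ultimately have "(k*s)*(\<rho> - h*p) = rid M" using rindec_splitD[OF M NQ] by blast
 then have "p*((k*s)*(\<rho> - h*p)) = p" by (simp add: VHD(2)[OF V(1)])
 then have "p = 0" by (simp add: mult.assoc[symmetric] K(6))
 with \<open>p ~= 0\<close> show False ..
qed

text \<open>By induction on total dimension every nonzero endomorphism is invertible, for a
  noninvertible one with smallest image is contradictory. Subtracting an eigenvalue at one vertex
  destroys invertibility, so the difference is zero.\<close>

theorem rindec_brick: fixes M :: "('v, 'a, 'k::alg_closed_field) rep" assumes "rindec Q M" shows "scalar_endos M" using assms
proof (induction "td M" arbitrary: M rule: less_induct)
 case less
 note M = less.prems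
 have MQ: "M : Rep" using M by (simp add: rindec_def)
 define P where "P J c c' b b' <-> J : Rep & c : rhm M J & c' : VH J M & c*c' = rid J &
   b : rhm J M & b' : VH M J & b'*b = rid J & b*c ~= 0 &
   ~ (EX u:VH M M. u*(b*c) = rid M)" for J c c' b b'
 have inv: "EX u:VH M M. u*f = rid M" if f: "f : rhm M M" "f ~= 0" for f proof (rule ccontr)
  assume ninv: "~ ?thesis"
  obtain I p i p' i' where "I : Rep" "p : rhm M I" "i : rhm I M" "p' : VH I M" "i' : VH M I"
   "f = i*p" "p*p' = rid I" "i'*i = rid I" by (rule image_fact[OF MQ MQ f(1)])
  then have "P I p p' i i'" using f ninv by (auto simp: P_def)
  then have "EX n J c c' b b'. td J = n & P J c c' b b'" by blast
  then obtain n where n: "EX J c c' b b'. td J = n & P J c c' b b'" "!!m. m < n ==> ~ (EX J c c' b b'. td J = m & P J c c' b b')"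
   unfolding exists_least_iff[of "%n. EX J c c' b b'. td J = n & P J c c' b b'"] by blast
  then obtain J c c' b b' where J: "td J = n" "P J c c' b b'" by blast
  show False proof (rule minimal_endo_contradiction[OF M, of J c c' b b'])
   show "Ext0 N N" if "td N < td M" "rindec Q N" for N :: "('v, 'a, 'k) rep"
    using less.hyps[OF that] that(2) brick_rigid(1)[of N] by (simp add: rindec_def)
   fix J' b1 b1' c1 c1'
   assume "J' : Rep" "c1 : rhm M J'" "c1' : VH J' M" "c1*c1' = rid J'" "b1 : rhm J' M" "b1' : VH M J'" "b1'*b1 = rid J'" "b1*c1 ~= 0"
    "~ (EX u:VH M M. u*(b1*c1) = rid M)"
   then have "P J' c1 c1' b1 b1'" by (simp add: P_def)
   then show "td J <= td J'" using n(2)[of "td J'"] unfolding J(1) linorder_not_less[symmetric] by blast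
  qed (use J(2) in \<open>simp_all add: P_def\<close>)
 qed
 show ?case unfolding scalar_endos_def proof
  fix f assume f: "f : rhm M M"
  obtain v where v: "fst M v ~= 0" using M by (auto simp: rindec_def)
  obtain c x where x: "x ~= 0" "app (E (fst M v)) x = x" "app (f v) x = (%i. c*x i)" by (rule eigenvector_exists[OF rhom_HV[OF f] v])
  let ?g = "f - (%v. sm c (rid M v))"
  have g: "?g : rhm M M" using f MQ by (intro rhom_diff rhom_sm) auto
  have "app (?g v) x = 0" by (simp add: rid_def x fun_eq_iff)
  have "?g = 0" proof (rule ccontr)
   assume "?g ~= 0"
   then obtain u where "u*?g = rid M" using inv[OF g] by blast
   then have "u v*?g v = E (fst M v)" by (auto simp: fun_eq_iff rid_def)
   then have "app (u v) (app (?g v) x) = x" using x(2) by (metis app_times)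
   then show False using \<open>app (?g v) x = 0\<close> x(1) by simp
  qed
  then show "EX c. f = (%v. sm c (rid M v))" by (metis eq_iff_diff_eq_0)
 qed
qed

end

section \<open>Extensions and direct sums\<close>

context quiver begin

text \<open>The middle term is the block triangular representation with off-diagonal block
  \<open>pz\<close>. \<open>s2\<close> and \<open>p1\<close> are only vertexwise; the last two
  equations say by how much they fail to commute with the arrows.\<close>

lemma extension_exists: fixes A B :: "('v, 'a, 'k::field) rep" assumes AB: "A : Rep" "B : Rep"
  and pz: "!!a. a : Q1 ==> pz a : HV (fst A (hd a)) (fst B (tl a))"
 obtains X s1 s2 p1 p2 where "X : Rep" "!!v. fst X v = fst A v + fst B v" "s1 : rhm A X" "p2 : rhm X B" "s2 : VH B X" "p1 : VH X A"
  "p1*s1 = rid A" "p2*s2 = rid B" "p1*s2 = 0" "p2*s1 = 0" "s1*p1 + s2*p2 = rid X"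
  "!!a. a : Q1 ==> ar X a*s2 (tl a) = s1 (hd a)*pz a + s2 (hd a)*ar B a" "!!a. a : Q1 ==> p1 (hd a)*ar X a = pz a*p2 (tl a) + ar A a*p1 (tl a)"
proof -
 let ?d = "%v. fst A v + fst B v"
 define s1 s2 p1 p2 :: "'v => 'k lop" where
  sd: "s1 v = emb1 (fst A v) (fst B v)" "s2 v = emb2 (fst A v) (fst B v)" "p1 v = prj1 (fst A v) (fst B v)" "p2 v = prj2 (fst A v) (fst B v)" for v
 note h = direct_sum_ops[where 'k = 'k, of "fst A v" "fst B v" for v, folded sd]
 define Y where "Y a = s1 (hd a)*(ar A a*p1 (tl a)) + s1 (hd a)*(pz a*p2 (tl a))
  + s2 (hd a)*(ar B a*p2 (tl a))" for a
 define X where "X = mkrep Q ?d Y"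
 have X: "X : Rep" unfolding X_def by (rule mkrep_reps) (simp add: dim_outside[OF AB(1)] dim_outside[OF AB(2)])
 have d: "fst X v = ?d v" for v by (simp add: X_def)
 have Y: "ar X a = Y a" if a: "a : Q1" for a unfolding X_def using a by (rule ar_mkrep) (unfold Y_def, intro HV_add HV_mult[OF h(1)] HV_mult[OF h(2)]
    HV_mult[OF ar_HV[OF AB(1) a] h(3)] HV_mult[OF pz[OF a] h(4)] HV_mult[OF ar_HV[OF AB(2) a] h(4)])
 note ld = HVD[OF h(1)] HVD[OF h(2)] HVD[OF h(3)] HVD[OF h(4)] massoc[OF h(5)] massoc[OF h(6)]
  massoc[OF h(7)] massoc[OF h(8)] h(5-8)
 show thesis proof (rule that[OF X d])
  show "s1 : rhm A X" by (rule rhomI)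
    (simp_all add: d h(1) Y, simp add: Y_def algebra_simps ld HVD[OF ar_HV[OF AB(1)]] HVD[OF pz])
  show "p2 : rhm X B" by (rule rhomI) (simp_all add: d h(4) Y, simp add: Y_def algebra_simps ld HVD[OF ar_HV[OF AB(2)]])
  show "s2 : VH B X" "p1 : VH X A" using h by (simp_all add: VH_def d)
  show "p1*s1 = rid A" "p2*s2 = rid B" "p1*s2 = 0" "p2*s1 = 0" "s1*p1 + s2*p2 = rid X" by (auto simp: fun_eq_iff rid_def d h)
  fix a assume a: "a : Q1"
  show "ar X a*s2 (tl a) = s1 (hd a)*pz a + s2 (hd a)*ar B a" by (simp add: Y[OF a] Y_def algebra_simps ld HVD[OF pz[OF a]] HVD[OF ar_HV[OF AB(2) a]])
  show "p1 (hd a)*ar X a = pz a*p2 (tl a) + ar A a*p1 (tl a)"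
   by (simp add: Y[OF a] Y_def algebra_simps ld HVD[OF pz[OF a]] massoc[OF HVD(1)[OF pz[OF a]]]
     HVD[OF ar_HV[OF AB(1) a]] massoc[OF HVD(1)[OF ar_HV[OF AB(1) a]]])
 qed
qed

lemma hom_sum_ge: assumes M: "M : Rep" and X: "X : Rep" and d: "direct_sum Q M A B i j p q"
 shows "hom X A + hom X B <= hom X M" "hom A X + hom B X <= hom M X" proof -
 note h = direct_sumD[OF d]
 show "hom X A + hom X B <= hom X M" proof (rule hom_ge_add[OF X M X h(2) lin_left[of p] lin_left[of j]])
  show "rhm X A <= (*) p ` rhm X M" proof
   fix f assume f: "f : rhm X A"
   have "f = p*(i*f)" by (simp add: mult.assoc[symmetric] h(7) rid_left[OF f])
   then show "f : (*) p ` rhm X M" using h(3) f by blast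
  qed
  show "j*f : rhm X M & p*(j*f) = 0" if "f : rhm X B" for f using h(5) that by (auto simp: massoc[OF h(10)])
  show "f = 0" if "f : rhm X B" "j*f = 0" for f using arg_cong[OF that(2), of "%x. q*x"] by (simp add: massoc[OF h(8)] rid_left[OF that(1)])
 qed
 show "hom A X + hom B X <= hom M X" proof (rule hom_ge_add[OF M X h(2) X lin_right[of i] lin_right[of q]])
  show "rhm A X <= (%f. f*i) ` rhm M X" proof
   fix f assume f: "f : rhm A X"
   have "f = (f*p)*i" by (simp add: mult.assoc h(7) rid_right[OF f])
   then show "f : (%f. f*i) ` rhm M X" using h(4) f by blast
  qed
  show "f*q : rhm M X & f*q*i = 0" if "f : rhm B X" for f using h(6) that by (auto simp: mult.assoc h(9))
  show "f = 0" if "f : rhm B X" "f*q = 0" for f using arg_cong[OF that(2), of "%x. x*j"] by (simp add: mult.assoc h(8) rid_right[OF that(1)])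
 qed
qed

lemma direct_sum_dim: fixes M :: "('v, 'a, 'k::field) rep" assumes M: "M : Rep" and d: "direct_sum Q M A B i j p q"
 shows "fst M v = fst A v + fst B v" proof -
 note h = direct_sumD[OF d]
 have e: "p v*i v = E (fst A v)" "q v*j v = E (fst B v)" "q v*i v = 0" "p v*j v = 0" "i v*p v + j v*q v = E (fst M v)"
  using fun_cong[OF h(7), of v] fun_cong[OF h(8), of v] fun_cong[OF h(9), of v] fun_cong[OF h(10), of v]
   fun_cong[OF h(11), of v] by (simp_all add: rid_def)
 let ?d = "%f :: nat => nat => 'k lop. f (fst A v) (fst B v)"
 note o = direct_sum_ops[where 'k = 'k, of "fst A v" "fst B v"]
 note m = rhom_HV[OF h(3), of v] rhom_HV[OF h(4), of v] rhom_HV[OF h(5), of v] rhom_HV[OF h(6), of v]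
 let ?f = "i v*?d prj1 + j v*?d prj2" and ?g = "?d emb1*p v + ?d emb2*q v"
 have fg: "?f : HV (fst M v) (fst A v + fst B v)" "?g : HV (fst A v + fst B v) (fst M v)" using m o by blast+
 have "?g*?f = E (fst A v + fst B v)" by (simp add: algebra_simps massoc[OF e(1)] massoc[OF e(2)] massoc[OF e(3)] massoc[OF e(4)]
    HVD[OF o(3)] HVD[OF o(4)] o(9))
 moreover have "?f*?g = E (fst M v)" by (simp add: algebra_simps massoc[OF o(5)] massoc[OF o(6)] massoc[OF o(7)] massoc[OF o(8)]
    HVD[OF m(2)] HVD[OF m(4)] e(5))
 ultimately show ?thesis using left_inv_le[OF fg] left_inv_le[OF fg(2,1)] by simp
qed

text \<open>For a nonsplit extension \<open>X\<close> of \<open>B\<close> by \<open>A\<close>, left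
  exactness in both variables bounds \<open>hom X X\<close> by the sum of the four Hom dimensions of
  \<open>A\<close> and \<open>B\<close>, which \<open>hom M M\<close> reaches. The bound is strict
  since the identity of \<open>A\<close> does not extend to \<open>X\<close>.\<close>

lemma nonsplit_extension_hom_less: fixes M :: "('v, 'a, 'k::field) rep" assumes M: "M : Rep" and d: "direct_sum Q M A B i j p q" and E: "~ Ext0 B A"
 obtains X :: "('v, 'a, 'k) rep" where "X : Rep" "fst X = fst M" "hom X X < hom M M" proof -
 have AB: "A : Rep" "B : Rep" using d by (auto simp: direct_sum_def summand_def)
 have "EX pz. (ALL a:Q1. pz a : HV (fst A (hd a)) (fst B (tl a))) &
  ~ (EX h:VH B A. ALL a:Q1. pz a = h (hd a)*ar B a - ar A a*h (tl a))" proof (rule ccontr)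
  assume n: "~ ?thesis"
  have "Ext0 B A" proof (rule Ext0I, rule ccontr)
   fix pz :: "'a => 'k lop"
   assume a: "!!a. a : Q1 ==> pz a : HV (fst A (hd a)) (fst B (tl a))"
    and b: "~ (EX h:VH B A. ALL a:Q1. pz a = h (hd a)*ar B a - ar A a*h (tl a))"
   show False by (rule notE[OF n], rule exI[of _ pz], rule conjI[OF ballI[OF a] b])
  qed
  with E show False ..
 qed
 then obtain pz where pz': "(ALL a:Q1. pz a : HV (fst A (hd a)) (fst B (tl a))) &
  ~ (EX h:VH B A. ALL a:Q1. pz a = h (hd a)*ar B a - ar A a*h (tl a))" ..
 then have pz: "!!a. a : Q1 ==> pz a : HV (fst A (hd a)) (fst B (tl a))"
  and nsplit: "!!h. h : VH B A ==> ~ (ALL a:Q1. pz a = h (hd a)*ar B a - ar A a*h (tl a))" by simp_all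
 obtain X s1 s2 p1 p2 where X: "X : Rep" "!!v. fst X v = fst A v + fst B v" "s1 : rhm A X" "p2 : rhm X B" "s2 : VH B X" "p1 : VH X A"
  "p1*s1 = rid A" "p2*s2 = rid B" "p1*s2 = 0" "p2*s1 = 0" "s1*p1 + s2*p2 = rid X"
  "!!a. a : Q1 ==> ar X a*s2 (tl a) = s1 (hd a)*pz a + s2 (hd a)*ar B a" "!!a. a : Q1 ==> p1 (hd a)*ar X a = pz a*p2 (tl a) + ar A a*p1 (tl a)"
  by (rule extension_exists[OF AB, of pz]) (simp_all only: pz)
 have at: "p1 v*s1 v = E (fst A v)" "p2 v*s2 v = E (fst B v)" for v using fun_cong[OF X(7), of v] fun_cong[OF X(8), of v] by (simp_all add: rid_def)
 have expand: "f = s1*(p1*f) + s2*(p2*f)" if "f : VH L X" for f L using VHD(1)[OF that] unfolding X(11)[symmetric] by (simp add: algebra_simps)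
 have expand': "f = f*s1*p1 + f*s2*p2" if "f : VH X L" for f L using VHD(2)[OF that] unfolding X(11)[symmetric] by (simp add: algebra_simps)
 have 1: "hom X X <= hom X B + hom X A" proof (rule hom_le_add(1)[OF X(1,1,1) AB(2) X(1) AB(1) lin_left[of p2] lin_left[of p1]])
  show "p2*f : rhm X B" if "f : rhm X X" for f using X(4) that by blast
  show "p1*f : rhm X A" if f: "f : rhm X X" "p2*f = 0" for f proof (rule rhomI)
   show "(p1*f) v : HV (fst A v) (fst X v)" for v using VH_at[OF VH_mult[OF X(6) rhom_VH[OF f(1)]]] .
   fix a assume a: "a : Q1"
   have "p2 v*f v = 0" for v using fun_cong[OF f(2), of v] by simp
   then have "p1 (hd a)*ar X a*f (tl a) = ar A a*(p1 (tl a)*f (tl a))" by (simp add: X(13)[OF a] algebra_simps)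
   then show "(p1*f) (hd a)*ar X a = ar A a*(p1*f) (tl a)" by (simp add: mult.assoc rhom_ar[OF f(1) a])
  qed
  show "f = 0" if "f : rhm X X" "p2*f = 0" "p1*f = 0" for f using expand[OF rhom_VH[OF that(1)]] that(2,3) by simp
 qed
 have kill: "f*s2 : rhm B L" if f: "f : rhm X L" "f*s1 = 0" for f L proof (rule rhomI)
  show "(f*s2) v : HV (fst L v) (fst B v)" for v using VH_at[OF VH_mult[OF rhom_VH[OF f(1)] X(5)]] .
  fix a assume a: "a : Q1"
  have fs: "f v*s1 v = 0" for v using fun_cong[OF f(2), of v] by simp
  have "f (hd a)*(ar X a*s2 (tl a)) = f (hd a)*(s2 (hd a)*ar B a)" by (simp add: X(12)[OF a] algebra_simps massoc[OF fs])
  then show "(f*s2) (hd a)*ar B a = ar L a*(f*s2) (tl a)" by (simp add: mult.assoc massoc[OF rhom_ar[OF f(1) a]])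
 qed
 have zero: "f = 0" if "f : rhm X L" "f*s1 = 0" "f*s2 = 0" for f L using expand'[OF rhom_VH[OF that(1)]] that(2,3) by simp
 have 2: "hom X B <= hom A B + hom B B" by (rule hom_le_add(1)[OF X(1) AB(2) AB(1) AB(2) AB(2,2) lin_right[of s1] lin_right[of s2]])
   (use X(3) kill zero in blast)+
 have 3: "hom X A < hom A A + hom B A"
 proof (rule hom_le_add(2)[OF X(1) AB(1,1,1) AB(2,1) lin_right[of s1] lin_right[of s2] _ _ _ rid_rhom[OF AB(1)]])
  \<comment> \<open>A morphism from \<open>X\<close> to \<open>A\<close> restricting to the identity
    would be a retraction, and its component on \<open>B\<close> would solve the equation for
    \<open>pz\<close>.\<close>
  show "rid A ~: (%f. f*s1) ` rhm X A" proof
   assume "rid A : (%f. f*s1) ` rhm X A"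
   then obtain f where f: "f : rhm X A" "f*s1 = rid A" by auto
   have fs: "f v*s1 v = E (fst A v)" for v using fun_cong[OF f(2), of v] by (simp add: rid_def)
   have "- (f*s2) : VH B A" by (rule VH_uminus[OF VH_mult[OF rhom_VH[OF f(1)] X(5)]])
   moreover have "pz a = (- (f*s2)) (hd a)*ar B a - ar A a*(- (f*s2)) (tl a)" if a: "a : Q1" for a proof -
    have "pz a + f (hd a)*(s2 (hd a)*ar B a) = f (hd a)*(ar X a*s2 (tl a))" by (simp add: X(12)[OF a] algebra_simps massoc[OF fs] HVD[OF pz[OF a]])
    then show ?thesis by (simp add: massoc[OF rhom_ar[OF f(1) a]] algebra_simps eq_diff_eq)
   qed
   ultimately show False using nsplit by blast
  qed
 qed (use X(3) kill zero in blast)+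
 have "hom X X < hom A B + hom B B + hom A A + hom B A" using 1 2 3 by simp
 also have "... <= hom M A + hom M B" using hom_sum_ge(2)[OF M AB(1) d] hom_sum_ge(2)[OF M AB(2) d] by simp
 also have "... <= hom M M" by (rule hom_sum_ge(1)[OF M M d])
 finally have "hom X X < hom M M" .
 moreover have "fst X = fst M" using X(2) direct_sum_dim[OF M d] by auto
 ultimately show thesis by (intro that[OF X(1)])
qed

lemma Ext0_direct_sum_left: fixes M Y :: "('v, 'a, 'k::field) rep"
 assumes M: "M : Rep" and d: "direct_sum Q M A B i j p q" and E: "Ext0 A Y" "Ext0 B Y" shows "Ext0 M Y" proof (rule Ext0I)
 fix pz :: "'a => 'k lop"
 assume pz: "!!a. a : Q1 ==> pz a : HV (fst Y (hd a)) (fst M (tl a))"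
 have h: "i : rhm A M" "p : rhm M A" "j : rhm B M" "q : rhm M B" "i*p + j*q = rid M" using d by (auto simp: direct_sum_def summand_def)
 have e: "i v*p v + j v*q v = E (fst M v)" for v using fun_cong[OF h(5), of v] by (simp add: rid_def)
 obtain f where f: "f : VH A Y" "!!a. a : Q1 ==> pz a*i (tl a) = f (hd a)*ar A a - ar Y a*f (tl a)"
  by (rule Ext0E[OF E(1), of "%a. pz a*i (tl a)"]) (auto intro: HV_mult[OF pz rhom_HV[OF h(1)]])
 obtain g where g: "g : VH B Y" "!!a. a : Q1 ==> pz a*j (tl a) = g (hd a)*ar B a - ar Y a*g (tl a)"
  by (rule Ext0E[OF E(2), of "%a. pz a*j (tl a)"]) (auto intro: HV_mult[OF pz rhom_HV[OF h(3)]])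
 show "EX h:VH M Y. ALL a:Q1. pz a = h (hd a)*ar M a - ar Y a*h (tl a)" proof (intro bexI[of _ "f*p + g*q"] ballI)
  show "f*p + g*q : VH M Y" by (intro VH_add VH_mult[OF f(1) rhom_VH[OF h(2)]] VH_mult[OF g(1) rhom_VH[OF h(4)]])
  fix a assume a: "a : Q1"
  have "pz a = pz a*(i (tl a)*p (tl a) + j (tl a)*q (tl a))" by (simp add: e HVD[OF pz[OF a]])
  also have "... = (pz a*i (tl a))*p (tl a) + (pz a*j (tl a))*q (tl a)" by (simp add: algebra_simps)
  also have "... = (f*p + g*q) (hd a)*ar M a - ar Y a*(f*p + g*q) (tl a)" unfolding f(2)[OF a] g(2)[OF a]
   by (simp add: algebra_simps rhom_ar[OF h(2) a] rhom_ar[OF h(4) a])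
  finally show "pz a = (f*p + g*q) (hd a)*ar M a - ar Y a*(f*p + g*q) (tl a)" .
 qed
qed

lemma Ext0_direct_sum_right: fixes M Y :: "('v, 'a, 'k::field) rep"
 assumes M: "M : Rep" and d: "direct_sum Q M A B i j p q" and E: "Ext0 Y A" "Ext0 Y B" shows "Ext0 Y M" proof (rule Ext0I)
 fix pz :: "'a => 'k lop"
 assume pz: "!!a. a : Q1 ==> pz a : HV (fst M (hd a)) (fst Y (tl a))"
 have h: "i : rhm A M" "p : rhm M A" "j : rhm B M" "q : rhm M B" "i*p + j*q = rid M" using d by (auto simp: direct_sum_def summand_def)
 have e: "i v*p v + j v*q v = E (fst M v)" for v using fun_cong[OF h(5), of v] by (simp add: rid_def)
 obtain f where f: "f : VH Y A" "!!a. a : Q1 ==> p (hd a)*pz a = f (hd a)*ar Y a - ar A a*f (tl a)"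
  by (rule Ext0E[OF E(1), of "%a. p (hd a)*pz a"]) (auto intro: HV_mult[OF rhom_HV[OF h(2)] pz])
 obtain g where g: "g : VH Y B" "!!a. a : Q1 ==> q (hd a)*pz a = g (hd a)*ar Y a - ar B a*g (tl a)"
  by (rule Ext0E[OF E(2), of "%a. q (hd a)*pz a"]) (auto intro: HV_mult[OF rhom_HV[OF h(4)] pz])
 show "EX h:VH Y M. ALL a:Q1. pz a = h (hd a)*ar Y a - ar M a*h (tl a)" proof (intro bexI[of _ "i*f + j*g"] ballI)
  show "i*f + j*g : VH Y M" by (intro VH_add VH_mult[OF rhom_VH[OF h(1)] f(1)] VH_mult[OF rhom_VH[OF h(3)] g(1)])
  fix a assume a: "a : Q1"
  have "pz a = (i (hd a)*p (hd a) + j (hd a)*q (hd a))*pz a" by (simp add: e HVD[OF pz[OF a]])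
  also have "... = i (hd a)*(p (hd a)*pz a) + j (hd a)*(q (hd a)*pz a)" by (simp add: algebra_simps)
  also have "... = (i*f + j*g) (hd a)*ar Y a - ar M a*(i*f + j*g) (tl a)" unfolding f(2)[OF a] g(2)[OF a]
   by (simp add: algebra_simps massoc[OF rhom_ar[OF h(1) a]] massoc[OF rhom_ar[OF h(3) a]])
  finally show "pz a = (i*f + j*g) (hd a)*ar Y a - ar M a*(i*f + j*g) (tl a)" .
 qed
qed

end

section \<open>Uniqueness and existence for a given dimension vector\<close>

context pos_quiver begin

lemma rindec_reps: "rindec Q M ==> M : Rep" "rindec Q M ==> EX v. fst M v ~= 0" by (auto simp: rindec_def)

lemma scalar_endos_rindec: fixes M :: "('v, 'a, 'k::field) rep" assumes M: "M : Rep" "EX v. fst M v ~= 0" "scalar_endos M" shows "rindec Q M"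
 unfolding rindec_def proof (intro conjI M ballI impI)
 fix e assume e: "e : rhm M M" "e*e = e"
 obtain c where c: "e = (%v. sm c (rid M v))" using M(3) e(1) by (auto simp: scalar_endos_def)
 obtain v where v: "fst M v ~= 0" using M(2) by blast
 have "sm (c*c) (E (fst M v)) = sm c (E (fst M v) :: 'k lop)" using fun_cong[OF e(2), of v] by (simp add: c rid_def)
 then have "app (sm (c*c) (E (fst M v))) (uv 0) 0 = app (sm c (E (fst M v)) :: 'k lop) (uv 0) 0" by simp
 then have "c*c = c" using v by (simp add: app_E_uv) (simp add: uv_def)
 then have "c = 0 \<or> c = 1" by simp
 then show "e = 0 \<or> e = rid M" by (auto simp: c fun_eq_iff)
qed

text \<open>Equal dimension vectors give Euler form 1 between \<open>M\<close> and \<open>X\<close>,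
  hence a nonzero \<open>f\<close>. Its image \<open>I\<close> is a quotient of the rigid
  \<open>M\<close> and a subobject of the rigid \<open>X\<close>, so \<open>hom M I\<close> and
  \<open>hom I X\<close> are values of the Euler form; positivity then shows that \<open>I\<close>
  is everything.\<close>

theorem rindec_unique: fixes M X :: "('v, 'a, 'k::alg_closed_field) rep" assumes M: "rindec Q M" and X: "rindec Q X" and d: "fst M = fst X"
 shows "riso Q M X" proof -
 have MQ: "M : Rep" "X : Rep" using M X by (simp_all add: rindec_def)
 note rM = brick_rigid[OF rindec_reps[OF M] rindec_brick[OF M]]
 note rX = brick_rigid[OF rindec_reps[OF X] rindec_brick[OF X]]
 have dv: "dv X = dv M" by (auto simp: dv_def d)
 have "hom M X >= 1" using euler_form[OF MQ] rM(2) by (simp add: dv)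
 then obtain f where f: "f : rhm M X" "f ~= 0" using hom_pos_iff[OF MQ] by blast
 obtain I p i p' i' where I: "I : Rep" "p : rhm M I" "i : rhm I X" "p' : VH I M" "i' : VH X I"
  "f = i*p" "p*p' = rid I" "i'*i = rid I" by (rule image_fact[OF MQ f(1)])
 have "rid I ~= 0" proof
  assume "rid I = 0"
  then have "p = 0" using rid_left[OF I(2)] by simp
  with f(2) I(6) show False by simp
 qed
 then have II: "hom I I >= 1" using hom_pos_iff[OF I(1,1)] I(1) by blast
 have "ext M I = 0" "ext I X = 0" using Ext0_quot[OF rM(1) I(2,4,7)] Ext0_sub[OF rX(1) I(3,5,8)] ext_eq_0_iff MQ I(1) by blast+
 then have e: "int (hom M I) = eform (dv M) (dv I)" "int (hom I X) = eform (dv I) (dv M)"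
  using euler_form[OF MQ(1) I(1)] euler_form[OF I(1) MQ(2)] by (simp_all add: dv)
 have "hom I I <= hom M I" proof (rule hom_le[OF I(1,1) MQ(1) I(1) lin_right[of p]])
  show "g = 0" if "g : rhm I I" "g*p = 0" for g using arg_cong[OF that(2), of "%x. x*p'"] by (simp add: mult.assoc I(7) rid_right[OF that(1)])
 qed (use I(2) in blast)
 moreover have "hom I I <= hom I X" proof (rule hom_le[OF I(1,1) I(1) MQ(2) lin_left[of i]])
  show "g = 0" if "g : rhm I I" "i*g = 0" for g using arg_cong[OF that(2), of "%x. i'*x"] by (simp add: massoc[OF I(8)] rid_left[OF that(1)])
 qed (use I(3) in blast)
 \<comment> \<open>Expanding gives 1 - \<open>hom M I\<close> - \<open>hom I X\<close> +
   \<open>eform (dv I) (dv I)\<close>. Both Hom dimensions are at least \<open>hom I I\<close>, and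
   the last term is at most \<open>hom I I\<close>, so the total is at most 1 -
   \<open>hom I I\<close>.\<close>
 ultimately have "eform (%v. dv M v - dv I v) (%v. dv M v - dv I v) <= 0" using e II euler_form[OF I(1,1)] rM(2) by (simp add: eform_diff)
 then have "dv M v = dv I v" if "v : Q0" for v using eform_pos[of "%v. dv M v - dv I v"] that by force
 then have td: "td M = td I" "td X = td I" unfolding td_def using d by (auto simp: dv_def intro!: sum.cong)
 have ii: "i*i' = rid X" by (rule mono_td(2)[OF MQ(2) I(1) rhom_VH[OF I(3)] I(5,8)]) (simp add: td)
 have pp: "p'*p = rid M" by (rule mono_td(2)[OF MQ(1) I(1,4) rhom_VH[OF I(2)] I(7)]) (simp add: td)
 have "i' : rhm X I" by (rule rhom_inverse[OF I(3,5,8) ii I(1) MQ(2)])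
 moreover have "p' : rhm I M" by (rule rhom_inverse[OF I(2,4) pp I(7) MQ(1) I(1)])
 ultimately have "p'*i' : rhm X M" by blast
 moreover have "(p'*i')*f = rid M" "f*(p'*i') = rid X"
  by (simp_all add: I(6) mult.assoc massoc[OF I(8)] rid_left[OF I(2)] pp massoc[OF I(7)] VHD(1)[OF I(5)] ii)
 ultimately show ?thesis unfolding riso_def using f(1) by blast
qed

text \<open>The hypothesis speaks of orthogonal summands that need not exhaust \<open>M\<close>, so
  it is inherited by summands of \<open>M\<close> and the induction goes through. Indecomposable
  parts are rigid as bricks.\<close>

lemma orthogonal_summands_rigid: fixes M :: "('v, 'a, 'k::alg_closed_field) rep" assumes "M : Rep"
  and "!!A B i j p q. summand Q M A i p ==> summand Q M B j q ==> q*i = 0 ==> p*j = 0 ==> Ext0 B A" shows "Ext0 M M" using assms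
proof (induction "td M" arbitrary: M rule: less_induct)
 case less
 note M = less.prems(1)
 show ?case proof (cases "rindec Q M")
  case True
  then show ?thesis using brick_rigid(1)[OF M] rindec_reps(2) rindec_brick by blast
 next
  case nind: False
  show ?thesis proof (cases "EX v. fst M v ~= 0")
   case False
   then have z: "fst M v = 0" for v by blast
   show ?thesis proof (rule Ext0I, rule bexI[of _ 0], rule ballI)
    fix pz :: "'a => 'k lop" and a
    assume "!!a. a : Q1 ==> pz a : HV (fst M (hd a)) (fst M (tl a))" "a : Q1"
    then have "pz a : HV (fst M (hd a)) (fst M (tl a))" by blast
    then have "pz a = 0" unfolding z by (rule HV_0l)
    then show "pz a = 0 (hd a)*ar M a - ar M a*0 (tl a)" by simp
   qed (auto simp: VH_def)
  next
   case True
   then obtain e where e: "e : rhm M M" "e*e = e" "e ~= 0" "e ~= rid M" using nind M by (auto simp: rindec_def)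
   obtain A B i j p q where d: "direct_sum Q M A B i j p q" "i*p = e" by (rule split_rep[OF M e(1,2)])
   have h: "summand Q M A i p" "summand Q M B j q" "q*i = 0" "p*j = 0" "i*p + j*q = rid M" using d(1) by (auto simp: direct_sum_def)
   have sub: "Ext0 C C" if s: "summand Q M C s r" "s*r ~= rid M" for C s r proof (rule less.hyps)
    have C: "C : Rep" "s : rhm C M" "r : rhm M C" "r*s = rid C" using s(1) by (auto simp: summand_def)
    show "td C < td M" using mono_td(2)[OF M C(1) rhom_VH[OF C(2)] rhom_VH[OF C(3)] C(4)] s(2) by force
    show "C : Rep" by (rule C)
    fix A1 B1 i1 j1 p1 q1
    assume 1: "summand Q C A1 i1 p1" "summand Q C B1 j1 q1" "q1*i1 = 0" "p1*j1 = 0"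
    have lift: "summand Q M N (s*i2) (p2*r)" if "summand Q C N i2 p2" for N i2 p2
     using that C by (auto simp: summand_def mult.assoc massoc[OF C(4)] rid_left)
    show "Ext0 B1 A1" proof (rule less.prems(2)[OF lift[OF 1(1)] lift[OF 1(2)]])
     have "i1 : rhm A1 C" "j1 : rhm B1 C" using 1 by (simp_all add: summand_def)
     then show "q1*r*(s*i1) = 0" "p1*r*(s*j1) = 0" by (simp_all add: mult.assoc massoc[OF C(4)] rid_left 1)
    qed
   qed
   have "j*q = rid M - e" using h(5) d(2) by (simp add: algebra_simps)
   then have "Ext0 A A" "Ext0 B B" using sub h(1,2) e(3,4) d(2) by auto
   moreover have "Ext0 B A" "Ext0 A B" using less.prems(2) h by blast+
   ultimately have "Ext0 M A" "Ext0 M B" using Ext0_direct_sum_left[OF M d(1)] by blast+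
   then show ?thesis by (rule Ext0_direct_sum_right[OF M d(1)])
  qed
 qed
qed

text \<open>Among all representations with dimension vector \<open>d\<close> one with smallest
  endomorphism ring is taken. It is rigid, as otherwise a nonsplit extension of its summands would
  do better; then Euler form 1 leaves only scalar endomorphisms.\<close>

theorem rindec_exists: assumes d: "!!v. d v >= 0" "!!v. v ~: Q0 ==> d v = 0" and q: "eform d d = 1"
 obtains M :: "('v, 'a, 'k::alg_closed_field) rep" where "rindec Q M" "dv M = d" proof -
 define R :: "('v, 'a, 'k) rep set" where "R = {M : Rep. dv M = d}"
 \<comment> \<open>All arrows zero: this serves only to show that there is a representation to
   minimise over.\<close>
 have "mkrep Q (%v. nat (d v)) (%a. 0 :: 'k lop) : R" using d by (auto simp: R_def dv_def fun_eq_iff intro!: mkrep_reps)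
 then obtain M where M: "M : R" "!!X. X : R ==> hom M M <= hom X X" using ex_has_least_nat[of "%M. M : R" _ "%M. hom M M"] by blast
 then have MQ: "M : Rep" and dM: "dv M = d" by (auto simp: R_def)
 have "Ext0 M M" proof (rule orthogonal_summands_rigid[OF MQ])
  fix A B i j p q
  assume h: "summand Q M A i p" "summand Q M B j q" "q*i = 0" "p*j = 0"
  have A: "A : Rep" "i : rhm A M" "p : rhm M A" "p*i = rid A"
   and B: "B : Rep" "j : rhm B M" "q : rhm M B" "q*j = rid B" using h(1,2) by (auto simp: summand_def)
  have e: "i*p : rhm M M" "(i*p)*(i*p) = i*p" using A by (auto simp: mult.assoc massoc[OF A(4)] rid_left[OF A(3)])
  \<comment> \<open>\<open>A\<close> and \<open>B\<close> need not add up to \<open>M\<close>. The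
    idempotent \<open>i*p\<close> is completed to a full decomposition, whose complement
    \<open>B'\<close> still contains \<open>B\<close>.\<close>
  obtain A' B' i' j' p' q' where d': "direct_sum Q M A' B' i' j' p' q'" "i'*p' = i*p" by (rule split_rep[OF MQ e])
  have h': "A' : Rep" "i' : rhm A' M" "p' : rhm M A'" "p'*i' = rid A'"
   "B' : Rep" "j' : rhm B' M" "q' : rhm M B'" "q'*j' = rid B'" "i'*p' + j'*q' = rid M" using d'(1) by (auto simp: direct_sum_def summand_def)
  have "Ext0 B' A'" proof (rule ccontr)
   assume "~ Ext0 B' A'"
   obtain X :: "('v, 'a, 'k) rep" where X: "X : Rep" "fst X = fst M" "hom X X < hom M M"
    by (rule nonsplit_extension_hom_less[OF MQ d'(1) \<open>~ Ext0 B' A'\<close>])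
   have "X : R" using X dM by (auto simp: R_def dv_def fun_eq_iff)
   from M(2)[OF this] X(3) show False by simp
  qed
  text \<open>\<open>A\<close> is a quotient of \<open>A'\<close> and \<open>B\<close> is a subobject of \<open>B'\<close>.\<close>
  then have "Ext0 B' A" proof (rule Ext0_quot)
   show "p*i' : rhm A' A" using A h' by blast
   show "p'*i : VH A A'" by (rule VH_mult[OF rhom_VH[OF h'(3)] rhom_VH[OF A(2)]])
   have "p*i'*(p'*i) = p*((i'*p')*i)" by (simp add: mult.assoc)
   also have "... = rid A" unfolding d'(2) by (simp add: mult.assoc A(4) massoc[OF A(4)])
   finally show "p*i'*(p'*i) = rid A" .
  qed
  then show "Ext0 B A" proof (rule Ext0_sub)
   show "q'*j : rhm B B'" using B h' by blast
   show "q*j' : VH B' B" by (rule VH_mult[OF rhom_VH[OF B(3)] rhom_VH[OF h'(6)]])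
   have "j'*q' = rid M - i*p" using h'(9) d'(2) by (simp add: algebra_simps)
   have "q*j'*(q'*j) = q*((j'*q')*j)" by (simp add: mult.assoc)
   also have "... = q*((rid M - i*p)*j)" by (simp only: \<open>j'*q' = _\<close>)
   also have "... = rid B" by (simp add: left_diff_distrib mult.assoc h(4) rid_left[OF B(2)] B(4))
   finally show "q*j'*(q'*j) = rid B" .
  qed
 qed
 then have "ext M M = 0" using ext_eq_0_iff[OF MQ MQ] by simp
 then have hom1: "hom M M = 1" using euler_form[OF MQ MQ] q dM by simp
 have nz: "EX v. fst M v ~= 0" proof (rule ccontr)
  assume "~ ?thesis"
  then have "d = (%v. 0)" using dM by (auto simp: dv_def)
  with q show False by (simp add: eform_def)
 qed
 have "scalar_endos M" unfolding scalar_endos_def proof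
  fix f assume f: "f : rhm M M"
  have r0: "rid M ~= 0" using nz by (simp add: rid_eq_0)
  show "EX c. f = (%v. sm c (rid M v))" proof (rule ccontr)
   assume n: "~ ?thesis"
   have "f ~: fam.span {rid M}" unfolding fam.span_singleton using n by auto
   moreover have "fam.independent {rid M}" using r0 by simp
   ultimately have "fam.independent (insert f {rid M})" by (rule fam.independent_insertI)
   then have "fam.dim {f, rid M} = card {f, rid M}" by (rule fam.dim_eq_card_independent)
   moreover have "f ~= rid M" proof
    assume "f = rid M"
    then have "f = (%v. sm 1 (rid M v))" by simp
    with n show False by blast
   qed
   moreover have "fam.dim {f, rid M} <= hom M M" unfolding hom_def using f MQ by (intro dim_mono[OF findim_rhom[OF MQ MQ]]) auto
   ultimately show False using hom1 by simp
  qed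
 qed
 then show thesis using that scalar_endos_rindec[OF MQ nz] dM by blast
qed

end

section \<open>Roots\<close>

context quiver begin

definition bform :: "('v => int) => ('v => int) => int" where
 "bform x y = eform x y + eform y x"

lemma eform_scale: "eform (%v. c*x v) y = c*eform x y" "eform y (%v. c*x v) = c*eform y x" by (simp_all add: eform_def algebra_simps sum_distrib_left)

lemma eform_simple_right: "i : Q0 ==> eform x (simple_root i) = x i - (\<Sum>a\<in>Q1. if hd a = i then x (tl a) else 0)"
 by (simp add: eform_def simple_root_def if_distrib cong: if_cong)

lemma eform_simple_left: "i : Q0 ==> eform (simple_root i) x = x i - (\<Sum>a\<in>Q1. if tl a = i then x (hd a) else 0)" proof -
 assume i: "i : Q0"
 have "(\<Sum>v\<in>Q0. simple_root i v*x v) = (\<Sum>v\<in>Q0. if v = i then x v else 0)"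
  "(\<Sum>a\<in>Q1. simple_root i (tl a)*x (hd a)) = (\<Sum>a\<in>Q1. if tl a = i then x (hd a) else 0)"
  by (intro sum.cong; simp add: simple_root_def)+
 then show ?thesis using i by (simp add: eform_def sum.delta)
qed

end

context pos_quiver begin

text \<open>A loop at \<open>i\<close> would push the Euler form of the simple root at
  \<open>i\<close> down to 0 or less.\<close>

lemma loopless: "a : Q1 ==> tl a ~= hd a" proof
 assume a: "a : Q1" and l: "tl a = hd a"
 let ?i = "hd a"
 have i: "?i : Q0" using a by simp
 have "1 <= eform (simple_root ?i) (simple_root ?i)" using i by (intro eform_pos) (auto simp: simple_root_def)
 also have "... = 1 - (\<Sum>b\<in>Q1. if head Q b = ?i then simple_root ?i (tail Q b) else 0)"
  by (subst eform_simple_right[OF i]) (simp add: simple_root_def)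
 finally have "(\<Sum>b\<in>Q1. if head Q b = ?i then simple_root ?i (tail Q b) else 0) <= 0" by simp
 moreover have "(if hd a = ?i then simple_root ?i (tl a) else 0) <=
   (\<Sum>b\<in>Q1. if head Q b = ?i then simple_root ?i (tail Q b) else 0)" by (rule member_le_sum[OF a]) (auto simp: simple_root_def)
 ultimately show False by (simp add: l simple_root_def)
qed

lemma eform_simple: "i : Q0 ==> eform (simple_root i) (simple_root i) = 1" proof -
 assume i: "i : Q0"
 have "(\<Sum>a\<in>Q1. if hd a = i then simple_root i (tl a) else 0) = 0" by (intro sum.neutral) (auto simp: simple_root_def dest: loopless)
 then show ?thesis by (simp add: eform_simple_right[OF i]) (simp add: simple_root_def)
qed

text \<open>Links the reflections, defined by edge counts, to the symmetrised Euler form: an arrow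
  at \<open>i\<close> contributes through its other end, which is well defined since there are no
  loops.\<close>

lemma cartan_sum: assumes i: "i : Q0" shows "(\<Sum>j\<in>Q0. cartan Q i j*c j) = bform c (simple_root i)" proof -
 have arc: "(\<Sum>j\<in>Q0 - {i}. if {tl a, hd a} = {i, j} then c j else 0) =
   (if hd a = i then c (tl a) else 0) + (if tl a = i then c (hd a) else 0)"
  if a: "a : Q1" for a proof -
  have "{tl a, hd a} = {i, j} <-> (hd a = i & j = tl a) \<or> (tl a = i & j = hd a)" for j using loopless[OF a] by (auto simp: doubleton_eq_iff)
  then have "(\<Sum>j\<in>Q0 - {i}. if {tl a, hd a} = {i, j} then c j else 0) =
   (\<Sum>j\<in>Q0 - {i}. (if j = tl a then (if hd a = i then c j else 0) else 0) +
    (if j = hd a then (if tl a = i then c j else 0) else 0))" using loopless[OF a] by (intro sum.cong) auto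
  also have "... = (if hd a = i then c (tl a) else 0) + (if tl a = i then c (hd a) else 0)"
   using a loopless[OF a] by (auto simp: sum.distrib sum.delta)
  finally show ?thesis .
 qed
 have "(\<Sum>j\<in>Q0. cartan Q i j*c j) = 2*c i + (\<Sum>j\<in>Q0 - {i}. cartan Q i j*c j)"
  using i by (subst sum.remove[OF finite_verts i]) (simp add: cartan_def)
 also have "(\<Sum>j\<in>Q0 - {i}. cartan Q i j*c j) =
   (\<Sum>j\<in>Q0 - {i}. - (\<Sum>a\<in>Q1. if {tl a, hd a} = {i, j} then c j else 0))" proof (intro sum.cong refl)
  fix j assume j: "j : Q0 - {i}"
  have "(\<Sum>a\<in>Q1. if {tl a, hd a} = {i, j} then c j else 0) =
    (\<Sum>a\<in>{a : Q1. {tl a, hd a} = {i, j}}. c j)" by (rule sum.inter_filter[symmetric]) simp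
  then show "cartan Q i j*c j = - (\<Sum>a\<in>Q1. if {tl a, hd a} = {i, j} then c j else 0)" using j by (auto simp: cartan_def edge_count_def)
 qed
 also have "... = - (\<Sum>j\<in>Q0 - {i}. \<Sum>a\<in>Q1. if {tl a, hd a} = {i, j} then c j else 0)" by (rule sum_negf)
 also have "(\<Sum>j\<in>Q0 - {i}. \<Sum>a\<in>Q1. if {tl a, hd a} = {i, j} then c j else 0) =
   (\<Sum>a\<in>Q1. \<Sum>j\<in>Q0 - {i}. if {tl a, hd a} = {i, j} then c j else 0)" by (rule sum.swap)
 also have "... = (\<Sum>a\<in>Q1. (if hd a = i then c (tl a) else 0) + (if tl a = i then c (hd a) else 0))" by (intro sum.cong refl arc)
 finally show ?thesis by (simp add: bform_def eform_simple_left[OF i] eform_simple_right[OF i] sum.distrib)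
qed

lemma reflection_eq: "i : Q0 ==> reflection Q i c = (%v. c v - bform c (simple_root i)*simple_root i v)"
 unfolding reflection_def by (simp add: cartan_sum)

lemma eform_reflection: assumes i: "i : Q0" shows "eform (reflection Q i c) (reflection Q i c) = eform c c"
 using i by (simp add: reflection_eq eform_diff eform_scale eform_simple)
  (simp add: bform_def algebra_simps)

lemma reflection_involution: assumes i: "i : Q0" shows "reflection Q i (reflection Q i c) = c" proof -
 have "bform (%v. c v - bform c (simple_root i)*simple_root i v) (simple_root i) = - bform c (simple_root i)"
  using i by (subst bform_def) (simp add: eform_diff eform_scale eform_simple, simp add: bform_def)
 then show ?thesis by (simp add: reflection_eq[OF i])
qed

lemma root_eform: "c : roots Q ==> eform c c = 1 & (ALL v. v ~: Q0 --> c v = 0)" proof (induction rule: roots.induct)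
 case (simple i)
 then show ?case by (simp add: eform_simple) (auto simp: simple_root_def)
next
 case (reflect c i)
 then show ?case by (auto simp: eform_reflection) (auto simp: reflection_def simple_root_def)
qed

text \<open>Descent on the height. Since \<open>bform x x = 2\<close> is positive, some
  \<open>i\<close> with \<open>x i > 0\<close> pairs positively with \<open>x\<close>. Unless
  \<open>x\<close> is that simple root, positivity at the difference forces the pairing to be 1, so
  the reflection subtracts the simple root once and stays nonnegative.\<close>

lemma root_if_eform: assumes "!!v. x v >= 0" "!!v. v ~: Q0 ==> x v = 0" "eform x x = 1" shows "x : roots Q" using assms
proof (induction "nat (\<Sum>v\<in>Q0. x v)" arbitrary: x rule: less_induct)
 case less
 note x = less.prems
 have "EX i:Q0. x i > 0 & bform x (simple_root i) > 0" proof (rule ccontr)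
  assume *: "~ ?thesis"
  have "bform x x = (\<Sum>i\<in>Q0. x i*bform x (simple_root i))" proof -
   have "x = (%v. \<Sum>i\<in>Q0. x i*simple_root i v)" using x(2) by (auto simp: simple_root_def fun_eq_iff if_distrib cong: if_cong)
   have lin: "eform y (%v. \<Sum>i\<in>J. x i*simple_root i v) = (\<Sum>i\<in>J. x i*eform y (simple_root i))"
    "eform (%v. \<Sum>i\<in>J. x i*simple_root i v) y = (\<Sum>i\<in>J. x i*eform (simple_root i) y)"
    if "finite J" for y J using that by (induction J rule: finite_induct) (simp_all add: eform_add eform_scale, simp_all add: eform_def)
   have "bform x x = eform x (%v. \<Sum>i\<in>Q0. x i*simple_root i v) + eform (%v. \<Sum>i\<in>Q0. x i*simple_root i v) x"
    unfolding bform_def using \<open>x = _\<close> by metis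
   then show ?thesis by (simp add: lin bform_def distrib_left sum.distrib)
  qed
  moreover have "x i*bform x (simple_root i) <= 0" if "i : Q0" for i using*that x(1)[of i] by (cases "x i = 0") (auto simp: mult_nonneg_nonpos)
  ultimately have "bform x x <= 0" by (simp add: sum_nonpos)
  then show False using x(3) by (simp add: bform_def)
 qed
 then obtain i where i: "i : Q0" "x i > 0" "bform x (simple_root i) > 0" by blast
 show ?case proof (cases "x = simple_root i")
  case True then show ?thesis using i(1) by (simp add: roots.simple)
 next
  case False
  define y where "y = (%v. x v - simple_root i v)"
  have "EX v:Q0. y v ~= 0" proof (rule ccontr)
   assume "~ ?thesis"
   then have "x v = simple_root i v" for v using x(2)[of v] i(1) by (cases "v : Q0") (auto simp: y_def simple_root_def)
   with False show False by auto
  qed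
  then have "eform y y >= 1" by (rule eform_pos)
  then have "bform x (simple_root i) <= 1" by (simp add: y_def eform_diff eform_simple[OF i(1)] x(3) bform_def)
  then have b1: "bform x (simple_root i) = 1" using i(3) by simp
  then have ry: "reflection Q i x = y" by (simp add: reflection_eq[OF i(1)] y_def)
  have "y : roots Q" proof (rule less.hyps)
   have "(\<Sum>v\<in>Q0. simple_root i v) = 1" using i(1) by (simp add: simple_root_def)
   then have s: "(\<Sum>v\<in>Q0. y v) = (\<Sum>v\<in>Q0. x v) - 1" by (simp add: y_def sum_subtractf)
   have "(\<Sum>v\<in>Q0. x v) >= x i" using i(1) x(1) by (intro member_le_sum) auto
   then show "nat (\<Sum>v\<in>Q0. y v) < nat (\<Sum>v\<in>Q0. x v)" using s i(2) by simp
   show "y v >= 0" for v using x(1)[of v] i(2) by (auto simp: y_def simple_root_def)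
   show "v ~: Q0 ==> y v = 0" for v using x(2)[of v] i(1) by (auto simp: y_def simple_root_def)
   show "eform y y = 1" using eform_reflection[OF i(1), of x] ry x(3) by simp
  qed
  then have "reflection Q i y : roots Q" using i(1) by (rule roots.reflect)
  then show ?thesis using reflection_involution[OF i(1), of x] ry by simp
 qed
qed

text \<open>A set of vertices inside which there are at least as many arrows as vertices would violate positivity.\<close>

lemma arcs_within_less: assumes C: "C <= Q0" "C ~= {}" shows "card {a : Q1. tl a : C & hd a : C} < card C" proof -
 let ?x = "%v. if v : C then 1 else 0 :: int"
 have "1 <= eform ?x ?x" using C by (intro eform_pos) auto
 also have "eform ?x ?x = int (card C) - int (card {a : Q1. tl a : C & hd a : C})" proof -
  have "(\<Sum>v\<in>Q0. ?x v*?x v) = (\<Sum>v\<in>{v : Q0. v : C}. 1)" by (subst sum.inter_filter) (auto intro!: sum.cong)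
  also have "{v : Q0. v : C} = C" using C(1) by auto
  finally have 1: "(\<Sum>v\<in>Q0. ?x v*?x v) = int (card C)" by simp
  have "(\<Sum>a\<in>Q1. ?x (tl a)*?x (hd a)) = (\<Sum>a\<in>{a : Q1. tl a : C & hd a : C}. 1)" by (subst sum.inter_filter) (auto intro!: sum.cong)
  then show ?thesis unfolding eform_def 1 by simp
 qed
 finally show ?thesis by linarith
qed

text \<open>If every vertex of \<open>C\<close> received an arrow from \<open>C\<close>, choosing
  one for each would give as many arrows inside \<open>C\<close> as vertices.\<close>

lemma source_in: assumes C: "C <= Q0" "C ~= {}"
 obtains v where "v : C" "!!a. a : Q1 ==> hd a = v ==> tl a ~: C" proof (rule ccontr)
 assume n: "~ thesis"
 have "ALL v:C. EX a. a : Q1 & hd a = v & tl a : C" using n that by blast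
 from bchoice[OF this] obtain g where g: "!!v. v : C ==> g v : Q1 & head Q (g v) = v & tail Q (g v) : C" by blast
 have "inj_on g C" using g by (metis inj_onI)
 then have "card C = card (g ` C)" by (simp add: card_image)
 also have "... <= card {a : Q1. tl a : C & hd a : C}" using g by (intro card_mono) auto
 finally show False using arcs_within_less[OF C] by simp
qed

end

section \<open>Positivity for Dynkin diagrams\<close>

text \<open>The contribution of an arm \<open>1, ..., p\<close> attached to the vertex \<open>p + 1\<close>.\<close>

primrec arm :: "(nat => real) => nat => real" where "arm y 0 = 0"
| "arm y (Suc p) = arm y p + y (Suc p) ^ 2 - y (Suc p)*y (Suc (Suc p))"

text \<open>Completing squares from the outer end inward. The constant is the exact minimum over the
  arm for a fixed value at the attaching vertex. With three arms, positivity at the branch vertex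
  then becomes the classical condition that the reciprocals of the arm lengths plus one add up to
  more than 1.\<close>

lemma arm_lower: "arm y p >= - (real p / (2*(real p + 1)))*y (Suc p) ^ 2" proof (induction p)
 case (Suc p)
 define u where "u = y (Suc p)"
 define w where "w = y (Suc (Suc p))"
 define r where "r = real p + 1"
 have r: "r > 0" by (simp add: r_def)
 have "arm y (Suc p) >= - ((r-1) / (2*r))*u ^ 2 + u ^ 2 - u*w" using Suc by (simp add: u_def w_def r_def)
 moreover have "- ((r-1) / (2*r))*u ^ 2 + u ^ 2 - u*w + r / (2*(r+1))*w ^ 2 >= 0" proof -
  define s where "s = r + 1"
  have s: "s > 0" using r by (simp add: s_def)
  have "- ((r-1) / (2*r))*u ^ 2 + u ^ 2 = s / (2*r)*u ^ 2" using r by (simp add: s_def field_simps)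
  moreover have "s / (2*r)*u ^ 2 - u*w + r / (2*s)*w ^ 2 = s / (2*r)*(u - r / s*w) ^ 2" using r s by (simp add: field_simps power2_eq_square)
  moreover have "s / (2*r)*(u - r / s*w) ^ 2 >= 0" using r s by simp
  ultimately show ?thesis unfolding s_def by linarith
 qed
 ultimately show ?case by (simp add: u_def w_def r_def add.commute)
qed simp

lemma arm_zero: "arm y p <= 0 ==> y (Suc p) = 0 ==> i : {1..p} ==> y i = 0" proof (induction p)
 case (Suc p)
 have "arm y p + y (Suc p) ^ 2 <= 0" using Suc.prems by simp
 moreover have "- (real p / (2*(real p + 1)))*y (Suc p) ^ 2 + y (Suc p) ^ 2
   = (real p + 2) / (2*(real p + 1))*y (Suc p) ^ 2" by (simp add: field_simps)
 ultimately have "(real p + 2) / (2*(real p + 1))*y (Suc p) ^ 2 <= 0" using arm_lower[of p y] by linarith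
 then have y: "y (Suc p) = 0" by (auto simp: mult_le_0_iff divide_le_0_iff)
 then show ?case using Suc.IH Suc.prems by (cases "i = Suc p") auto
qed simp

lemma chain_arm: "(\<Sum>i\<in>{1..Suc p}. y i ^ 2) - (\<Sum>i\<in>{1..<Suc p}. y i*y (Suc i)) = arm y p + y (Suc p) ^ 2" proof (induction p)
 case (Suc p)
 have "{1..Suc (Suc p)} = insert (Suc (Suc p)) {1..Suc p}" "{1..<Suc (Suc p)} = insert (Suc p) {1..<Suc p}" by auto
 then show ?case using Suc by simp
qed simp

definition dynkin_form :: "dynkin => (nat => real) => real" where
 "dynkin_form \<Delta> y = (\<Sum>i\<in>{1..dynkin_rank \<Delta>}. y i ^ 2) - (\<Sum>e\<in>dynkin_edges \<Delta>. \<Prod>i\<in>e. y i)"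

lemma chain_edges: "{{i, i + 1} | i. 1 <= i & i + 1 <= n} = (%i. {i, Suc i}) ` {1..<n}" by auto

lemma inj_chain: "inj_on (%i. {i, Suc i}) A" by (rule inj_onI) (auto simp: doubleton_eq_iff)

lemma sum_chain: "(\<Sum>e\<in>(%i. {i, Suc i}) ` A. \<Prod>i\<in>e. y i) = (\<Sum>i\<in>A. y i*y (Suc i))" for y :: "nat => real"
 by (simp add: sum.reindex[OF inj_chain])

lemma form_A: "n >= 1 ==> dynkin_form (DynA n) y = arm y (n-1) + y n ^ 2"
 using chain_arm[of y "n - 1"] by (simp add: dynkin_form_def chain_edges[simplified] sum_chain)

lemma form_branch: assumes m: "m >= 1" "c <= m" "1 <= c" "c ~= m"
 shows "(\<Sum>i\<in>{1..Suc m}. y i ^ 2) - (\<Sum>e\<in>insert {c, Suc m} ((%i. {i, Suc i}) ` {1..<m}). \<Prod>i\<in>e. y i)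
  = arm y (m-1) + y m ^ 2 + y (Suc m) ^ 2 - y c*y (Suc m)" proof -
 have "{c, Suc m} ~: (%i. {i, Suc i}) ` {1..<m}" using m by (auto simp: doubleton_eq_iff)
 then have "(\<Sum>e\<in>insert {c, Suc m} ((%i. {i, Suc i}) ` {1..<m}). \<Prod>i\<in>e. y i)
   = y c*y (Suc m) + (\<Sum>i\<in>{1..<m}. y i*y (Suc i))" using m by (subst sum.insert) (auto simp: sum_chain)
 moreover have "(\<Sum>i\<in>{1..Suc m}. y i ^ 2) = (\<Sum>i\<in>{1..m}. y i ^ 2) + y (Suc m) ^ 2" by simp
 ultimately show ?thesis using chain_arm[of y "m - 1"] m by simp
qed

lemma dynkin_form_pos: assumes v: "valid_dynkin \<Delta>" and le: "dynkin_form \<Delta> y <= 0" and i: "i : {1..dynkin_rank \<Delta>}" shows "y i = 0"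
proof (cases \<Delta>)
 case (DynA n)
 then have n: "n >= 1" "i : {1..n}" using v i by auto
 have "arm y n <= 0" if "y (Suc n) = 0" using le DynA n form_A[of n y] that by (cases n) auto
 \<comment> \<open>A fictitious vertex \<open>n + 1\<close> with value 0 turns the whole chain into
   an arm, to which \<open>arm_zero\<close> applies.\<close>
 define z where "z j = (if j = Suc n then 0 else y j)" for j
 have az: "arm z p = arm y p" if "p < n" for p using that by (induction p) (auto simp: z_def)
 have "arm z n = arm y (n-1) + y n ^ 2" using n az[of "n - 1"] by (cases n) (auto simp: z_def)
 then have "arm z n <= 0" using le DynA n form_A[of n y] by simp
 from arm_zero[OF this, of i] have "z i = 0" using n by (simp add: z_def)
 then show ?thesis using n by (auto simp: z_def)
next
 case (DynD n)
 then have n: "n >= 4" "i : {1..n}" using v i by auto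
 define p where "p = n - 3"
 have p: "n = Suc (Suc (Suc p))" using n(1) unfolding p_def by arith
 let ?c = "y (Suc p)" let ?u = "y (Suc (Suc p))" let ?w = "y n"
 have "dynkin_form \<Delta> y = arm y (Suc p) + ?u ^ 2 + ?w ^ 2 - ?c*?w" proof -
  have "n - 2 = Suc p" "n - 1 = Suc (Suc p)" "n = Suc (Suc (Suc p))" by (simp_all add: p)
  then show ?thesis using form_branch[of "Suc (Suc p)" "Suc p" y]
   by (simp only: dynkin_form_def DynD dynkin_edges.simps dynkin_rank.simps chain_edges) simp
 qed
 then have f: "dynkin_form \<Delta> y = arm y p + ?c ^ 2 / 2 + (?u - ?c / 2) ^ 2 + (?w - ?c / 2) ^ 2" by (simp add: power2_eq_square field_simps)
 have "- (real p / (2*(real p + 1)))*?c ^ 2 + ?c ^ 2 / 2 = 1 / (2*(real p + 1))*?c ^ 2" by (simp add: field_simps)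
 then have *: "1 / (2*(real p + 1))*?c ^ 2 + (?u - ?c / 2) ^ 2 + (?w - ?c / 2) ^ 2 <= 0" using f le arm_lower[of p y] by linarith
 moreover have "1 / (2*(real p + 1))*?c ^ 2 >= 0" "(?u - ?c / 2) ^ 2 >= 0" "(?w - ?c / 2) ^ 2 >= 0" by simp_all
 ultimately have "1 / (2*(real p + 1))*?c ^ 2 = 0" "(?u - ?c / 2) ^ 2 = 0" "(?w - ?c / 2) ^ 2 = 0" by linarith+
 then have z: "?c = 0" "?u = 0" "?w = 0" by (auto simp: add_eq_0_iff)
 have "arm y p <= 0" using f le z by simp
 then have "y j = 0" if "j : {1..p}" for j using arm_zero[of y p j] z that by simp
 moreover have "i : {1..p} \<or> i = Suc p \<or> i = Suc (Suc p) \<or> i = n" using n p by auto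
 ultimately show ?thesis using z by auto
next
 case (DynE n)
 then have n: "n : {6, 7, 8}" "i : {1..n}" using v i by auto
 define r where "r = n - 4"
 have r: "r : {2, 3, 4}" "n = r + 4" using n by (auto simp: r_def)
 let ?c = "y 3" let ?w = "y n"
 \<comment> \<open>The second long arm, vertices \<open>r + 3\<close> down to 4, read from its outer
   end so that \<open>z (Suc r)\<close> is the branch vertex 3.\<close>
 define z where "z j = y (r + 4 - j)" for j
 have "dynkin_form \<Delta> y = arm y (r+2) + y (r+3) ^ 2 + ?w ^ 2 - ?c*?w" proof -
  have "n - 1 = r + 3" "n = Suc (r+3)" by (simp_all add: r(2))
  then show ?thesis using form_branch[of "r + 3" 3 y] r(1) by (simp only: dynkin_form_def DynE dynkin_edges.simps dynkin_rank.simps chain_edges) auto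
 qed
 moreover have "arm y (r+2) + y (r+3) ^ 2 = arm y 2 + ?c ^ 2 + arm z r" using r(1) by (auto simp: z_def eval_nat_numeral)
 ultimately have f: "dynkin_form \<Delta> y = arm y 2 + arm z r + 3 / 4*?c ^ 2 + (?w - ?c / 2) ^ 2" by (simp add: power2_eq_square field_simps)
 have zc: "z (Suc r) = ?c" by (simp add: z_def)
 have 2: "arm y 2 >= - (1 / 3)*?c ^ 2" using arm_lower[of 2 y] by (simp add: eval_nat_numeral)
 have 3: "arm z r >= - (2 / 5)*?c ^ 2" proof -
  have "- (2 / 5)*?c ^ 2 <= - (real r / (2*(real r + 1)))*?c ^ 2" using r(1) by (intro mult_right_mono) auto
  also have "... <= arm z r" using arm_lower[of r z] unfolding zc .
  finally show ?thesis .
 qed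
 \<comment> \<open>1/60 = 3/4 - 1/3 - 2/5: the branch vertex after losing 1/4 to the arm of length
   one, 1/3 to the arm of length two and at most 2/5 to the arm of length \<open>r\<close>. The
   bound is attained for \<open>r = 4\<close>, that is, type E8.\<close>
 have "(1 / 60)*?c ^ 2 + (?w - ?c / 2) ^ 2 <= 0" using f 2 3 le by linarith
 moreover have "(1 / 60)*?c ^ 2 >= 0" "(?w - ?c / 2) ^ 2 >= 0" by simp_all
 ultimately have "(1 / 60)*?c ^ 2 = 0" "(?w - ?c / 2) ^ 2 = 0" by linarith+
 then have c0: "?c = 0" "?w = 0" by (auto simp: add_eq_0_iff)
 have "arm y 2 <= 0" "arm z r <= 0" using f 2 3 le c0 by auto
 then have "y j = 0" if "j : {1..2}" for j using arm_zero[of y 2 j] c0 that by (simp add: eval_nat_numeral)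
 moreover have zj: "z j = 0" if "j : {1..r}" for j using arm_zero[of z r j] c0 zc \<open>arm z r <= 0\<close> that by simp
 have "y j = 0" if "j : {4..r + 3}" for j proof -
  have "z (r + 4 - j) = 0" using that by (intro zj) auto
  then show ?thesis using that by (simp add: z_def)
 qed
 moreover have "i : {1..2} \<or> i = 3 \<or> i : {4..r + 3} \<or> i = n" using n r(2) by auto
 ultimately show ?thesis using c0 by auto
qed

lemma dynkin_edges_pairs: assumes "valid_dynkin \<Delta>" "e : dynkin_edges \<Delta>"
 obtains i j where "e = {i, j}" "i ~= j" "i : {1..dynkin_rank \<Delta>}" "j : {1..dynkin_rank \<Delta>}" proof (cases \<Delta>)
 case (DynA n)
 then obtain i where "e = {i, i + 1}" "1 <= i" "i + 1 <= n" using assms(2) by auto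
 then show thesis using that[of i "i + 1"] DynA by simp
next
 case (DynD n)
 have n: "n >= 4" using assms(1) DynD by simp
 from DynD consider "e = {n - 2, n}" | i where "e = {i, i + 1}" "1 <= i" "i + 1 <= n - 1" using assms(2) by auto
 then show thesis proof cases
  case 1 then show thesis using that[of "n - 2" n] DynD n by simp
 next
  case 2 then show thesis using that[of i "i + 1"] DynD n by simp
 qed
next
 case (DynE n)
 have n: "n >= 6" using assms(1) DynE by auto
 from DynE consider "e = {3, n}" | i where "e = {i, i + 1}" "1 <= i" "i + 1 <= n - 1" using assms(2) by auto
 then show thesis proof cases
  case 1 then show thesis using that[of 3 n] DynE n by simp
 next
  case 2 then show thesis using that[of i "i + 1"] DynE n by simp
 qed
qed

text \<open>Edge counts 0 and 1 make arrows and edges correspond bijectively, and the diagonal of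
  the Euler form is blind to orientation.\<close>

theorem dynkin_pos_quiver: fixes Q :: "('v, 'a) pre_digraph"
 assumes Q: "fin_digraph Q" and v: "valid_dynkin \<Delta>" and u: "underlying_graph_is Q \<Delta>" shows "pos_quiver Q" proof -
 interpret quiver Q using Q by (simp add: quiver_def)
 obtain h where h: "bij_betw h (verts Q) {1..dynkin_rank \<Delta>}"
  "!!u v. u : verts Q ==> v : verts Q ==> edge_count Q u v = (if {h u, h v} : dynkin_edges \<Delta> then 1 else 0)"
  using u by (auto simp: underlying_graph_is_def)
 let ?e = "%a. {h (tail Q a), h (head Q a)}"
 have inj: "inj_on h (verts Q)" using h(1) by (simp add: bij_betw_def)
 have ec: "edge_count Q (tail Q a) (head Q a) >= 1" if "a : arcs Q" for a proof -
  have "{a} <= {b : arcs Q. {tail Q b, head Q b} = {tail Q a, head Q a}}" using that by auto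
  then show ?thesis unfolding edge_count_def by (metis (no_types, lifting) card_mono finite_arcs
   finite_Collect_conjI card.empty card_insert_disjoint empty_iff finite.emptyI One_nat_def finite_subset mem_Collect_eq subsetI)
 qed
 have eE: "?e a : dynkin_edges \<Delta>" if "a : arcs Q" for a using ec[OF that] h(2)[of "tail Q a" "head Q a"] that by (auto split: if_splits)
 have ne: "h (tail Q a) ~= h (head Q a)" if "a : arcs Q" for a proof -
  note ea = eE[OF that]
  obtain i j where "?e a = {i, j}" "i ~= j" "i : {1..dynkin_rank \<Delta>}" "j : {1..dynkin_rank \<Delta>}" by (rule dynkin_edges_pairs[OF v ea])
  then show ?thesis by auto
 qed
 have bij: "bij_betw ?e (arcs Q) (dynkin_edges \<Delta>)" unfolding bij_betw_def proof
  show "inj_on ?e (arcs Q)" proof (rule inj_onI)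
   fix a b assume ab: "a : arcs Q" "b : arcs Q" "?e a = ?e b"
   then have "{tail Q a, head Q a} = {tail Q b, head Q b}" using inj_onD[OF inj] by (auto simp: doubleton_eq_iff)
   then have "{a, b} <= {c : arcs Q. {tail Q c, head Q c} = {tail Q a, head Q a}}" using ab by auto
   then have "card {a, b} <= edge_count Q (tail Q a) (head Q a)" unfolding edge_count_def by (intro card_mono) auto
   also have "... <= 1" using h(2)[of "tail Q a" "head Q a"] ab by auto
   finally show "a = b" by (cases "a = b") auto
  qed
  show "?e ` arcs Q = dynkin_edges \<Delta>" proof
   show "dynkin_edges \<Delta> <= ?e ` arcs Q" proof
    fix e assume e: "e : dynkin_edges \<Delta>"
    obtain i j where ij: "e = {i, j}" "i ~= j" "i : {1..dynkin_rank \<Delta>}" "j : {1..dynkin_rank \<Delta>}" by (rule dynkin_edges_pairs[OF v e])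
    then obtain x y where xy: "x : verts Q" "y : verts Q" "h x = i" "h y = j" using h(1) unfolding bij_betw_def by (metis imageE)
    then have "edge_count Q x y = 1" using h(2) e ij(1) by simp
    then have "{a : arcs Q. {tail Q a, head Q a} = {x, y}} ~= {}" unfolding edge_count_def by (metis card.empty zero_neq_one)
    then obtain a where "a : arcs Q" "{tail Q a, head Q a} = {x, y}" by blast
    then have "?e a = e" using xy ij(1) by (auto simp: doubleton_eq_iff)
    then show "e : ?e ` arcs Q" using \<open>a : arcs Q\<close> by blast
   qed
  qed (use eE in blast)
 qed
 have form: "real_of_int (eform x x) = dynkin_form \<Delta> (%m. real_of_int (x (inv_into (verts Q) h m)))" for x proof -
  let ?y = "%m. real_of_int (x (inv_into (verts Q) h m))"
  have yh: "?y (h u) = real_of_int (x u)" if "u : verts Q" for u using inj that by simp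
  have "(\<Sum>i\<in>{1..dynkin_rank \<Delta>}. ?y i ^ 2) = (\<Sum>u\<in>verts Q. ?y (h u) ^ 2)" by (rule sum.reindex_bij_betw[OF h(1), symmetric])
  moreover have "(\<Sum>e\<in>dynkin_edges \<Delta>. \<Prod>i\<in>e. ?y i) = (\<Sum>a\<in>arcs Q. \<Prod>i\<in>?e a. ?y i)"
   by (rule sum.reindex_bij_betw[OF bij, symmetric])
  moreover have "(\<Sum>a\<in>arcs Q. \<Prod>i\<in>?e a. ?y i) = (\<Sum>a\<in>arcs Q. real_of_int (x (tail Q a))*real_of_int (x (head Q a)))"
   using ne yh by (intro sum.cong refl) simp
  ultimately show ?thesis using yh by (simp add: dynkin_form_def eform_def power2_eq_square)
 qed
 show ?thesis proof
  fix x :: "'v => int" assume "EX v:verts Q. x v ~= 0"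
  then obtain w where w: "w : verts Q" "x w ~= 0" by blast
  show "1 <= eform x x" proof (rule ccontr)
   assume "~ 1 <= eform x x"
   then have "dynkin_form \<Delta> (%m. real_of_int (x (inv_into (verts Q) h m))) <= 0" using form[of x] by simp
   moreover have "h w : {1..dynkin_rank \<Delta>}" using w(1) h(1) unfolding bij_betw_def by blast
   ultimately show False using dynkin_form_pos[OF v, of _ "h w"] w inj by force
  qed
 qed
qed

section \<open>Weak maps of complexes\<close>

text \<open>
  A weak map is a family of chain maps \<open>\<phi>\<^sub>v\<close>, one for each vertex, which commute with the arrows up
  to chosen homotopies \<open>\<psi>\<^sub>a\<close>. Since a path category is free, no higher coherence is needed, and weak
  maps up to homotopy compute the morphisms of the derived category without any resolutions.
\<close>

definition df where
 "df X i v = op (snd X i v)"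

definition ax where
 "ax X i a = ar (fst X i) a"

type_synonym ('v, 'a, 'k) wmap = "(int => 'v => 'k lop) \<times> (int => 'a => 'k lop)"

definition wm where
 "wm Q X Y = {(ph, pz).
   (ALL i v. ph i v : HV (cdim Y i v) (cdim X i v)) &
   (ALL i v. ph (i+1) v*df X i v = df Y i v*ph i v) &
   (ALL i. ALL a:arcs Q. pz i a : HV (cdim Y (i-1) (head Q a)) (cdim X i (tail Q a))) &
   (ALL i. ALL a:arcs Q. ph i (head Q a)*ax X i a - ax Y i a*ph i (tail Q a) =
    df Y (i-1) (head Q a)*pz i a + pz (i+1) a*df X i (tail Q a))}"

text \<open>The second component pastes the two homotopies of the squares at an arrow. Associativity
  and bilinearity hold on the nose; the unit laws are stated up to \<open>hot\<close>, as second
  components are unconstrained off the arrow set.\<close>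

definition wc :: "('v, 'a) pre_digraph => ('v, 'a, 'k::field) wmap => ('v, 'a, 'k) wmap => ('v, 'a, 'k) wmap" where
 "wc Q w' w = (%i v. fst w' i v*fst w i v,
   %i a. fst w' (i-1) (head Q a)*snd w i a + snd w' i a*fst w i (tail Q a))"

definition wid :: "('v, 'a, 'k::field) cpx => ('v, 'a, 'k) wmap" where
 "wid X = (%i v. E (cdim X i v), %i a. 0)"

definition wadd :: "('v, 'a, 'k::field) wmap => ('v, 'a, 'k) wmap => ('v, 'a, 'k) wmap" where
 "wadd w w' = (%i v. fst w i v + fst w' i v, %i a. snd w i a + snd w' i a)"

definition wscl :: "'k::field => ('v, 'a, 'k) wmap => ('v, 'a, 'k) wmap" where
 "wscl c w = (%i v. sm c (fst w i v), %i a. sm c (snd w i a))"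

definition w0 :: "('v, 'a, 'k::field) wmap" where
 "w0 = (%i v. 0, %i a. 0)"

text \<open>In the total complex of vertexwise and arrowwise maps, weak maps are the cocycles of
  degree 0 and \<open>(h, et)\<close> is a cochain of degree -1 whose coboundary is the difference
  of \<open>w\<close> and \<open>w'\<close>. Thus \<open>et\<close>, of degree -2 on complexes, is
  the homotopy of homotopies.\<close>

locale htp =
 fixes Q X Y h et w w' assumes D: "!!i v. h i v : HV (cdim Y (i-1) v) (cdim X i v)"
  "!!i a. a : arcs Q ==> et i a : HV (cdim Y (i-2) (head Q a)) (cdim X i (tail Q a))"
  "!!i v. fst w i v - fst w' i v = df Y (i-1) v*h i v + h (i+1) v*df X i v" "!!i a. a : arcs Q ==> snd w i a - snd w' i a =
    h i (head Q a)*ax X i a - ax Y (i-1) a*h i (tail Q a)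
    + df Y (i-2) (head Q a)*et i a - et (i+1) a*df X i (tail Q a)"

lemmas htpD = htp.D

definition hot where "hot Q X Y w w' <-> (EX h et. htp Q X Y h et w w')"

lemmas hotI = hot_def[THEN iffD2, OF exI, OF exI, OF htp.intro]

lemma hotE: assumes "hot Q X Y w w'" obtains h et where "htp Q X Y h et w w'" using assms unfolding hot_def by blast

lemma wmI: assumes "!!i v. ph i v : HV (cdim Y i v) (cdim X i v)" "!!i v. ph (i+1) v*df X i v = df Y i v*ph i v"
  "!!i a. a : arcs Q ==> pz i a : HV (cdim Y (i-1) (head Q a)) (cdim X i (tail Q a))"
  "!!i a. a : arcs Q ==> ph i (head Q a)*ax X i a - ax Y i a*ph i (tail Q a) =
    df Y (i-1) (head Q a)*pz i a + pz (i+1) a*df X i (tail Q a)"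
 shows "(ph, pz) : wm Q X Y" unfolding wm_def by (simp add: assms)

lemma wmD: assumes "w : wm Q X Y" shows "fst w i v : HV (cdim Y i v) (cdim X i v)" "fst w (i+1) v*df X i v = df Y i v*fst w i v"
  "a : arcs Q ==> snd w i a : HV (cdim Y (i-1) (head Q a)) (cdim X i (tail Q a))"
  "a : arcs Q ==> fst w i (head Q a)*ax X i a - ax Y i a*fst w i (tail Q a) =
    df Y (i-1) (head Q a)*snd w i a + snd w (i+1) a*df X i (tail Q a)" using assms unfolding wm_def by auto

lemma wmD': assumes "w : wm Q X Y" shows "fst w i v*df X (i-1) v = df Y (i-1) v*fst w (i-1) v" "a : arcs Q ==> fst w i (head Q a)*ax X i a =
    ax Y i a*fst w i (tail Q a) + df Y (i-1) (head Q a)*snd w i a + snd w (i+1) a*df X i (tail Q a)"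
 using wmD(2)[OF assms, of "i - 1" v] wmD(4)[OF assms, of a i] by (simp_all add: algebra_simps)

lemma wc_assoc: "wc Q (wc Q w'' w') w = wc Q w'' (wc Q w' w)" by (simp add: wc_def algebra_simps)

lemma wc_wadd: "wc Q w (wadd u u') = wadd (wc Q w u) (wc Q w u')" "wc Q (wadd u u') w = wadd (wc Q u w) (wc Q u' w)"
 by (simp_all add: wc_def wadd_def algebra_simps)

lemma wc_wscl: "wc Q w (wscl c u) = wscl c (wc Q w u)" "wc Q (wscl c u) w = wscl c (wc Q u w)" by (simp_all add: wc_def wscl_def sm_distrib)

context quiver begin

abbreviation Wm where "Wm == wm Q"
abbreviation Wc where "Wc == wc Q"
abbreviation Hot where "Hot == hot Q"

context
 fixes X :: "('v, 'a, 'k::field) cpx" assumes X: "X : Cpx"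
begin

lemma cpx_rep: "fst X i : Rep" using X by (simp add: complexes_def)

lemma df_HV: "df X i v : HV (cdim X (i+1) v) (cdim X i v)" using X unfolding complexes_def rep_maps_def df_def cdim_def by (auto intro: op_carrier)

lemma df_HV': "df X (i-1) v : HV (cdim X i v) (cdim X (i-1) v)" using df_HV[of "i - 1" v] by simp

lemma ax_HV: "a : Q1 ==> ax X i a : HV (cdim X i (hd a)) (cdim X i (tl a))" unfolding ax_def cdim_def by (rule ar_HV[OF cpx_rep])

lemma dd: "df X (i+1) v*df X i v = 0" proof -
 have c: "snd X i v : carrier_mat (cdim X (i+1) v) (cdim X i v)" for i using X unfolding complexes_def rep_maps_def cdim_def by auto
 have "snd X (i+1) v*snd X i v = 0\<^sub>m (cdim X (i+2) v) (cdim X i v)" using X by (simp add: complexes_def)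
 then have "op (snd X (i+1) v*snd X i v) = 0" by simp
 then show ?thesis by (simp add: op_times[OF c c] df_def)
qed

lemma dd': "df X i v*df X (i-1) v = 0" "df X (i-1) v*df X (i-2) v = 0" using dd[of "i - 1" v] dd[of "i - 2" v] by (simp_all add: algebra_simps)

lemma df_ax: "a : Q1 ==> df X i (hd a)*ax X i a = ax X (i+1) a*df X i (tl a)" proof -
 assume a: "a : Q1"
 have "(%v. op (snd X i v)) : rhm (fst X i) (fst X (i+1))" using X by (intro rep_maps_op) (auto simp: complexes_def)
 from rhom_ar[OF this a] show ?thesis by (simp add: df_def ax_def)
qed

lemma df_ax': "a : Q1 ==> df X (i-1) (hd a)*ax X (i-1) a = ax X i a*df X (i-1) (tl a)" using df_ax[of a "i - 1"] by simp

lemma cdim_outside: "v ~: Q0 ==> cdim X i v = 0" unfolding cdim_def by (rule dim_outside[OF cpx_rep])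

lemma finite_support: "finite {i. EX v. cdim X i v ~= 0}" using X by (simp add: complexes_def)

lemma wid_wm: "wid X : Wm X X" unfolding wid_def by (rule wmI) (auto simp: HVD[OF df_HV] HVD[OF ax_HV])

end

definition mkcpx :: "(int => 'v => nat) => (int => 'v => 'k::field lop) => (int => 'a => 'k lop) => ('v, 'a, 'k) cpx" where
 "mkcpx n d A = (%i. mkrep Q (n i) (A i), %i v. mt (n (i+1) v) (n i v) (d i v))"

lemma cdim_mkcpx [simp]: "cdim (mkcpx n d A) i v = n i v" by (simp add: mkcpx_def cdim_def)

lemma mkcpx_complex: assumes n: "!!i v. v ~: Q0 ==> n i v = 0" "finite {i. EX v. n i v ~= 0}"
  and d: "!!i v. d i v : HV (n (i+1) v) (n i v)" "!!i v. d (i+1) v*d i v = 0" and A: "!!i a. a : Q1 ==> A i a : HV (n i (hd a)) (n i (tl a))"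
   "!!i a. a : Q1 ==> d i (hd a)*A i a = A (i+1) a*d i (tl a)"
 shows "mkcpx n d A : Cpx" "df (mkcpx n d A) i v = d i v" "a : Q1 ==> ax (mkcpx n d A) i a = A i a" proof -
 let ?X = "mkcpx n d A"
 have r: "fst ?X i : Rep" for i unfolding mkcpx_def fst_conv by (rule mkrep_reps) (rule n(1))
 show df: "df ?X i v = d i v" for i v by (simp add: df_def mkcpx_def op_mt[OF d(1)])
 show ax: "a : Q1 ==> ax ?X i a = A i a" for i a by (simp add: ax_def mkcpx_def ar_mkrep[OF _ A(1)])
 have sn: "snd ?X i v = mt (n (i+1) v) (n i v) (d i v)" for i v by (simp add: mkcpx_def)
 have "snd ?X i : rep_maps Q (fst ?X i) (fst ?X (i+1))" for i proof -
  have "d i : rhm (fst ?X i) (fst ?X (i+1))" proof (rule rhomI)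
   show "d i v : HV (fst (fst ?X (i+1)) v) (fst (fst ?X i) v)" for v by (simp add: mkcpx_def d(1))
   show "d i (hd a)*ar (fst ?X i) a = ar (fst ?X (i+1)) a*d i (tl a)" if "a : Q1" for a
    using A(2)[OF that, of i] ax[OF that, of i] ax[OF that, of "i + 1"] by (simp add: ax_def)
  qed
  from mtf_maps[OF r r this] show ?thesis by (simp add: mtf_def mkcpx_def)
 qed
 moreover have "snd ?X (i+1) v*snd ?X i v = 0\<^sub>m (cdim ?X (i+2) v) (cdim ?X i v)" for i v proof -
  have "snd ?X (i+1) v*snd ?X i v = mt (n (i + 1 + 1) v) (n i v) 0" unfolding sn by (simp only: mt_times[OF d(1)[of "i + 1" v] d(1)[of i v]] d(2))
  also have "... = 0\<^sub>m (cdim ?X (i+2) v) (cdim ?X i v)"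
   using mt_op[of "0\<^sub>m (n (i+2) v) (n i v)" "n (i+2) v" "n i v"] by (simp add: add.commute)
  finally show ?thesis .
 qed
 ultimately show "?X : Cpx" using r n(2) by (simp add: complexes_def)
qed

lemma wm_comp: assumes X: "X : Cpx" and Z: "Z : Cpx" and w: "w : Wm X Y" and w': "w' : Wm Y Z" shows "Wc w' w : Wm X Z" unfolding wc_def
proof (rule wmI)
 show "fst w' i v*fst w i v : HV (cdim Z i v) (cdim X i v)" for i v by (rule HV_mult[OF wmD(1)[OF w'] wmD(1)[OF w]])
 show "fst w' (i+1) v*fst w (i+1) v*df X i v = df Z i v*(fst w' i v*fst w i v)" for i v
  by (simp add: mult.assoc wmD(2)[OF w] massoc[OF wmD(2)[OF w']])
 fix i a assume a: "a : Q1"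
 show "fst w' (i-1) (hd a)*snd w i a + snd w' i a*fst w i (tl a) : HV (cdim Z (i-1) (hd a)) (cdim X i (tl a))"
  by (intro HV_add HV_mult[OF wmD(1)[OF w'] wmD(3)[OF w a]] HV_mult[OF wmD(3)[OF w' a] wmD(1)[OF w]])
 have "fst w' i (hd a)*(fst w i (hd a)*ax X i a) = ax Z i a*(fst w' i (tl a)*fst w i (tl a))
   + df Z (i-1) (hd a)*(snd w' i a*fst w i (tl a)) + snd w' (i+1) a*(df Y i (tl a)*fst w i (tl a))
   + df Z (i-1) (hd a)*(fst w' (i-1) (hd a)*snd w i a) + fst w' i (hd a)*(snd w (i+1) a*df X i (tl a))" unfolding wmD'(2)[OF w a]
  by (simp add: distrib_left massoc[OF wmD'(2)[OF w' a]] massoc[OF wmD'(1)[OF w']] distrib_right mult.assoc add.assoc)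
 then show "fst w' i (hd a)*fst w i (hd a)*ax X i a - ax Z i a*(fst w' i (tl a)*fst w i (tl a)) =
   df Z (i-1) (hd a)*(fst w' (i-1) (hd a)*snd w i a + snd w' i a*fst w i (tl a)) +
   (fst w' (i + 1 - 1) (hd a)*snd w (i+1) a + snd w' (i+1) a*fst w (i+1) (tl a))*df X i (tl a)"
  by (simp add: algebra_simps wmD(2)[OF w, of i "tl a", unfolded add.commute[of i 1]])
qed

lemma wadd_wm: "w : Wm X Y ==> w' : Wm X Y ==> wadd w w' : Wm X Y" unfolding wadd_def
 by (rule wmI) (auto intro!: HV_add wmD(1,3) simp: algebra_simps wmD(2) wmD'(2))

lemma wscl_wm: "w : Wm X Y ==> wscl c w : Wm X Y" unfolding wscl_def
 by (rule wmI) (auto intro!: HV_sm wmD(1,3) simp: wmD(2), metis sm_distrib(1,2) wmD(4))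

lemma w0_wm: "w0 : Wm X Y" unfolding w0_def by (rule wmI) auto

lemma hot_eqI: assumes "!!i v. fst w i v = fst w' i v" "!!i a. a : Q1 ==> snd w i a = snd w' i a" shows "Hot X Y w w'"
 by (rule hotI[of "%i v. 0" _ _ _ "%i a. 0"]) (simp_all add: assms)

lemma hot_refl: "Hot X Y w w" by (rule hot_eqI) auto

lemma hot_sym: assumes "Hot X Y w w'" shows "Hot X Y w' w" proof -
 obtain h et where "htp Q X Y h et w w'" by (rule hotE[OF assms])
 note h = htpD[OF this]
 show ?thesis proof (rule hotI[of "%i v. - h i v" _ _ _ "%i a. - et i a"])
  show "fst w' i v - fst w i v = df Y (i-1) v*- h i v + - h (i+1) v*df X i v" for i v using h(3)[of i v] by (simp add: algebra_simps)
  show "snd w' i a - snd w i a = - h i (hd a)*ax X i a - ax Y (i-1) a*- h i (tl a)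
    + df Y (i-2) (hd a)*- et i a - - et (i+1) a*df X i (tl a)" if "a : Q1" for i a using h(4)[OF that, of i] by (simp add: algebra_simps)
 qed (auto intro: HV_uminus h)
qed

lemma hot_wadd: assumes "Hot X Y w w'" "Hot X Y u u'" shows "Hot X Y (wadd w u) (wadd w' u')" proof -
 obtain h et where "htp Q X Y h et w w'" by (rule hotE[OF assms(1)])
 note h = htpD[OF this]
 obtain g th where "htp Q X Y g th u u'" by (rule hotE[OF assms(2)])
 note g = htpD[OF this]
 show ?thesis unfolding wadd_def proof (rule hotI[of "%i v. h i v + g i v" _ _ _ "%i a. et i a + th i a"], unfold fst_conv snd_conv)
  have "fst w i v + fst u i v - (fst w' i v + fst u' i v) = (fst w i v - fst w' i v) + (fst u i v - fst u' i v)" for i v by simp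
  then show "fst w i v + fst u i v - (fst w' i v + fst u' i v) =
    df Y (i-1) v*(h i v + g i v) + (h (i+1) v + g (i+1) v)*df X i v" for i v unfolding h(3) g(3) by (simp add: algebra_simps)
  fix i a assume a: "a : Q1"
  have "snd w i a + snd u i a - (snd w' i a + snd u' i a) = (snd w i a - snd w' i a) + (snd u i a - snd u' i a)" by simp
  then show "snd w i a + snd u i a - (snd w' i a + snd u' i a) =
    (h i (hd a) + g i (hd a))*ax X i a - ax Y (i-1) a*(h i (tl a) + g i (tl a))
    + df Y (i-2) (hd a)*(et i a + th i a) - (et (i+1) a + th (i+1) a)*df X i (tl a)" unfolding h(4)[OF a] g(4)[OF a] by (simp add: algebra_simps)
 qed (auto intro: HV_add h g)
qed

lemma hot_wscl: assumes "Hot X Y w w'" shows "Hot X Y (wscl c w) (wscl c w')" proof -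
 obtain h et where "htp Q X Y h et w w'" by (rule hotE[OF assms(1)])
 note h = htpD[OF this]
 show ?thesis unfolding wscl_def
  by (rule hotI[of "%i v. sm c (h i v)" _ _ _ "%i a. sm c (et i a)"], unfold fst_conv snd_conv sm_distrib(2)[symmetric] h(3) h(4))
   (auto intro: HV_sm h simp: sm_distrib)
qed

text \<open>Homotopies add: the two given ones are added and the common term \<open>w'\<close> is
  subtracted from both sides.\<close>

lemma hot_trans: assumes "Hot X Y w w'" "Hot X Y w' w''" shows "Hot X Y w w''" proof -
 have "Hot X Y (wadd (wadd w w') (wscl (-1) w')) (wadd (wadd w' w'') (wscl (-1) w'))" by (intro hot_wadd assms hot_refl)
 moreover have "wadd (wadd w w') (wscl (-1) w') = w" "wadd (wadd w' w'') (wscl (-1) w') = w''"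
  using sm_distrib(6)[of 1] by (auto simp: wadd_def wscl_def)
 ultimately show ?thesis by simp
qed

lemma hot_left: assumes w: "Hot X Y w w'" and u: "u : Wm Y Z" and Z: "Z : Cpx" shows "Hot X Z (Wc u w) (Wc u w')" proof -
 obtain h et where "htp Q X Y h et w w'" by (rule hotE[OF w])
 note h = htpD[OF this]
 have u3: "snd u (i-1) a : HV (cdim Z (i-2) (hd a)) (cdim Y (i-1) (tl a))" if "a : Q1" for i a
  using wmD(3)[OF u that, of "i - 1"] by (simp add: algebra_simps)
 have u1: "fst u (i-1) v*df Y (i-2) v = df Z (i-2) v*fst u (i-2) v" for i v using wmD'(1)[OF u, of "i - 1" v] by (simp add: algebra_simps)
 \<comment> \<open>\<open>u\<close> commutes with an arrow only up to \<open>snd u\<close>, so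
   moving \<open>u*h\<close> past the arrow costs the correction
   \<open>snd u (i-1) a*h i (tl a)\<close>.\<close>
 show ?thesis unfolding wc_def proof (rule hotI[of "%i v. fst u (i-1) v*h i v" _ _ _
    "%i a. fst u (i-2) (hd a)*et i a - snd u (i-1) a*h i (tl a)"], unfold fst_conv snd_conv)
  show "fst u (i-1) v*h i v : HV (cdim Z (i-1) v) (cdim X i v)" for i v by (rule HV_mult[OF wmD(1)[OF u] h(1)])
  show "fst u i v*fst w i v - fst u i v*fst w' i v =
    df Z (i-1) v*(fst u (i-1) v*h i v) + fst u (i + 1 - 1) v*h (i+1) v*df X i v" for i v unfolding right_diff_distrib[symmetric] h(3)
   by (simp add: distrib_left mult.assoc massoc[OF wmD'(1)[OF u]])
  fix i a assume a: "a : Q1"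
  show "fst u (i-2) (hd a)*et i a - snd u (i-1) a*h i (tl a) : HV (cdim Z (i-2) (hd a)) (cdim X i (tl a))"
   by (intro HV_diff HV_mult[OF wmD(1)[OF u] h(2)[OF a]] HV_mult[OF u3[OF a] h(1)])
  have arr: "fst u (i-1) (hd a)*(ax Y (i-1) a*h i (tl a)) = ax Z (i-1) a*(fst u (i-1) (tl a)*h i (tl a))
    + df Z (i-2) (hd a)*(snd u (i-1) a*h i (tl a)) + snd u i a*(df Y (i-1) (tl a)*h i (tl a))"
   using arg_cong[OF wmD'(2)[OF u a, of "i - 1"], of "%x. x*h i (tl a)"] by (simp add: algebra_simps)
  let ?g = "%i a. fst u (i-2) (hd a)*et i a - snd u (i-1) a*h i (tl a)"
  show "fst u (i-1) (hd a)*snd w i a + snd u i a*fst w i (tl a) -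
    (fst u (i-1) (hd a)*snd w' i a + snd u i a*fst w' i (tl a)) =
    fst u (i-1) (hd a)*h i (hd a)*ax X i a - ax Z (i-1) a*(fst u (i-1) (tl a)*h i (tl a)) +
    df Z (i-2) (hd a)*?g i a - ?g (i+1) a*df X i (tl a)" (is "?l = ?r") proof -
   have "?l = fst u (i-1) (hd a)*(snd w i a - snd w' i a) + snd u i a*(fst w i (tl a) - fst w' i (tl a))" by (simp add: algebra_simps)
   also have "... = ?r" unfolding h(3) h(4)[OF a]
    by (simp add: distrib_left right_diff_distrib left_diff_distrib distrib_right mult.assoc arr massoc[OF u1])
   finally show ?thesis .
  qed
 qed
qed

lemma hot_right: assumes w: "Hot X Y w w'" and u: "u : Wm V X" shows "Hot V Y (Wc w u) (Wc w' u)" proof -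
 obtain h et where "htp Q X Y h et w w'" by (rule hotE[OF w])
 note h = htpD[OF this]
 have h1: "h (i-1) v : HV (cdim Y (i-2) v) (cdim X (i-1) v)" for i v using h(1)[of "i - 1" v] by (simp add: algebra_simps)
 show ?thesis unfolding wc_def proof (rule hotI[of "%i v. h i v*fst u i v" _ _ _
    "%i a. et i a*fst u i (tl a) + h (i-1) (hd a)*snd u i a"], unfold fst_conv snd_conv)
  show "h i v*fst u i v : HV (cdim Y (i-1) v) (cdim V i v)" for i v by (rule HV_mult[OF h(1) wmD(1)[OF u]])
  show "fst w i v*fst u i v - fst w' i v*fst u i v =
    df Y (i-1) v*(h i v*fst u i v) + h (i+1) v*fst u (i+1) v*df V i v" for i v unfolding left_diff_distrib[symmetric] h(3)
   by (simp add: distrib_right mult.assoc wmD(2)[OF u])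
  fix i a assume a: "a : Q1"
  show "et i a*fst u i (tl a) + h (i-1) (hd a)*snd u i a : HV (cdim Y (i-2) (hd a)) (cdim V i (tl a))"
   by (intro HV_add HV_mult[OF h(2)[OF a] wmD(1)[OF u]] HV_mult[OF h1 wmD(3)[OF u a]])
  have arr: "h i (hd a)*(fst u i (hd a)*ax V i a) = h i (hd a)*(ax X i a*fst u i (tl a))
    + h i (hd a)*(df X (i-1) (hd a)*snd u i a) + h i (hd a)*(snd u (i+1) a*df V i (tl a))" unfolding wmD'(2)[OF u a] by (simp add: algebra_simps)
  have h3: "fst w (i-1) v - fst w' (i-1) v = df Y (i-2) v*h (i-1) v + h i v*df X (i-1) v" for v using h(3)[of "i - 1" v] by (simp add: algebra_simps)
  let ?g = "%i a. et i a*fst u i (tl a) + h (i-1) (hd a)*snd u i a"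
  show "fst w (i-1) (hd a)*snd u i a + snd w i a*fst u i (tl a) -
    (fst w' (i-1) (hd a)*snd u i a + snd w' i a*fst u i (tl a)) =
    h i (hd a)*fst u i (hd a)*ax V i a - ax Y (i-1) a*(h i (tl a)*fst u i (tl a)) +
    df Y (i-2) (hd a)*?g i a - ?g (i+1) a*df V i (tl a)" (is "?l = ?r") proof -
   have "?l = (fst w (i-1) (hd a) - fst w' (i-1) (hd a))*snd u i a + (snd w i a - snd w' i a)*fst u i (tl a)" by (simp add: algebra_simps)
   also have "... = ?r" unfolding h3 h(4)[OF a]
    by (simp add: distrib_left right_diff_distrib left_diff_distrib distrib_right mult.assoc arr wmD(2)[OF u])
   finally show ?thesis .
  qed
 qed
qed

lemma wid_left: "w : Wm X Y ==> Hot X Y (Wc (wid Y) w) w" by (rule hot_eqI) (auto simp: wc_def wid_def HVD[OF wmD(1)] HVD[OF wmD(3)])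

lemma wid_right: "w : Wm X Y ==> Hot X Y (Wc w (wid X)) w" by (rule hot_eqI) (auto simp: wc_def wid_def HVD[OF wmD(1)] HVD[OF wmD(3)])

end

section \<open>Strict maps, cohomology models and inversion of quasi-isomorphisms\<close>

context quiver begin

definition strict :: "(int => 'v => 'k::field lop) => ('v, 'a, 'k) wmap" where
 "strict f = (f, %i a. 0)"

definition cm where
 "cm X Y = {f. (ALL i v. f i v : HV (cdim Y i v) (cdim X i v)) &
   (ALL i v. f (i+1) v*df X i v = df Y i v*f i v) &
   (ALL i. ALL a:Q1. f i (hd a)*ax X i a = ax Y i a*f i (tl a))}"

lemma strict_wm: "f : cm X Y ==> strict f : Wm X Y" unfolding strict_def cm_def by (rule wmI) auto

lemma strict_simps [simp]: "fst (strict f) = f" "snd (strict f) i a = 0" by (simp_all add: strict_def)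

lemma strict_comp: "Wc (strict g) (strict f) = strict (%i v. g i v*f i v)" by (simp add: wc_def strict_def)

text \<open>A chain map is invertible up to homotopy at each vertex if and only if it is a quasi-isomorphism.\<close>

definition qiso where
 "qiso X Y f <-> (ALL i v.
   (ALL x y. app (E (cdim X i v)) x = x --> app (df X i v) x = 0 --> app (f i v) x = app (df Y (i-1) v) y -->
    (EX z. x = app (df X (i-1) v) z)) &
   (ALL y. app (E (cdim Y i v)) y = y --> app (df Y i v) y = 0 -->
    (EX x z. app (E (cdim X i v)) x = x & app (df X i v) x = 0 & y - app (f i v) x = app (df Y (i-1) v) z)))"

lemma qiso_of_inverse: assumes X: "X : Cpx" and Y: "Y : Cpx" and f: "!!i v. f i v : HV (cdim Y i v) (cdim X i v)"
  and r: "!!i v. r i v : HV (cdim X i v) (cdim Y i v)" "!!i v. r (i+1) v*df Y i v = df X i v*r i v"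
  and h: "!!i v. E (cdim X i v) - r i v*f i v = df X (i-1) v*h i v + h (i+1) v*df X i v"
  and k: "!!i v. E (cdim Y i v) - f i v*r i v = df Y (i-1) v*k i v + k (i+1) v*df Y i v" shows "qiso X Y f" unfolding qiso_def
proof (intro allI conjI impI)
 fix i v x y
 assume x: "app (E (cdim X i v)) x = x" "app (df X i v) x = 0" "app (f i v) x = app (df Y (i-1) v) y"
 have "x = app (r i v) (app (f i v) x) + app (E (cdim X i v) - r i v*f i v) x" by (simp add: x)
 also have "... = app (r i v*df Y (i-1) v) y + app (df X (i-1) v*h i v + h (i+1) v*df X i v) x" unfolding x(3) h by simp
 also have "... = app (df X (i-1) v) (app (r (i-1) v) y + app (h i v) x)" using r(2)[of "i - 1" v] by (simp add: x(2))
 finally show "EX z. x = app (df X (i-1) v) z" by blast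
next
 fix i v y
 assume y: "app (E (cdim Y i v)) y = y" "app (df Y i v) y = 0"
 have "y - app (f i v) (app (r i v) y) = app (E (cdim Y i v) - f i v*r i v) y" by (simp add: y)
 also have "... = app (df Y (i-1) v) (app (k i v) y)" unfolding k by (simp add: y)
 finally have "y - app (f i v) (app (r i v) y) = app (df Y (i-1) v) (app (k i v) y)" .
 moreover have "app (E (cdim X i v)) (app (r i v) y) = app (r i v) y" by (metis HVD(1)[OF r(1)] app_times)
 moreover have "app (df X i v) (app (r i v) y) = 0" using arg_cong[OF r(2)[of i v], of "%g. app g y"] by (simp add: y)
 ultimately show "EX x z. app (E (cdim X i v)) x = x & app (df X i v) x = 0 & y - app (f i v) x = app (df Y (i-1) v) z" by blast
qed

end

text \<open>A minimal model: \<open>H\<close> has zero differential, hence is the cohomology of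
  \<open>X\<close>; \<open>I\<close> and \<open>P\<close> are mutually inverse up to homotopy, and
  \<open>k\<close> is a vertexwise contraction of the rest. The last four conditions concern
  vertices only and allow computations with cocycles.\<close>

locale mwe =
 fixes Q X H I P k assumes D: "H : complexes Q" "!!i v. df H i v = 0" "I : wm Q H X" "P : wm Q X H"
  "hot Q H H (wc Q P I) (wid H)" "hot Q X X (wc Q I P) (wid X)" "!!i v. df X i v*fst I i v = 0" "!!i v. fst P i v*df X (i-1) v = 0"
  "!!i v. fst P i v*fst I i v = E (cdim H i v)" "!!i v. fst I i v*fst P i v = E (cdim X i v) - df X (i-1) v*k i v - k (i+1) v*df X i v"

context quiver begin

lemma hot_cancel_mid: assumes "Hot Y Y (Wc a b) (wid Y)" and u: "u : Wm Y Z" and w: "w : Wm X Y" and Z: "Z : Cpx" and Y: "Y : Cpx"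
 shows "Hot X Z (Wc u (Wc a (Wc b w))) (Wc u w)" proof -
 have "Hot X Y (Wc (Wc a b) w) (Wc (wid Y) w)" by (rule hot_right[OF assms(1) w])
 then have "Hot X Y (Wc a (Wc b w)) w" unfolding wc_assoc by (rule hot_trans[OF _ wid_left[OF w]])
 then show ?thesis by (rule hot_left[OF _ u Z])
qed

text \<open>At each vertex the complex splits into its cohomology and a contractible part, since the
  scalars form a field. The splitting need not respect the arrows; compressing the arrows of
  \<open>X\<close> to \<open>H\<close> makes \<open>I\<close> and \<open>P\<close> commute with them
  up to homotopies built from \<open>k\<close>.\<close>

lemma ex_mwe: assumes X: "X : Cpx"
 obtains H I P k where "mwe Q X H I P k" proof -
 let ?n = "cdim X" and ?d = "df X"
 note dH = df_HV[OF X] and dH' = df_HV'[OF X]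
 have "ALL i v. EX g. g : HV (?n i v) (?n (i+1) v) & ?d i v*(g*?d i v) = ?d i v" using gen_inverse[OF dH] by metis
 then obtain g where g: "!!i v. g i v : HV (?n i v) (?n (i+1) v)" "!!i v. ?d i v*(g i v*?d i v) = ?d i v" unfolding choice_iff by blast
 have g': "g (i-1) v : HV (?n (i-1) v) (?n i v)" for i v using g(1)[of "i - 1" v] by simp
 have gd: "?d i v*(g i v*(?d i v*x)) = ?d i v*x" for i v x using massoc[OF g(2)] by (simp add: mult.assoc)
 have gd': "?d (i-1) v*(g (i-1) v*(?d (i-1) v*x)) = ?d (i-1) v*x" for i v x by (rule gd)
 note ld = HVD[OF dH] HVD[OF dH'] HVD[OF g(1)] HVD[OF g'] massoc[OF dd[OF X]] dd[OF X]
  massoc[OF dd'(1)[OF X]] dd'(1)[OF X]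
 \<comment> \<open>With \<open>g\<close> a generalised inverse of the differential, this projects
   onto a complement of the coboundaries inside the cocycles, as in a Hodge decomposition.\<close>
 define e where "e i v = (E (?n i v) - ?d (i-1) v*g (i-1) v)*(E (?n i v) - g i v*?d i v)" for i v
 have eHV: "e i v : HV (?n i v) (?n i v)" for i v unfolding e_def
  by (intro HV_mult[of _ _ "?n i v"] HV_diff HV_E HV_mult[OF dH' g'] HV_mult[OF g(1) dH])
 have de: "?d i v*e i v = 0" for i v by (simp add: e_def algebra_simps ld g(2) gd)
 have ed: "e i v*?d (i-1) v = 0" for i v by (simp add: e_def algebra_simps ld g(2) gd)
 have ee: "e i v*e i v = e i v" for i v proof -
  have "e i v*e i v = (E (?n i v) - ?d (i-1) v*g (i-1) v)*(e i v - g i v*(?d i v*e i v))"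
   by (simp add: e_def mult.assoc right_diff_distrib left_diff_distrib ld)
  also have "... = e i v - ?d (i-1) v*(g (i-1) v*e i v)" by (simp add: de left_diff_distrib HVD[OF eHV] mult.assoc)
  also have "g (i-1) v*e i v = g (i-1) v*(E (?n i v) - ?d (i-1) v*g (i-1) v)*(E (?n i v) - g i v*?d i v)" by (simp add: e_def mult.assoc)
  also have "?d (i-1) v*(g (i-1) v*(E (?n i v) - ?d (i-1) v*g (i-1) v)*(E (?n i v) - g i v*?d i v)) = 0" by (simp add: algebra_simps ld gd')
  finally show ?thesis by simp
 qed
 define k0 where "k0 i v = g (i-1) v*(E (?n i v) - g i v*?d i v)" for i v
 have k0: "k0 i v : HV (?n (i-1) v) (?n i v)" for i v unfolding k0_def by (intro HV_mult[OF g'] HV_diff HV_E HV_mult[OF g(1) dH])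
 have k0': "k0 (i+1) v : HV (?n i v) (?n (i+1) v)" for i v using k0[of "i + 1" v] by simp
 define T where "T i v = E (?n i v) - e i v" for i v
 have THV: "T i v : HV (?n i v) (?n i v)" for i v unfolding T_def by (intro HV_diff HV_E eHV)
 have T: "?d (i-1) v*k0 i v + k0 (i+1) v*?d i v = T i v" for i v by (simp add: T_def e_def k0_def left_diff_distrib right_diff_distrib mult.assoc ld)
 have TT: "T i v*T i v = T i v" for i v by (simp add: T_def algebra_simps ee HVD[OF eHV])
 have Td: "T (i+1) v*?d i v = ?d i v" "?d i v*T i v = ?d i v" for i v
  using ed[of "i + 1" v] de[of i v] by (simp_all add: T_def left_diff_distrib right_diff_distrib ld)
 have Td': "T i v*?d (i-1) v = ?d (i-1) v" "?d (i-1) v*T (i-1) v = ?d (i-1) v" for i v using Td(1)[of "i - 1" v] Td(2)[of "i - 1" v] by simp_all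
 \<comment> \<open>Compressing the contraction by \<open>T\<close>, the projection onto the
   contractible part, adds the side conditions that \<open>k\<close> kills \<open>s\<close> and
   \<open>p\<close> kills \<open>k\<close>. They make the homotopy component of the composite of
   \<open>I\<close> and \<open>P\<close> on \<open>H\<close> vanish.\<close>
 define k where "k i v = T (i-1) v*(k0 i v*T i v)" for i v
 have kHV: "k i v : HV (?n (i-1) v) (?n i v)" for i v unfolding k_def by (intro HV_mult[OF THV] HV_mult[OF k0 THV])
 have kT: "?d (i-1) v*k i v + k (i+1) v*?d i v = T i v" for i v proof -
  have "?d (i-1) v*k i v + k (i+1) v*?d i v = T i v*(?d (i-1) v*(k0 i v*T i v)) + T i v*(k0 (i+1) v*(?d i v*T i v))"
   by (simp add: k_def massoc[OF Td'(2)] massoc[OF Td'(1)] mult.assoc Td)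
  also have "... = T i v*((?d (i-1) v*k0 i v + k0 (i+1) v*?d i v)*T i v)" by (simp add: algebra_simps)
  also have "... = T i v" by (simp add: T TT)
  finally show ?thesis .
 qed
 have "ALL i v. EX r s p. s : HV (?n i v) r & p : HV r (?n i v) & s*p = e i v & p*s = E r" using split_idempotent[OF eHV ee] by metis
 then obtain r s p where h: "!!i v. s i v : HV (?n i v) (r i v)" "!!i v. p i v : HV (r i v) (?n i v)"
  "!!i v. s i v*p i v = e i v" "!!i v. p i v*s i v = E (r i v)" unfolding choice_iff by blast
 have se: "e i v*s i v = s i v" "p i v*e i v = p i v" for i v
  by (simp_all add: h(3)[symmetric] mult.assoc h(4) massoc[OF h(4)] HVD[OF h(1)] HVD[OF h(2)])
 have r0: "r i v = 0" if "?n i v = 0" for i v using left_inv_le[OF h(1,2,4)] that by (metis le_zero_eq)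
 define A where "A i a = p i (hd a)*(ax X i a*s i (tl a))" for i a
 define H where "H = mkcpx r (%i v. 0) A"
 have A: "A i a : HV (r i (hd a)) (r i (tl a))" if "a : Q1" for i a unfolding A_def by (intro HV_mult[OF h(2)] HV_mult[OF ax_HV[OF X that] h(1)])
 have fin: "finite {i. EX v. r i v ~= 0}" by (rule finite_subset[OF _ finite_support[OF X]], intro Collect_mono impI) (metis r0)
 note C = mkcpx_complex[of r "%i v. 0" A, OF r0[OF cdim_outside[OF X]] fin _ _ A]
 have Ts: "T i v*s i v = 0" "p i v*T i v = 0" for i v by (simp_all add: T_def algebra_simps se HVD[OF h(1)] HVD[OF h(2)])
 have H: "H : Cpx" "df H i v = 0" "s i v : HV (?n i v) (cdim H i v)" "p i v : HV (cdim H i v) (?n i v)"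
  "k i v : HV (?n (i-1) v) (?n i v)" "p i v*s i v = E (cdim H i v)" "a : Q1 ==> ax H i a = p i (hd a)*(ax X i a*s i (tl a))" for i v a
  unfolding H_def A_def[symmetric] by (rule C, auto)+ (simp_all add: h kHV, rule C, auto)
 have ds: "?d i v*s i v = 0" for i v using massoc[OF de[of i v], of "s i v"] by (simp add: se)
 have pd': "p i v*?d (i-1) v = 0" for i v using arg_cong[OF ed[of i v], of "%x. p i v*x"] by (simp add: mult.assoc[symmetric] se)
 have sp: "s i v*p i v = E (?n i v) - ?d (i-1) v*k i v - k (i+1) v*?d i v" for i v using kT[of i v] by (simp add: h(3) T_def algebra_simps)
 have ks: "k i v*s i v = 0" "p (i-1) v*k i v = 0" for i v by (simp_all add: k_def mult.assoc Ts massoc[OF Ts(2)])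
 have pd: "p (i+1) v*df X i v = 0" for i v using pd'[of "i + 1" v] by simp
 have p1: "p (i-1) v : HV (cdim H (i-1) v) (cdim X (i-1) v)" for i v by (rule H(4))
 have k1: "k (i-1) v : HV (cdim X (i-2) v) (cdim X (i-1) v)" for i v using H(5)[of "i - 1" v] by (simp add: algebra_simps)
 \<comment> \<open>The second components come from inserting \<open>s*p = 1 - d*k - k*d\<close> into
   the compressed arrow: what is left over is the boundary of \<open>k\<close> times the
   arrow.\<close>
 define I where "I = (s, %i a. - (k i (hd a)*(ax X i a*s i (tl a))))"
 define P where "P = (p, %i a. p (i-1) (hd a)*(ax X (i-1) a*k i (tl a)))"
 have I: "I : Wm H X" unfolding I_def proof (rule wmI)
  fix i a assume a: "a : Q1"
  show "- (k i (hd a)*(ax X i a*s i (tl a))) : HV (cdim X (i-1) (hd a)) (cdim H i (tl a))"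
   by (intro HV_uminus HV_mult[OF H(5)] HV_mult[OF ax_HV[OF X a] H(3)])
  have "df X i (hd a)*(ax X i a*s i (tl a)) = 0" by (simp add: massoc[OF df_ax[OF X a]] ds mult.assoc)
  then show "s i (hd a)*ax H i a - ax X i a*s i (tl a) =
    df X (i-1) (hd a)*- (k i (hd a)*(ax X i a*s i (tl a))) +
    - (k (i+1) (hd a)*(ax X (i+1) a*s (i+1) (tl a)))*df H i (tl a)"
   by (simp add: H(7)[OF a] massoc[OF sp] left_diff_distrib H(2) mult.assoc HVD[OF ax_HV[OF X a]])
 qed (simp_all add: H ds)
 have P: "P : Wm X H" unfolding P_def proof (rule wmI)
  fix i a assume a: "a : Q1"
  show "p (i-1) (hd a)*(ax X (i-1) a*k i (tl a)) : HV (cdim H (i-1) (hd a)) (cdim X i (tl a))"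
   by (intro HV_mult[OF H(4)] HV_mult[OF ax_HV[OF X a] H(5)])
  have "p i (hd a)*(ax X i a*df X (i-1) (tl a)) = 0" by (simp add: df_ax'[OF X a, symmetric] massoc[OF pd'])
  then have 0: "p i (hd a)*(ax X i a*(df X (i-1) (tl a)*x)) = 0" for x by (simp add: mult.assoc[symmetric])
  show "p i (hd a)*ax X i a - ax H i a*p i (tl a) =
    df H (i-1) (hd a)*(p (i-1) (hd a)*(ax X (i-1) a*k i (tl a))) +
    p (i + 1 - 1) (hd a)*(ax X (i + 1 - 1) a*k (i+1) (tl a))*df X i (tl a)"
   by (simp add: H(7)[OF a] sp mult.assoc right_diff_distrib H(2) HVD[OF ax_HV[OF X a]] 0)
 qed (simp_all add: H pd pd')
 have PI: "Hot H H (Wc P I) (wid H)" by (rule hot_eqI) (simp_all add: wc_def P_def I_def wid_def H(6) ks(1) massoc[OF ks(2)] mult.assoc)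
 have IP: "Hot X X (wid X) (Wc I P)" proof (rule hotI[of k _ _ _ "%i a. k (i-1) (hd a)*(ax X (i-1) a*k i (tl a))"])
  show "fst (wid X) i v - fst (Wc I P) i v = df X (i-1) v*k i v + k (i+1) v*df X i v" for i v by (simp add: wid_def wc_def I_def P_def sp)
  fix i a assume a: "a : Q1"
  show "k (i-1) (hd a)*(ax X (i-1) a*k i (tl a)) : HV (cdim X (i-2) (hd a)) (cdim X i (tl a))"
   by (intro HV_mult[OF k1] HV_mult[OF ax_HV[OF X a] H(5)])
  have sp1: "s (i-1) v*(p (i-1) v*x) = E (cdim X (i-1) v)*x - df X (i-2) v*(k (i-1) v*x) - k i v*(df X (i-1) v*x)" for v x
   using massoc[OF sp[of "i - 1" v]] by (simp add: left_diff_distrib mult.assoc)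
  show "snd (wid X) i a - snd (Wc I P) i a =
    k i (hd a)*ax X i a - ax X (i-1) a*k i (tl a) +
    df X (i-2) (hd a)*(k (i-1) (hd a)*(ax X (i-1) a*k i (tl a))) -
    k (i + 1 - 1) (hd a)*(ax X (i + 1 - 1) a*k (i+1) (tl a))*df X i (tl a)"
   by (simp add: wid_def wc_def I_def P_def sp sp1 right_diff_distrib mult.assoc HVD[OF ax_HV[OF X a]]
     massoc[OF df_ax'[OF X a]])
 qed (rule H(5))
 show thesis by (rule that[of H I P k], rule mwe.intro[OF H(1,2) I P PI hot_sym[OF IP]])
   (simp_all add: I_def P_def ds pd' H(6) sp)
qed

definition winverse where
 "winverse X Y f t <-> t : Wm Y X & Hot X X (Wc t f) (wid X) & Hot Y Y (Wc f t) (wid Y)"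

lemma winverse_qiso: assumes X: "X : Cpx" and Y: "Y : Cpx" and f: "f : cm X Y" and t: "winverse X Y (strict f) t" shows "qiso X Y f" proof -
 have t': "t : Wm Y X" "Hot X X (wid X) (Wc t (strict f))" "Hot Y Y (wid Y) (Wc (strict f) t)" using t hot_sym unfolding winverse_def by blast+
 obtain h where h: "!!i v. fst (wid X) i v - fst (Wc t (strict f)) i v = df X (i-1) v*h i v + h (i+1) v*df X i v"
  using hotE[OF t'(2)] htpD(3) by metis
 obtain k where k: "!!i v. fst (wid Y) i v - fst (Wc (strict f) t) i v = df Y (i-1) v*k i v + k (i+1) v*df Y i v"
  using hotE[OF t'(3)] htpD(3) by metis
 show ?thesis proof (rule qiso_of_inverse[OF X Y, of f "fst t" h k])
  show "f i v : HV (cdim Y i v) (cdim X i v)" for i v using f by (simp add: cm_def)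
  show "E (cdim X i v) - fst t i v*f i v = df X (i-1) v*h i v + h (i+1) v*df X i v" for i v using h[of i v] by (simp add: wid_def wc_def)
  show "E (cdim Y i v) - f i v*fst t i v = df Y (i-1) v*k i v + k (i+1) v*df Y i v" for i v using k[of i v] by (simp add: wid_def wc_def)
 qed (rule wmD[OF t'(1)])+
qed

text \<open>Between cohomology models the map induced by \<open>f\<close> is bijective at every
  vertex, and as differentials vanish its inverse is compatible with arrows. Sandwiching this
  inverse between the models yields an inverse of \<open>f\<close> among weak maps, with no
  resolution.\<close>

lemma qiso_winverse: fixes X Y :: "('v, 'a, 'k::field) cpx" assumes X: "X : Cpx" and Y: "Y : Cpx" and f: "f : cm X Y" and q: "qiso X Y f"
 obtains t where "winverse X Y (strict f) t" proof -
 obtain H I P k where "mwe Q X H I P k" by (rule ex_mwe[OF X])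
 note H = mwe.D[OF this]
 obtain K J R l where "mwe Q Y K J R l" by (rule ex_mwe[OF Y])
 note K = mwe.D[OF this]
 let ?F = "strict f :: ('v, 'a, 'k) wmap"
 have F: "?F : Wm X Y" by (rule strict_wm[OF f])
 have fd: "f (i+1) v*df X i v = df Y i v*f i v" "f i v*df X (i-1) v = df Y (i-1) v*f (i-1) v" for i v
  using wmD(2)[OF F, of i v] wmD'(1)[OF F, of i v] by simp_all
 define u where "u = Wc R (Wc ?F I)"
 have u: "u : Wm H K" unfolding u_def by (rule wm_comp[OF H(1) K(1) wm_comp[OF H(1) Y H(3) F] K(4)])
 have fu: "fst u i v = fst R i v*(f i v*fst I i v)" for i v by (simp add: u_def wc_def)
 have Ix: "app (df X i v) (app (fst I i v) x) = 0" for i v x by (metis H(7) app_times app_0)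
 have Jx: "app (df Y i v) (app (fst J i v) x) = 0" for i v x by (metis K(7) app_times app_0)
 have Pd: "app (fst P i v) (app (df X (i-1) v) x) = 0" for i v x by (metis H(8) app_times app_0)
 have Rd: "app (fst R i v) (app (df Y (i-1) v) x) = 0" for i v x by (metis K(8) app_times app_0)
 have "EX g. g : HV (cdim H i v) (cdim K i v) & g*fst u i v = E (cdim H i v) & fst u i v*g = E (cdim K i v)" for i v
 proof (rule bij_inverse[OF wmD(1)[OF u, of i v]])
  fix x :: "nat => 'k" assume x: "app (E (cdim H i v)) x = x" "app (fst u i v) x = 0"
  define z where "z = app (fst I i v) x"
  have z: "app (E (cdim X i v)) z = z" "app (df X i v) z = 0" unfolding z_def by (metis HVD(1)[OF wmD(1)[OF H(3)]] app_times, rule Ix)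
  have fz: "app (df Y i v) (app (f i v) z) = 0" using arg_cong[OF fd(1)[of i v], of "%g. app g z"] z(2) by simp
  have Rz: "app (fst R i v) (app (f i v) z) = 0" using x(2) by (simp add: fu z_def)
  have "app (f i v) z = app (E (cdim Y i v)) (app (f i v) z)" by (metis HVD(1)[OF wmD(1)[OF F]] app_times strict_simps(1))
  also have "... = app (fst J i v*fst R i v + df Y (i-1) v*l i v + l (i+1) v*df Y i v) (app (f i v) z)" by (simp add: K(10))
  also have "... = app (df Y (i-1) v) (app (l i v) (app (f i v) z))" by (simp add: fz Rz)
  finally obtain y where "z = app (df X (i-1) v) y" using q z unfolding qiso_def by metis
  then have "app (fst P i v) z = 0" by (simp add: Pd)
  moreover have "app (fst P i v) z = x" unfolding z_def by (metis H(9) app_times x(1))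
  ultimately show "x = 0" by simp
 next
  fix y :: "nat => 'k" assume y: "app (E (cdim K i v)) y = y"
  define y' where "y' = app (fst J i v) y"
  have "app (E (cdim Y i v)) y' = y'" "app (df Y i v) y' = 0" unfolding y'_def by (metis HVD(1)[OF wmD(1)[OF K(3)]] app_times, rule Jx)
  then obtain x z where x: "app (E (cdim X i v)) x = x" "app (df X i v) x = 0" "y' - app (f i v) x = app (df Y (i-1) v) z"
   using q unfolding qiso_def by metis
  have "y = app (fst R i v) y'" unfolding y'_def by (metis K(9) app_times y)
  also have "... = app (fst R i v) (app (f i v) x) + app (fst R i v) (y' - app (f i v) x)" by simp
  also have "... = app (fst R i v) (app (f i v) x)" unfolding x(3) by (simp add: Rd)
  also have "x = app (fst I i v*fst P i v + df X (i-1) v*k i v + k (i+1) v*df X i v) x" using x(1) by (simp add: H(10))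
  also have "app (fst R i v) (app (f i v) ...) = app (fst u i v) (app (fst P i v) x)
    + app (fst R i v) (app (f i v*df X (i-1) v) (app (k i v) x))" using x(2) by (simp add: fu)
  also have "... = app (fst u i v) (app (fst P i v) x)" unfolding fd(2) by (simp add: Rd)
  finally show "EX x. app (fst u i v) x = y" by metis
 qed blast
 then obtain c where c: "!!i v. c i v : HV (cdim H i v) (cdim K i v)" "!!i v. c i v*fst u i v = E (cdim H i v)"
  "!!i v. fst u i v*c i v = E (cdim K i v)" by metis
 \<comment> \<open>The second component is dictated by requiring the pasted homotopy of
   \<open>w\<close> with \<open>u\<close> to cancel, as in the inverse of a triangular
   matrix.\<close>
 define w where "w = (c, %i a. - (c (i-1) (hd a)*(snd u i a*c i (tl a))))"
 have w: "w : Wm K H" unfolding w_def proof (rule wmI)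
  fix i a assume a: "a : Q1"
  show "- (c (i-1) (hd a)*(snd u i a*c i (tl a))) : HV (cdim H (i-1) (hd a)) (cdim K i (tl a))"
   by (intro HV_uminus HV_mult[OF c(1)] HV_mult[OF wmD(3)[OF u a] c(1)])
  have ua: "fst u i (hd a)*ax H i a = ax K i a*fst u i (tl a)" using wmD'(2)[OF u a, of i] by (simp add: H(2) K(2))
  have "c i (hd a)*ax K i a = c i (hd a)*(ax K i a*(fst u i (tl a)*c i (tl a)))" by (simp add: c(3) HVD[OF ax_HV[OF K(1) a]])
  also have "... = c i (hd a)*(fst u i (hd a)*(ax H i a*c i (tl a)))" by (simp add: massoc[OF ua] mult.assoc)
  also have "... = ax H i a*c i (tl a)" by (simp add: massoc[OF c(2)] HVD[OF ax_HV[OF H(1) a]])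
  finally show "c i (hd a)*ax K i a - ax H i a*c i (tl a) =
    df H (i-1) (hd a)*- (c (i-1) (hd a)*(snd u i a*c i (tl a))) +
    - (c (i + 1 - 1) (hd a)*(snd u (i+1) a*c (i+1) (tl a)))*df K i (tl a)" by (simp add: H(2) K(2))
 qed (simp_all add: H(2) K(2) c(1))
 have wu: "Hot H H (Wc w u) (wid H)" by (rule hot_eqI) (simp_all add: wc_def w_def wid_def c(2) mult.assoc HVD[OF wmD(3)[OF u]])
 have uw: "Hot K K (Wc u w) (wid K)" by (rule hot_eqI) (simp_all add: wc_def w_def wid_def c(3) massoc[OF c(3)] HVD[OF HV_mult[OF wmD(3)[OF u] c(1)]])
 define t where "t = Wc I (Wc w R)"
 have wR: "Wc w R : Wm Y H" by (rule wm_comp[OF Y H(1) K(4) w])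
 have t: "t : Wm Y X" unfolding t_def by (rule wm_comp[OF Y X wR H(3)])
 have "Hot X X (Wc t ?F) (wid X)" proof -
  have "Hot X X (Wc (Wc t ?F) (wid X)) (Wc t ?F)" by (rule wid_right[OF wm_comp[OF X X F t]])
  then have "Hot X X (Wc t ?F) (Wc (Wc t ?F) (wid X))" by (rule hot_sym)
  moreover have "Hot X X (Wc (Wc t ?F) (wid X)) (Wc (Wc t ?F) (Wc I P))" by (rule hot_left[OF hot_sym[OF H(6)] wm_comp[OF X X F t] X])
  moreover have "Wc (Wc t ?F) (Wc I P) = Wc I (Wc w (Wc u P))" by (simp only: t_def u_def wc_assoc)
  moreover have "Hot X X (Wc I (Wc w (Wc u P))) (Wc I P)" by (rule hot_cancel_mid[OF wu H(3,4) X H(1)])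
  ultimately show ?thesis using hot_trans H(6) by metis
 qed
 moreover have "Hot Y Y (Wc ?F t) (wid Y)" proof -
  have FtY: "Wc ?F t : Wm Y Y" by (rule wm_comp[OF Y Y t F])
  have "Hot Y Y (Wc ?F t) (Wc (wid Y) (Wc ?F t))" by (rule hot_sym[OF wid_left[OF FtY]])
  moreover have "Hot Y Y (Wc (wid Y) (Wc ?F t)) (Wc (Wc J R) (Wc ?F t))" by (rule hot_right[OF hot_sym[OF K(6)] FtY])
  moreover have "Wc (Wc J R) (Wc ?F t) = Wc J (Wc u (Wc w R))" by (simp only: t_def u_def wc_assoc)
  moreover have "Hot Y Y (Wc J (Wc u (Wc w R))) (Wc J R)" by (rule hot_cancel_mid[OF uw K(3,4) Y K(1)])
  ultimately show ?thesis using hot_trans K(6) by metis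
 qed
 ultimately show thesis using that t unfolding winverse_def by blast
qed

end

text \<open>
  The path object of a graded map \<open>\<phi>\<close> from \<open>X\<close> to \<open>W\<close>. Its elements are triples \<open>(x, y, g)\<close>, with
  differential \<open>(d x, \<alpha> x + d y, \<phi> x - y - d g)\<close> and with arrows \<open>(x, y, g) \<mapsto> (x, y, g + \<psi> x)\<close>. It is used
  twice: to realize a weak map by a roof (\<open>\<alpha> = 0\<close>), and to replace a homotopy between weak maps by a
  homotopy commuting with the arrows (\<open>\<alpha>\<close> is the difference of two chain maps).
\<close>

locale path_cpx =
 fixes Q X W ph pz al Z S B G assumes D: "Z : complexes Q" "S : quiver.cm Q Z X" "quiver.qiso Z X S" "!!i v. B i v : HV (cdim W i v) (cdim Z i v)"
  "!!i a. a : arcs Q ==> B i (head Q a)*ax Z i a = ax W i a*B i (tail Q a)" "!!i v. B (i+1) v*df Z i v = al i v*S i v + df W i v*B i v"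
  "!!i v. G i v : HV (cdim W (i-1) v) (cdim Z i v)" "!!i v. G (i+1) v*df Z i v = ph i v*S i v - B i v - df W (i-1) v*G i v"
  "!!i a. a : arcs Q ==> G i (head Q a)*ax Z i a = ax W (i-1) a*G i (tail Q a) + pz i a*S i (tail Q a)"

context quiver begin

lemma path_object: fixes X W :: "('v, 'a, 'k::field) cpx" assumes X: "X : Cpx" and W: "W : Cpx" and ph: "!!i v. ph i v : HV (cdim W i v) (cdim X i v)"
  and pz: "!!i a. a : Q1 ==> pz i a : HV (cdim W (i-1) (hd a)) (cdim X i (tl a))" and al: "!!i v. al i v = ph (i+1) v*df X i v - df W i v*ph i v"
   "!!i a. a : Q1 ==> al i (hd a)*ax X i a = ax W (i+1) a*al i (tl a)"
  and coh: "!!i a. a : Q1 ==> ph i (hd a)*ax X i a - ax W i a*ph i (tl a) =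
    df W (i-1) (hd a)*pz i a + pz (i+1) a*df X i (tl a)"
 obtains Z S B G where "path_cpx Q X W ph pz al Z S B G" proof -
 let ?a = "cdim X" and ?b = "cdim W" and ?c = "%i. cdim W (i-1)"
 let ?n = "%i v. ?a i v + ?b i v + ?c i v"
 define s1 s2 s3 p1 p2 p3 :: "int => 'v => 'k lop" where
  sd: "s1 i v = emb1 (?a i v + ?b i v) (?c i v)*emb1 (?a i v) (?b i v)"
   "s2 i v = emb1 (?a i v + ?b i v) (?c i v)*emb2 (?a i v) (?b i v)" "s3 i v = emb2 (?a i v + ?b i v) (?c i v)"
   "p1 i v = prj1 (?a i v) (?b i v)*prj1 (?a i v + ?b i v) (?c i v)"
   "p2 i v = prj2 (?a i v) (?b i v)*prj1 (?a i v + ?b i v) (?c i v)" "p3 i v = prj2 (?a i v + ?b i v) (?c i v)" for i v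
 note o = direct_sum_ops[where 'k = 'k, of "?a i v" "?b i v" for i v] and t = direct_sum_ops[where 'k = 'k, of "?a i v + ?b i v" "?c i v" for i v]
 have h: "s1 i v : HV (?n i v) (?a i v)" "s2 i v : HV (?n i v) (?b i v)" "s3 i v : HV (?n i v) (?c i v)"
  "p1 i v : HV (?a i v) (?n i v)" "p2 i v : HV (?b i v) (?n i v)" "p3 i v : HV (?c i v) (?n i v)" for i v
  unfolding sd by (rule HV_mult[OF t(1) o(1)] HV_mult[OF t(1) o(2)] t(2) HV_mult[OF o(3) t(3)] HV_mult[OF o(4) t(3)] t(4))+
 have ps: "p1 i v*s1 i v = E (?a i v)" "p2 i v*s2 i v = E (?b i v)" "p3 i v*s3 i v = E (?c i v)"
  "p1 i v*s2 i v = 0" "p1 i v*s3 i v = 0" "p2 i v*s1 i v = 0" "p2 i v*s3 i v = 0" "p3 i v*s1 i v = 0" "p3 i v*s2 i v = 0" for i v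
  by (simp_all add: sd mult.assoc o t(5-8) t(5-8)[THEN massoc] HVD[OF o(1)] HVD[OF o(2)])
 have sp: "s1 i v*p1 i v + s2 i v*p2 i v + s3 i v*p3 i v = E (?n i v)" for i v proof -
  have "s1 i v*p1 i v + s2 i v*p2 i v = emb1 (?a i v + ?b i v) (?c i v) *
    ((emb1 (?a i v) (?b i v)*prj1 (?a i v) (?b i v) + emb2 (?a i v) (?b i v)*prj2 (?a i v) (?b i v))*prj1 (?a i v + ?b i v) (?c i v))"
   by (simp add: sd algebra_simps)
  then show ?thesis by (simp add: o(9) HVD[OF t(3)] t(9) sd(3,6))
 qed
 have h3: "s3 (i+1) v : HV (?n (i+1) v) (?b i v)" "p3 (i+1) v : HV (?b i v) (?n (i+1) v)" for i v
  using h(3)[of "i + 1" v] h(6)[of "i + 1" v] by simp_all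
 have p3s3: "p3 (i+1) v*s3 (i+1) v = E (?b i v)" for i v using ps(3)[of "i + 1" v] by simp
 note dX = df_HV[OF X] and dW = df_HV[OF W] and dW' = df_HV'[OF W]
 have ph1: "ph (i+1) v : HV (?b (i+1) v) (?a (i+1) v)" for i v by (rule ph)
 have alHV: "al i v : HV (?b (i+1) v) (?a i v)" for i v unfolding al(1) by (intro HV_diff HV_mult[OF ph dX] HV_mult[OF dW ph])
 have dal: "df W (i+1) v*al i v = - (al (i+1) v*df X i v)" for i v
  by (simp add: al(1) left_diff_distrib right_diff_distrib mult.assoc dd[OF X] massoc[OF dd[OF W]])

 note ld = HVD[OF h(1)] HVD[OF h(2)] HVD[OF h(3)] HVD[OF h(4)] HVD[OF h(5)] HVD[OF h(6)] HVD[OF h3(1)] HVD[OF h3(2)]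
  HVD[OF dX] HVD[OF dW] HVD[OF dW'] HVD[OF ph] HVD[OF alHV]
  ps ps[THEN massoc] p3s3 massoc[OF p3s3]
 define d where "d i v = s1 (i+1) v*(df X i v*p1 i v) + s2 (i+1) v*(al i v*p1 i v) + s2 (i+1) v*(df W i v*p2 i v)
  + s3 (i+1) v*(ph i v*p1 i v) - s3 (i+1) v*p2 i v - s3 (i+1) v*(df W (i-1) v*p3 i v)" for i v
 define A where "A i a = s1 i (hd a)*(ax X i a*p1 i (tl a)) + s2 i (hd a)*(ax W i a*p2 i (tl a))
  + s3 i (hd a)*(ax W (i-1) a*p3 i (tl a)) + s3 i (hd a)*(pz i a*p1 i (tl a))" for i a
 have pd: "p1 (i+1) v*d i v = df X i v*p1 i v" "p2 (i+1) v*d i v = al i v*p1 i v + df W i v*p2 i v"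
  "p3 (i+1) v*d i v = ph i v*p1 i v - p2 i v - df W (i-1) v*p3 i v" for i v by (simp_all add: d_def distrib_left right_diff_distrib ld)
 have dHV: "d i v : HV (?n (i+1) v) (?n i v)" for i v unfolding d_def
  by (intro HV_add HV_diff HV_mult[OF h(1) HV_mult[OF dX h(4)]] HV_mult[OF h(2) HV_mult[OF alHV h(4)]]
    HV_mult[OF h(2) HV_mult[OF dW h(5)]] HV_mult[OF h3(1) HV_mult[OF ph h(4)]] HV_mult[OF h3(1) h(5)]
    HV_mult[OF h3(1) HV_mult[OF dW' h(6)]])
 have AHV: "A i a : HV (?n i (hd a)) (?n i (tl a))" if a: "a : Q1" for i a unfolding A_def
  by (intro HV_add HV_mult[OF h(1) HV_mult[OF ax_HV[OF X a] h(4)]] HV_mult[OF h(2) HV_mult[OF ax_HV[OF W a] h(5)]]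
    HV_mult[OF h(3) HV_mult[OF ax_HV[OF W a] h(6)]] HV_mult[OF h(3) HV_mult[OF pz[OF a] h(4)]])
 have pA: "p1 i (hd a)*A i a = ax X i a*p1 i (tl a)" "p2 i (hd a)*A i a = ax W i a*p2 i (tl a)"
  "p3 i (hd a)*A i a = ax W (i-1) a*p3 i (tl a) + pz i a*p1 i (tl a)" if a: "a : Q1" for i a
  by (simp_all add: A_def distrib_left ld HVD[OF ax_HV[OF X a]] HVD[OF ax_HV[OF W a]] HVD[OF pz[OF a]]
    massoc[OF HVD(1)[OF ax_HV[OF X a]]] massoc[OF HVD(1)[OF ax_HV[OF W a]]] massoc[OF HVD(1)[OF pz[OF a]]])
 have joint: "x = y" if "E (?n j v)*x = x" "E (?n j v)*y = y" "p1 j v*x = p1 j v*y" "p2 j v*x = p2 j v*y" "p3 j v*x = p3 j v*y"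
  for j v and x y :: "'k lop" proof -
  have "x = (s1 j v*p1 j v + s2 j v*p2 j v + s3 j v*p3 j v)*x" using that(1) by (simp add: sp)
  also have "... = (s1 j v*p1 j v + s2 j v*p2 j v + s3 j v*p3 j v)*y" by (simp add: distrib_right mult.assoc that(3-5))
  also have "... = y" using that(2) by (simp add: sp)
  finally show ?thesis .
 qed
 have d2': "d j v*d i v = 0" if j: "j = i + 1" for i j v proof -
  note pdj = pd[of i v, folded j] and ddj = dd[OF X, of i v, folded j] dd[OF W, of i v, folded j]
  have dWj: "df W (j-1) v = df W i v" by (simp add: j)
  show ?thesis proof (rule joint[of "j + 1" v])
   show "p1 (j+1) v*(d j v*d i v) = p1 (j+1) v*0" by (simp add: massoc[OF pd(1)] mult.assoc pdj massoc[OF ddj(1)])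
   show "p2 (j+1) v*(d j v*d i v) = p2 (j+1) v*0" by (simp add: massoc[OF pd(2)] mult.assoc distrib_right pdj distrib_left massoc[OF ddj(2)]
      massoc[OF dal[of i v, folded j]])
   show "p3 (j+1) v*(d j v*d i v) = p3 (j+1) v*0" by (simp add: massoc[OF pd(3)] mult.assoc left_diff_distrib pdj right_diff_distrib dWj
      al(1)[of i v, folded j] distrib_right massoc[OF dd'(1)[OF W]])
  qed (simp_all add: HVD[OF dHV, simplified] HVD[OF dHV[of i v, folded j]])
 qed
 have d2: "d (i+1) v*d i v = 0" for i v by (rule d2') simp
 have dA: "d i (hd a)*A i a = A (i+1) a*d i (tl a)" if a: "a : Q1" for i a proof (rule joint[of "i + 1" "hd a"])
  show "p1 (i+1) (hd a)*(d i (hd a)*A i a) = p1 (i+1) (hd a)*(A (i+1) a*d i (tl a))"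
   by (simp add: massoc[OF pd(1)] massoc[OF pA(1)[OF a]] mult.assoc pA(1)[OF a] pd(1) massoc[OF df_ax[OF X a]])
  show "p2 (i+1) (hd a)*(d i (hd a)*A i a) = p2 (i+1) (hd a)*(A (i+1) a*d i (tl a))"
   by (simp add: massoc[OF pd(2)] massoc[OF pA(2)[OF a]] mult.assoc pA(1,2)[OF a] pd(2) distrib_left distrib_right
     massoc[OF df_ax[OF W a]] massoc[OF al(2)[OF a]])
  have c: "ph i (hd a)*(ax X i a*x) = ax W i a*(ph i (tl a)*x) + df W (i-1) (hd a)*(pz i a*x)
    + pz (i+1) a*(df X i (tl a)*x)" for x proof -
   have "ph i (hd a)*ax X i a = ax W i a*ph i (tl a) + df W (i-1) (hd a)*pz i a + pz (i+1) a*df X i (tl a)"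
    using coh[OF a, of i] by (simp add: algebra_simps)
   from arg_cong[OF this, of "%y. y*x"] show ?thesis by (simp add: distrib_right mult.assoc)
  qed
  show "p3 (i+1) (hd a)*(d i (hd a)*A i a) = p3 (i+1) (hd a)*(A (i+1) a*d i (tl a))"
   by (simp add: massoc[OF pd(3)] massoc[OF pA(3)[OF a]] mult.assoc pA[OF a] pd distrib_left distrib_right
     left_diff_distrib right_diff_distrib massoc[OF df_ax'[OF W a]] c)
 qed (simp_all add: HVD[OF dHV, simplified] HVD[OF AHV[OF a]] HVD[OF AHV[OF a, of "i + 1"], simplified])
 have n0: "?n i v = 0" if "v ~: Q0" for i v using cdim_outside[OF X that] cdim_outside[OF W that] by simp
 have fin: "finite {i. EX v. ?n i v ~= 0}" proof (rule finite_subset)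
  show "{i. EX v. ?n i v ~= 0} <= {i. EX v. ?a i v ~= 0} \<union> {i. EX v. ?b i v ~= 0} \<union> (%i. i + 1) ` {i. EX v. ?b i v ~= 0}" proof
   fix i assume "i : {i. EX v. ?n i v ~= 0}"
   then obtain v where "?a i v ~= 0 \<or> ?b i v ~= 0 \<or> ?b (i-1) v ~= 0" by auto
   moreover have "i : (%i. i + 1) ` {i. EX v. ?b i v ~= 0}" if "?b (i-1) v ~= 0" by (rule image_eqI[of _ _ "i - 1"]) (use that in auto)
   ultimately show "i : {i. EX v. ?a i v ~= 0} \<union> {i. EX v. ?b i v ~= 0} \<union> (%i. i + 1) ` {i. EX v. ?b i v ~= 0}" by blast
  qed
 qed (intro finite_UnI finite_imageI finite_support[OF X] finite_support[OF W])
 define Z where "Z = mkcpx ?n d A"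
 note C = mkcpx_complex[of ?n d A, OF n0 fin dHV d2 AHV dA]
 have Z: "Z : Cpx" "df Z i v = d i v" "a : Q1 ==> ax Z i a = A i a" "cdim Z i v = ?n i v" for i v a unfolding Z_def by (rule C; assumption)+ simp
 show thesis proof (rule that[of Z p1 p2 p3], rule path_cpx.intro)
  show "p1 : cm Z X" unfolding cm_def by (simp add: Z h pd pA)
  \<comment> \<open>A section sends x to (x, ph x, 0). The triples with x = 0 form a contractible
    complex, since the differential carries y isomorphically to the third slot; the homotopy moves
    that slot back, with a sign.\<close>
  show "qiso Z X p1" proof (rule qiso_of_inverse[OF Z(1) X, of p1 "%i v. s1 i v + s2 i v*ph i v" "%i v. - (s2 (i-1) v*p3 i v)" "%i v. 0"])
   show "s1 i v + s2 i v*ph i v : HV (cdim Z i v) (cdim X i v)" for i v unfolding Z(4) by (intro HV_add h HV_mult[OF h(2) ph])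
   show "(s1 (i+1) v + s2 (i+1) v*ph (i+1) v)*df X i v = df Z i v*(s1 i v + s2 i v*ph i v)" for i v by (simp add: Z d_def algebra_simps ld)
     (simp add: al(1) algebra_simps)
   show "E (cdim X i v) - p1 i v*(s1 i v + s2 i v*ph i v) = df X (i-1) v*0 + 0*df X i v" for i v by (simp add: distrib_left ld)
   have s23: "s2 (i + 1 - 1) v = s2 i v" "d (i-1) v*(s2 (i-1) v*x) = s2 i v*(df W (i-1) v*x) - s3 i v*(E (cdim W (i-1) v)*x)" for i v x proof -
    have "d (i-1) v*s2 (i-1) v = s2 i v*df W (i-1) v - s3 i v*E (cdim W (i-1) v)" by (simp add: d_def distrib_right left_diff_distrib mult.assoc ld)
    from arg_cong[OF this, of "%y. y*x"] show "d (i-1) v*(s2 (i-1) v*x) = s2 i v*(df W (i-1) v*x) - s3 i v*(E (cdim W (i-1) v)*x)"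
     by (simp add: left_diff_distrib mult.assoc)
   qed simp
   show "E (cdim Z i v) - (s1 i v + s2 i v*ph i v)*p1 i v =
     df Z (i-1) v*- (s2 (i-1) v*p3 i v) + - (s2 (i + 1 - 1) v*p3 (i+1) v)*df Z i v" for i v unfolding Z s23(1) sp[symmetric]
    by (simp add: s23(2) ld mult.assoc pd(3) right_diff_distrib distrib_right)
  qed (simp add: Z h)
 qed (simp_all add: Z h pd pA)
qed

end

section \<open>Morphisms of the derived category as weak maps\<close>

context quiver begin

text \<open>Homotopies that commute with the arrows, the operator version of
  \<open>homotopic\<close>. This is finer than \<open>Hot\<close> on strict maps;
  \<open>rectify\<close> bridges the gap after a quasi-isomorphism.\<close>

definition shot where
 "shot X Y f g <-> (EX h. (ALL i. h i : rhm (fst X i) (fst Y (i-1))) &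
   (ALL i v. f i v - g i v = df Y (i-1) v*h i v + h (i+1) v*df X i v))"

abbreviation mul (infixl "\<cdot>" 70) where "f \<cdot> g == (%i v. f i v*g i v)"

lemma cmD: assumes "f : cm X Y" shows "f i v : HV (cdim Y i v) (cdim X i v)" "f (i+1) v*df X i v = df Y i v*f i v"
  "a : Q1 ==> f i (hd a)*ax X i a = ax Y i a*f i (tl a)" "f i v*df X (i-1) v = df Y (i-1) v*f (i-1) v"
 using assms wmD'(1)[OF strict_wm[OF assms], of i v] unfolding cm_def by simp_all

lemma cm_comp: "f : cm X Y ==> g : cm Y Z ==> g \<cdot> f : cm X Z" unfolding cm_def[of X Z]
 by (auto intro: HV_mult[OF cmD(1) cmD(1)] simp: mult.assoc cmD(2) massoc[OF cmD(2)] cmD(3) massoc[OF cmD(3)])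

lemma shot_hot: assumes "shot X Y f g" shows "Hot X Y (strict f) (strict g)" proof -
 obtain h where h: "!!i. h i : rhm (fst X i) (fst Y (i-1))" "!!i v. f i v - g i v = df Y (i-1) v*h i v + h (i+1) v*df X i v"
  using assms unfolding shot_def by blast
 show ?thesis proof (rule hotI[of h _ _ _ "%i a. 0"])
  show "h i v : HV (cdim Y (i-1) v) (cdim X i v)" for i v using rhom_HV[OF h(1), of i v] by (simp add: cdim_def)
  show "snd (strict f :: ('v, 'a, 'b) wmap) i a - snd (strict g :: ('v, 'a, 'b) wmap) i a =
    h i (hd a)*ax X i a - ax Y (i-1) a*h i (tl a)
    + df Y (i-2) (hd a)*0 - 0*df X i (tl a)" if "a : Q1" for i a using rhom_ar[OF h(1) that, of i] by (simp add: ax_def)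
 qed (simp_all add: h(2))
qed

lemma shot_comp_right: assumes "shot X Y f g" and e: "e : cm V X" shows "shot V Y (f \<cdot> e) (g \<cdot> e)" proof -
 obtain h where h: "!!i. h i : rhm (fst X i) (fst Y (i-1))" "!!i v. f i v - g i v = df Y (i-1) v*h i v + h (i+1) v*df X i v"
  using assms unfolding shot_def by blast
 show ?thesis unfolding shot_def proof (intro exI[of _ "h \<cdot> e"] conjI allI)
  show "(%v. h i v*e i v) : rhm (fst V i) (fst Y (i-1))" for i proof -
   have "e i : rhm (fst V i) (fst X i)" by (rule rhomI) (use cmD(1)[OF e, of i] cmD(3)[OF e, of _ i] in \<open>simp_all add: cdim_def ax_def\<close>)
   from rhom_mult[OF h(1) this] show ?thesis by (simp add: times_fun_def)
  qed
  show "f i v*e i v - g i v*e i v = df Y (i-1) v*(h i v*e i v) + h (i+1) v*e (i+1) v*df V i v" for i v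
   unfolding left_diff_distrib[symmetric] h(2) by (simp add: distrib_right mult.assoc cmD(2)[OF e])
 qed
qed

lemma realize: fixes X Y :: "('v, 'a, 'k::field) cpx" assumes X: "X : Cpx" and Y: "Y : Cpx" and w: "w : Wm X Y"
 obtains Z s b where "Z : Cpx" "s : cm Z X" "qiso Z X s" "b : cm Z Y" "Hot Z Y (strict b) (Wc w (strict s))" proof -
 obtain Z S B G where "path_cpx Q X Y (fst w) (snd w) (%i v. 0) Z S B G" proof (rule path_object[OF X Y, of "fst w" "snd w" "%i v. 0"])
  show "fst w i v : HV (cdim Y i v) (cdim X i v)" for i v by (rule wmD(1)[OF w])
  show "snd w i a : HV (cdim Y (i-1) (hd a)) (cdim X i (tl a))" if "a : Q1" for i a by (rule wmD(3)[OF w that])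
  show "0 = fst w (i+1) v*df X i v - df Y i v*fst w i v" for i v by (simp add: wmD(2)[OF w])
  show "0*ax X i a = ax Y (i+1) a*0" for i a by simp
  show "fst w i (hd a)*ax X i a - ax Y i a*fst w i (tl a) = df Y (i-1) (hd a)*snd w i a + snd w (i+1) a*df X i (tl a)"
   if "a : Q1" for i a by (rule wmD(4)[OF w that])
 qed (rule that)
 note Z = path_cpx.D[OF this]
 have b: "B : cm Z Y" unfolding cm_def using Z(4-6) by simp
 have "Hot Z Y (Wc w (strict S)) (strict B)" proof (rule hotI[of G _ _ _ "%i a. 0"])
  show "fst (Wc w (strict S)) i v - fst (strict B :: ('v, 'a, 'k) wmap) i v = df Y (i-1) v*G i v + G (i+1) v*df Z i v" for i v
   by (simp add: Z(8) wc_def)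
  show "snd (Wc w (strict S)) i a - snd (strict B :: ('v, 'a, 'k) wmap) i a = G i (hd a)*ax Z i a - ax Y (i-1) a*G i (tl a)
    + df Y (i-2) (hd a)*0 - 0*df Z i (tl a)" if "a : Q1" for i a by (simp add: Z(9)[OF that] wc_def)
 qed (simp_all add: Z(7))
 then show thesis using that[OF Z(1-3) b] hot_sym by blast
qed

text \<open>This is Y[-1]. A homotopy between maps to \<open>Y\<close> is a graded map of degree 0
  to it, as the path object construction requires.\<close>

lemma unshift_complex: assumes Y: "Y : Cpx"
 obtains W where "W : Cpx" "!!i v. cdim W i v = cdim Y (i-1) v" "!!i v. df W i v = - df Y (i-1) v" "!!i a. a : Q1 ==> ax W i a = ax Y (i-1) a" proof -
 let ?n = "%i v. cdim Y (i-1) v" and ?d = "%i v. - df Y (i-1) v" and ?A = "%i a. ax Y (i-1) a"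
 have fin: "finite {i. EX v. ?n i v ~= 0}" proof (rule finite_subset)
  show "{i. EX v. ?n i v ~= 0} <= (%i. i + 1) ` {i. EX v. cdim Y i v ~= 0}" proof
   fix i assume "i : {i. EX v. ?n i v ~= 0}"
   then show "i : (%i. i + 1) ` {i. EX v. cdim Y i v ~= 0}" by (intro image_eqI[of _ _ "i - 1"]) auto
  qed
 qed (intro finite_imageI finite_support[OF Y])
 have d: "?d i v : HV (?n (i+1) v) (?n i v)" for i v using HV_uminus[OF df_HV'[OF Y, of i v]] by simp
 have d2: "?d (i+1) v*?d i v = 0" for i v using dd'(1)[OF Y, of i v] by simp
 have dA: "?d i (hd a)*?A i a = ?A (i+1) a*?d i (tl a)" if "a : Q1" for i a using df_ax'[OF Y that, of i] by simp
 note C = mkcpx_complex[of ?n ?d ?A, OF cdim_outside[OF Y] fin d d2 ax_HV[OF Y] dA]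
 show thesis by (rule that[of "mkcpx ?n ?d ?A"]) (rule C | simp; assumption?)+
qed

text \<open>The path object is formed for the homotopy \<open>h\<close> itself, read as a map to
  Y[-1] that fails to be a chain map by f - g. Its second coordinate is a homotopy commuting with
  the arrows.\<close>

lemma rectify: assumes X: "X : Cpx" and Y: "Y : Cpx" and f: "f : cm X Y" and g: "g : cm X Y" and hot: "Hot X Y (strict f) (strict g)"
 obtains Z s where "Z : Cpx" "s : cm Z X" "qiso Z X s" "shot Z Y (f \<cdot> s) (g \<cdot> s)" proof -
 obtain h et where "htp Q X Y h et (strict f) (strict g)" by (rule hotE[OF hot])
 note h = htpD[OF this]
 obtain W where W: "W : Cpx" "!!i v. cdim W i v = cdim Y (i-1) v" "!!i v. df W i v = - df Y (i-1) v" "!!i a. a : Q1 ==> ax W i a = ax Y (i-1) a"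
  by (rule unshift_complex[OF Y], rule that)
 have i2: "i - 1 - 1 = i - 2" for i :: int by simp
 obtain Z S B G where "path_cpx Q X W h et (%i v. f i v - g i v) Z S B G" proof (rule path_object[OF X W(1), of h et "%i v. f i v - g i v"])
  show "h i v : HV (cdim W i v) (cdim X i v)" for i v by (simp add: W h)
  show "et i a : HV (cdim W (i-1) (hd a)) (cdim X i (tl a))" if "a : Q1" for i a using h(2)[OF that, of i] by (simp add: W i2)
  show "f i v - g i v = h (i+1) v*df X i v - df W i v*h i v" for i v using h(3)[of i v] by (simp add: W)
  show "(f i (hd a) - g i (hd a))*ax X i a = ax W (i+1) a*(f i (tl a) - g i (tl a))" if "a : Q1" for i a
   using cmD(3)[OF f that, of i] cmD(3)[OF g that, of i] by (simp add: W that algebra_simps)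
  show "h i (hd a)*ax X i a - ax W i a*h i (tl a) = df W (i-1) (hd a)*et i a + et (i+1) a*df X i (tl a)"
   if "a : Q1" for i a using h(4)[OF that, of i] by (simp add: W that i2 algebra_simps)
 qed (rule that)
 note Z = path_cpx.D[OF this]
 have "shot Z Y (f \<cdot> S) (g \<cdot> S)" unfolding shot_def proof (intro exI[of _ B] conjI allI)
  show "B i : rhm (fst Z i) (fst Y (i-1))" for i
   by (rule rhomI) (use Z(4)[of i] Z(5)[of _ i] W in \<open>simp_all add: cdim_def[symmetric] ax_def[symmetric]\<close>)
  show "f i v*S i v - g i v*S i v = df Y (i-1) v*B i v + B (i+1) v*df Z i v" for i v by (simp only: left_diff_distrib[symmetric]) (simp add: Z(6) W)
 qed
 then show thesis using that[OF Z(1-3)] by blast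
qed

lemma winverse_cancel: assumes X: "X : Cpx" and L: "L : Cpx" and Y: "Y : Cpx" and F: "F : Wm X Y" and t: "winverse X Y F t"
  and ab: "a : Wm Y L" "b : Wm Y L" and hot: "Hot X L (Wc a F) (Wc b F)" shows "Hot Y L a b" proof -
 have t': "t : Wm Y X" "Hot Y Y (Wc F t) (wid Y)" using t unfolding winverse_def by blast+
 have r: "Hot Y L (Wc (Wc c F) t) c" if "c : Wm Y L" for c unfolding wc_assoc using hot_trans[OF hot_left[OF t'(2) that L] wid_right[OF that]] .
 show ?thesis using hot_trans[OF hot_trans[OF hot_sym[OF r[OF ab(1)]] hot_right[OF hot t'(1)]] r[OF ab(2)]] .
qed

lemma winverse_comp: assumes X: "X : Cpx" and Y: "Y : Cpx" and Z: "Z : Cpx"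
  and F: "F : Wm X Y" "winverse X Y F t" and G: "G : Wm Y Z" "winverse Y Z G u" shows "winverse X Z (Wc G F) (Wc t u)" proof -
 have t: "t : Wm Y X" "Hot X X (Wc t F) (wid X)" "Hot Y Y (Wc F t) (wid Y)" using F(2) unfolding winverse_def by blast+
 have u: "u : Wm Z Y" "Hot Y Y (Wc u G) (wid Y)" "Hot Z Z (Wc G u) (wid Z)" using G(2) unfolding winverse_def by blast+
 show ?thesis unfolding winverse_def proof (intro conjI)
  show "Wc t u : Wm Z X" by (rule wm_comp[OF Z X u(1) t(1)])
  have "Hot X X (Wc t (Wc u (Wc G F))) (Wc t F)" by (rule hot_cancel_mid[OF u(2) t(1) F(1) X Y])
  then show "Hot X X (Wc (Wc t u) (Wc G F)) (wid X)" unfolding wc_assoc by (rule hot_trans[OF _ t(2)])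
  have "Hot Z Z (Wc G (Wc F (Wc t u))) (Wc G u)" by (rule hot_cancel_mid[OF t(3) G(1) u(1) Z Y])
  then show "Hot Z Z (Wc (Wc G F) (Wc t u)) (wid Z)" unfolding wc_assoc by (rule hot_trans[OF _ u(3)])
 qed
qed

lemma qiso_comp: assumes "X : Cpx" "Y : Cpx" "Z : Cpx" and f: "f : cm X Y" "qiso X Y f" and g: "g : cm Y Z" "qiso Y Z g"
 shows "qiso X Z (g \<cdot> f)" proof -
 obtain t where t: "winverse X Y (strict f) t" by (rule qiso_winverse[OF assms(1,2) f])
 obtain u where u: "winverse Y Z (strict g) u" by (rule qiso_winverse[OF assms(2,3) g])
 have "winverse X Z (strict (g \<cdot> f)) (Wc t u)"
  using winverse_comp[OF assms(1-3) strict_wm[OF f(1)] t strict_wm[OF g(1)] u] unfolding strict_comp .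
 then show ?thesis by (rule winverse_qiso[OF assms(1,3) cm_comp[OF f(1) g(1)]])
qed

text \<open>Composing \<open>f\<close> with a weak inverse of \<open>t\<close> gives a weak map from
  \<open>Z\<close> to \<open>Z'\<close>; realising it by a roof closes the square up to weak
  homotopy, and \<open>rectify\<close> makes the homotopy strict.\<close>

lemma ore: assumes Z: "Z : Cpx" "Z' : Cpx" "Y : Cpx" and f: "f : cm Z Y" and t: "t : cm Z' Y" "qiso Z' Y t"
 obtains V u w where "V : Cpx" "u : cm V Z" "qiso V Z u" "w : cm V Z'" "shot V Y (f \<cdot> u) (t \<cdot> w)" proof -
 obtain r where r: "winverse Z' Y (strict t) r" by (rule qiso_winverse[OF Z(2,3) t])
 have r': "r : Wm Y Z'" "Hot Y Y (Wc (strict t) r) (wid Y)" using r unfolding winverse_def by blast+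
 have v: "Wc r (strict f) : Wm Z Z'" by (rule wm_comp[OF Z(1,2) strict_wm[OF f] r'(1)])
 obtain V s b where V: "V : Cpx" "s : cm V Z" "qiso V Z s" "b : cm V Z'"
  "Hot V Z' (strict b) (Wc (Wc r (strict f)) (strict s))" by (rule realize[OF Z(1,2) v])
 have fs: "Wc (strict f) (strict s) : Wm V Y" unfolding strict_comp by (rule strict_wm[OF cm_comp[OF V(2) f]])
 have "Hot V Y (Wc (strict t) (strict b)) (Wc (strict t) (Wc (Wc r (strict f)) (strict s)))" by (rule hot_left[OF V(5) strict_wm[OF t(1)] Z(3)])
 moreover have "Wc (strict t) (Wc (Wc r (strict f)) (strict s)) = Wc (Wc (strict t) r) (Wc (strict f) (strict s))" by (simp only: wc_assoc)
 ultimately have "Hot V Y (Wc (strict t) (strict b)) (Wc (Wc (strict t) r) (Wc (strict f) (strict s)))" by simp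
 moreover have "Hot V Y (Wc (Wc (strict t) r) (Wc (strict f) (strict s))) (Wc (strict f) (strict s))"
  by (rule hot_trans[OF hot_right[OF r'(2) fs] wid_left[OF fs]])
 ultimately have "Hot V Y (Wc (strict t) (strict b)) (Wc (strict f) (strict s))" by (rule hot_trans)
 from hot_sym[OF this] have hfb: "Hot V Y (strict (f \<cdot> s)) (strict (t \<cdot> b))" unfolding strict_comp .
 obtain U e where U: "U : Cpx" "e : cm U V" "qiso U V e" "shot U Y ((f \<cdot> s) \<cdot> e) ((t \<cdot> b) \<cdot> e)"
  by (rule rectify[OF V(1) Z(3) cm_comp[OF V(2) f] cm_comp[OF V(4) t(1)] hfb])
 show thesis by (rule that[OF U(1) cm_comp[OF U(2) V(2)] qiso_comp[OF U(1) V(1) Z(1) U(2,3) V(2,3)] cm_comp[OF U(2) V(4)]])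
   (use U(4) in \<open>simp add: mult.assoc\<close>)
qed

definition oroof where
 "oroof X Y Z s f <-> Z : Cpx & s : cm Z X & qiso Z X s & f : cm Z Y"

text \<open>The fraction f s^-1 equals \<open>w\<close>, written without the inverse.\<close>

definition represents where
 "represents Y w Z s f <-> Hot Z Y (strict f) (Wc w (strict s))"

lemma represents_unique: assumes "X : Cpx" "Y : Cpx" "oroof X Y Z s f" "w : Wm X Y" "w' : Wm X Y" "represents Y w Z s f" "represents Y w' Z s f"
 shows "Hot X Y w w'" proof -
 have r: "Z : Cpx" "s : cm Z X" "qiso Z X s" using assms(3) unfolding oroof_def by blast+
 obtain t where "winverse Z X (strict s) t" by (rule qiso_winverse[OF r(1) assms(1) r(2,3)])
 from winverse_cancel[OF r(1) assms(2,1) strict_wm[OF r(2)] this assms(4,5)] show ?thesis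
  using hot_trans[OF hot_sym[OF assms(6)[unfolded represents_def]] assms(7)[unfolded represents_def]] .
qed

lemma represents_exists: assumes "X : Cpx" "Y : Cpx" "oroof X Y Z s f"
 obtains w where "w : Wm X Y" "represents Y w Z s f" proof -
 have r: "Z : Cpx" "s : cm Z X" "qiso Z X s" "f : cm Z Y" using assms(3) unfolding oroof_def by blast+
 obtain t where t: "winverse Z X (strict s) t" by (rule qiso_winverse[OF r(1) assms(1) r(2,3)])
 have t': "t : Wm X Z" "Hot Z Z (Wc t (strict s)) (wid Z)" using t unfolding winverse_def by blast+
 have f: "strict f : Wm Z Y" by (rule strict_wm[OF r(4)])
 have "Hot Z Y (Wc (strict f) (Wc t (strict s))) (strict f)" by (rule hot_trans[OF hot_left[OF t'(2) f assms(2)] wid_right[OF f]])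
 then have "represents Y (Wc (strict f) t) Z s f" unfolding represents_def wc_assoc by (rule hot_sym)
 then show thesis by (rule that[OF wm_comp[OF assms(1,2) t'(1) f]])
qed

lemma represents_cong: "Hot X Y w w' ==> s : cm Z X ==> represents Y w Z s f ==> represents Y w' Z s f"
 unfolding represents_def by (rule hot_trans[OF _ hot_right[OF _ strict_wm]])

text \<open>\<open>ore\<close> equalises the denominators. The numerators then agree up to weak
  homotopy because both represent \<open>w\<close>, and one more quasi-isomorphism makes that
  homotopy commute with the arrows.\<close>

lemma represents_common: assumes X: "X : Cpx" and Y: "Y : Cpx" and w: "w : Wm X Y"
  and r: "oroof X Y Z s f" "represents Y w Z s f" and r': "oroof X Y Z' s' f'" "represents Y w Z' s' f'"
 obtains V u u' where "V : Cpx" "u : cm V Z" "u' : cm V Z'" "qiso V X (s \<cdot> u)"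
  "shot V X (s \<cdot> u) (s' \<cdot> u')" "shot V Y (f \<cdot> u) (f' \<cdot> u')" proof -
 have Z: "Z : Cpx" "s : cm Z X" "qiso Z X s" "f : cm Z Y" using r(1) unfolding oroof_def by blast+
 have Z': "Z' : Cpx" "s' : cm Z' X" "qiso Z' X s'" "f' : cm Z' Y" using r'(1) unfolding oroof_def by blast+
 obtain V u b where V: "V : Cpx" "u : cm V Z" "qiso V Z u" "b : cm V Z'" "shot V X (s \<cdot> u) (s' \<cdot> b)"
  by (rule ore[OF Z(1) Z'(1) X Z(2) Z'(2,3)])
 have 1: "Hot V Y (strict (f \<cdot> u)) (Wc w (strict (s \<cdot> u)))"
  using hot_right[OF r(2)[unfolded represents_def] strict_wm[OF V(2)]] by (simp only: strict_comp wc_assoc)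
 have 2: "Hot V Y (Wc w (strict (s \<cdot> u))) (Wc w (strict (s' \<cdot> b)))" by (rule hot_left[OF shot_hot[OF V(5)] w Y])
 have 3: "Hot V Y (strict (f' \<cdot> b)) (Wc w (strict (s' \<cdot> b)))"
  using hot_right[OF r'(2)[unfolded represents_def] strict_wm[OF V(4)]] by (simp only: strict_comp wc_assoc)
 note hfb = hot_trans[OF hot_trans[OF 1 2] hot_sym[OF 3]]
 obtain U e where U: "U : Cpx" "e : cm U V" "qiso U V e" "shot U Y ((f \<cdot> u) \<cdot> e) ((f' \<cdot> b) \<cdot> e)"
  by (rule rectify[OF V(1) Y cm_comp[OF V(2) Z(4)] cm_comp[OF V(4) Z'(4)] hfb])
 have ue: "qiso U Z (u \<cdot> e)" by (rule qiso_comp[OF U(1) V(1) Z(1) U(2,3) V(2,3)])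
 show thesis proof (rule that[OF U(1) cm_comp[OF U(2) V(2)] cm_comp[OF U(2) V(4)]])
  show "qiso U X (s \<cdot> (u \<cdot> e))" by (rule qiso_comp[OF U(1) Z(1) X cm_comp[OF U(2) V(2)] ue Z(2,3)])
  show "shot U X (s \<cdot> (u \<cdot> e)) (s' \<cdot> (b \<cdot> e))" using shot_comp_right[OF V(5) U(2)] by (simp only: mult.assoc)
  show "shot U Y (f \<cdot> (u \<cdot> e)) (f' \<cdot> (b \<cdot> e))" using U(4) by (simp only: mult.assoc)
 qed
qed

end

section \<open>Comparison of matrix roofs with weak maps\<close>

context quiver begin

definition opc where "opc f = (%i v. op (f i v))"

definition mtc :: "('v, 'a, 'k::field) cpx => ('v, 'a, 'k) cpx => (int => 'v => 'k lop) => ('v, 'k) cmap" where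
 "mtc X Y f = (%i v. mt (cdim Y i v) (cdim X i v) (f i v))"

lemma cpxD: assumes "X : Cpx" shows "snd X i : rep_maps Q (fst X i) (fst X (i+1))" "snd X i v : carrier_mat (cdim X (i+1) v) (cdim X i v)"
  "snd X (i-1) v : carrier_mat (cdim X i v) (cdim X (i-1) v)" proof -
 have *: "snd X i : rep_maps Q (fst X i) (fst X (i+1))" for i using assms unfolding complexes_def by blast
 then show "snd X i : rep_maps Q (fst X i) (fst X (i+1))" .
 have **: "snd X i v : carrier_mat (cdim X (i+1) v) (cdim X i v)" for i using *[of i] unfolding rep_maps_def cdim_def by blast
 show "snd X i v : carrier_mat (cdim X (i+1) v) (cdim X i v)" by (rule **)
 show "snd X (i-1) v : carrier_mat (cdim X i v) (cdim X (i-1) v)" using **[of "i - 1"] by simp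
qed

lemma chainD: "f : chain_maps Q X Y ==> f i v : carrier_mat (cdim Y i v) (cdim X i v)" unfolding chain_maps_def rep_maps_def cdim_def by blast

lemma rhom_cdim_iff: "f : rhm (fst X i) (fst Y j) <-> (ALL v. f v : HV (cdim Y j v) (cdim X i v)) &
  (ALL a:Q1. f (hd a)*ax X i a = ax Y j a*f (tl a))" unfolding rhom_def cdim_def ax_def by blast

lemma cm_iff: "f : cm X Y <-> (ALL i. f i : rhm (fst X i) (fst Y i)) & (ALL i v. f (i+1) v*df X i v = df Y i v*f i v)"
 unfolding cm_def rhom_cdim_iff by blast

lemma opc_cm: assumes "X : Cpx" "Y : Cpx" "f : chain_maps Q X Y" shows "opc f : cm X Y" unfolding cm_iff opc_def proof (intro conjI allI)
 show "(%v. op (f i v)) : rhm (fst X i) (fst Y i)" for i using assms(3) unfolding chain_maps_def by (intro rep_maps_op cpx_rep assms(1,2)) blast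
 show "op (f (i+1) v)*df X i v = df Y i v*op (f i v)" for i v proof -
  have "f (i+1) v*snd X i v = snd Y i v*f i v" using assms(3) unfolding chain_maps_def by blast
  then show ?thesis by (simp add: df_def op_times[OF chainD[OF assms(3)] cpxD(2)[OF assms(1)], symmetric]
    op_times[OF cpxD(2)[OF assms(2)] chainD[OF assms(3)], symmetric])
 qed
qed

lemma opc_mtc: "f : cm X Y ==> opc (mtc X Y f) = f" unfolding opc_def mtc_def by (simp add: op_mt[OF cmD(1)])

lemma mtc_chain: assumes "X : Cpx" "Y : Cpx" "f : cm X Y" shows "mtc X Y f : chain_maps Q X Y" unfolding chain_maps_def
proof (intro CollectI conjI allI)
 have r: "f i : rhm (fst X i) (fst Y i)" for i using assms(3) unfolding cm_iff by blast
 have m: "mtc X Y f i = mtf (fst Y i) (fst X i) (f i)" for i by (simp add: mtc_def mtf_def cdim_def)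
 show rm: "mtc X Y f i : rep_maps Q (fst X i) (fst Y i)" for i unfolding m by (rule mtf_maps[OF cpx_rep[OF assms(1)] cpx_rep[OF assms(2)] r])
 have c: "mtc X Y f i v : carrier_mat (cdim Y i v) (cdim X i v)" for i v by (simp add: mtc_def)
 have o: "op (mtc X Y f i v) = f i v" for i v by (simp add: mtc_def op_mt[OF cmD(1)[OF assms(3)]])
 have "op (mtc X Y f (i+1) v*snd X i v) = op (snd Y i v*mtc X Y f i v)" for i v
  by (simp add: op_times[OF c cpxD(2)[OF assms(1)]] op_times[OF cpxD(2)[OF assms(2)] c] o df_def[symmetric] cmD(2)[OF assms(3)])
 then show "mtc X Y f (i+1) v*snd X i v = snd Y i v*mtc X Y f i v" for i v
  using op_inject[OF mult_carrier_mat[OF c cpxD(2)[OF assms(1)]] mult_carrier_mat[OF cpxD(2)[OF assms(2)] c]] by blast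
qed

lemma opc_comp: assumes "f : chain_maps Q X Y" "g : chain_maps Q Y Z" shows "opc (cmap_comp g f) = opc g \<cdot> opc f"
 unfolding opc_def cmap_comp_def by (simp add: op_times[OF chainD[OF assms(2)] chainD[OF assms(1)]])

lemma cmap_mem: assumes "X : Cpx" "Y : Cpx" "Z : Cpx" "f : chain_maps Q X Y" "g : chain_maps Q Y Z"
 shows "cmap_comp g f : chain_maps Q X Z" "opc (cmap_comp g f) = opc g \<cdot> opc f" proof -
 show "opc (cmap_comp g f) = opc g \<cdot> opc f" by (rule opc_comp[OF assms(4,5)])
 have "cmap_comp g f = mtc X Z (opc g \<cdot> opc f)" proof (intro ext)
  fix i v
  have "cmap_comp g f i v : carrier_mat (cdim Z i v) (cdim X i v)"
   unfolding cmap_comp_def by (rule mult_carrier_mat[OF chainD[OF assms(5)] chainD[OF assms(4)]])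
  then show "cmap_comp g f i v = mtc X Z (opc g \<cdot> opc f) i v"
   unfolding mtc_def opc_def op_times[OF chainD[OF assms(5)] chainD[OF assms(4)], symmetric] cmap_comp_def by (simp add: mt_op)
 qed
 moreover have "mtc X Z (opc g \<cdot> opc f) : chain_maps Q X Z"
  by (rule mtc_chain[OF assms(1,3) cm_comp[OF opc_cm[OF assms(1,2,4)] opc_cm[OF assms(2,3,5)]]])
 ultimately show "cmap_comp g f : chain_maps Q X Z" by simp
qed

lemma shot_iff: assumes X: "X : Cpx" and Y: "Y : Cpx" and f: "f : chain_maps Q X Y" and g: "g : chain_maps Q X Y"
 shows "homotopic Q X Y f g <-> shot X Y (opc f) (opc g)" proof
 assume "homotopic Q X Y f g"
 then obtain h where h: "!!i. h i : rep_maps Q (fst X i) (fst Y (i-1))"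
  "!!i v. f i v - g i v = snd Y (i-1) v*h i v + h (i+1) v*snd X i v" unfolding homotopic_def by blast
 have c: "h i v : carrier_mat (cdim Y (i-1) v) (cdim X i v)" for i v using h(1)[of i] unfolding rep_maps_def cdim_def by blast
 have c1: "h (i+1) v : carrier_mat (cdim Y i v) (cdim X (i+1) v)" for i v using c[of "i + 1" v] by simp
 show "shot X Y (opc f) (opc g)" unfolding shot_def proof (intro exI[of _ "opc h"] conjI allI)
  show "opc h i : rhm (fst X i) (fst Y (i-1))" for i unfolding opc_def by (rule rep_maps_op[OF cpx_rep[OF X] cpx_rep[OF Y] h(1)])
  show "opc f i v - opc g i v = df Y (i-1) v*opc h i v + opc h (i+1) v*df X i v" for i v
   unfolding opc_def df_def op_minus[OF chainD[OF f] chainD[OF g], symmetric] h(2)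
    op_plus[OF mult_carrier_mat[OF cpxD(3)[OF Y] c] mult_carrier_mat[OF c1 cpxD(2)[OF X]]]
    op_times[OF cpxD(3)[OF Y] c] op_times[OF c1 cpxD(2)[OF X]] ..
 qed
next
 assume "shot X Y (opc f) (opc g)"
 then obtain h where h: "!!i. h i : rhm (fst X i) (fst Y (i-1))"
  "!!i v. opc f i v - opc g i v = df Y (i-1) v*h i v + h (i+1) v*df X i v" unfolding shot_def by blast
 let ?h = "%i. mtf (fst Y (i-1)) (fst X i) (h i)"
 have rm: "?h i : rep_maps Q (fst X i) (fst Y (i-1))" for i by (rule mtf_maps[OF cpx_rep[OF X] cpx_rep[OF Y] h(1)])
 have c: "?h i v : carrier_mat (cdim Y (i-1) v) (cdim X i v)" for i v using rm[of i] unfolding rep_maps_def cdim_def by blast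
 have c1: "?h (i+1) v : carrier_mat (cdim Y i v) (cdim X (i+1) v)" for i v using c[of "i + 1" v] by simp
 have o: "op (?h i v) = h i v" for i v by (rule op_mtf[OF h(1)])
 show "homotopic Q X Y f g" unfolding homotopic_def proof (intro exI[of _ ?h] conjI allI)
  show "?h i : rep_maps Q (fst X i) (fst Y (i-1))" for i by (rule rm)
  fix i v
  have "op (f i v - g i v) = op (snd Y (i-1) v*?h i v + ?h (i+1) v*snd X i v)"
   unfolding op_plus[OF mult_carrier_mat[OF cpxD(3)[OF Y] c] mult_carrier_mat[OF c1 cpxD(2)[OF X]]]
    op_times[OF cpxD(3)[OF Y] c] op_times[OF c1 cpxD(2)[OF X]] o op_minus[OF chainD[OF f] chainD[OF g]] using h(2)[of i v] unfolding opc_def df_def .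
  then show "f i v - g i v = snd Y (i-1) v*?h i v + ?h (i+1) v*snd X i v" using op_inject[OF minus_carrier_mat[OF chainD[OF g]]
    add_carrier_mat[OF mult_carrier_mat[OF c1 cpxD(2)[OF X]]]] by blast
 qed
qed

lemma cocycle_iff: assumes "X : Cpx" shows "x : cocycles X i v <-> x : carrier_vec (cdim X i v) & app (df X i v) (sq x) = 0"
proof (cases "x : carrier_vec (cdim X i v)")
 case True
 have "sq (snd X i v *\<^sub>v x) = app (df X i v) (sq x)" unfolding df_def by (rule sq_mult_mat_vec[OF cpxD(2)[OF assms] True])
 moreover have "snd X i v *\<^sub>v x : carrier_vec (cdim X (i+1) v)" using cpxD(2)[OF assms] True by (rule mult_mat_vec_carrier)
 ultimately show ?thesis using True sq_inject[of "snd X i v *\<^sub>v x" "cdim X (i+1) v" "0\<^sub>v (cdim X (i+1) v)"] by (simp add: cocycles_def)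
qed (simp add: cocycles_def)

lemma coboundary_iff: assumes "X : Cpx" and x: "x : carrier_vec (cdim X i v)" shows "x : coboundaries X i v <-> (EX y. sq x = app (df X (i-1) v) y)"
proof
 assume "x : coboundaries X i v"
 then obtain y where y: "y : carrier_vec (cdim X (i-1) v)" "x = snd X (i-1) v *\<^sub>v y" unfolding coboundaries_def by blast
 then have "sq x = app (df X (i-1) v) (sq y)" unfolding df_def using sq_mult_mat_vec[OF cpxD(3)[OF assms(1)] y(1)] by simp
 then show "EX y. sq x = app (df X (i-1) v) y" by blast
next
 assume "EX y. sq x = app (df X (i-1) v) y"
 then obtain y where y: "sq x = app (df X (i-1) v) y" by blast
 have "app (E (cdim X (i-1) v)) (app (E (cdim X (i-1) v)) y) = app (E (cdim X (i-1) v)) y" by (metis E_idem app_times)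
 then obtain z where z: "z : carrier_vec (cdim X (i-1) v)" "sq z = app (E (cdim X (i-1) v)) y" using sq_range by metis
 have "sq (snd X (i-1) v *\<^sub>v z) = app (df X (i-1) v*E (cdim X (i-1) v)) y"
  unfolding sq_mult_mat_vec[OF cpxD(3)[OF assms(1)] z(1)] z(2) df_def by simp
 also have "... = sq x" unfolding HVD(2)[OF df_HV'[OF assms(1)]] y ..
 finally have "snd X (i-1) v *\<^sub>v z = x" using sq_inject[OF mult_mat_vec_carrier[OF cpxD(3)[OF assms(1)] z(1)] x] by blast
 then show "x : coboundaries X i v" using z(1) unfolding coboundaries_def by blast
qed

lemma qiso_iff: assumes X: "X : Cpx" and Y: "Y : Cpx" and f: "f : chain_maps Q X Y" shows "quasi_iso X Y f <-> qiso X Y (opc f)" proof -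
 have fx: "sq (f i v *\<^sub>v x) = app (opc f i v) (sq x)" "f i v *\<^sub>v x : carrier_vec (cdim Y i v)" if "x : carrier_vec (cdim X i v)" for i v x
  unfolding opc_def using sq_mult_mat_vec[OF chainD[OF f] that] mult_mat_vec_carrier[OF chainD[OF f] that] by simp_all
 have 1: "(ALL x:cocycles X i v. f i v *\<^sub>v x : coboundaries Y i v --> x : coboundaries X i v) <->
   (ALL x y. app (E (cdim X i v)) x = x --> app (df X i v) x = 0 --> app (opc f i v) x = app (df Y (i-1) v) y -->
    (EX z. x = app (df X (i-1) v) z))" (is "?l <-> ?r") for i v proof
  assume l: ?l
  show ?r proof (intro allI impI)
   fix x y assume h: "app (E (cdim X i v)) x = x" "app (df X i v) x = 0" "app (opc f i v) x = app (df Y (i-1) v) y"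
   obtain u where u: "u : carrier_vec (cdim X i v)" "sq u = x" using h(1) sq_range by metis
   have "u : cocycles X i v" using u h(2) cocycle_iff[OF X] by simp
   moreover have "f i v *\<^sub>v u : coboundaries Y i v" unfolding coboundary_iff[OF Y fx(2)[OF u(1)]] fx(1)[OF u(1)] u(2) using h(3) by blast
   ultimately have "u : coboundaries X i v" using l by blast
   then show "EX z. x = app (df X (i-1) v) z" unfolding coboundary_iff[OF X u(1)] u(2) .
  qed
 next
  assume r: ?r
  show ?l proof (intro ballI impI)
   fix x assume h: "x : cocycles X i v" "f i v *\<^sub>v x : coboundaries Y i v"
   have x: "x : carrier_vec (cdim X i v)" "app (df X i v) (sq x) = 0" using h(1) cocycle_iff[OF X] by blast+
   obtain y where "app (opc f i v) (sq x) = app (df Y (i-1) v) y" using h(2) unfolding coboundary_iff[OF Y fx(2)[OF x(1)]] fx(1)[OF x(1)] by blast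
   then show "x : coboundaries X i v" unfolding coboundary_iff[OF X x(1)] using r sq_carrier[OF x(1)] x(2) by blast
  qed
 qed
 have 2: "(ALL y:cocycles Y i v. EX x:cocycles X i v. y - f i v *\<^sub>v x : coboundaries Y i v) <->
   (ALL y. app (E (cdim Y i v)) y = y --> app (df Y i v) y = 0 -->
    (EX x z. app (E (cdim X i v)) x = x & app (df X i v) x = 0 & y - app (opc f i v) x = app (df Y (i-1) v) z))" (is "?l <-> ?r") for i v proof
  assume l: ?l
  show ?r proof (intro allI impI)
   fix y assume h: "app (E (cdim Y i v)) y = y" "app (df Y i v) y = 0"
   obtain u where u: "u : carrier_vec (cdim Y i v)" "sq u = y" using h(1) sq_range by metis
   have "u : cocycles Y i v" using u h(2) cocycle_iff[OF Y] by simp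
   then obtain x where x: "x : cocycles X i v" "u - f i v *\<^sub>v x : coboundaries Y i v" using l by blast
   have x': "x : carrier_vec (cdim X i v)" "app (df X i v) (sq x) = 0" using x(1) cocycle_iff[OF X] by blast+
   have "EX z. y - app (opc f i v) (sq x) = app (df Y (i-1) v) z"
    using x(2) unfolding coboundary_iff[OF Y minus_carrier_vec[OF u(1) fx(2)[OF x'(1)]]] sq_minus[OF u(1) fx(2)[OF x'(1)]] fx(1)[OF x'(1)] u(2) .
   then show "EX x z. app (E (cdim X i v)) x = x & app (df X i v) x = 0 & y - app (opc f i v) x = app (df Y (i-1) v) z"
    using sq_carrier[OF x'(1)] x'(2) by blast
  qed
 next
  assume r: ?r
  show ?l proof (intro ballI)
   fix y assume h: "y : cocycles Y i v"
   have y: "y : carrier_vec (cdim Y i v)" "app (df Y i v) (sq y) = 0" using h cocycle_iff[OF Y] by blast+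
   then obtain x z where x: "app (E (cdim X i v)) x = x" "app (df X i v) x = 0" "sq y - app (opc f i v) x = app (df Y (i-1) v) z"
    using r sq_carrier[OF y(1)] by blast
   obtain u where u: "u : carrier_vec (cdim X i v)" "sq u = x" using x(1) sq_range by metis
   have "y - f i v *\<^sub>v u : coboundaries Y i v"
    unfolding coboundary_iff[OF Y minus_carrier_vec[OF y(1) fx(2)[OF u(1)]]] sq_minus[OF y(1) fx(2)[OF u(1)]] fx(1)[OF u(1)] u(2) using x(3) by blast
   moreover have "u : cocycles X i v" using u x(2) cocycle_iff[OF X] by simp
   ultimately show "EX x:cocycles X i v. y - f i v *\<^sub>v x : coboundaries Y i v" by blast
  qed
 qed
 show ?thesis unfolding quasi_iso_def qiso_def 1 2 ..
qed

lemma roofs_oroof: assumes "X : Cpx" "Y : Cpx" "(Z, s, f) : roofs Q X Y"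
 shows "oroof X Y Z (opc s) (opc f)" "s : chain_maps Q Z X" "f : chain_maps Q Z Y" "Z : Cpx" proof -
 have h: "Z : Cpx" "s : chain_maps Q Z X" "quasi_iso Z X s" "f : chain_maps Q Z Y" using assms(3) unfolding roofs_def by blast+
 then show "s : chain_maps Q Z X" "f : chain_maps Q Z Y" "Z : Cpx" by blast+
 show "oroof X Y Z (opc s) (opc f)" unfolding oroof_def
  using h(1) opc_cm[OF h(1) assms(1) h(2)] opc_cm[OF h(1) assms(2) h(4)] h(3) qiso_iff[OF h(1) assms(1) h(2)] by blast
qed

lemma oroof_roofs: assumes "X : Cpx" "Y : Cpx" "oroof X Y Z s f" shows "(Z, mtc Z X s, mtc Z Y f) : roofs Q X Y" proof -
 have h: "Z : Cpx" "s : cm Z X" "qiso Z X s" "f : cm Z Y" using assms(3) unfolding oroof_def by blast+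
 note c = mtc_chain[OF h(1) assms(1) h(2)]
 show ?thesis unfolding roofs_def using h(1,3) c mtc_chain[OF h(1) assms(2) h(4)] qiso_iff[OF h(1) assms(1) c] unfolding opc_mtc[OF h(2)] by blast
qed

text \<open>These sets turn out to be exactly the equivalence classes of roofs, so the Hom sets of
  the derived category are weak maps modulo \<open>Hot\<close>.\<close>

definition cl where
 "cl X Y w = {(Z, s, f). (Z, s, f) : roofs Q X Y & represents Y w Z (opc s) (opc f)}"

lemma oroof_cl: assumes "X : Cpx" "Y : Cpx" "oroof X Y Z s f" "represents Y w Z s f" shows "(Z, mtc Z X s, mtc Z Y f) : cl X Y w" proof -
 have h: "s : cm Z X" "f : cm Z Y" using assms(3) unfolding oroof_def by blast+
 show ?thesis unfolding cl_def using oroof_roofs[OF assms(1-3)] assms(4) by (simp add: opc_mtc[OF h(1)] opc_mtc[OF h(2)])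
qed

lemma cl_nonempty: assumes "X : Cpx" "Y : Cpx" "w : Wm X Y"
 obtains Z s f where "oroof X Y Z s f" "represents Y w Z s f" "(Z, mtc Z X s, mtc Z Y f) : cl X Y w" proof -
 obtain Z s b where Z: "Z : Cpx" "s : cm Z X" "qiso Z X s" "b : cm Z Y" "Hot Z Y (strict b) (Wc w (strict s))" by (rule realize[OF assms])
 then have o: "oroof X Y Z s b" "represents Y w Z s b" unfolding oroof_def represents_def by blast+
 show thesis by (rule that[OF o oroof_cl[OF assms(1,2) o]])
qed

lemma cl_cong: assumes "X : Cpx" "Y : Cpx" "Hot X Y w w'" shows "cl X Y w = cl X Y w'" proof -
 have "cl X Y w <= cl X Y w'" if "Hot X Y w w'" for w w' proof
  fix r assume "r : cl X Y w"
  then obtain Z s f where r: "r = (Z, s, f)" "(Z, s, f) : roofs Q X Y" "represents Y w Z (opc s) (opc f)" unfolding cl_def by blast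
  have "opc s : cm Z X" using roofs_oroof(1)[OF assms(1,2) r(2)] unfolding oroof_def by blast
  from represents_cong[OF that this r(3)] show "r : cl X Y w'" using r unfolding cl_def by blast
 qed
 then show ?thesis using assms(3) hot_sym[OF assms(3)] by blast
qed

lemma cl_eq_iff: assumes "X : Cpx" "Y : Cpx" "w : Wm X Y" "w' : Wm X Y" shows "cl X Y w = cl X Y w' <-> Hot X Y w w'" proof
 assume eq: "cl X Y w = cl X Y w'"
 obtain Z s f where r: "oroof X Y Z s f" "represents Y w Z s f" "(Z, mtc Z X s, mtc Z Y f) : cl X Y w" by (rule cl_nonempty[OF assms(1-3)])
 have c: "s : cm Z X" "f : cm Z Y" using r(1) unfolding oroof_def by blast+
 have "represents Y w' Z s f" using r(3)[unfolded eq] unfolding cl_def by (auto simp: opc_mtc[OF c(1)] opc_mtc[OF c(2)])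
 from represents_unique[OF assms(1,2) r(1) assms(3,4) r(2) this] show "Hot X Y w w'" .
qed (rule cl_cong[OF assms(1,2)])

text \<open>Two roofs are related when a common weak map is behind both. This description lets
  classes be computed without a separate proof that the relation is transitive.\<close>

lemma roof_rel_iff: assumes X: "X : Cpx" and Y: "Y : Cpx" shows "(r, r') : roof_rel Q X Y <-> (EX w:Wm X Y. r : cl X Y w & r' : cl X Y w)" proof
 assume a: "(r, r') : roof_rel Q X Y"
 obtain Z s f where r: "r = (Z, s, f)" by (cases r)
 obtain Z' s' f' where r': "r' = (Z', s', f')" by (cases r')
 have R: "(Z, s, f) : roofs Q X Y" "(Z', s', f') : roofs Q X Y" using a unfolding r r' roof_rel_def by blast+
 obtain W u u' where W: "W : Cpx" "u : chain_maps Q W Z" "u' : chain_maps Q W Z'" "quasi_iso W X (cmap_comp s u)"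
  "homotopic Q W X (cmap_comp s u) (cmap_comp s' u')" "homotopic Q W Y (cmap_comp f u) (cmap_comp f' u')" using a unfolding r r' roof_rel_def by blast
 note o = roofs_oroof[OF X Y R(1)] and o' = roofs_oroof[OF X Y R(2)]
 note m1 = cmap_mem[OF W(1) o(4) X W(2) o(2)] and m2 = cmap_mem[OF W(1) o'(4) X W(3) o'(2)]
  and m3 = cmap_mem[OF W(1) o(4) Y W(2) o(3)] and m4 = cmap_mem[OF W(1) o'(4) Y W(3) o'(3)]
 have q: "qiso W X (opc s \<cdot> opc u)" using qiso_iff[OF W(1) X m1(1)] W(4) m1(2) by simp
 have h1: "shot W X (opc s \<cdot> opc u) (opc s' \<cdot> opc u')" using shot_iff[OF W(1) X m1(1) m2(1)] W(5) m1(2) m2(2) by simp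
 have h2: "shot W Y (opc f \<cdot> opc u) (opc f' \<cdot> opc u')" using shot_iff[OF W(1) Y m3(1) m4(1)] W(6) m3(2) m4(2) by simp
 obtain w where w: "w : Wm X Y" "represents Y w Z (opc s) (opc f)" by (rule represents_exists[OF X Y o(1)])
 obtain w' where w': "w' : Wm X Y" "represents Y w' Z' (opc s') (opc f')" by (rule represents_exists[OF X Y o'(1)])
 note u = opc_cm[OF W(1) o(4) W(2)] and u' = opc_cm[OF W(1) o'(4) W(3)]
 have or: "oroof X Y W (opc s \<cdot> opc u) (opc f \<cdot> opc u)" unfolding oroof_def
  using W(1) q cm_comp[OF u opc_cm[OF o(4) X o(2)]] cm_comp[OF u opc_cm[OF o(4) Y o(3)]] by blast
 have 1: "represents Y w W (opc s \<cdot> opc u) (opc f \<cdot> opc u)" unfolding represents_def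
  using hot_right[OF w(2)[unfolded represents_def] strict_wm[OF u]] by (simp only: strict_comp wc_assoc)
 have 2: "Hot W Y (strict (opc f' \<cdot> opc u')) (Wc w' (strict (opc s' \<cdot> opc u')))"
  using hot_right[OF w'(2)[unfolded represents_def] strict_wm[OF u']] by (simp only: strict_comp wc_assoc)
 have 3: "Hot W Y (Wc w' (strict (opc s' \<cdot> opc u'))) (Wc w' (strict (opc s \<cdot> opc u)))"
  by (rule hot_left[OF hot_sym[OF shot_hot[OF h1]] w'(1) Y])
 have 4: "represents Y w' W (opc s \<cdot> opc u) (opc f \<cdot> opc u)" unfolding represents_def
  by (rule hot_trans[OF shot_hot[OF h2] hot_trans[OF 2 3]])
 have "Hot X Y w' w" by (rule represents_unique[OF X Y or w'(1) w(1) 4 1])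
 then have "cl X Y w' = cl X Y w" by (rule cl_cong[OF X Y])
 moreover have "r' : cl X Y w'" unfolding r' cl_def using R(2) w'(2) by blast
 moreover have "r : cl X Y w" unfolding r cl_def using R(1) w(2) by blast
 ultimately show "EX w:Wm X Y. r : cl X Y w & r' : cl X Y w" using w(1) by blast
next
 assume "EX w:Wm X Y. r : cl X Y w & r' : cl X Y w"
 then obtain w where w: "w : Wm X Y" "r : cl X Y w" "r' : cl X Y w" by blast
 obtain Z s f where r: "r = (Z, s, f)" by (cases r)
 obtain Z' s' f' where r': "r' = (Z', s', f')" by (cases r')
 have R: "(Z, s, f) : roofs Q X Y" "(Z', s', f') : roofs Q X Y" "represents Y w Z (opc s) (opc f)" "represents Y w Z' (opc s') (opc f')"
  using w(2,3) unfolding r r' cl_def by blast+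
 note o = roofs_oroof[OF X Y R(1)] and o' = roofs_oroof[OF X Y R(2)]
 obtain V u u' where V: "V : Cpx" "u : cm V Z" "u' : cm V Z'" "qiso V X (opc s \<cdot> u)"
  "shot V X (opc s \<cdot> u) (opc s' \<cdot> u')" "shot V Y (opc f \<cdot> u) (opc f' \<cdot> u')"
  by (rule represents_common[OF X Y w(1) o(1) R(3) o'(1) R(4)])
 let ?u = "mtc V Z u" and ?u' = "mtc V Z' u'"
 have uc: "?u : chain_maps Q V Z" "?u' : chain_maps Q V Z'" by (intro mtc_chain V o(4) o'(4))+
 note m1 = cmap_mem[OF V(1) o(4) X uc(1) o(2)] and m2 = cmap_mem[OF V(1) o'(4) X uc(2) o'(2)]
  and m3 = cmap_mem[OF V(1) o(4) Y uc(1) o(3)] and m4 = cmap_mem[OF V(1) o'(4) Y uc(2) o'(3)]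
 note ou = opc_mtc[OF V(2)] opc_mtc[OF V(3)]
 have "quasi_iso V X (cmap_comp s ?u)" using qiso_iff[OF V(1) X m1(1)] V(4) m1(2) ou by simp
 moreover have "homotopic Q V X (cmap_comp s ?u) (cmap_comp s' ?u')" using shot_iff[OF V(1) X m1(1) m2(1)] V(5) m1(2) m2(2) ou by simp
 moreover have "homotopic Q V Y (cmap_comp f ?u) (cmap_comp f' ?u')" using shot_iff[OF V(1) Y m3(1) m4(1)] V(6) m3(2) m4(2) ou by simp
 ultimately show "(r, r') : roof_rel Q X Y" unfolding roof_rel_def r r' using R(1,2) V(1) uc by blast
qed

lemma roof_class_cl: assumes "X : Cpx" "Y : Cpx" "w : Wm X Y" "r : cl X Y w" shows "roof_class Q X Y r = cl X Y w" proof -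
 have *: "cl X Y w' = cl X Y w" if w': "w' : Wm X Y" "r : cl X Y w'" for w' proof -
  obtain Z s f where r: "r = (Z, s, f)" by (cases r)
  have R: "(Z, s, f) : roofs Q X Y" "represents Y w Z (opc s) (opc f)" "represents Y w' Z (opc s) (opc f)"
   using assms(4) that unfolding r cl_def by blast+
  have "Hot X Y w' w" by (rule represents_unique[OF assms(1,2) roofs_oroof(1)[OF assms(1,2) R(1)] w'(1) assms(3) R(3,2)])
  then show ?thesis by (rule cl_cong[OF assms(1,2)])
 qed
 have "r' : roof_class Q X Y r <-> r' : cl X Y w" for r'
  unfolding roof_class_def Image_singleton_iff roof_rel_iff[OF assms(1,2)] using*assms(3,4) by blast
 then show ?thesis by blast
qed

section \<open>The operations of the derived category on weak maps\<close>

definition wk where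
 "wk X Y w = (X, Y, cl X Y w)"

lemma wk_eq_iff: assumes "X : Cpx" "Y : Cpx" "w : Wm X Y" "w' : Wm X Y" shows "wk X Y w = wk X Y w' <-> Hot X Y w w'"
 unfolding wk_def using cl_eq_iff[OF assms] by simp

lemma Hom_D: assumes X: "X : Cpx" and Y: "Y : Cpx" shows "Hom DQ X Y = wk X Y ` Wm X Y" proof -
 have "roofs Q X Y // roof_rel Q X Y = cl X Y ` Wm X Y" proof (intro equalityI subsetI)
  fix c assume "c : roofs Q X Y // roof_rel Q X Y"
  then obtain r where r: "r : roofs Q X Y" "c = roof_class Q X Y r" unfolding roof_class_def by (rule quotientE)
  obtain Z s f where rr: "r = (Z, s, f)" by (cases r)
  obtain w where w: "w : Wm X Y" "represents Y w Z (opc s) (opc f)" by (rule represents_exists[OF X Y roofs_oroof(1)[OF X Y r(1)[unfolded rr]]])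
  have "r : cl X Y w" using w(2) r(1) unfolding rr cl_def by blast
  from roof_class_cl[OF X Y w(1) this] show "c : cl X Y ` Wm X Y" using r(2) w(1) by blast
 next
  fix c assume "c : cl X Y ` Wm X Y"
  then obtain w where w: "w : Wm X Y" "c = cl X Y w" by blast
  obtain Z s f where m: "(Z, mtc Z X s, mtc Z Y f) : cl X Y w" by (rule cl_nonempty[OF X Y w(1)])
  have r: "(Z, mtc Z X s, mtc Z Y f) : roofs Q X Y" using m unfolding cl_def by blast
  show "c : roofs Q X Y // roof_rel Q X Y"
   using quotientI[OF r, of "roof_rel Q X Y"] roof_class_cl[OF X Y w(1) m] w(2) unfolding roof_class_def by simp
 qed
 then show ?thesis unfolding derived_category_def wk_def by auto
qed

lemma Hom_D_wk: "X : Cpx ==> Y : Cpx ==> w : Wm X Y ==> wk X Y w : Hom DQ X Y" by (simp add: Hom_D)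

lemma Ob_D [simp]: "Ob DQ = Cpx" by (simp add: derived_category_def)

lemma chain_map_one: assumes "X : Cpx"
 shows "(%i v. 1\<^sub>m (cdim X i v)) : chain_maps Q X X" "opc (%i v. 1\<^sub>m (cdim X i v)) = (%i v. E (cdim X i v))" "qiso X X (%i v. E (cdim X i v))"
proof -
 have "(%i v. E (cdim X i v)) : cm X X" unfolding cm_def by (simp add: HVD[OF df_HV[OF assms]] HVD[OF ax_HV[OF assms]])
 from mtc_chain[OF assms assms this] show "(%i v. 1\<^sub>m (cdim X i v)) : chain_maps Q X X" by (simp add: mtc_def)
 show "opc (%i v. 1\<^sub>m (cdim X i v)) = (%i v. E (cdim X i v))" by (simp add: opc_def)
 show "qiso X X (%i v. E (cdim X i v))" by (rule qiso_of_inverse[OF assms assms, of _ "%i v. E (cdim X i v)" "%i v. 0" "%i v. 0"])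
   (simp_all add: HVD[OF df_HV[OF assms]])
qed

lemma Idn_D: assumes X: "X : Cpx" shows "Idn DQ X = wk X X (wid X)" proof -
 let ?e = "%i v. 1\<^sub>m (cdim X i v)"
 note c = chain_map_one[OF X]
 have "(X, ?e, ?e) : roofs Q X X" unfolding roofs_def using X c(1) c(3) qiso_iff[OF X X c(1)] unfolding c(2) by blast
 moreover have "represents X (wid X) X (opc ?e) (opc ?e)" unfolding represents_def c(2) by (rule hot_eqI) (simp_all add: wc_def wid_def)
 ultimately have "(X, ?e, ?e) : cl X X (wid X)" unfolding cl_def by blast
 from roof_class_cl[OF X X wid_wm[OF X] this] show ?thesis by (simp add: derived_category_def wk_def)
qed

lemma Zer_D: assumes X: "X : Cpx" and Y: "Y : Cpx" shows "Zer DQ X Y = wk X Y w0" proof -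
 let ?e = "%i v. 1\<^sub>m (cdim X i v)" and ?z = "%i v. 0\<^sub>m (cdim Y i v) (cdim X i v)"
 note c = chain_map_one[OF X]
 have "(%i v. 0) : cm X Y" unfolding cm_def by simp
 then have "mtc X Y (%i v. 0) : chain_maps Q X Y" by (rule mtc_chain[OF X Y])
 moreover have "mtc X Y (%i v. 0) = ?z" unfolding mtc_def using mt_op[OF zero_carrier_mat] by (metis op_zero)
 ultimately have z: "?z : chain_maps Q X Y" by simp
 have "(X, ?e, ?z) : roofs Q X Y" unfolding roofs_def using X c(1) c(3) z qiso_iff[OF X X c(1)] unfolding c(2) by blast
 moreover have "represents Y w0 X (opc ?e) (opc ?z)" unfolding represents_def by (rule hot_eqI) (simp_all add: wc_def w0_def opc_def)
 ultimately have "(X, ?e, ?z) : cl X Y w0" unfolding cl_def by blast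
 from roof_class_cl[OF X Y w0_wm this] show ?thesis by (simp add: derived_category_def wk_def)
qed

lemma Union_const: assumes "!!c. c : A ==> c = B" "A ~= {}" shows "\<Union> A = B" using assms by blast

text \<open>The composite is defined as a union over all completed squares. Each member is the class
  of the same weak map, and \<open>ore\<close> provides at least one member, so the union is that
  class; sums and multiples are treated alike.\<close>

lemma Cmp_D: assumes X: "X : Cpx" and Y: "Y : Cpx" and L: "L : Cpx" and a: "a : Wm X Y" and b: "b : Wm Y L"
 shows "Cmp DQ (wk Y L b) (wk X Y a) = wk X L (Wc b a)" proof -
 let ?ba = "Wc b a"
 note ba = wm_comp[OF X L a b]
 let ?A = "{roof_class Q X L (V, cmap_comp s u, cmap_comp g w) | V s u g w.
   EX Z f Z' t. (Z, s, f) : cl X Y a & (Z', t, g) : cl Y L b & V : Cpx &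
    u : chain_maps Q V Z & w : chain_maps Q V Z' & quasi_iso V Z u &
    homotopic Q V Y (cmap_comp f u) (cmap_comp t w)}"
 have "c = cl X L ?ba" if cA: "c : ?A" for c proof -
  obtain V s u g w Z f Z' t where h: "c = roof_class Q X L (V, cmap_comp s u, cmap_comp g w)"
   "(Z, s, f) : cl X Y a" "(Z', t, g) : cl Y L b" "V : Cpx" "u : chain_maps Q V Z" "w : chain_maps Q V Z'" "quasi_iso V Z u"
   "homotopic Q V Y (cmap_comp f u) (cmap_comp t w)" using cA by blast
  have R: "(Z, s, f) : roofs Q X Y" "(Z', t, g) : roofs Q Y L" "represents Y a Z (opc s) (opc f)" "represents L b Z' (opc t) (opc g)"
   using h(2,3) unfolding cl_def by blast+
  note o = roofs_oroof[OF X Y R(1)] and o' = roofs_oroof[OF Y L R(2)]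
  note m1 = cmap_mem[OF h(4) o(4) X h(5) o(2)] and m2 = cmap_mem[OF h(4) o'(4) L h(6) o'(3)]
  note m3 = cmap_mem[OF h(4) o(4) Y h(5) o(3)] and m4 = cmap_mem[OF h(4) o'(4) Y h(6) o'(2)]
  note ucm = opc_cm[OF h(4) o(4) h(5)] and wcm = opc_cm[OF h(4) o'(4) h(6)]
  have qs: "qiso Z X (opc s)" using o(1) unfolding oroof_def by blast
  have qu: "qiso V Z (opc u)" using h(7) qiso_iff[OF h(4) o(4) h(5)] by blast
  have "qiso V X (opc s \<cdot> opc u)" by (rule qiso_comp[OF h(4) o(4) X ucm qu opc_cm[OF o(4) X o(2)] qs])
  then have q: "quasi_iso V X (cmap_comp s u)" using qiso_iff[OF h(4) X m1(1)] m1(2) by simp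
  have r: "(V, cmap_comp s u, cmap_comp g w) : roofs Q X L" unfolding roofs_def using h(4) q m1(1) m2(1) by blast
  have sh: "shot V Y (opc f \<cdot> opc u) (opc t \<cdot> opc w)" using shot_iff[OF h(4) Y m3(1) m4(1)] h(8) m3(2) m4(2) by simp
  have 1: "Hot V L (strict (opc g \<cdot> opc w)) (Wc b (strict (opc t \<cdot> opc w)))"
   using hot_right[OF R(4)[unfolded represents_def] strict_wm[OF wcm]] by (simp only: strict_comp wc_assoc)
  have 2: "Hot V L (Wc b (strict (opc t \<cdot> opc w))) (Wc b (strict (opc f \<cdot> opc u)))" by (rule hot_left[OF hot_sym[OF shot_hot[OF sh]] b L])
  have "Hot V Y (strict (opc f \<cdot> opc u)) (Wc a (strict (opc s \<cdot> opc u)))"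
   using hot_right[OF R(3)[unfolded represents_def] strict_wm[OF ucm]] by (simp only: strict_comp wc_assoc)
  from hot_left[OF this b L]
  have 3: "Hot V L (Wc b (strict (opc f \<cdot> opc u))) (Wc ?ba (strict (opc s \<cdot> opc u)))" by (simp only: wc_assoc)
  have "represents L ?ba V (opc (cmap_comp s u)) (opc (cmap_comp g w))"
   unfolding represents_def m1(2) m2(2) by (rule hot_trans[OF 1 hot_trans[OF 2 3]])
  then have "(V, cmap_comp s u, cmap_comp g w) : cl X L ?ba" using r unfolding cl_def by blast
  from roof_class_cl[OF X L ba this] show ?thesis unfolding h(1) .
 qed
 moreover have "?A ~= {}" proof -
  obtain Z s f where Z: "oroof X Y Z s f" "(Z, mtc Z X s, mtc Z Y f) : cl X Y a" by (rule cl_nonempty[OF X Y a])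
  obtain Z' t g where Z': "oroof Y L Z' t g" "(Z', mtc Z' Y t, mtc Z' L g) : cl Y L b" by (rule cl_nonempty[OF Y L b])
  have c: "Z : Cpx" "f : cm Z Y" "Z' : Cpx" "t : cm Z' Y" "qiso Z' Y t" using Z(1) Z'(1) unfolding oroof_def by blast+
  obtain V u w where V: "V : Cpx" "u : cm V Z" "qiso V Z u" "w : cm V Z'" "shot V Y (f \<cdot> u) (t \<cdot> w)" by (rule ore[OF c(1,3) Y c(2,4,5)])
  note mu = mtc_chain[OF V(1) c(1) V(2)] and mw = mtc_chain[OF V(1) c(3) V(4)]
  note mf = mtc_chain[OF c(1) Y c(2)] and m_t = mtc_chain[OF c(3) Y c(4)]
  note m3 = cmap_mem[OF V(1) c(1) Y mu mf] and m4 = cmap_mem[OF V(1) c(3) Y mw m_t]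
  have "quasi_iso V Z (mtc V Z u)" using V(3) qiso_iff[OF V(1) c(1) mu] opc_mtc[OF V(2)] by simp
  moreover have "homotopic Q V Y (cmap_comp (mtc Z Y f) (mtc V Z u)) (cmap_comp (mtc Z' Y t) (mtc V Z' w))"
   using V(5) shot_iff[OF V(1) Y m3(1) m4(1)] unfolding m3(2) m4(2) opc_mtc[OF V(2)] opc_mtc[OF V(4)] opc_mtc[OF c(2)] opc_mtc[OF c(4)] by blast
  ultimately show ?thesis using Z(2) Z'(2) V(1) mu mw by blast
 qed
 ultimately have "\<Union> ?A = cl X L ?ba" by (rule Union_const)
 then show ?thesis by (simp add: derived_category_def wk_def)
qed

lemma Add_D: assumes X: "X : Cpx" and Y: "Y : Cpx" and a: "a : Wm X Y" and b: "b : Wm X Y" shows "Add DQ (wk X Y a) (wk X Y b) = wk X Y (wadd a b)"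
proof -
 let ?A = "{roof_class Q X Y (Z, s, %i v. f i v + g i v) | Z s f g. (Z, s, f) : cl X Y a & (Z, s, g) : cl X Y b}"
 have "c = cl X Y (wadd a b)" if cA: "c : ?A" for c proof -
  obtain Z s f g where h: "c = roof_class Q X Y (Z, s, %i v. f i v + g i v)" "(Z, s, f) : cl X Y a" "(Z, s, g) : cl X Y b" using cA by blast
  have R: "(Z, s, f) : roofs Q X Y" "(Z, s, g) : roofs Q X Y" "represents Y a Z (opc s) (opc f)" "represents Y b Z (opc s) (opc g)"
   using h(2,3) unfolding cl_def by blast+
  note o = roofs_oroof[OF X Y R(1)] and o' = roofs_oroof[OF X Y R(2)]
  note fc = opc_cm[OF o(4) Y o(3)] and gc = opc_cm[OF o(4) Y o'(3)]
  have sum: "opc (%i v. f i v + g i v) = (%i v. opc f i v + opc g i v)" unfolding opc_def by (simp add: op_plus[OF chainD[OF o(3)] chainD[OF o'(3)]])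
  have "(%i v. opc f i v + opc g i v) : cm Z Y" unfolding cm_def using cmD[OF fc] cmD[OF gc] by (auto simp: distrib_left distrib_right)
  from mtc_chain[OF o(4) Y this]
  have "(%i v. f i v + g i v) : chain_maps Q Z Y"
   unfolding sum[symmetric] unfolding mtc_def opc_def by (simp add: mt_op[OF add_carrier_mat[OF chainD[OF o'(3)]]])
  then have r: "(Z, s, %i v. f i v + g i v) : roofs Q X Y" using R(1) unfolding roofs_def by blast
  have "Hot Z Y (wadd (strict (opc f)) (strict (opc g))) (Wc (wadd a b) (strict (opc s)))"
   unfolding wc_wadd by (rule hot_wadd[OF R(3,4)[unfolded represents_def]])
  then have "represents Y (wadd a b) Z (opc s) (opc (%i v. f i v + g i v))" unfolding represents_def sum by (simp add: wadd_def strict_def)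
  then have "(Z, s, %i v. f i v + g i v) : cl X Y (wadd a b)" using r unfolding cl_def by blast
  from roof_class_cl[OF X Y wadd_wm[OF a b] this] show ?thesis unfolding h(1) .
 qed
 moreover have "?A ~= {}" proof -
  obtain Z s f where Z: "oroof X Y Z s f" "represents Y a Z s f" by (rule cl_nonempty[OF X Y a])
  have c: "Z : Cpx" "s : cm Z X" "qiso Z X s" "f : cm Z Y" using Z(1) unfolding oroof_def by blast+
  \<comment> \<open>A common denominator: the weak map \<open>b\<close> is pulled back along the
    denominator \<open>s\<close> of \<open>a\<close> and realised over \<open>Z\<close>, so both
    fractions live over \<open>V\<close> with denominator \<open>s\<close> after
    \<open>t\<close>.\<close>
  note bs = wm_comp[OF c(1) Y strict_wm[OF c(2)] b]
  obtain V t g where V: "oroof Z Y V t g" "represents Y (Wc b (strict s)) V t g" by (rule cl_nonempty[OF c(1) Y bs])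
  have d: "V : Cpx" "t : cm V Z" "qiso V Z t" "g : cm V Y" using V(1) unfolding oroof_def by blast+
  note st = cm_comp[OF d(2) c(2)] and q = qiso_comp[OF d(1) c(1) X d(2,3) c(2,3)]
  have o1: "oroof X Y V (s \<cdot> t) (f \<cdot> t)" unfolding oroof_def using d(1) st q cm_comp[OF d(2) c(4)] by blast
  have o2: "oroof X Y V (s \<cdot> t) g" unfolding oroof_def using d(1) st q d(4) by blast
  have r1: "represents Y a V (s \<cdot> t) (f \<cdot> t)" unfolding represents_def
   using hot_right[OF Z(2)[unfolded represents_def] strict_wm[OF d(2)]] by (simp only: strict_comp wc_assoc)
  have r2: "represents Y b V (s \<cdot> t) g" using V(2) unfolding represents_def by (simp only: strict_comp wc_assoc)
  show ?thesis using oroof_cl[OF X Y o1 r1] oroof_cl[OF X Y o2 r2] by blast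
 qed
 ultimately have "\<Union> ?A = cl X Y (wadd a b)" by (rule Union_const)
 then show ?thesis by (simp add: derived_category_def wk_def)
qed

lemma Scl_D: assumes X: "X : Cpx" and Y: "Y : Cpx" and w: "w : Wm X Y" shows "Scl DQ c (wk X Y w) = wk X Y (wscl c w)" proof -
 let ?A = "{roof_class Q X Y (Z, s, %i v. c \<cdot>\<^sub>m f i v) | Z s f. (Z, s, f) : cl X Y w}"
 have "d = cl X Y (wscl c w)" if cA: "d : ?A" for d proof -
  obtain Z s f where h: "d = roof_class Q X Y (Z, s, %i v. c \<cdot>\<^sub>m f i v)" "(Z, s, f) : cl X Y w" using cA by blast
  have R: "(Z, s, f) : roofs Q X Y" "represents Y w Z (opc s) (opc f)" using h(2) unfolding cl_def by blast+
  note o = roofs_oroof[OF X Y R(1)]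
  note fc = opc_cm[OF o(4) Y o(3)]
  have sc: "opc (%i v. c \<cdot>\<^sub>m f i v) = (%i v. sm c (opc f i v))" unfolding opc_def by (simp add: op_smult)
  have "(%i v. sm c (opc f i v)) : cm Z Y" unfolding cm_def using cmD[OF fc] by auto
  from mtc_chain[OF o(4) Y this]
  have "(%i v. c \<cdot>\<^sub>m f i v) : chain_maps Q Z Y"
   unfolding sc[symmetric] unfolding mtc_def opc_def by (simp add: mt_op[OF smult_carrier_mat[OF chainD[OF o(3)]]])
  then have r: "(Z, s, %i v. c \<cdot>\<^sub>m f i v) : roofs Q X Y" using R(1) unfolding roofs_def by blast
  have "Hot Z Y (wscl c (strict (opc f))) (Wc (wscl c w) (strict (opc s)))" unfolding wc_wscl by (rule hot_wscl[OF R(2)[unfolded represents_def]])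
  then have "represents Y (wscl c w) Z (opc s) (opc (%i v. c \<cdot>\<^sub>m f i v))" unfolding represents_def sc by (simp add: wscl_def strict_def)
  then have "(Z, s, %i v. c \<cdot>\<^sub>m f i v) : cl X Y (wscl c w)" using r unfolding cl_def by blast
  from roof_class_cl[OF X Y wscl_wm[OF w] this] show ?thesis unfolding h(1) .
 qed
 moreover have "?A ~= {}" proof -
  obtain Z s f where "(Z, mtc Z X s, mtc Z Y f) : cl X Y w" by (rule cl_nonempty[OF X Y w])
  then show ?thesis by blast
 qed
 ultimately have "\<Union> ?A = cl X Y (wscl c w)" by (rule Union_const)
 then show ?thesis by (simp add: derived_category_def wk_def)
qed

end

section \<open>Linear categories and automorphisms\<close>

locale precategory =
 fixes C :: "('o, 'm, 'k::field) lincat"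
begin

abbreviation cmp (infixr "**" 70) where "g ** f == Cmp C g f"

definition arr where "arr f X Y <-> X : Ob C & Y : Ob C & f : Hom C X Y"

lemma arr_ob: "arr f X Y ==> X : Ob C" "arr f X Y ==> Y : Ob C" unfolding arr_def by blast+

end

text \<open>This much supports isomorphism classes and the criterion \<open>indecI\<close>. It is
  the structure established for the orbit category, while the derived category is shown to satisfy
  \<open>linear_category\<close> as well.\<close>

locale zero_category = precategory C for C :: "('o, 'm, 'k::field) lincat" +
 assumes arr_cmp: "arr g Y Z ==> arr f X Y ==> arr (g ** f) X Z" and arr_id: "X : Ob C ==> arr (Idn C X) X X"
  and arr_zer: "X : Ob C ==> Y : Ob C ==> arr (Zer C X Y) X Y" and assoc: "arr h Z W ==> arr g Y Z ==> arr f X Y ==> (h ** g) ** f = h ** (g ** f)"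
  and id_arr: "arr f X Y ==> Idn C Y ** f = f" "arr f X Y ==> f ** Idn C X = f"
  and zer_arr: "arr f X Y ==> Z : Ob C ==> Zer C Y Z ** f = Zer C X Z" "arr f Y Z ==> X : Ob C ==> f ** Zer C X Y = Zer C X Z"
begin

lemma id_hom: "X : Ob C ==> Idn C X : Hom C X X" using arr_id unfolding arr_def by blast
lemma zer_hom: "X : Ob C ==> Y : Ob C ==> Zer C X Y : Hom C X Y" using arr_zer unfolding arr_def by blast

definition iso where
 "iso X Y <-> (EX f g. arr f X Y & arr g Y X & g ** f = Idn C X & f ** g = Idn C Y)"

lemma iso_obj_iff: "X : Ob C ==> Y : Ob C ==> iso_obj C X Y <-> iso X Y" unfolding iso_obj_def iso_def arr_def by blast

lemma iso_ob: assumes "iso X Y" shows "X : Ob C" "Y : Ob C" using assms unfolding iso_def arr_def by blast+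

lemma iso_refl: "X : Ob C ==> iso X X" unfolding iso_def using arr_id id_arr(1)[OF arr_id] by blast

lemma iso_sym: "iso X Y ==> iso Y X" unfolding iso_def by blast

lemma iso_trans: assumes "iso X Y" "iso Y Z" shows "iso X Z" proof -
 obtain f g where f: "arr f X Y" "arr g Y X" "g ** f = Idn C X" "f ** g = Idn C Y" using assms(1) unfolding iso_def by blast
 obtain f' g' where f': "arr f' Y Z" "arr g' Z Y" "g' ** f' = Idn C Y" "f' ** g' = Idn C Z" using assms(2) unfolding iso_def by blast
 have "(g ** g') ** (f' ** f) = g ** ((g' ** f') ** f)" by (simp only: assoc[OF f(2) f'(2) arr_cmp[OF f'(1) f(1)]] assoc[OF f'(2,1) f(1)])
 then have 1: "(g ** g') ** (f' ** f) = Idn C X" by (simp add: f' f id_arr(1)[OF f(1)])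
 have "(f' ** f) ** (g ** g') = f' ** ((f ** g) ** g')" by (simp only: assoc[OF f'(1) f(1) arr_cmp[OF f(2) f'(2)]] assoc[OF f(1,2) f'(2)])
 then have 2: "(f' ** f) ** (g ** g') = Idn C Z" by (simp add: f' f id_arr(1)[OF f'(2)])
 show ?thesis unfolding iso_def using arr_cmp[OF f'(1) f(1)] arr_cmp[OF f(2) f'(2)] 1 2 by blast
qed

lemma iso_class_eq: "X : Ob C ==> iso_class C X = {Y. iso X Y}" unfolding iso_class_def using iso_obj_iff iso_ob(2) by blast

lemma iso_class_eq_iff: assumes "X : Ob C" "Y : Ob C" shows "iso_class C X = iso_class C Y <-> iso X Y" proof
 assume "iso_class C X = iso_class C Y"
 then show "iso X Y" unfolding iso_class_eq[OF assms(1)] iso_class_eq[OF assms(2)] using iso_refl[OF assms(2)] by blast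
next
 assume i: "iso X Y"
 have "iso X Z <-> iso Y Z" for Z using iso_trans[OF i] iso_trans[OF iso_sym[OF i]] by blast
 then show "iso_class C X = iso_class C Y" unfolding iso_class_eq[OF assms(1)] iso_class_eq[OF assms(2)] by auto
qed

text \<open>In a decomposition, \<open>i ** p\<close> is idempotent. If it is zero then so is the
  identity of \<open>Y\<close>; if it is the identity of \<open>X\<close> then \<open>q\<close>
  equals \<open>q ** i ** p\<close>, which is zero, and \<open>Z\<close> is a zero object.\<close>

lemma indecI: assumes X: "X : Ob C" "Idn C X ~= Zer C X X" and e: "!!e. arr e X X ==> e ** e = e ==> e = Zer C X X \<or> e = Idn C X"
 shows "indecomposable C X" unfolding indecomposable_def proof (intro conjI ballI impI)
 show "X : Ob C" by (rule X(1))
 show "~ zero_obj C X" using X(2) unfolding zero_obj_def .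
 fix Y Z assume Y: "Y : Ob C" and Z: "Z : Ob C" and "is_direct_sum C X Y Z"
 then obtain i j p q where i: "arr i Y X" "arr j Z X" "arr p X Y" "arr q X Z" "p ** i = Idn C Y" "q ** j = Idn C Z" "q ** i = Zer C Y Z"
  unfolding is_direct_sum_def arr_def using X(1) by blast
 have ip: "arr (i ** p) X X" by (rule arr_cmp[OF i(1,3)])
 have "(i ** p) ** (i ** p) = i ** ((p ** i) ** p)" by (simp only: assoc[OF i(1,3) ip] assoc[OF i(3,1,3)])
 then have "(i ** p) ** (i ** p) = i ** p" by (simp add: i(5) id_arr[OF i(3)])
 from e[OF ip this] show "zero_obj C Y \<or> zero_obj C Z" proof
  assume z: "i ** p = Zer C X X"
  have "p ** ((i ** p) ** i) = (p ** i) ** (p ** i)" by (simp only: assoc[OF i(1,3,1)] assoc[OF i(3,1) arr_cmp[OF i(3,1)]])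
  then have "Idn C Y = p ** (Zer C X X ** i)" unfolding z by (simp add: i(5) id_arr[OF arr_id[OF Y]])
  then show ?thesis unfolding zero_obj_def using zer_arr(1)[OF i(1) X(1)] zer_arr(2)[OF i(3) Y] by simp
 next
  assume z: "i ** p = Idn C X"
  have "q = q ** (i ** p)" unfolding z using id_arr[OF i(4)] by simp
  also have "... = Zer C X Z" unfolding assoc[OF i(4,1,3), symmetric] i(7) using zer_arr(1)[OF i(3) Z] .
  finally have "Idn C Z = Zer C X Z ** j" using i(6) by simp
  then show ?thesis unfolding zero_obj_def using zer_arr(1)[OF i(2) Z] by simp
 qed
qed

end

locale linear_category = zero_category C for C :: "('o, 'm, 'k::field) lincat" +
 assumes arr_disjoint: "arr f X Y ==> arr f X' Y' ==> X = X' & Y = Y'" and arr_add: "arr f X Y ==> arr g X Y ==> arr (Add C f g) X Y"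
  and arr_scl: "arr f X Y ==> arr (Scl C a f) X Y"
  and add_assoc: "arr f X Y ==> arr g X Y ==> arr h X Y ==> Add C (Add C f g) h = Add C f (Add C g h)"
  and add_comm: "arr f X Y ==> arr g X Y ==> Add C f g = Add C g f" and add_zer: "arr f X Y ==> Add C (Zer C X Y) f = f"
  and scl_simps: "arr f X Y ==> Scl C 0 f = Zer C X Y" "arr f X Y ==> Scl C 1 f = f" "arr f X Y ==> Scl C a (Scl C b f) = Scl C (a*b) f"
  and scl_add: "arr f X Y ==> Scl C (a + b) f = Add C (Scl C a f) (Scl C b f)"
  and arr_cmp_add: "arr g Y Z ==> arr f X Y ==> arr f' X Y ==> g ** Add C f f' = Add C (g ** f) (g ** f')"
   "arr g Y Z ==> arr g' Y Z ==> arr f X Y ==> Add C g g' ** f = Add C (g ** f) (g' ** f)"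
  and arr_cmp_scl: "arr g Y Z ==> arr f X Y ==> g ** Scl C a f = Scl C a (g ** f)" "arr g Y Z ==> arr f X Y ==> Scl C a g ** f = Scl C a (g ** f)"
begin

lemma arr_scl_zer: "X : Ob C ==> Y : Ob C ==> Scl C a (Zer C X Y) = Zer C X Y" using scl_simps(1,3)[OF arr_zer, of X Y] by (metis mult_zero_right)
lemma scl_eq_zer: assumes "arr f X Y" "Scl C a f = Zer C X Y" "a ~= 0" shows "f = Zer C X Y" proof -
 have "f = Scl C (inverse a) (Scl C a f)" using scl_simps(2,3)[OF assms(1)] assms(3) by simp
 then show ?thesis unfolding assms(2) using arr_scl_zer arr_ob[OF assms(1)] by simp
qed
lemma scl_eq_scl: assumes "arr f X Y" "Scl C a f = Scl C b f" "a ~= b" shows "f = Zer C X Y" proof (rule scl_eq_zer[OF assms(1)])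
 have "Scl C (a - b) f = Add C (Scl C a f) (Scl C (- b) f)" using scl_add[OF assms(1), of a "- b"] by simp
 also have "... = Scl C (b + - b) f" unfolding assms(2) using scl_add[OF assms(1), of b "- b"] by simp
 also have "... = Zer C X Y" using scl_simps(1)[OF assms(1)] by simp
 finally show "Scl C (a - b) f = Zer C X Y" .
qed (use assms(3) in simp)

lemma indecomposable_iso: assumes "iso X Y" "indecomposable C X" shows "indecomposable C Y" proof -
 note XY = iso_ob[OF assms(1)]
 obtain f g where f: "arr f X Y" "arr g Y X" "g ** f = Idn C X" "f ** g = Idn C Y" using assms(1) unfolding iso_def by blast
 show ?thesis unfolding indecomposable_def proof (intro conjI ballI impI)
  show "Y : Ob C" by (rule XY)
  have "Idn C X = Zer C X X" if "Idn C Y = Zer C Y Y" proof -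
   have "Idn C X = g ** (Idn C Y ** f)" unfolding id_arr[OF f(1)] f(3) ..
   then show ?thesis unfolding that using zer_arr(1)[OF f(1) XY(2)] zer_arr(2)[OF f(2) XY(1)] by simp
  qed
  then show "~ zero_obj C Y" using assms(2) unfolding indecomposable_def zero_obj_def by blast
  fix A B assume AB: "A : Ob C" "B : Ob C" "is_direct_sum C Y A B"
  then obtain i j p q where i: "arr i A Y" "arr j B Y" "arr p Y A" "arr q Y B"
   "p ** i = Idn C A" "q ** j = Idn C B" "q ** i = Zer C A B" "p ** j = Zer C B A" "Add C (i ** p) (j ** q) = Idn C Y"
   unfolding is_direct_sum_def arr_def using XY by blast
  note m = arr_cmp[OF f(2) i(1)] arr_cmp[OF f(2) i(2)] arr_cmp[OF i(3) f(1)] arr_cmp[OF i(4) f(1)]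
  have c: "(u ** f) ** (g ** v) = u ** v" if "arr u Y A'" "arr v B' Y" for u v A' B'
   unfolding assoc[OF that(1) f(1) arr_cmp[OF f(2) that(2)]] assoc[OF f(1,2) that(2), symmetric] f(4) id_arr(1)[OF that(2)] ..
  have d: "(g ** v) ** (u ** f) = g ** ((v ** u) ** f)" if "arr u Y A'" "arr v A' Y" for u v A'
   unfolding assoc[OF f(2) that(2) arr_cmp[OF that(1) f(1)]] assoc[OF that(2,1) f(1)] ..
  have "Add C ((g ** i) ** (p ** f)) ((g ** j) ** (q ** f)) = g ** (Add C (i ** p) (j ** q) ** f)"
   unfolding d[OF i(3,1)] d[OF i(4,2)] arr_cmp_add(2)[OF arr_cmp[OF i(1,3)] arr_cmp[OF i(2,4)] f(1)]
   by (rule arr_cmp_add(1)[symmetric, OF f(2) arr_cmp[OF arr_cmp[OF i(1,3)] f(1)] arr_cmp[OF arr_cmp[OF i(2,4)] f(1)]])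
  then have "Add C ((g ** i) ** (p ** f)) ((g ** j) ** (q ** f)) = Idn C X" unfolding i(9) id_arr(1)[OF f(1)] f(3) .
  then have "is_direct_sum C X A B" unfolding is_direct_sum_def
   using m c[OF i(3,1)] c[OF i(4,2)] c[OF i(4,1)] c[OF i(3,2)] i(5-8) unfolding arr_def by metis
  then show "zero_obj C A \<or> zero_obj C B" using assms(2) AB unfolding indecomposable_def by blast
 qed
qed

definition brick where
 "brick X <-> X : Ob C & Idn C X ~= Zer C X X & (ALL f. arr f X X --> (EX c. f = Scl C c (Idn C X)))"

lemma brickD: assumes "brick X" shows "X : Ob C" "Idn C X ~= Zer C X X" "arr (Idn C X) X X" using assms arr_id unfolding brick_def by blast+

lemma brick_scalar: assumes "brick X" "arr f X X" obtains c where "f = Scl C c (Idn C X)" using assms unfolding brick_def by blast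

lemma brick_scl_inject: assumes "brick X" "Scl C a (Idn C X) = Scl C b (Idn C X)" shows "a = b"
 using scl_eq_scl[OF brickD(3)[OF assms(1)] assms(2)] brickD(2)[OF assms(1)] by blast

lemma brick_indecomposable: assumes "brick X" shows "indecomposable C X" proof (rule indecI)
 note X = brickD[OF assms]
 show "X : Ob C" "Idn C X ~= Zer C X X" by (rule X)+
 fix e assume e: "arr e X X" "e ** e = e"
 obtain c where c: "e = Scl C c (Idn C X)" by (rule brick_scalar[OF assms e(1)])
 have "e ** e = Scl C c e" using arr_cmp_scl(2)[OF X(3) e(1), of c] id_arr(1)[OF e(1)] c by simp
 then have "Scl C (c*c) (Idn C X) = Scl C c (Idn C X)" using e(2) scl_simps(3)[OF X(3)] c by simp
 from brick_scl_inject[OF assms this] have "c = 0 \<or> c = 1" by simp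
 then show "e = Zer C X X \<or> e = Idn C X" using c scl_simps(1,2)[OF X(3)] by auto
qed

text \<open>Both composites are scalars, and evaluating f g f in two ways shows that the scalars
  agree. One nonzero composite therefore makes \<open>f\<close> invertible.\<close>

lemma brick_retract: assumes X: "brick X" and Y: "brick Y" and f: "arr f X Y" and g: "arr g Y X" and nz: "g ** f ~= Zer C X X" shows "iso X Y" proof -
 obtain c where c: "g ** f = Scl C c (Idn C X)" by (rule brick_scalar[OF X arr_cmp[OF g f]])
 obtain d where d: "f ** g = Scl C d (Idn C Y)" by (rule brick_scalar[OF Y arr_cmp[OF f g]])
 note iX = brickD(3)[OF X] and iY = brickD(3)[OF Y]
 have "c ~= 0" using nz c scl_simps(1)[OF iX] by auto
 have "Scl C c f = (f ** g) ** f" unfolding assoc[OF f g f] c using arr_cmp_scl(1)[OF f iX] id_arr(2)[OF f] by simp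
 also have "... = Scl C d f" unfolding d using arr_cmp_scl(2)[OF iY f] id_arr(1)[OF f] by simp
 finally have cd: "Scl C c f = Scl C d f" .
 have "f ~= Zer C X Y" using nz zer_arr(2)[OF g brickD(1)[OF X]] by blast
 then have "c = d" using scl_eq_scl[OF f cd] by blast
 let ?g = "Scl C (inverse c) g"
 have "?g ** f = Idn C X" "f ** ?g = Idn C Y"
  using arr_cmp_scl(2)[OF g f] arr_cmp_scl(1)[OF f g] c d \<open>c = d\<close> \<open>c ~= 0\<close> scl_simps(2,3)[OF iX] scl_simps(2,3)[OF iY] by simp_all
 then show ?thesis unfolding iso_def using f arr_scl[OF g] by blast
qed

lemma brick_iso: assumes X: "brick X" and iso: "iso X Y" shows "brick Y" proof -
 obtain f g where f: "arr f X Y" "arr g Y X" "g ** f = Idn C X" "f ** g = Idn C Y" using iso unfolding iso_def by blast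
 note XY = iso_ob[OF iso] and iX = brickD(3)[OF X]
 show ?thesis unfolding brick_def proof (intro conjI allI impI)
  show "Y : Ob C" by (rule XY)
  show "Idn C Y ~= Zer C Y Y" proof
   assume z: "Idn C Y = Zer C Y Y"
   have "Idn C X = g ** (Idn C Y ** f)" unfolding id_arr[OF f(1)] f(3) ..
   then have "Idn C X = Zer C X X" unfolding z using zer_arr(1)[OF f(1) XY(2)] zer_arr(2)[OF f(2) XY(1)] by simp
   then show False using brickD(2)[OF X] by blast
  qed
  fix e assume e: "arr e Y Y"
  obtain c where c: "g ** (e ** f) = Scl C c (Idn C X)" by (rule brick_scalar[OF X arr_cmp[OF f(2) arr_cmp[OF e f(1)]]])
  have "e = (f ** g) ** (e ** (f ** g))" unfolding f(4) id_arr[OF e] ..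
  also have "... = f ** (g ** ((e ** f) ** g))" unfolding assoc[OF e f(1,2)] assoc[OF f(1,2) arr_cmp[OF e arr_cmp[OF f(1,2)]]] ..
  also have "... = f ** (Scl C c (Idn C X) ** g)" unfolding c[symmetric] assoc[OF f(2) arr_cmp[OF e f(1)] f(2)] ..
  also have "... = Scl C c (Idn C Y)" using arr_cmp_scl(2)[OF iX f(2)] id_arr(1)[OF f(2)] arr_cmp_scl(1)[OF f(1,2)] f(4) by simp
  finally show "EX c. e = Scl C c (Idn C Y)" by blast
 qed
qed

definition lauto :: "('o => 'o) => ('m => 'm) => bool" where
 "lauto F G <-> linear_automorphism C (F, G)"

lemma lautoI: assumes "bij_betw F (Ob C) (Ob C)" "!!X. X : Ob C ==> G (Idn C X) = Idn C (F X)"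
  "!!X Y. X : Ob C ==> Y : Ob C ==> bij_betw G (Hom C X Y) (Hom C (F X) (F Y))" "!!X Y Z f g. arr f X Y ==> arr g Y Z ==> G (g ** f) = G g ** G f"
  "!!X Y f g. arr f X Y ==> arr g X Y ==> G (Add C f g) = Add C (G f) (G g)" "!!X Y f a. arr f X Y ==> G (Scl C a f) = Scl C a (G f)"
 shows "lauto F G" unfolding lauto_def linear_automorphism_def fst_conv snd_conv using assms unfolding arr_def by blast

lemma lautoD: assumes "lauto F G" shows "bij_betw F (Ob C) (Ob C)" "X : Ob C ==> G (Idn C X) = Idn C (F X)"
  "X : Ob C ==> Y : Ob C ==> bij_betw G (Hom C X Y) (Hom C (F X) (F Y))" "arr f X Y ==> arr g Y Z ==> G (g ** f) = G g ** G f"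
  "arr f X Y ==> arr f' X Y ==> G (Add C f f') = Add C (G f) (G f')" "arr f X Y ==> G (Scl C a f) = Scl C a (G f)"
  "X : Ob C ==> F X : Ob C" "arr f X Y ==> arr (G f) (F X) (F Y)" "X : Ob C ==> Y : Ob C ==> G (Zer C X Y) = Zer C (F X) (F Y)" proof -
 note h = assms[unfolded lauto_def linear_automorphism_def fst_conv snd_conv]
 show 1: "bij_betw F (Ob C) (Ob C)" and "X : Ob C ==> G (Idn C X) = Idn C (F X)"
  and 3: "X : Ob C ==> Y : Ob C ==> bij_betw G (Hom C X Y) (Hom C (F X) (F Y))" for X Y using h by blast+
 show "arr f X Y ==> arr g Y Z ==> G (g ** f) = G g ** G f" using h unfolding arr_def by blast
 show "arr f X Y ==> arr f' X Y ==> G (Add C f f') = Add C (G f) (G f')" using h unfolding arr_def by blast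
 show s: "arr f X Y ==> G (Scl C a f) = Scl C a (G f)" for f X Y a using h unfolding arr_def by blast
 show F: "X : Ob C ==> F X : Ob C" for X using bij_betwE[OF 1] by blast
 show m: "arr f X Y ==> arr (G f) (F X) (F Y)" for f X Y using bij_betwE[OF 3] F unfolding arr_def by blast
 show "G (Zer C X Y) = Zer C (F X) (F Y)" if XY: "X : Ob C" "Y : Ob C" proof -
  note z = arr_zer[OF XY]
  have "G (Zer C X Y) = G (Scl C 0 (Zer C X Y))" using scl_simps(1)[OF z] by simp
  also have "... = Scl C 0 (G (Zer C X Y))" by (rule s[OF z])
  also have "... = Zer C (F X) (F Y)" by (rule scl_simps(1)[OF m[OF z]])
  finally show ?thesis .
 qed
qed

lemma all_mors_arr: "f : all_mors C <-> (EX X Y. arr f X Y)" unfolding all_mors_def arr_def by blast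

text \<open>Disjointness of Hom sets upgrades bijectivity on each Hom set to bijectivity on all
  morphisms, and this is the map that negative powers invert.\<close>

lemma lauto_mors: assumes "lauto F G" shows "bij_betw G (all_mors C) (all_mors C)" proof (rule bij_betwI')
 fix f g assume "f : all_mors C" "g : all_mors C"
 then obtain X Y X' Y' where f: "arr f X Y" and g: "arr g X' Y'" unfolding all_mors_arr by blast
 show "G f = G g <-> f = g" proof
  assume eq: "G f = G g"
  have "F X = F X' & F Y = F Y'" using arr_disjoint[OF lautoD(8)[OF assms f]] lautoD(8)[OF assms g] eq by simp
  then have "X = X' & Y = Y'" using bij_betw_imp_inj_on[OF lautoD(1)[OF assms]] arr_ob[OF f] arr_ob[OF g] unfolding inj_on_def by blast
  then show "f = g" using bij_betw_imp_inj_on[OF lautoD(3)[OF assms arr_ob[OF f]]] f g eq unfolding inj_on_def arr_def by blast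
 qed simp
next
 fix f assume "f : all_mors C" then show "G f : all_mors C" unfolding all_mors_arr using lautoD(8)[OF assms] by blast
next
 fix g assume "g : all_mors C"
 then obtain X' Y' where g: "arr g X' Y'" unfolding all_mors_arr by blast
 obtain X where X: "X : Ob C" "X' = F X" using bij_betw_imp_surj_on[OF lautoD(1)[OF assms]] arr_ob(1)[OF g] by blast
 obtain Y where Y: "Y : Ob C" "Y' = F Y" using bij_betw_imp_surj_on[OF lautoD(1)[OF assms]] arr_ob(2)[OF g] by blast
 have "g : G ` Hom C X Y" using bij_betw_imp_surj_on[OF lautoD(3)[OF assms X(1) Y(1)]] g X(2) Y(2) unfolding arr_def by blast
 then show "EX f:all_mors C. g = G f" using X(1) Y(1) unfolding all_mors_def by blast
qed

lemma lauto_reflect: assumes "lauto F G" "f : all_mors C" "X : Ob C" "Y : Ob C" "arr (G f) (F X) (F Y)" shows "arr f X Y" proof -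
 obtain X' Y' where f: "arr f X' Y'" using assms(2) unfolding all_mors_arr by blast
 have "F X = F X' & F Y = F Y'" using arr_disjoint[OF assms(5) lautoD(8)[OF assms(1) f]] .
 then have "X = X' & Y = Y'" using bij_betw_imp_inj_on[OF lautoD(1)[OF assms(1)]] arr_ob[OF f] assms(3,4) unfolding inj_on_def by blast
 then show ?thesis using f by simp
qed

lemma lauto_id: "lauto (%X. X) (%f. f)" by (rule lautoI) (simp_all add: bij_betw_def)

lemma lauto_comp: assumes F: "lauto F G" and F': "lauto F' G'" shows "lauto (F \<circ> F') (G \<circ> G')" proof (rule lautoI)
 show "bij_betw (F \<circ> F') (Ob C) (Ob C)" by (rule bij_betw_trans[OF lautoD(1)[OF F'] lautoD(1)[OF F]])
 show "bij_betw (G \<circ> G') (Hom C X Y) (Hom C ((F \<circ> F') X) ((F \<circ> F') Y))" if "X : Ob C" "Y : Ob C" for X Y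
  using bij_betw_trans[OF lautoD(3)[OF F' that] lautoD(3)[OF F lautoD(7)[OF F' that(1)] lautoD(7)[OF F' that(2)]]] by (simp add: comp_def)
qed (simp_all add: lautoD(2)[OF F] lautoD(2)[OF F'] lautoD(7)[OF F'] lautoD(4)[OF F'] lautoD(4)[OF F lautoD(8)[OF F'] lautoD(8)[OF F']]
 lautoD(5)[OF F'] lautoD(5)[OF F lautoD(8)[OF F'] lautoD(8)[OF F']] lautoD(6)[OF F'] lautoD(6)[OF F lautoD(8)[OF F']])

lemma lauto_cong: assumes F: "lauto F G" and "!!X. X : Ob C ==> F' X = F X" "!!f. f : all_mors C ==> G' f = G f" shows "lauto F' G'"
proof (rule lautoI)
 have G: "G' f = G f" if "arr f X Y" for f X Y using assms(3) that all_mors_arr by blast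
 show "bij_betw F' (Ob C) (Ob C)" using lautoD(1)[OF F] bij_betw_cong[of "Ob C" F' F] assms(2) by blast
 show "bij_betw G' (Hom C X Y) (Hom C (F' X) (F' Y))" if "X : Ob C" "Y : Ob C" for X Y
  using lautoD(3)[OF F that] bij_betw_cong[of "Hom C X Y" G' G] G that unfolding arr_def by (simp add: assms(2))
 show "G' (Idn C X) = Idn C (F' X)" if "X : Ob C" for X using G[OF arr_id[OF that]] lautoD(2)[OF F that] assms(2)[OF that] by simp
 show "G' (g ** f) = G' g ** G' f" if "arr f X Y" "arr g Y Z" for X Y Z f g
  using G[OF that(1)] G[OF that(2)] G[OF arr_cmp[OF that(2,1)]] lautoD(4)[OF F that] by simp
 show "G' (Add C f g) = Add C (G' f) (G' g)" if "arr f X Y" "arr g X Y" for X Y f g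
  using G[OF that(1)] G[OF that(2)] G[OF arr_add[OF that]] lautoD(5)[OF F that] by simp
 show "G' (Scl C a f) = Scl C a (G' f)" if "arr f X Y" for X Y f a using G[OF that] G[OF arr_scl[OF that]] lautoD(6)[OF F that] by simp
qed

lemma lauto_inv: assumes F: "lauto F G" shows "lauto (inv_into (Ob C) F) (inv_into (all_mors C) G)" proof (rule lautoI)
 let ?F = "inv_into (Ob C) F" and ?G = "inv_into (all_mors C) G"
 note bF = lautoD(1)[OF F] and bG = lauto_mors[OF F]
 have FF: "F (?F X) = X" "?F X : Ob C" if "X : Ob C" for X
  using bij_betw_inv_into_right[OF bF that] bij_betwE[OF bij_betw_inv_into[OF bF]] that by blast+
 have GG: "G (?G f) = f" "?G f : all_mors C" if "f : all_mors C" for f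
  using bij_betw_inv_into_right[OF bG that] bij_betwE[OF bij_betw_inv_into[OF bG]] that by blast+
 have Gi: "?G (G f) = f" if "f : all_mors C" for f by (rule bij_betw_inv_into_left[OF bG that])
 have a: "f : all_mors C" if "arr f X Y" for f X Y using that all_mors_arr by blast
 have aG: "arr (?G f) (?F X) (?F Y)" if "arr f X Y" for f X Y
  by (rule lauto_reflect[OF F GG(2)[OF a[OF that]] FF(2)[OF arr_ob(1)[OF that]] FF(2)[OF arr_ob(2)[OF that]]])
   (simp add: FF arr_ob[OF that] GG(1)[OF a[OF that]] that)
 have eq: "?G x = y" if "arr y X Y" "G y = x" for x y X Y using Gi[OF a[OF that(1)]] that(2) by simp
 show "bij_betw ?F (Ob C) (Ob C)" by (rule bij_betw_inv_into[OF bF])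
 show "?G (Idn C X) = Idn C (?F X)" if "X : Ob C" for X by (rule eq[OF arr_id[OF FF(2)[OF that]]]) (simp add: lautoD(2)[OF F] FF that)
 show "?G (g ** f) = ?G g ** ?G f" if "arr f X Y" "arr g Y Z" for X Y Z f g
  by (rule eq[OF arr_cmp[OF aG[OF that(2)] aG[OF that(1)]]]) (simp add: lautoD(4)[OF F aG[OF that(1)] aG[OF that(2)]] GG a[OF that(1)] a[OF that(2)])
 show "?G (Add C f g) = Add C (?G f) (?G g)" if "arr f X Y" "arr g X Y" for X Y f g
  by (rule eq[OF arr_add[OF aG[OF that(1)] aG[OF that(2)]]]) (simp add: lautoD(5)[OF F aG[OF that(1)] aG[OF that(2)]] GG a[OF that(1)] a[OF that(2)])
 show "?G (Scl C b f) = Scl C b (?G f)" if "arr f X Y" for X Y f b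
  by (rule eq[OF arr_scl[OF aG[OF that]]]) (simp add: lautoD(6)[OF F aG[OF that]] GG a[OF that])
 show "bij_betw ?G (Hom C X Y) (Hom C (?F X) (?F Y))" if XY: "X : Ob C" "Y : Ob C" for X Y proof (rule bij_betwI[of _ _ _ G])
  show "?G : Hom C X Y \<rightarrow> Hom C (?F X) (?F Y)" using aG XY unfolding arr_def by blast
  show "G : Hom C (?F X) (?F Y) \<rightarrow> Hom C X Y" using lautoD(8)[OF F, of _ "?F X" "?F Y"] FF XY unfolding arr_def by auto
  show "G (?G f) = f" if "f : Hom C X Y" for f using GG a that XY unfolding arr_def by blast
  show "?G (G f) = f" if "f : Hom C (?F X) (?F Y)" for f using Gi a that FF XY unfolding arr_def by blast
 qed
qed

lemma lauto_iso: assumes F: "lauto F G" and "iso X Y" shows "iso (F X) (F Y)" proof -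
 obtain f g where f: "arr f X Y" "arr g Y X" "g ** f = Idn C X" "f ** g = Idn C Y" using assms(2) unfolding iso_def by blast
 have "G g ** G f = Idn C (F X)" "G f ** G g = Idn C (F Y)"
  using lautoD(4)[OF F f(1,2)] lautoD(4)[OF F f(2,1)] f(3,4) lautoD(2)[OF F] arr_ob[OF f(1)] by simp_all
 then show ?thesis unfolding iso_def using lautoD(8)[OF F f(1)] lautoD(8)[OF F f(2)] by blast
qed

lemma lauto_brick: assumes F: "lauto F G" and X: "brick X" shows "brick (F X)" unfolding brick_def proof (intro conjI allI impI)
 note bX = brickD[OF X]
 show FX: "F X : Ob C" by (rule lautoD(7)[OF F bX(1)])
 note bij = lautoD(3)[OF F bX(1,1)]
 show "Idn C (F X) ~= Zer C (F X) (F X)" proof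
  assume "Idn C (F X) = Zer C (F X) (F X)"
  then have "G (Idn C X) = G (Zer C X X)" using lautoD(2)[OF F bX(1)] lautoD(9)[OF F bX(1,1)] by simp
  then show False using bij_betw_imp_inj_on[OF bij] bX(2) id_hom[OF bX(1)] zer_hom[OF bX(1,1)] unfolding inj_on_def by blast
 qed
 fix f assume f: "arr f (F X) (F X)"
 obtain g where g: "arr g X X" "f = G g" using bij_betw_imp_surj_on[OF bij] f bX(1) unfolding arr_def by blast
 obtain c where "g = Scl C c (Idn C X)" by (rule brick_scalar[OF X g(1)])
 then have "f = Scl C c (Idn C (F X))" using g(2) lautoD(6)[OF F bX(3)] lautoD(2)[OF F bX(1)] by simp
 then show "EX c. f = Scl C c (Idn C (F X))" by blast
qed

end

section \<open>Integer powers of automorphisms\<close>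

lemma int_iter_mem: assumes "bij_betw g A A" "x : A" shows "int_iter A g i x : A" proof -
 have "(g ^^ n) x : A" if "bij_betw g A A" for n g by (induction n) (use assms(2) bij_betwE[OF that] in auto)
 then show ?thesis unfolding int_iter_def using assms(1) bij_betw_inv_into[OF assms(1)] by auto
qed

lemma int_iter_succ: assumes b: "bij_betw g A A" and x: "x : A" shows "int_iter A g (i+1) x = g (int_iter A g i x)" proof (cases "i >= 0")
 case True
 then have "nat (i+1) = Suc (nat i)" by simp
 then show ?thesis using True unfolding int_iter_def by simp
next
 case False
 then have s: "nat (- i) = Suc (nat (- (i+1)))" by simp
 have m: "(inv_into A g ^^ n) x : A" for n by (induction n) (use x bij_betwE[OF bij_betw_inv_into[OF b]] in auto)
 have "int_iter A g (i+1) x = (inv_into A g ^^ nat (- (i+1))) x" proof (cases "i = -1")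
  case True then show ?thesis by (simp add: int_iter_def)
 next
  case False' : False
  have "~ i + 1 >= 0" using False False' by simp
  then show ?thesis by (simp only: int_iter_def if_False)
 qed
 moreover have "g (int_iter A g i x) = g (inv_into A g ((inv_into A g ^^ nat (- (i+1))) x))" using False s by (simp add: int_iter_def)
 ultimately show ?thesis using bij_betw_inv_into_right[OF b m] by simp
qed

lemma int_iter_pred: assumes b: "bij_betw g A A" and x: "x : A" shows "int_iter A g (i-1) x = inv_into A g (int_iter A g i x)"
 using int_iter_succ[OF assms, of "i - 1"] bij_betw_inv_into_left[OF b int_iter_mem[OF assms]] by simp

lemma int_iter_add: assumes b: "bij_betw g A A" and x: "x : A" shows "int_iter A g (i + j) x = int_iter A g i (int_iter A g j x)"
proof (induction i rule: int_induct[where k = 0])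
 case base show ?case by (simp add: int_iter_def)
next
 case (step1 i)
 have "int_iter A g (i + 1 + j) x = g (int_iter A g (i + j) x)" using int_iter_succ[OF assms, of "i + j"] by (simp add: algebra_simps)
 then show ?case using step1.IH int_iter_succ[OF b int_iter_mem[OF assms]] by simp
next
 case (step2 i)
 have "int_iter A g (i - 1 + j) x = inv_into A g (int_iter A g (i + j) x)" using int_iter_pred[OF assms, of "i + j"] by (simp add: algebra_simps)
 then show ?case using step2.IH int_iter_pred[OF b int_iter_mem[OF assms]] by simp
qed

lemma int_iter_0 [simp]: "int_iter A g 0 x = x" by (simp add: int_iter_def)
lemma int_iter_1 [simp]: "int_iter A g 1 x = g x" by (simp add: int_iter_def)

context linear_category begin

lemma lauto_pow: assumes F: "lauto F G" shows "lauto (obj_pow C (F, G) i) (mor_pow C (F, G) i)" proof (induction i rule: int_induct[where k = 0])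
 case base
 show ?case by (rule lauto_cong[OF lauto_id]) (simp_all add: obj_pow_def mor_pow_def)
next
 case (step1 i)
 show ?case by (rule lauto_cong[OF lauto_comp[OF F step1.IH]])
  (simp_all add: obj_pow_def mor_pow_def int_iter_succ[OF lautoD(1)[OF F]] int_iter_succ[OF lauto_mors[OF F]])
next
 case (step2 i)
 show ?case by (rule lauto_cong[OF lauto_comp[OF lauto_inv[OF F] step2.IH]])
  (simp_all add: obj_pow_def mor_pow_def int_iter_pred[OF lautoD(1)[OF F]] int_iter_pred[OF lauto_mors[OF F]])
qed

end

section \<open>Orbit categories\<close>

lemma (in comm_monoid) finprod_swap: assumes "finite A" "!!i j. i : A ==> j : B ==> f i j : carrier G"
 shows "finprod G (%i. finprod G (f i) B) A = finprod G (%j. finprod G (%i. f i j) A) B" using assms proof (induction A rule: finite_induct)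
 case (insert a A)
 have c: "finprod G (f i) B : carrier G" if "i : insert a A" for i using insert.prems[OF that] by (intro finprod_closed) auto
 have "finprod G (%i. finprod G (f i) B) (insert a A) = finprod G (f a) B \<otimes> finprod G (%j. finprod G (%i. f i j) A) B"
  using insert.IH insert.prems insert.hyps c by (subst finprod_insert) auto
 also have "... = finprod G (%j. f a j \<otimes> finprod G (%i. f i j) A) B"
  using insert.prems by (intro finprod_multf[symmetric]) (auto intro!: finprod_closed)
 also have "... = finprod G (%j. finprod G (%i. f i j) (insert a A)) B"
  using insert.prems insert.hyps by (intro finprod_cong') (auto intro!: finprod_closed)
 finally show ?case .
qed simp

context linear_category begin

abbreviation osum :: "'o => 'o => (int => 'm) => int set => 'm" where "osum X Y f A == finprod (hom_monoid C X Y) f A"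

lemma hom_monoid_simps [simp]: "carrier (hom_monoid C X Y) = Hom C X Y" "monoid.mult (hom_monoid C X Y) = Add C" "one (hom_monoid C X Y) = Zer C X Y"
 by (simp_all add: hom_monoid_def)

lemma hom_cm: assumes "X : Ob C" "Y : Ob C" shows "comm_monoid (hom_monoid C X Y)" proof -
 have a: "f : Hom C X Y <-> arr f X Y" for f using assms unfolding arr_def by blast
 show ?thesis by (rule comm_monoidI) (auto simp: a arr_add arr_zer assms add_zer intro: add_assoc add_comm)
qed

lemma osum_arr: "X : Ob C ==> Y : Ob C ==> (!!i. i : A ==> arr (f i) X Y) ==> arr (osum X Y f A) X Y"
 using comm_monoid.finprod_closed[OF hom_cm, of X Y f A] unfolding arr_def by (simp add: Pi_iff)

lemma osum_cong: "X : Ob C ==> Y : Ob C ==> (!!i. i : A ==> arr (f i) X Y) ==> (!!i. i : A ==> f i = g i) ==> osum X Y f A = osum X Y g A"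
 by (rule comm_monoid.finprod_cong'[OF hom_cm]) (simp_all add: Pi_iff arr_def)

lemma osum_empty: "X : Ob C ==> Y : Ob C ==> osum X Y f {} = Zer C X Y" using comm_monoid.finprod_empty[OF hom_cm] by simp

lemma osum_insert: "X : Ob C ==> Y : Ob C ==> finite A ==> a ~: A ==> (!!i. i : insert a A ==> arr (f i) X Y) ==>
  osum X Y f (insert a A) = Add C (f a) (osum X Y f A)"
 using comm_monoid.finprod_insert[OF hom_cm, of X Y A a f] unfolding arr_def by (simp add: Pi_iff)

lemma osum_mono: "X : Ob C ==> Y : Ob C ==> finite B ==> A <= B ==> (!!i. i : B ==> arr (f i) X Y) ==> (!!i. i : B - A ==> f i = Zer C X Y) ==>
  osum X Y f A = osum X Y f B" by (rule comm_monoid.finprod_mono_neutral_cong_left[OF hom_cm]) (simp_all add: Pi_iff arr_def)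

lemma osum_single: assumes "X : Ob C" "Y : Ob C" "finite A" "a : A" "!!i. i : A ==> arr (f i) X Y" "!!i. i : A ==> i ~= a ==> f i = Zer C X Y"
 shows "osum X Y f A = f a" proof -
 have "osum X Y f {a} = osum X Y f A" by (rule osum_mono[OF assms(1-3)]) (use assms(4-6) in auto)
 moreover have "osum X Y f {a} = Add C (f a) (osum X Y f {})" by (rule osum_insert[OF assms(1,2)]) (use assms(4,5) in auto)
 moreover have "... = f a"
  using add_comm[OF arr_zer[OF assms(1,2)] assms(5)[OF assms(4)]] add_zer[OF assms(5)[OF assms(4)]] osum_empty[OF assms(1,2)] by simp
 ultimately show ?thesis by simp
qed

lemma osum_zero: assumes "X : Ob C" "Y : Ob C" "!!i. i : A ==> f i = Zer C X Y" shows "osum X Y f A = Zer C X Y"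
 using comm_monoid.finprod_one_eqI[OF hom_cm[OF assms(1,2)], of A f] assms(3) by simp

lemma osum_swap: assumes "X : Ob C" "Y : Ob C" "finite A" "!!i j. i : A ==> j : B ==> arr (f i j) X Y"
 shows "osum X Y (%i. osum X Y (f i) B) A = osum X Y (%j. osum X Y (%i. f i j) A) B"
 by (rule comm_monoid.finprod_swap[OF hom_cm[OF assms(1,2)] assms(3)]) (use assms(4) in \<open>simp add: arr_def\<close>)

lemma osum_shift: assumes "X : Ob C" "Y : Ob C" "!!i. i : (%l. j + l) ` A ==> arr (f i) X Y"
 shows "osum X Y f ((%l. j + l) ` A) = osum X Y (%l. f (j + l)) A"
 by (rule comm_monoid.finprod_reindex[OF hom_cm[OF assms(1,2)]]) (use assms(3) in \<open>auto simp: arr_def inj_on_def\<close>)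

lemma osum_map: assumes X: "X : Ob C" "Y : Ob C" and X': "X' : Ob C" "Y' : Ob C" and A: "finite A" "!!i. i : A ==> arr (f i) X Y"
  and T: "!!g. arr g X Y ==> arr (T g) X' Y'" "!!g h. arr g X Y ==> arr h X Y ==> T (Add C g h) = Add C (T g) (T h)" "T (Zer C X Y) = Zer C X' Y'"
 shows "T (osum X Y f A) = osum X' Y' (%i. T (f i)) A" using A proof (induction A rule: finite_induct)
 case empty then show ?case by (simp add: osum_empty[OF X] osum_empty[OF X'] T)
next
 case (insert a A)
 have a: "arr (f a) X Y" "arr (osum X Y f A) X Y" using insert.prems osum_arr[OF X, of A f] by auto
 have "osum X Y f (insert a A) = Add C (f a) (osum X Y f A)" by (rule osum_insert[OF X insert.hyps insert.prems])
 moreover have "osum X' Y' (%i. T (f i)) (insert a A) = Add C (T (f a)) (osum X' Y' (%i. T (f i)) A)"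
  by (rule osum_insert[OF X' insert.hyps T(1)[OF insert.prems]])
 ultimately show ?case using T(2)[OF a] insert.IH insert.prems by simp
qed

end

locale orbit = linear_category C for C :: "('o, 'm, 'k::field) lincat" +
 fixes F :: "'o => 'o" and G :: "'m => 'm" assumes F: "lauto F G"
begin

definition Fo where "Fo = obj_pow C (F, G)"
definition Fm where "Fm = mor_pow C (F, G)"

lemma lauto_F: "lauto (Fo i) (Fm i)" unfolding Fo_def Fm_def by (rule lauto_pow[OF F])

lemmas Fo_ob = lautoD(7)[OF lauto_F]
lemmas Fm_arr = lautoD(8)[OF lauto_F]
lemmas Fm_id = lautoD(2)[OF lauto_F]
lemmas Fm_cmp = lautoD(4)[OF lauto_F]
lemmas Fm_add = lautoD(5)[OF lauto_F]
lemmas Fm_scl = lautoD(6)[OF lauto_F]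
lemmas Fm_zer = lautoD(9)[OF lauto_F]

lemma Fo_Fo: "X : Ob C ==> Fo i (Fo j X) = Fo (i + j) X" unfolding Fo_def obj_pow_def fst_conv using int_iter_add[OF lautoD(1)[OF F]] by simp

lemma Fm_Fm: "arr f X Y ==> Fm i (Fm j f) = Fm (i + j) f" unfolding Fm_def mor_pow_def snd_conv
 by (rule int_iter_add[symmetric, OF lauto_mors[OF F]]) (auto simp: all_mors_arr)

lemma Fo_0 [simp]: "Fo 0 X = X" by (simp add: Fo_def obj_pow_def)
lemma Fm_0 [simp]: "Fm 0 f = f" by (simp add: Fm_def mor_pow_def)

definition supp where
 "supp X Y u = {i. u i ~= Zer C (Fo i X) Y}"

definition gm where
 "gm X Y u <-> X : Ob C & Y : Ob C & (ALL i. arr (u i) (Fo i X) Y) & finite (supp X Y u)"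

lemma gmD: assumes "gm X Y u" shows "X : Ob C" "Y : Ob C" "arr (u i) (Fo i X) Y" "finite (supp X Y u)" using assms unfolding gm_def by blast+

definition conv where
 "conv X Y Z w u n = osum (Fo n X) Z (%i. w (n - i) ** Fm (n - i) (u i)) (supp X Y u)"

lemma term_arr: assumes "gm X Y u" "gm Y Z w" shows "arr (w (n - i) ** Fm (n - i) (u i)) (Fo n X) Z" proof (rule arr_cmp[OF gmD(3)[OF assms(2)]])
 show "arr (Fm (n - i) (u i)) (Fo n X) (Fo (n - i) Y)" using Fm_arr[OF gmD(3)[OF assms(1)], of "n - i" i] by (simp add: Fo_Fo[OF gmD(1)[OF assms(1)]])
qed

lemma term_zero: assumes "gm X Y u" "gm Y Z w" shows "i ~: supp X Y u ==> w (n - i) ** Fm (n - i) (u i) = Zer C (Fo n X) Z"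
  "n - i ~: supp Y Z w ==> w (n - i) ** Fm (n - i) (u i) = Zer C (Fo n X) Z" proof -
 note X = gmD(1)[OF assms(1)] and Y = gmD(2)[OF assms(1)] and Z = gmD(2)[OF assms(2)]
 have n: "Fo (n - i) (Fo i X) = Fo n X" by (simp add: Fo_Fo[OF X])
 show "w (n - i) ** Fm (n - i) (u i) = Zer C (Fo n X) Z" if "i ~: supp X Y u"
  using that zer_arr(2)[OF gmD(3)[OF assms(2), of "n - i"] Fo_ob[OF X]] Fm_zer[OF Fo_ob[OF X] Y] n unfolding supp_def by simp
 show "w (n - i) ** Fm (n - i) (u i) = Zer C (Fo n X) Z" if "n - i ~: supp Y Z w"
  using that zer_arr(1)[OF Fm_arr[OF gmD(3)[OF assms(1)], of "n - i" i] Z] n unfolding supp_def by simp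
qed

lemma conv_superset: assumes "gm X Y u" "gm Y Z w" "finite A" "supp X Y u <= A"
 shows "conv X Y Z w u n = osum (Fo n X) Z (%i. w (n - i) ** Fm (n - i) (u i)) A" unfolding conv_def
 by (rule osum_mono[OF Fo_ob[OF gmD(1)[OF assms(1)]] gmD(2)[OF assms(2)] assms(3,4) term_arr[OF assms(1,2)] term_zero(1)[OF assms(1,2)]]) simp

lemma conv_support: "gm X Y u ==> gm Y Z w ==> supp X Z (conv X Y Z w u) <= (\<Union>a\<in>supp X Y u. (%l. a + l) ` supp Y Z w)" proof
 fix n assume u: "gm X Y u" and w: "gm Y Z w" and n: "n : supp X Z (conv X Y Z w u)"
 note Xn = Fo_ob[OF gmD(1)[OF u], of n] and Z = gmD(2)[OF w]
 have "EX i:supp X Y u. w (n - i) ** Fm (n - i) (u i) ~= Zer C (Fo n X) Z"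
  using n osum_zero[OF Xn Z, of "supp X Y u" "%i. w (n - i) ** Fm (n - i) (u i)"] unfolding supp_def[of X Z] conv_def by blast
 then obtain i where i: "i : supp X Y u" "n - i : supp Y Z w" using term_zero(2)[OF u w] by blast
 then show "n : (\<Union>a\<in>supp X Y u. (%l. a + l) ` supp Y Z w)" by (intro UN_I[of i] image_eqI[of _ _ "n - i"]) auto
qed

lemma conv_gm: assumes "gm X Y u" "gm Y Z w" shows "gm X Z (conv X Y Z w u)" unfolding gm_def proof (intro conjI allI)
 show X: "X : Ob C" and Z: "Z : Ob C" using gmD assms by blast+
 show "arr (conv X Y Z w u i) (Fo i X) Z" for i unfolding conv_def by (rule osum_arr[OF Fo_ob[OF X] Z term_arr[OF assms]])
 show "finite (supp X Z (conv X Y Z w u))" by (rule finite_subset[OF conv_support[OF assms]]) (use gmD(4)[OF assms(1)] gmD(4)[OF assms(2)] in blast)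
qed

text \<open>Both sides are one double sum with terms h(n-i) F^(n-i)(g(i-j)) F^(n-j)(f j). The work
  lies in the index sets: \<open>j\<close> runs over the support of \<open>f\<close>, and
  \<open>i\<close> over the sumset of the supports of \<open>f\<close> and \<open>g\<close>, a
  finite set that serves for all \<open>j\<close> at once.\<close>

lemma conv_assoc: assumes f: "gm X Y f" and g: "gm Y Z g" and h: "gm Z W h" shows "conv X Y W (conv Y Z W h g) f = conv X Z W h (conv X Y Z g f)"
proof
 fix n
 note X = gmD(1)[OF f] and Y = gmD(2)[OF f] and Z = gmD(2)[OF g] and W = gmD(2)[OF h]
 note Xn = Fo_ob[OF X]
 let ?A = "supp X Y f" and ?D = "supp Y Z g" and ?B = "\<Union>a\<in>supp X Y f. (%l. a + l) ` supp Y Z g"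
 have A: "finite ?A" and D: "finite ?D" using gmD(4)[OF f] gmD(4)[OF g] by blast+
 then have B: "finite ?B" by blast
 have Ff: "arr (Fm (n - j) (f j)) (Fo n X) (Fo (n - j) Y)" for n j using Fm_arr[OF gmD(3)[OF f], of "n - j" j] by (simp add: Fo_Fo[OF X])
 let ?t = "%i j. h (n - i) ** (Fm (n - i) (g (i - j)) ** Fm (n - j) (f j))"
 have Fg: "arr (Fm (n - i) (g (i - j))) (Fo (n - j) Y) (Fo (n - i) Z)" for i j
  using Fm_arr[OF gmD(3)[OF g], of "n - i" "i - j"] by (simp add: Fo_Fo[OF Y])
 have t: "arr (?t i j) (Fo n X) W" for i j by (rule arr_cmp[OF gmD(3)[OF h] arr_cmp[OF Fg Ff]])
 have l1: "h (n - i) ** Fm (n - i) (conv X Y Z g f i) = osum (Fo n X) W (%j. ?t i j) ?A" for i proof -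
  let ?T = "%x. h (n - i) ** Fm (n - i) x"
  have nX: "Fo (n - i) (Fo i X) = Fo n X" by (simp add: Fo_Fo[OF X])
  have "?T (osum (Fo i X) Z (%j. g (i - j) ** Fm (i - j) (f j)) ?A) = osum (Fo n X) W (%j. ?T (g (i - j) ** Fm (i - j) (f j))) ?A"
  proof (rule osum_map[OF Xn Z Xn W A term_arr[OF f g]])
   show "arr (?T x) (Fo n X) W" if "arr x (Fo i X) Z" for x using arr_cmp[OF gmD(3)[OF h] Fm_arr[OF that], of "n - i"] nX by simp
   show "?T (Add C x y) = Add C (?T x) (?T y)" if "arr x (Fo i X) Z" "arr y (Fo i X) Z" for x y
    unfolding Fm_add[OF that] by (rule arr_cmp_add(1)[OF gmD(3)[OF h] Fm_arr[OF that(1)] Fm_arr[OF that(2)]])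
   show "?T (Zer C (Fo i X) Z) = Zer C (Fo n X) W" unfolding Fm_zer[OF Xn Z] nX by (rule zer_arr(2)[OF gmD(3)[OF h] Xn])
  qed
  moreover have "Fm (n - i) (g (i - j) ** Fm (i - j) (f j)) = Fm (n - i) (g (i - j)) ** Fm (n - j) (f j)" for j
   unfolding Fm_cmp[OF Ff gmD(3)[OF g]] Fm_Fm[OF gmD(3)[OF f]] by simp
  ultimately show ?thesis unfolding conv_def by simp
 qed
 have "conv X Z W h (conv X Y Z g f) n = osum (Fo n X) W (%i. h (n - i) ** Fm (n - i) (conv X Y Z g f i)) ?B"
  by (rule conv_superset[OF conv_gm[OF f g] h B conv_support[OF f g]])
 also have "... = osum (Fo n X) W (%i. osum (Fo n X) W (%j. ?t i j) ?A) ?B" by (simp only: l1)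
 also have "... = osum (Fo n X) W (%j. osum (Fo n X) W (%i. ?t i j) ?B) ?A" by (rule osum_swap[OF Xn W B t])
 also have "... = osum (Fo n X) W (%j. conv Y Z W h g (n - j) ** Fm (n - j) (f j)) ?A" proof (rule osum_cong[OF Xn W])
  show "arr (osum (Fo n X) W (%i. ?t i j) ?B) (Fo n X) W" for j by (rule osum_arr[OF Xn W t])
  fix j assume j: "j : ?A"
  let ?D' = "(%l. j + l) ` ?D"
  have "osum (Fo n X) W (%i. ?t i j) ?D' = osum (Fo n X) W (%i. ?t i j) ?B" proof (rule osum_mono[OF Xn W B _ t])
   show "?D' <= ?B" using j by blast
   fix i assume "i : ?B - ?D'"
   then have nD: "i ~: ?D'" by blast
   have "i - j ~: ?D" by (rule notI, rule notE[OF nD], rule image_eqI[of _ _ "i - j"]) simp_all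
   then have "g (i - j) = Zer C (Fo (i - j) Y) Z" unfolding supp_def by blast
   then have "Fm (n - i) (g (i - j)) = Zer C (Fo (n - j) Y) (Fo (n - i) Z)"
    using Fm_zer[OF Fo_ob[OF Y] Z, of "n - i" "i - j"] by (simp add: Fo_Fo[OF Y])
   then show "?t i j = Zer C (Fo n X) W" using zer_arr(1)[OF Ff Fo_ob[OF Z]] zer_arr(2)[OF gmD(3)[OF h] Xn] by simp
  qed
  then have "osum (Fo n X) W (%i. ?t i j) ?B = osum (Fo n X) W (%l. ?t (j + l) j) ?D" using osum_shift[OF Xn W, of j ?D "%i. ?t i j" n] t by simp
  also have "... = osum (Fo n X) W (%l. (h (n - j - l) ** Fm (n - j - l) (g l)) ** Fm (n - j) (f j)) ?D" proof (rule osum_cong[OF Xn W t])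
   fix l
   have e: "n - (j + l) = n - j - l" "j + l - j = l" by simp_all
   have Fgl: "arr (Fm (n - j - l) (g l)) (Fo (n - j) Y) (Fo (n - j - l) Z)" using Fg[of "j + l" j] unfolding e .
   show "?t (j + l) j = (h (n - j - l) ** Fm (n - j - l) (g l)) ** Fm (n - j) (f j)" unfolding e by (rule assoc[symmetric, OF gmD(3)[OF h] Fgl Ff])
  qed
  also have "... = conv Y Z W h g (n - j) ** Fm (n - j) (f j)" unfolding conv_def
  proof (rule osum_map[symmetric, OF Fo_ob[OF Y] W Xn W D term_arr[OF g h]])
   show "arr (x ** Fm (n - j) (f j)) (Fo n X) W" if "arr x (Fo (n - j) Y) W" for x by (rule arr_cmp[OF that Ff])
   show "Add C x y ** Fm (n - j) (f j) = Add C (x ** Fm (n - j) (f j)) (y ** Fm (n - j) (f j))"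
    if "arr x (Fo (n - j) Y) W" "arr y (Fo (n - j) Y) W" for x y by (rule arr_cmp_add(2)[OF that Ff])
   show "Zer C (Fo (n - j) Y) W ** Fm (n - j) (f j) = Zer C (Fo n X) W" by (rule zer_arr(1)[OF Ff W])
  qed
  finally show "osum (Fo n X) W (%i. ?t i j) ?B = conv Y Z W h g (n - j) ** Fm (n - j) (f j)" .
 qed
 also have "... = conv X Y W (conv Y Z W h g) f n" unfolding conv_def[of X Y W] ..
 finally show "conv X Y W (conv Y Z W h g) f n = conv X Z W h (conv X Y Z g f) n" ..
qed

definition hg where
 "hg X Y a f = (%i. if i = a then f else Zer C (Fo i X) Y)"

lemma hg_gm: assumes "X : Ob C" "arr f (Fo a X) Y" shows "gm X Y (hg X Y a f)" unfolding gm_def proof (intro conjI allI)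
 show "X : Ob C" "Y : Ob C" using assms arr_ob by blast+
 then show "arr (hg X Y a f i) (Fo i X) Y" for i using assms arr_zer[OF Fo_ob] by (simp add: hg_def)
 have "supp X Y (hg X Y a f) <= {a}" by (auto simp: supp_def hg_def)
 then show "finite (supp X Y (hg X Y a f))" by (rule finite_subset) simp
qed

lemma conv_hg_right: assumes X: "X : Ob C" "arr f (Fo a X) Y" and w: "gm Y Z w" shows "conv X Y Z w (hg X Y a f) n = w (n - a) ** Fm (n - a) f"
proof -
 note g = hg_gm[OF X]
 have "supp X Y (hg X Y a f) <= {a}" by (auto simp: supp_def hg_def)
 then have "conv X Y Z w (hg X Y a f) n = osum (Fo n X) Z (%i. w (n - i) ** Fm (n - i) (hg X Y a f i)) {a}" by (intro conv_superset[OF g w]) simp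
 also have "... = w (n - a) ** Fm (n - a) (hg X Y a f a)" by (rule osum_single[OF Fo_ob[OF X(1)] gmD(2)[OF w] _ _ term_arr[OF g w]]) auto
 finally show ?thesis by (simp add: hg_def)
qed

lemma conv_id_right: assumes "gm X Y w" shows "conv X X Y w (hg X X 0 (Idn C X)) = w" proof
 fix n
 note X = gmD(1)[OF assms]
 have "conv X X Y w (hg X X 0 (Idn C X)) n = w (n-0) ** Fm (n-0) (Idn C X)" by (rule conv_hg_right[OF X _ assms]) (simp add: arr_id[OF X])
 then show "conv X X Y w (hg X X 0 (Idn C X)) n = w n" using Fm_id[OF X] id_arr(2)[OF gmD(3)[OF assms]] by simp
qed

lemma conv_id_left: assumes u: "gm X Y u" shows "conv X Y Y (hg Y Y 0 (Idn C Y)) u = u" proof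
 fix n
 note X = gmD(1)[OF u] and Y = gmD(2)[OF u]
 let ?e = "hg Y Y 0 (Idn C Y)"
 have e: "gm Y Y ?e" by (rule hg_gm[OF Y]) (simp add: arr_id[OF Y])
 have "conv X Y Y ?e u n = osum (Fo n X) Y (%i. ?e (n - i) ** Fm (n - i) (u i)) (insert n (supp X Y u))"
  by (rule conv_superset[OF u e]) (use gmD(4)[OF u] in auto)
 also have "... = ?e (n - n) ** Fm (n - n) (u n)" by (rule osum_single[OF Fo_ob[OF X] Y _ _ term_arr[OF u e] term_zero(2)[OF u e]])
   (use gmD(4)[OF u] in \<open>auto simp: supp_def hg_def\<close>)
 also have "... = u n" using id_arr(1)[OF gmD(3)[OF u]] by (simp add: hg_def)
 finally show "conv X Y Y ?e u n = u n" .
qed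

lemma conv_hg: assumes "X : Ob C" "arr f (Fo a X) Y" "arr g (Fo b Y) Z" shows "conv X Y Z (hg Y Z b g) (hg X Y a f) = hg X Z (a + b) (g ** Fm b f)"
proof
 fix n
 have Y: "Y : Ob C" using arr_ob[OF assms(2)] by blast
 note c = conv_hg_right[OF assms(1,2) hg_gm[OF Y assms(3)]]
 show "conv X Y Z (hg Y Z b g) (hg X Y a f) n = hg X Z (a + b) (g ** Fm b f) n" proof (cases "n = a + b")
  case True then show ?thesis unfolding c by (simp add: hg_def)
 next
  case False
  then have "hg Y Z b g (n - a) = Zer C (Fo (n - a) Y) Z" by (auto simp: hg_def)
  then show ?thesis unfolding c using False zer_arr(1)[OF Fm_arr[OF assms(2)], of Z "n - a"] arr_ob[OF assms(3)]
   by (simp add: hg_def Fo_Fo[OF assms(1)])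
 qed
qed

abbreviation "OC == orbit_category C (F, G)"
abbreviation "orb == functor_orbit C (F, G)"

lemma rep_of_orb: assumes "X : Ob C" obtains i where "rep_of (orb X) = Fo i X" "rep_of (orb X) : Ob C" proof -
 have "rep_of (orb X) : orb X" unfolding rep_of_def by (rule someI[of _ X]) (metis Fo_0 Fo_def functor_orbit_def rangeI)
 then obtain i where "rep_of (orb X) = Fo i X" unfolding functor_orbit_def Fo_def by blast
 then show thesis using that Fo_ob[OF assms] by metis
qed

lemma orb_eq: assumes "X : Ob C" shows "orb (Fo i X) = orb X" proof -
 have "Fo j (Fo i X) : range (%i. Fo i X)" for j using Fo_Fo[OF assms] by blast
 moreover have "Fo j X : range (%j. Fo j (Fo i X))" for j by (rule image_eqI[of _ _ "j - i"]) (simp_all add: Fo_Fo[OF assms])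
 ultimately show ?thesis unfolding functor_orbit_def Fo_def[symmetric] by blast
qed

lemma OC_ob: "Ob OC = orb ` Ob C" by (simp add: orbit_category_def)

lemma rep_ob: "U : Ob OC ==> rep_of U : Ob C" unfolding OC_ob using rep_of_orb by blast

lemma orb_rep: "U : Ob OC ==> orb (rep_of U) = U" unfolding OC_ob using rep_of_orb orb_eq by (metis (full_types) imageE)

lemma OC_hom: "U : Ob OC ==> V : Ob OC ==> m : Hom OC U V <-> (EX u. m = (U, V, u) & gm (rep_of U) (rep_of V) u)"
 using rep_ob Fo_ob unfolding orbit_category_def gm_def supp_def arr_def Fo_def by auto

lemma OC_simps: "Cmp OC (V, W, w) (U, V, u) = (U, W, conv (rep_of U) (rep_of V) (rep_of W) w u)"
 "Idn OC U = (U, U, hg (rep_of U) (rep_of U) 0 (Idn C (rep_of U)))" "Zer OC U V = (U, V, %i. Zer C (Fo i (rep_of U)) (rep_of V))"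
 "Add OC (U, V, u) (U, V, u') = (U, V, %i. Add C (u i) (u' i))"
 by (simp_all add: orbit_category_def conv_def[abs_def] supp_def Fo_def Fm_def hg_def cong: if_cong)

lemma zero_gm: "X : Ob C ==> Y : Ob C ==> gm X Y (%i. Zer C (Fo i X) Y)" unfolding gm_def supp_def using arr_zer Fo_ob by simp

lemma conv_zero: assumes X: "X : Ob C" and Y: "Y : Ob C" and Z: "Z : Ob C"
 shows "gm X Y u ==> conv X Y Z (%i. Zer C (Fo i Y) Z) u = (%i. Zer C (Fo i X) Z)"
  "gm Y Z w ==> conv X Y Z w (%i. Zer C (Fo i X) Y) = (%i. Zer C (Fo i X) Z)" proof -
 show "conv X Y Z (%i. Zer C (Fo i Y) Z) u = (%i. Zer C (Fo i X) Z)" if "gm X Y u" unfolding conv_def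
  by (rule ext, rule osum_zero[OF Fo_ob[OF X] Z], rule term_zero(2)[OF that zero_gm[OF Y Z]]) (simp add: supp_def)
 show "conv X Y Z w (%i. Zer C (Fo i X) Y) = (%i. Zer C (Fo i X) Z)" if "gm Y Z w" unfolding conv_def
  by (rule ext, rule osum_zero[OF Fo_ob[OF X] Z], rule term_zero(1)[OF zero_gm[OF X Y] that]) (simp add: supp_def)
qed

sublocale OC: precategory "orbit_category C (F, G)" .

lemma OC_arr: "OC.arr m U V <-> U : Ob OC & V : Ob OC & (EX u. m = (U, V, u) & gm (rep_of U) (rep_of V) u)" unfolding OC.arr_def using OC_hom by blast

sublocale OC: zero_category "orbit_category C (F, G)" proof
 show "OC.arr (Idn OC U) U U" if "U : Ob OC" for U unfolding OC_arr OC_simps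
  using hg_gm[OF rep_ob[OF that], of "Idn C (rep_of U)" 0 "rep_of U"] arr_id[OF rep_ob[OF that]] that by simp
 show "OC.arr (Zer OC U V) U V" if "U : Ob OC" "V : Ob OC" for U V
  unfolding OC_arr OC_simps using zero_gm[OF rep_ob[OF that(1)] rep_ob[OF that(2)]] that by blast
 show "OC.cmp (OC.cmp m'' m') m = OC.cmp m'' (OC.cmp m' m)" if "OC.arr m'' W T" "OC.arr m' V W" "OC.arr m U V" for m m' m'' U V W T
  using that unfolding OC_arr by (auto simp: OC_simps conv_assoc)
qed (auto simp: OC_arr OC_simps conv_gm conv_id_left conv_id_right conv_zero rep_ob)

lemma orb_ob: "X : Ob C ==> orb X : Ob OC" unfolding OC_ob by blast

lemma orbit_iso: assumes U: "U : Ob OC" and V: "V : Ob OC" and iso: "iso (rep_of U) (Fo a (rep_of V))" shows "OC.iso U V" proof -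
 let ?X = "rep_of U" and ?Y = "rep_of V"
 note X = rep_ob[OF U] and Y = rep_ob[OF V]
 obtain f g where f: "arr f ?X (Fo a ?Y)" "arr g (Fo a ?Y) ?X" "g ** f = Idn C ?X" "f ** g = Idn C (Fo a ?Y)" using iso unfolding iso_def by blast
 have f': "arr (Fm (- a) f) (Fo (- a) ?X) ?Y" using Fm_arr[OF f(1), of "- a"] by (simp add: Fo_Fo[OF Y])
 let ?m = "(U, V, hg ?X ?Y (- a) (Fm (- a) f))" and ?m' = "(V, U, hg ?Y ?X a g)"
 have m: "OC.arr ?m U V" "OC.arr ?m' V U" unfolding OC_arr using U V hg_gm[OF X f'] hg_gm[OF Y f(2)] by blast+
 have "OC.cmp ?m' ?m = Idn OC U" unfolding OC_simps conv_hg[OF X f' f(2)] by (simp add: Fm_Fm[OF f(1)] f)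
 moreover have "OC.cmp ?m ?m' = Idn OC V" unfolding OC_simps conv_hg[OF Y f(2) f']
  using Fm_cmp[OF f(2,1), of "- a"] f(4) Fm_id[OF Fo_ob[OF Y], of "- a" a] by (simp add: Fo_Fo[OF Y])
 ultimately show ?thesis unfolding OC.iso_def using m by blast
qed

lemma orb_iso: assumes "iso X Y" shows "OC.iso (orb X) (orb Y)" proof -
 note XY = iso_ob[OF assms]
 obtain i where i: "rep_of (orb X) = Fo i X" by (rule rep_of_orb[OF XY(1)])
 obtain j where j: "rep_of (orb Y) = Fo j Y" by (rule rep_of_orb[OF XY(2)])
 have "Fo (i - j) (Fo j Y) = Fo i Y" by (simp add: Fo_Fo[OF XY(2)])
 then have "iso (rep_of (orb X)) (Fo (i - j) (rep_of (orb Y)))" unfolding i j using lauto_iso[OF lauto_F assms] by simp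
 then show ?thesis by (rule orbit_iso[OF orb_ob[OF XY(1)] orb_ob[OF XY(2)]])
qed

text \<open>The degree 0 component of the composite is the identity and is a sum of products of
  homogeneous parts, so some product is nonzero. For bricks one nonzero product already yields an
  isomorphism.\<close>

lemma orbit_iso_bricks: assumes U: "U : Ob OC" and V: "V : Ob OC" and X: "brick (rep_of U)" and Y: "brick (rep_of V)" and iso: "OC.iso U V"
 obtains i where "iso (rep_of U) (Fo i (rep_of V))" proof -
 let ?X = "rep_of U" and ?Y = "rep_of V"
 obtain m m' where m: "OC.arr m U V" "OC.arr m' V U" "OC.cmp m' m = Idn OC U" using iso unfolding OC.iso_def by blast
 obtain u where u: "m = (U, V, u)" "gm ?X ?Y u" using m(1) OC_arr by blast
 obtain w where w: "m' = (V, U, w)" "gm ?Y ?X w" using m(2) OC_arr by blast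
 note obX = rep_ob[OF U]
 have "conv ?X ?Y ?X w u = hg ?X ?X 0 (Idn C ?X)" using m(3) unfolding u(1) w(1) OC_simps by simp
 then have "conv ?X ?Y ?X w u 0 = Idn C ?X" by (simp add: hg_def)
 then have "conv ?X ?Y ?X w u 0 ~= Zer C (Fo 0 ?X) ?X" using brickD(2)[OF X] by simp
 then have "EX i. w (0 - i) ** Fm (0 - i) (u i) ~= Zer C (Fo 0 ?X) ?X"
  unfolding conv_def using osum_zero[OF Fo_ob[OF obX] obX, of "supp ?X ?Y u" "%i. w (0 - i) ** Fm (0 - i) (u i)" 0] by blast
 then obtain i where i: "w (- i) ** Fm (- i) (u i) ~= Zer C ?X ?X" by auto
 have "arr (Fm (- i) (u i)) ?X (Fo (- i) ?Y)" using Fm_arr[OF gmD(3)[OF u(2)], of "- i" i] by (simp add: Fo_Fo[OF obX])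
 from brick_retract[OF X lauto_brick[OF lauto_F Y] this gmD(3)[OF w(2)] i] show thesis by (rule that)
qed

text \<open>An idempotent \<open>e\<close> lives in degrees at most 0, so its component in degree 0
  is an idempotent scalar \<open>c\<close>, either 0 or 1. In the largest negative degree t of its
  support, idempotency reads e_t = 2c e_t, which is impossible; hence \<open>e\<close> is
  homogeneous of degree 0.\<close>

lemma orbit_indecomposable: assumes U: "U : Ob OC" and X: "brick (rep_of U)"
  and van: "!!i f. i > 0 ==> arr f (Fo i (rep_of U)) (rep_of U) ==> f = Zer C (Fo i (rep_of U)) (rep_of U)" shows "indecomposable OC U"
proof (rule OC.indecI[OF U])
 let ?X = "rep_of U"
 note bX = brickD[OF X]
 show "Idn OC U ~= Zer OC U U" unfolding OC_simps using bX(2) by (auto simp: hg_def dest: fun_cong[of _ _ 0])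
 fix m assume m: "OC.arr m U U" "OC.cmp m m = m"
 obtain e where e: "m = (U, U, e)" "gm ?X ?X e" using m(1) OC_arr by blast
 have ee: "conv ?X ?X ?X e e = e" using m(2) unfolding e(1) OC_simps by simp
 have pos: "i <= 0" if "i : supp ?X ?X e" for i using that van[OF _ gmD(3)[OF e(2)], of i] unfolding supp_def by force
 obtain c where c: "e 0 = Scl C c (Idn C ?X)" using brick_scalar[OF X, of "e 0"] gmD(3)[OF e(2), of 0] by auto
 note Xn = Fo_ob[OF bX(1)]
 let ?t = "%n i. e (n - i) ** Fm (n - i) (e i)"
 have ex: "e n = osum (Fo n ?X) ?X (?t n) A" if "finite A" "supp ?X ?X e <= A" for n A using conv_superset[OF e(2,2) that, of n] ee by simp
 note ta = term_arr[OF e(2,2)] and tz = term_zero[OF e(2,2)]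
 have "e 0 = ?t 0 0" proof -
  have "e 0 = osum (Fo 0 ?X) ?X (?t 0) (insert 0 (supp ?X ?X e))" by (rule ex) (use gmD(4)[OF e(2)] in auto)
  also have "... = ?t 0 0" proof (rule osum_single[OF Xn bX(1) _ _ ta])
   fix i assume "i : insert 0 (supp ?X ?X e)" "i ~= 0"
   then have "i < 0" using pos[of i] by auto
   then have "0 - i ~: supp ?X ?X e" using pos[of "0 - i"] by auto
   then show "?t 0 i = Zer C (Fo 0 ?X) ?X" by (rule tz(2))
  qed (use gmD(4)[OF e(2)] in auto)
  finally show ?thesis .
 qed
 then have "e 0 = e 0 ** e 0" unfolding diff_self Fm_0 .
 then have "Scl C c (Idn C ?X) = Scl C c (Idn C ?X) ** Scl C c (Idn C ?X)" unfolding c .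
 then have "Scl C c (Idn C ?X) = Scl C (c*c) (Idn C ?X)"
  using arr_cmp_scl[OF arr_scl[OF bX(3)] bX(3), of c c] arr_cmp_scl(2)[OF bX(3,3), of c] id_arr(1)[OF bX(3)] scl_simps(3)[OF bX(3)] by simp
 from brick_scl_inject[OF X this] have c01: "c = 0 \<or> c = 1" by simp
 have low: "e n = Zer C (Fo n ?X) ?X" if "n < 0" for n proof (rule ccontr)
  assume ne: "e n ~= Zer C (Fo n ?X) ?X"
  let ?N = "{i : supp ?X ?X e. i < 0}"
  have fN: "finite ?N" using gmD(4)[OF e(2)] by simp
  \<comment> \<open>Two negative degrees of the support add up to something below \<open>t\<close>,
    so only the two products with one factor in degree 0 contribute to the component at
    \<open>t\<close>.\<close>
  define t where "t = Max ?N"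
  have "n : ?N" using ne \<open>n < 0\<close> unfolding supp_def by simp
  then have t: "t : ?N" "!!i. i : ?N ==> i <= t" unfolding t_def using Max_in[OF fN] Max_ge[OF fN] by blast+
  then have t0: "t < 0" "e t ~= Zer C (Fo t ?X) ?X" unfolding supp_def by auto
  have "supp ?X ?X e <= insert 0 ?N" using pos by force
  then have sup: "supp ?X ?X e <= insert 0 (insert t ?N)" by blast
  have "e t = osum (Fo t ?X) ?X (?t t) (insert 0 (insert t ?N))" by (rule ex[OF _ sup]) (use fN in simp)
  also have "... = osum (Fo t ?X) ?X (?t t) {0, t}" proof (rule osum_mono[symmetric, OF Xn bX(1) _ _ ta])
   fix i assume "i : insert 0 (insert t ?N) - {0, t}"
   then have i: "i < t" using t(2)[of i] by auto
   then have "t - i ~: supp ?X ?X e" using pos[of "t - i"] by auto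
   then show "?t t i = Zer C (Fo t ?X) ?X" by (rule tz(2))
  qed (use fN in auto)
  also have "... = Add C (?t t 0) (osum (Fo t ?X) ?X (?t t) {t})" by (rule osum_insert[OF Xn bX(1) _ _ ta]) (use t0(1) in auto)
  also have "osum (Fo t ?X) ?X (?t t) {t} = ?t t t" by (rule osum_single[OF Xn bX(1) _ _ ta]) auto
  also have "?t t 0 = Scl C c (e t)"
   unfolding c using Fm_scl[OF bX(3), of t c] Fm_id[OF bX(1), of t] arr_cmp_scl(1)[OF gmD(3)[OF e(2), of t] arr_id[OF Xn]]
    id_arr(2)[OF gmD(3)[OF e(2), of t]] by simp
  also have "?t t t = Scl C c (e t)" using c arr_cmp_scl(2)[OF bX(3) gmD(3)[OF e(2), of t]] id_arr(1)[OF gmD(3)[OF e(2), of t]] by simp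
  also have "Add C (Scl C c (e t)) (Scl C c (e t)) = Scl C (c + c) (e t)" using scl_add[OF gmD(3)[OF e(2), of t], of c c] by simp
  finally have eq: "Scl C 1 (e t) = Scl C (c + c) (e t)" using scl_simps(2)[OF gmD(3)[OF e(2), of t]] by simp
  \<comment> \<open>Valid in every characteristic: \<open>c = 0\<close> would give 1 = 0, and
    \<open>c = 1\<close> would give 1 = 1 + 1.\<close>
  have "1 ~= c + c" proof
   assume h: "1 = c + c"
   from c01 show False proof
    assume "c = 1"
    then have "(1::'k) + 1 = 1 + 0" using h by (metis add.right_neutral)
    then show False using add_left_imp_eq[of 1 1 "0::'k"] by simp
   qed (use h in simp)
  qed
  from scl_eq_scl[OF gmD(3)[OF e(2), of t] eq this] show False using t0(2) by blast
 qed
 have e': "e = (%i. if i = 0 then e 0 else Zer C (Fo i ?X) ?X)" proof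
  fix i show "e i = (if i = 0 then e 0 else Zer C (Fo i ?X) ?X)"
   using low[of i] van[OF _ gmD(3)[OF e(2)], of i] by (cases "i < 0"; cases "i = 0") auto
 qed
 show "m = Zer OC U U \<or> m = Idn OC U" using c01 proof
  assume "c = 0"
  then have "e 0 = Zer C (Fo 0 ?X) ?X" using c scl_simps(1)[OF bX(3)] by simp
  then have "e = (%i. Zer C (Fo i ?X) ?X)" using e' by (metis (full_types))
  then show ?thesis unfolding e(1) OC_simps by simp
 next
  assume "c = 1"
  then have e0: "e 0 = Idn C ?X" using c scl_simps(2)[OF bX(3)] by simp
  have "e = hg ?X ?X 0 (Idn C ?X)" using e' unfolding hg_def e0 .
  then show ?thesis unfolding e(1) OC_simps by simp
 qed
qed

text \<open>A decomposition of the representative becomes one of the orbit by homogeneous morphisms;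
  their degrees compensate for the representatives \<open>Fo a Y\<close> and \<open>Fo b Z\<close>
  that were chosen in the orbits of the summands.\<close>

lemma orbit_indecomposableD: assumes ind: "indecomposable OC U" shows "indecomposable C (rep_of U)" proof -
 have U: "U : Ob OC" using ind unfolding indecomposable_def by blast
 let ?X = "rep_of U"
 note X = rep_ob[OF U]
 show ?thesis unfolding indecomposable_def proof (intro conjI ballI impI)
  show "?X : Ob C" by (rule X)
  have nz: "Idn OC V = Zer OC V V" if "V : Ob OC" "Idn C (rep_of V) = Zer C (rep_of V) (rep_of V)" for V
   unfolding OC_simps using that(2) by (auto simp: hg_def)
  show "~ zero_obj C ?X" using ind nz[OF U] unfolding indecomposable_def zero_obj_def by blast
  fix Y Z assume Y: "Y : Ob C" and Z: "Z : Ob C" and "is_direct_sum C ?X Y Z"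
  then obtain i j p q where i: "arr i Y ?X" "arr j Z ?X" "arr p ?X Y" "arr q ?X Z"
   "p ** i = Idn C Y" "q ** j = Idn C Z" "q ** i = Zer C Y Z" "p ** j = Zer C Z Y" "Add C (i ** p) (j ** q) = Idn C ?X"
   unfolding is_direct_sum_def arr_def using X by blast
  obtain a where a: "rep_of (orb Y) = Fo a Y" by (rule rep_of_orb[OF Y])
  obtain b where b: "rep_of (orb Z) = Fo b Z" by (rule rep_of_orb[OF Z])
  note FY = Fo_ob[OF Y, of a] and FZ = Fo_ob[OF Z, of b]
  have i': "arr i (Fo (- a) (Fo a Y)) ?X" "arr j (Fo (- b) (Fo b Z)) ?X" using i(1,2) by (simp_all add: Fo_Fo[OF Y] Fo_Fo[OF Z])
  note p' = Fm_arr[OF i(3), of a] and q' = Fm_arr[OF i(4), of b]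
  let ?i = "(orb Y, U, hg (Fo a Y) ?X (- a) i)" and ?j = "(orb Z, U, hg (Fo b Z) ?X (- b) j)"
  let ?p = "(U, orb Y, hg ?X (Fo a Y) a (Fm a p))" and ?q = "(U, orb Z, hg ?X (Fo b Z) b (Fm b q))"
  have h: "?i : Hom OC (orb Y) U" "?j : Hom OC (orb Z) U" "?p : Hom OC U (orb Y)" "?q : Hom OC U (orb Z)"
   unfolding OC_hom[OF orb_ob[OF Y] U] OC_hom[OF orb_ob[OF Z] U] OC_hom[OF U orb_ob[OF Y]] OC_hom[OF U orb_ob[OF Z]] a b
   using hg_gm[OF FY i'(1)] hg_gm[OF FZ i'(2)] hg_gm[OF X p'] hg_gm[OF X q'] by simp_all
  have c: "Cmp OC ?p ?i = Idn OC (orb Y)" "Cmp OC ?q ?j = Idn OC (orb Z)" "Cmp OC ?q ?i = Zer OC (orb Y) (orb Z)" "Cmp OC ?p ?j = Zer OC (orb Z) (orb Y)"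
   unfolding OC_simps a b conv_hg[OF FY i'(1) p'] conv_hg[OF FZ i'(2) q'] conv_hg[OF FY i'(1) q'] conv_hg[OF FZ i'(2) p']
    Fm_cmp[OF i(1,3), symmetric] Fm_cmp[OF i(2,4), symmetric] Fm_cmp[OF i(1,4), symmetric] Fm_cmp[OF i(2,3), symmetric] i(5-8)
    Fm_id[OF Y] Fm_id[OF Z] Fm_zer[OF Y Z] Fm_zer[OF Z Y] by (auto simp: hg_def fun_eq_iff Fo_Fo[OF Y] Fo_Fo[OF Z])
  have ip: "Cmp OC ?i ?p = (U, U, hg ?X ?X 0 (i ** p))" "Cmp OC ?j ?q = (U, U, hg ?X ?X 0 (j ** q))"
   unfolding OC_simps a b conv_hg[OF X p' i'(1)] conv_hg[OF X q' i'(2)] by (simp_all add: Fm_Fm[OF i(3)] Fm_Fm[OF i(4)])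
  have "Add OC (Cmp OC ?i ?p) (Cmp OC ?j ?q) = Idn OC U"
   unfolding ip unfolding OC_simps using i(9) add_zer[OF arr_zer[OF Fo_ob[OF X] X]] by (auto simp: hg_def)
  then have "is_direct_sum OC U (orb Y) (orb Z)" unfolding is_direct_sum_def using h c by blast
  then have "zero_obj OC (orb Y) \<or> zero_obj OC (orb Z)" using ind orb_ob[OF Y] orb_ob[OF Z] unfolding indecomposable_def by blast
  moreover have "zero_obj C W" if W: "W : Ob C" and z: "zero_obj OC (orb W)" for W proof -
   obtain d where d: "rep_of (orb W) = Fo d W" by (rule rep_of_orb[OF W])
   have "Idn C (Fo d W) = Zer C (Fo d W) (Fo d W)" using z unfolding zero_obj_def OC_simps d by (auto simp: hg_def dest: fun_cong[of _ _ 0])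
   then have "Fm d (Idn C W) = Fm d (Zer C W W)" using Fm_id[OF W] Fm_zer[OF W W] by simp
   then show ?thesis unfolding zero_obj_def
    using bij_betw_imp_inj_on[OF lautoD(3)[OF lauto_F W W, of d]] id_hom[OF W] zer_hom[OF W W] unfolding inj_on_def by blast
  qed
  ultimately show "zero_obj C Y \<or> zero_obj C Z" using Y Z by blast
 qed
qed

end

section \<open>Indecomposable objects of the derived category\<close>

context quiver begin

lemma Hom_DE: assumes "f : Hom DQ X Y" "X : Cpx" "Y : Cpx"
 obtains w where "w : Wm X Y" "f = wk X Y w" using assms(1) unfolding Hom_D[OF assms(2,3)] by blast

lemma wk_cong: "X : Cpx ==> Y : Cpx ==> Hot X Y w w' ==> wk X Y w = wk X Y w'" unfolding wk_def using cl_cong by simp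

sublocale D: precategory "DQ :: (('v, 'a, 'k::field) cpx, ('v, 'a, 'k) D_mor, 'k) lincat" .

lemma arr_DE: assumes "D.arr f X Y"
 obtains w where "X : Cpx" "Y : Cpx" "w : Wm X Y" "f = wk X Y w" using assms Hom_D unfolding D.arr_def Ob_D by blast

lemma arr_wk: "X : Cpx ==> Y : Cpx ==> w : Wm X Y ==> D.arr (wk X Y w) X Y" unfolding D.arr_def by (simp add: Hom_D_wk)

text \<open>Through \<open>Cmp_D\<close>, \<open>Add_D\<close> and \<open>Scl_D\<close> every axiom
  becomes an identity of weak maps; apart from the unit laws these hold without passing to homotopy
  classes.\<close>

sublocale D: linear_category "DQ :: (('v, 'a, 'k::field) cpx, ('v, 'a, 'k) D_mor, 'k) lincat" proof
 note D = Cmp_D Add_D Scl_D Zer_D Idn_D arr_wk wm_comp wadd_wm wscl_wm wid_wm w0_wm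
 let ?D = "DQ :: (('v, 'a, 'k) cpx, ('v, 'a, 'k) D_mor, 'k) lincat"
 fix f g h X Y Z W X' Y' and a b :: 'k
 show "D.arr g Y Z ==> D.arr f X Y ==> D.arr (Cmp ?D g f) X Z" by (elim arr_DE) (simp add: D)
 show "X : Ob ?D ==> D.arr (Idn ?D X) X X" by (simp add: D)
 show "X : Ob ?D ==> Y : Ob ?D ==> D.arr (Zer ?D X Y) X Y" by (simp add: D)
 show "D.arr h Z W ==> D.arr g Y Z ==> D.arr f X Y ==> Cmp ?D (Cmp ?D h g) f = Cmp ?D h (Cmp ?D g f)" by (elim arr_DE) (simp add: D wc_assoc)
 show "D.arr f X Y ==> Cmp ?D (Idn ?D Y) f = f" "D.arr f X Y ==> Cmp ?D f (Idn ?D X) = f"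
  by (elim arr_DE, simp add: D wk_cong[OF _ _ wid_left] wk_cong[OF _ _ wid_right])+
 show "D.arr f X Y ==> Z : Ob ?D ==> Cmp ?D (Zer ?D Y Z) f = Zer ?D X Z" "D.arr f Y Z ==> X : Ob ?D ==> Cmp ?D f (Zer ?D X Y) = Zer ?D X Z"
  by (elim arr_DE, simp add: D, simp add: wc_def w0_def)+
 show "D.arr f X Y ==> D.arr f X' Y' ==> X = X' & Y = Y'" by (elim arr_DE) (simp add: wk_def)
 fix f' g'
 show "D.arr f X Y ==> D.arr g X Y ==> D.arr (Add ?D f g) X Y" "D.arr f X Y ==> D.arr (Scl ?D a f) X Y" by (elim arr_DE, simp add: D)+
 show "D.arr f X Y ==> D.arr g X Y ==> D.arr h X Y ==> Add ?D (Add ?D f g) h = Add ?D f (Add ?D g h)"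
  by (elim arr_DE) (simp add: D, simp add: wadd_def add.assoc)
 show "D.arr f X Y ==> D.arr g X Y ==> Add ?D f g = Add ?D g f" by (elim arr_DE) (simp add: D, simp add: wadd_def add.commute)
 show "D.arr f X Y ==> Add ?D (Zer ?D X Y) f = f" "D.arr f X Y ==> Scl ?D 0 f = Zer ?D X Y" "D.arr f X Y ==> Scl ?D 1 f = f"
  "D.arr f X Y ==> Scl ?D a (Scl ?D b f) = Scl ?D (a*b) f" "D.arr f X Y ==> Scl ?D (a + b) f = Add ?D (Scl ?D a f) (Scl ?D b f)"
  by (elim arr_DE, simp add: D, simp add: wadd_def wscl_def w0_def sm_distrib)+
 show "D.arr g Y Z ==> D.arr f X Y ==> D.arr f' X Y ==> Cmp ?D g (Add ?D f f') = Add ?D (Cmp ?D g f) (Cmp ?D g f')"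
  "D.arr g Y Z ==> D.arr g' Y Z ==> D.arr f X Y ==> Cmp ?D (Add ?D g g') f = Add ?D (Cmp ?D g f) (Cmp ?D g' f)"
  "D.arr g Y Z ==> D.arr f X Y ==> Cmp ?D g (Scl ?D a f) = Scl ?D a (Cmp ?D g f)"
  "D.arr g Y Z ==> D.arr f X Y ==> Cmp ?D (Scl ?D a g) f = Scl ?D a (Cmp ?D g f)" by (elim arr_DE, simp add: D wc_wadd wc_wscl)+
qed

lemma iso_D: "D.iso X Y <-> X : Cpx & Y : Cpx & (EX w:Wm X Y. EX t. winverse X Y w t)" proof
 assume i: "D.iso X Y"
 note XY = D.iso_ob[OF i, unfolded Ob_D]
 obtain f g where f: "f : Hom DQ X Y" "g : Hom DQ Y X" "Cmp DQ g f = Idn DQ X" "Cmp DQ f g = Idn DQ Y" using i unfolding D.iso_def D.arr_def by blast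
 obtain w where w: "w : Wm X Y" "f = wk X Y w" by (rule Hom_DE[OF f(1) XY])
 obtain t where t: "t : Wm Y X" "g = wk Y X t" by (rule Hom_DE[OF f(2) XY(2,1)])
 have "Hot X X (Wc t w) (wid X)" "Hot Y Y (Wc w t) (wid Y)"
  using f(3,4) unfolding w(2) t(2) Cmp_D[OF XY(1,2,1) w(1) t(1)] Cmp_D[OF XY(2,1,2) t(1) w(1)] Idn_D[OF XY(1)] Idn_D[OF XY(2)]
   wk_eq_iff[OF XY(1,1) wm_comp[OF XY(1,1) w(1) t(1)] wid_wm[OF XY(1)]] wk_eq_iff[OF XY(2,2) wm_comp[OF XY(2,2) t(1) w(1)] wid_wm[OF XY(2)]] .
 then show "X : Cpx & Y : Cpx & (EX w:Wm X Y. EX t. winverse X Y w t)" using XY w(1) t(1) unfolding winverse_def by blast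
next
 assume "X : Cpx & Y : Cpx & (EX w:Wm X Y. EX t. winverse X Y w t)"
 then obtain w t where XY: "X : Cpx" "Y : Cpx" and w: "w : Wm X Y" "t : Wm Y X"
  and h: "Hot X X (Wc t w) (wid X)" "Hot Y Y (Wc w t) (wid Y)" unfolding winverse_def by blast
 have "Cmp DQ (wk Y X t) (wk X Y w) = Idn DQ X" "Cmp DQ (wk X Y w) (wk Y X t) = Idn DQ Y"
  unfolding Cmp_D[OF XY(1,2,1) w] Cmp_D[OF XY(2,1,2) w(2,1)] Idn_D[OF XY(1)] Idn_D[OF XY(2)]
  using wk_cong[OF XY(1,1) h(1)] wk_cong[OF XY(2,2) h(2)] by blast+
 then show "D.iso X Y" unfolding D.iso_def D.arr_def Ob_D using XY Hom_D_wk[OF XY w(1)] Hom_D_wk[OF XY(2,1) w(2)] by blast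
qed

section \<open>Complexes with zero differential and stalk complexes\<close>

definition zc :: "(int => ('v, 'a, 'k::field) rep) => ('v, 'a, 'k) cpx" where
 "zc N = (N, %i v. 0\<^sub>m (fst (N (i+1)) v) (fst (N i) v))"

definition gr :: "(int => ('v, 'a, 'k::field) rep) => bool" where
 "gr N <-> (ALL i. N i : Rep) & finite {i. EX v. fst (N i) v ~= 0}"

lemma zc_simps [simp]: "cdim (zc N) i v = fst (N i) v" "df (zc N) i v = 0" "ax (zc N) i a = ar (N i) a" "fst (zc N) = N"
 by (simp_all add: zc_def cdim_def df_def ax_def)

lemma zc_complex: fixes N :: "int => ('v, 'a, 'k::field) rep" assumes "gr N" shows "zc N : Cpx" proof -
 have "(0 :: 'v => 'k lop) : rhm (N i) (N (i+1))" for i by simp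
 then have "mtf (N (i+1)) (N i) (0 :: 'v => 'k lop) : rep_maps Q (N i) (N (i+1))" for i using assms unfolding gr_def by (intro mtf_maps) auto
 moreover have "mtf (N (i+1)) (N i) (0 :: 'v => 'k lop) = (%v. 0\<^sub>m (fst (N (i+1)) v) (fst (N i) v))" for i
  unfolding mtf_def using mt_op[OF zero_carrier_mat] by (metis op_zero zero_fun_apply)
 ultimately have "(%v. 0\<^sub>m (fst (N (i+1)) v) (fst (N i) v)) : rep_maps Q (N i) (N (i+1))" for i by simp
 then show ?thesis using assms unfolding gr_def complexes_def zc_def by (simp add: cdim_def add.commute)
qed

lemma zero_differential_zc: assumes "X : Cpx" "!!i v. df X i v = 0" shows "X = zc (fst X)" "gr (fst X)" proof -
 have "snd X i v = 0\<^sub>m (fst (fst X (i+1)) v) (fst (fst X i) v)" for i v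
  using op_inject[OF cpxD(2)[OF assms(1), of i v] zero_carrier_mat] assms(2)[of i v] by (simp add: df_def cdim_def)
 then have "snd X = (%i v. 0\<^sub>m (fst (fst X (i+1)) v) (fst (fst X i) v))" by (intro ext)
 then show "X = zc (fst X)" unfolding zc_def by (metis prod.collapse)
 show "gr (fst X)" using assms(1) cpx_rep finite_support[OF assms(1)] unfolding gr_def cdim_def by blast
qed

lemma wm_zc: "w : Wm (zc M) (zc N) <-> (ALL i. fst w i : rhm (M i) (N i)) &
  (ALL i. ALL a:Q1. snd w i a : HV (fst (N (i-1)) (hd a)) (fst (M i) (tl a)))" unfolding wm_def rhom_def by (cases w) auto

lemma hot_zc: "Hot (zc M) (zc N) w w' <-> fst w = fst w' & (EX h. (ALL i v. h i v : HV (fst (N (i-1)) v) (fst (M i) v)) &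
  (ALL i. ALL a:Q1. snd w i a - snd w' i a = h i (hd a)*ar (M i) a - ar (N (i-1)) a*h i (tl a)))"
 (is "?l <-> ?e & (EX h. ?P h)") proof
 assume ?l
 then obtain h et where "htp Q (zc M) (zc N) h et w w'" by (rule hotE)
 note h = htpD[OF this, simplified]
 have "?P h" using h(1,4) by blast
 then show "?e & (EX h. ?P h)" using h(3) by (auto simp: fun_eq_iff)
next
 assume a: "?e & (EX h. ?P h)"
 then obtain h where h: "?P h" by blast
 show ?l by (rule hotI[of h _ _ _ "%i a. 0"]) (use a h in simp_all)
qed

lemma strict_wm_zc: "(!!i. f i : rhm (M i) (N i)) ==> strict f : Wm (zc M) (zc N)" unfolding wm_zc by simp

lemma zc_iso: assumes M: "gr M" and N: "gr N" and iso: "!!i. riso Q (M i) (N i)" shows "D.iso (zc M) (zc N)" proof -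
 have "EX f g. f : rhm (M i) (N i) & g : rhm (N i) (M i) & g*f = rid (M i) & f*g = rid (N i)" for i using iso[of i] unfolding riso_def by blast
 then obtain f g where f: "!!i. f i : rhm (M i) (N i)" "!!i. g i : rhm (N i) (M i)" "!!i. g i*f i = rid (M i)" "!!i. f i*g i = rid (N i)" by metis
 have "g i v*f i v = E (fst (M i) v)" "f i v*g i v = E (fst (N i) v)" for i v
  using f(3)[of i] f(4)[of i] by (auto simp: rid_def dest: fun_cong[of _ _ v])
 then have "Wc (strict g) (strict f) = wid (zc M)" "Wc (strict f) (strict g) = wid (zc N)" unfolding strict_comp by (simp_all add: strict_def wid_def)
 then have "winverse (zc M) (zc N) (strict f) (strict g)" unfolding winverse_def using strict_wm_zc[of g N M, OF f(2)] by (simp add: hot_refl)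
 then show ?thesis unfolding iso_D using zc_complex[OF M] zc_complex[OF N] strict_wm_zc[of f M N, OF f(1)] by blast
qed

text \<open>A degreewise family of idempotents splits the complex into two, and in the derived
  category one part must be zero. For zero differentials a homotopy cannot change the vertex
  components, so a zero object is zero in every degree.\<close>

lemma zc_idempotents: fixes H :: "int => ('v, 'a, 'k::field) rep" assumes H: "gr H" and ind: "indecomposable DQ (zc H)"
  and e: "!!i. e i : rhm (H i) (H i)" "!!i. e i*e i = e i" shows "(ALL i. e i = 0) \<or> (ALL i. e i = rid (H i))" proof -
 have Hr: "H i : Rep" for i using H unfolding gr_def by blast
 have "EX A B j k p q. direct_sum Q (H i) A B j k p q & j*p = e i" for i by (rule split_rep[OF Hr e]) blast
 then obtain N N' s s' p p' where ds: "!!i. direct_sum Q (H i) (N i) (N' i) (s i) (s' i) (p i) (p' i)" and spe: "!!i. s i*p i = e i" by metis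
 note d = direct_sumD[OF ds]
 note N = d(1,3,4) spe d(7) and N' = d(2,5,6,11,8)
 have fin: "gr L" if L: "!!i. L i : Rep" "!!i. a i : rhm (L i) (H i)" "!!i. b i : rhm (H i) (L i)" "!!i. b i*a i = rid (L i)" for L a b proof -
  have dims: "fst (L i) v = 0" if "fst (H i) v = 0" for i v proof -
   have "b i v = 0" using rhom_HV[OF L(3), of i v] that HV_0r by simp
   then have "E (fst (L i) v) = (0 :: 'k lop)" using fun_cong[OF L(4), of i v] by (simp add: rid_def)
   then show ?thesis by simp
  qed
  have "fst (H i) v ~= 0" if "fst (L i) v ~= 0" for i v by (rule contrapos_nn[OF that dims])
  then have "{i. EX v. fst (L i) v ~= 0} <= {i. EX v. fst (H i) v ~= 0}" by (intro Collect_mono) blast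
  then show ?thesis using H L(1) finite_subset unfolding gr_def by blast
 qed
 have g: "gr N" by (rule fin[of N s p, OF N(1,2,3,5)])
 have g': "gr N'" by (rule fin[of N' s' p', OF N'(1,2,3,5)])
 note C = zc_complex[OF H] zc_complex[OF g] zc_complex[OF g']
 note w = strict_wm_zc[of s N H, OF N(2)] strict_wm_zc[of s' N' H, OF N'(2)] strict_wm_zc[of p H N, OF N(3)] strict_wm_zc[of p' H N', OF N'(3)]
 have 1: "Wc (strict p) (strict s) = wid (zc N)" "Wc (strict p') (strict s') = wid (zc N')"
  "Wc (strict p') (strict s) = w0" "Wc (strict p) (strict s') = w0" unfolding strict_comp using N(5) N'(5) d(9,10)
  by (auto simp: strict_def wid_def w0_def fun_eq_iff rid_def)
 have 2: "wadd (Wc (strict s) (strict p)) (Wc (strict s') (strict p')) = wid (zc H)" proof -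
  have "s i v*p i v + s' i v*p' i v = E (fst (H i) v)" for i v using fun_cong[OF d(11)[of i], of v] by (simp add: rid_def)
  then show ?thesis unfolding strict_comp by (simp add: wadd_def wid_def strict_def)
 qed
 have "is_direct_sum DQ (zc H) (zc N) (zc N')" unfolding is_direct_sum_def proof (intro bexI conjI)
  let ?i = "wk (zc N) (zc H) (strict s)" and ?j = "wk (zc N') (zc H) (strict s')"
  let ?p = "wk (zc H) (zc N) (strict p)" and ?q = "wk (zc H) (zc N') (strict p')"
  show "Cmp DQ ?p ?i = Idn DQ (zc N)" unfolding Cmp_D[OF C(2,1,2) w(1,3)] 1 Idn_D[OF C(2)] ..
  show "Cmp DQ ?q ?j = Idn DQ (zc N')" unfolding Cmp_D[OF C(3,1,3) w(2,4)] 1 Idn_D[OF C(3)] ..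
  show "Cmp DQ ?q ?i = Zer DQ (zc N) (zc N')" unfolding Cmp_D[OF C(2,1,3) w(1,4)] 1 Zer_D[OF C(2,3)] ..
  show "Cmp DQ ?p ?j = Zer DQ (zc N') (zc N)" unfolding Cmp_D[OF C(3,1,2) w(2,3)] 1 Zer_D[OF C(3,2)] ..
  show "Add DQ (Cmp DQ ?i ?p) (Cmp DQ ?j ?q) = Idn DQ (zc H)" unfolding Cmp_D[OF C(1,2,1) w(3,1)] Cmp_D[OF C(1,3,1) w(4,2)]
    Add_D[OF C(1,1) wm_comp[OF C(1,1) w(3,1)] wm_comp[OF C(1,1) w(4,2)]] 2 Idn_D[OF C(1)] ..
  show "?i : Hom DQ (zc N) (zc H)" "?j : Hom DQ (zc N') (zc H)" "?p : Hom DQ (zc H) (zc N)" "?q : Hom DQ (zc H) (zc N')"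
   by (rule Hom_D_wk[OF C(2,1) w(1)] Hom_D_wk[OF C(3,1) w(2)] Hom_D_wk[OF C(1,2) w(3)] Hom_D_wk[OF C(1,3) w(4)])+
 qed
 then have "zero_obj DQ (zc N) \<or> zero_obj DQ (zc N')" using ind C unfolding indecomposable_def by simp
 moreover have "rid (L i) = 0" if "gr L" "zero_obj DQ (zc L)" for L :: "int => ('v, 'a, 'k) rep" and i proof -
  note c = zc_complex[OF that(1)]
  have "Hot (zc L) (zc L) (wid (zc L)) w0" using that(2) unfolding zero_obj_def Idn_D[OF c] Zer_D[OF c c] wk_eq_iff[OF c c wid_wm[OF c] w0_wm] .
  then have "E (fst (L i) v) = (0 :: 'k lop)" for v unfolding hot_zc by (simp add: wid_def w0_def fun_eq_iff)
  then show ?thesis by (simp add: rid_def fun_eq_iff)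
 qed
 ultimately have "(ALL i. rid (N i) = 0) \<or> (ALL i. rid (N' i) = 0)" using g g' by blast
 then show ?thesis proof
  assume 0: "ALL i. rid (N i) = 0"
  have "e i = 0" for i proof -
   have "s i = 0" using rid_right[OF N(2)[of i]] 0 by simp
   then show ?thesis using N(4)[of i] by simp
  qed
  then show ?thesis by blast
 next
  assume 0: "ALL i. rid (N' i) = 0"
  have "e i = rid (H i)" for i proof -
   have "s' i = 0" using rid_right[OF N'(2)[of i]] 0 by simp
   then show ?thesis using d(11)[of i] spe by simp
  qed
  then show ?thesis by blast
 qed
qed

text \<open>The sign matters: M[n] sits in cohomological degree -n, because \<open>shift_cpx\<close>
  reads off the entry at \<open>i + 1\<close>.\<close>

definition stf :: "('v, 'a, 'k::field) rep => int => int => ('v, 'a, 'k) rep" where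
 "stf M n = (%i. if i = - n then M else zero_rep Q)"

text \<open>The stalk complex \<open>M[n]\<close>.\<close>

definition stk :: "('v, 'a, 'k::field) rep => int => ('v, 'a, 'k) cpx" where
 "stk M n = zc (stf M n)"

lemma zero_rep_simps [simp]: "fst (zero_rep Q) v = 0" "a : Q1 ==> ar (zero_rep Q) a = 0" by (simp_all add: zero_rep_def ar_def)

lemma zero_rep_reps: "zero_rep Q : Rep" by (auto simp: zero_rep_def reps_def)

lemma gr_stf: "M : Rep ==> gr (stf M n)" unfolding gr_def by (auto simp: stf_def zero_rep_reps intro: finite_subset[of _ "{- n}"])

lemma stk_complex: "M : Rep ==> stk M n : Cpx" unfolding stk_def by (rule zc_complex[OF gr_stf])

lemma stalk_stk: "stalk Q M = stk M 0" by (simp add: stalk_def stk_def zc_def stf_def Let_def)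

lemma shift_stk: fixes M :: "('v, 'a, 'k::field) rep" shows "shift_cpx (stk M n) = stk M (n+1)" proof -
 have "stf M n (i+1) = stf M (n+1) i" for i by (auto simp: stf_def)
 moreover have "- 0\<^sub>m a b = (0\<^sub>m a b :: 'k mat)" for a b by (rule eq_matI) auto
 ultimately show ?thesis by (simp add: shift_cpx_def stk_def zc_def fun_eq_iff)
qed

lemma riso_zero: "M : Rep ==> (!!v. fst M v = 0) ==> riso Q M (zero_rep Q)" unfolding riso_def by (intro bexI[of _ 0]) (auto simp: rid_def fun_eq_iff)

lemma stk_iso: "M : Rep ==> N : Rep ==> riso Q M N ==> D.iso (stk M n) (stk N n)"
 unfolding stk_def by (rule zc_iso[OF gr_stf gr_stf]) (auto simp: stf_def riso_refl zero_rep_reps)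

lemma stk_isoD: fixes M N :: "('v, 'a, 'k::field) rep" assumes iso: "D.iso (stk M m) (stk N n)" and M: "fst M v ~= 0" shows "m = n" "riso Q M N"
proof -
 obtain w t where w: "w : Wm (stk M m) (stk N n)" "t : Wm (stk N n) (stk M m)"
  "Hot (stk M m) (stk M m) (Wc t w) (wid (stk M m))" "Hot (stk N n) (stk N n) (Wc w t) (wid (stk N n))"
  using iso unfolding iso_D winverse_def by blast
 have r: "fst w i : rhm (stf M m i) (stf N n i)" "fst t i : rhm (stf N n i) (stf M m i)" for i using w(1,2) unfolding stk_def wm_zc by blast+
 have e: "fst t i v*fst w i v = E (fst (stf M m i) v)" "fst w i v*fst t i v = E (fst (stf N n i) v)" for i v
  using w(3,4) unfolding stk_def hot_zc by (auto simp: wc_def wid_def fun_eq_iff)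
 show mn: "m = n" proof (rule ccontr)
  assume "m ~= n"
  then have "fst w (- m) v : HV 0 (fst M v)" using rhom_HV[OF r(1), of "- m" v] by (simp add: stf_def)
  from HV_0l[OF this] have "E (fst M v) = (0 :: 'k lop)" using e(1)[of "- m" v] by (simp add: stf_def)
  then show False using M by simp
 qed
 show "riso Q M N" unfolding riso_def proof (intro bexI conjI)
  show "fst w (- m) : rhm M N" "fst t (- m) : rhm N M" using r[of "- m"] mn by (simp_all add: stf_def)
  show "fst t (- m)*fst w (- m) = rid M" "fst w (- m)*fst t (- m) = rid N" using e[of "- m"] mn by (simp_all add: stf_def rid_def fun_eq_iff)
 qed
qed

text \<open>\<open>X\<close> is isomorphic to its cohomology. The projection onto one nonzero degree
  is an idempotent family and hence the identity, so only that degree survives; idempotents inside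
  it give indecomposability of the representation.\<close>

lemma indecomposable_stk: fixes X :: "('v, 'a, 'k::field) cpx" assumes ind: "indecomposable DQ X"
 obtains M n where "rindec Q M" "D.iso X (stk M n)" proof -
 have X: "X : Cpx" using ind unfolding indecomposable_def by simp
 obtain H I P k where "mwe Q X H I P k" by (rule ex_mwe[OF X])
 note H = mwe.D[OF this]

 have iso: "D.iso X H" unfolding iso_D winverse_def using X H by blast
 define N where "N = fst H"
 have N: "H = zc N" "gr N" unfolding N_def using zero_differential_zc[OF H(1,2)] by simp_all
 have Nr: "N i : Rep" for i using N(2) unfolding gr_def by blast
 have indN: "indecomposable DQ (zc N)" using D.indecomposable_iso[OF iso ind] N(1) by simp
 note c = zc_complex[OF N(2)]
 have "EX i v. fst (N i) v ~= 0" proof (rule ccontr)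
  assume "~ (EX i v. fst (N i) v ~= 0)"
  then have "wid (zc N) = w0" by (simp add: wid_def w0_def)
  then have "zero_obj DQ (zc N)" unfolding zero_obj_def Idn_D[OF c] Zer_D[OF c c] by simp
  then show False using indN unfolding indecomposable_def by blast
 qed
 then obtain i v where iv: "fst (N i) v ~= 0" by blast
 define fam where "fam e = (%j. if j = i then e else (0 :: 'v => 'k lop))" for e
 have fam: "(ALL j. fam e j = 0) \<or> (ALL j. fam e j = rid (N j))" if "e : rhm (N i) (N i)" "e*e = e" for e
  by (rule zc_idempotents[OF N(2) indN]) (use that in \<open>auto simp: fam_def\<close>)
 have "rid (N i) ~= 0" using iv by (auto simp: rid_eq_0)
 have out: "fst (N j) u = 0" if "j ~= i" for j u proof -
  have "(ALL j. fam (rid (N i)) j = 0) \<or> (ALL j. fam (rid (N i)) j = rid (N j))" by (rule fam[OF rid_rhom[OF Nr]]) simp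
  moreover have "fam (rid (N i)) i ~= 0" using \<open>rid (N i) ~= 0\<close> by (simp add: fam_def)
  ultimately have "fam (rid (N i)) j = rid (N j)" by blast
  then have "rid (N j) = 0" using that by (simp add: fam_def)
  then show ?thesis unfolding rid_eq_0 by blast
 qed
 have ri: "rindec Q (N i)" unfolding rindec_def proof (intro conjI ballI impI)
  show "N i : Rep" by (rule Nr)
  show "EX v. fst (N i) v ~= 0" using iv by blast
  fix e assume e: "e : rhm (N i) (N i)" "e*e = e"
  show "e = 0 \<or> e = rid (N i)" using fam[OF e] unfolding fam_def by (metis (full_types))
 qed
 have "D.iso (zc N) (stk (N i) (- i))" unfolding stk_def proof (rule zc_iso[OF N(2) gr_stf[OF Nr]])
  show "riso Q (N j) (stf (N i) (- i) j)" for j by (cases "j = i") (simp_all add: stf_def riso_refl Nr riso_zero[OF Nr out])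
 qed
 then have "D.iso X (stk (N i) (- i))" using D.iso_trans[OF iso] N(1) by simp
 then show thesis by (rule that[OF ri])
qed

text \<open>A weak map has a component of degree 0 and one of degree -1. Between stalks these are
  the Hom and the Ext part, and both lack room unless the shifts agree or differ by one.\<close>

lemma Hom_stk_zero: assumes M: "M : Rep" and N: "N : Rep" and f: "D.arr f (stk M m) (stk N n)" and mn: "n - m ~: {0, 1}"
 shows "f = Zer DQ (stk M m) (stk N n)" proof -
 obtain w where w: "w : Wm (stk M m) (stk N n)" "f = wk (stk M m) (stk N n) w" by (rule arr_DE[OF f])
 note c = stk_complex[OF M, of m] stk_complex[OF N, of n]
 have "fst w i v = 0" for i v proof -
  have "fst w i : rhm (stf M m i) (stf N n i)" using w(1) unfolding stk_def wm_zc by blast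
  from rhom_HV[OF this] have "fst w i v : HV (fst (stf N n i) v) (fst (stf M m i) v)" .
  then show ?thesis using mn HV_0l HV_0r by (cases "i = - n"; cases "i = - m") (auto simp: stf_def)
 qed
 moreover have "snd w i a = 0" if "a : Q1" for i a proof -
  have "snd w i a : HV (fst (stf N n (i-1)) (hd a)) (fst (stf M m i) (tl a))" using w(1) that unfolding stk_def wm_zc by blast
  then show ?thesis using mn HV_0l HV_0r by (cases "i - 1 = - n"; cases "i = - m") (auto simp: stf_def)
 qed
 ultimately have "Hot (stk M m) (stk N n) w w0" by (intro hot_eqI) (simp_all add: w0_def)
 then show ?thesis unfolding w(2) Zer_D[OF c] by (rule wk_cong[OF c])
qed

lemma Hom_stk_Ext0: assumes M: "M : Rep" and N: "N : Rep" and f: "D.arr f (stk M m) (stk N (m+1))" and E: "Ext0 M N"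
 shows "f = Zer DQ (stk M m) (stk N (m+1))" proof -
 obtain w where w: "w : Wm (stk M m) (stk N (m+1))" "f = wk (stk M m) (stk N (m+1)) w" by (rule arr_DE[OF f])
 note c = stk_complex[OF M, of m] stk_complex[OF N, of "m + 1"]
 have f0: "fst w i v = 0" for i v proof -
  have "fst w i : rhm (stf M m i) (stf N (m+1) i)" using w(1) unfolding stk_def wm_zc by blast
  from rhom_HV[OF this] have "fst w i v : HV (fst (stf N (m+1) i) v) (fst (stf M m i) v)" .
  then show ?thesis using HV_0l HV_0r by (cases "i = - m") (auto simp: stf_def)
 qed
 have s: "snd w i a : HV (fst (stf N (m+1) (i-1)) (hd a)) (fst (stf M m i) (tl a))" if "a : Q1" for i a
  using w(1) that unfolding stk_def wm_zc by blast
 obtain h where h: "h : VH M N" "!!a. a : Q1 ==> snd w (- m) a = h (hd a)*ar M a - ar N a*h (tl a)"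
  by (rule Ext0E[OF E, of "snd w (- m)"]) (use s[of _ "- m"] in \<open>simp add: stf_def\<close>, rule that)
 have "Hot (stk M m) (stk N (m+1)) w w0" unfolding stk_def hot_zc proof (intro conjI exI[of _ "%i v. if i = - m then h v else 0"] allI ballI)
  show "fst w = fst w0" using f0 by (simp add: w0_def fun_eq_iff)
  show "(if i = - m then h v else 0) : HV (fst (stf N (m+1) (i-1)) v) (fst (stf M m i) v)" for i v using VH_at[OF h(1), of v] by (simp add: stf_def)
  fix i a assume a: "a : Q1"
  show "snd w i a - snd w0 i a = (if i = - m then h (hd a) else 0)*ar (stf M m i) a
    - ar (stf N (m+1) (i-1)) a*(if i = - m then h (tl a) else 0)"
   using h(2)[OF a] s[OF a, of i] HV_0r by (cases "i = - m") (auto simp: stf_def w0_def)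
 qed
 then show ?thesis unfolding w(2) Zer_D[OF c] by (rule wk_cong[OF c])
qed

lemma brick_stk: fixes M :: "('v, 'a, 'k::field) rep" assumes M: "M : Rep" "fst M u ~= 0" "!!f. f : rhm M M ==> EX c. f = (%v. sm c (rid M v))"
 shows "D.brick (stk M n)" unfolding D.brick_def proof (intro conjI allI impI)
 note c = stk_complex[OF M(1), of n]
 show "stk M n : Ob DQ" using c by simp
 show "Idn DQ (stk M n) ~= Zer DQ (stk M n) (stk M n)" proof
  assume "Idn DQ (stk M n) = Zer DQ (stk M n) (stk M n)"
  then have "Hot (stk M n) (stk M n) (wid (stk M n)) w0" unfolding Idn_D[OF c] Zer_D[OF c c] wk_eq_iff[OF c c wid_wm[OF c] w0_wm] .
  then have "E (fst (stf M n (- n)) u) = (0 :: 'k lop)" unfolding stk_def hot_zc by (simp add: wid_def w0_def fun_eq_iff)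
  then show False using M(2) by (simp add: stf_def)
 qed
 fix f assume "D.arr f (stk M n) (stk M n)"
 then obtain w where w: "w : Wm (stk M n) (stk M n)" "f = wk (stk M n) (stk M n) w" by (rule arr_DE)
 have r: "fst w i : rhm (stf M n i) (stf M n i)" for i using w(1) unfolding stk_def wm_zc by blast
 then have "fst w (- n) : rhm M M" using r[of "- n"] by (simp add: stf_def)
 then obtain z where z: "fst w (- n) = (%v. sm z (rid M v))" using M(3) by blast
 have "Hot (stk M n) (stk M n) w (wscl z (wid (stk M n)))" proof (rule hot_eqI)
  show "fst w i v = fst (wscl z (wid (stk M n))) i v" for i v
   using z HV_0l[of "fst w i v"] rhom_HV[OF r, of i v] by (cases "i = - n") (auto simp: stf_def wscl_def wid_def stk_def rid_def)
  show "snd w i a = snd (wscl z (wid (stk M n))) i a" if "a : Q1" for i a proof -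
   have "snd w i a : HV (fst (stf M n (i-1)) (hd a)) (fst (stf M n i) (tl a))" using w(1) that unfolding stk_def wm_zc by blast
   then have "snd w i a = 0" using HV_0l HV_0r by (cases "i = - n") (auto simp: stf_def)
   then show ?thesis by (simp add: wscl_def wid_def)
  qed
 qed
 then have "f = Scl DQ z (Idn DQ (stk M n))" unfolding w(2) Idn_D[OF c] Scl_D[OF c c wid_wm[OF c]] by (rule wk_cong[OF c c])
 then show "EX z. f = Scl DQ z (Idn DQ (stk M n))" by blast
qed

end

section \<open>Serre duality and the cluster category\<close>

context linear_category begin

lemma functional_zero: assumes "linear_functional C X Y l" "X : Ob C" "Y : Ob C" shows "l (Zer C X Y) = 0" proof -
 have "l (Scl C 0 (Zer C X Y)) = 0*l (Zer C X Y)" using assms(1) zer_hom[OF assms(2,3)] unfolding linear_functional_def by blast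
 then show ?thesis using arr_scl_zer[OF assms(2,3)] by simp
qed

text \<open>When Hom(X, Y) is zero, \<open>g\<close> and the zero morphism induce the same
  functional, and the functional determines the morphism.\<close>

lemma serre_vanish: assumes S: "serre_functor C (S, G)" and X: "X : Ob C" and Y: "Y : Ob C" and van: "!!f. arr f X Y ==> f = Zer C X Y"
  and g: "arr g Y (S X)" shows "g = Zer C Y (S X)" proof -
 obtain et :: "'o => 'o => 'm => 'm => 'k" where et: "ALL X:Ob C. ALL Y:Ob C.
     (ALL g:Hom C Y (S X). linear_functional C X Y (%f. et X Y f g)) &
     (ALL f:Hom C X Y. linear_functional C Y (S X) (et X Y f)) &
     (ALL l. linear_functional C X Y l --> (EX! g. g : Hom C Y (S X) & (ALL f:Hom C X Y. et X Y f g = l f)))"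
  using S unfolding serre_functor_def fst_conv by (elim conjE exE) (rule that)
 note SX = arr_ob(2)[OF g]
 have lf: "linear_functional C X Y (%f. et X Y f h)" if "h : Hom C Y (S X)" for h using et X Y that by blast
 have z: "et X Y f h = 0" if "f : Hom C X Y" "h : Hom C Y (S X)" for f h
  using functional_zero[OF lf[OF that(2)] X Y] van[of f] that X Y unfolding arr_def by simp
 have l0: "linear_functional C X Y (%f. 0)" unfolding linear_functional_def by simp
 have u: "EX! g. g : Hom C Y (S X) & (ALL f:Hom C X Y. et X Y f g = 0)" using et[rule_format, OF X Y] l0 by blast
 have "g : Hom C Y (S X)" "Zer C Y (S X) : Hom C Y (S X)" using g zer_hom[OF Y SX] unfolding arr_def by blast+
 then show ?thesis using u z by blast
qed

text \<open>Every functional on Hom(X, Y) is induced by some morphism from \<open>Y\<close> to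
  \<open>S X\<close>; if that morphism is zero, so is the functional.\<close>

lemma serre_vanish_functional:
 assumes S: "serre_functor C (S, G)" and X: "X : Ob C" and Y: "Y : Ob C" and van: "!!g. arr g Y (S X) ==> g = Zer C Y (S X)"
  and l: "linear_functional C X Y l" and f: "arr f X Y" and SX: "S X : Ob C" shows "l f = 0" proof -
 obtain et :: "'o => 'o => 'm => 'm => 'k" where et: "ALL X:Ob C. ALL Y:Ob C.
     (ALL g:Hom C Y (S X). linear_functional C X Y (%f. et X Y f g)) &
     (ALL f:Hom C X Y. linear_functional C Y (S X) (et X Y f)) &
     (ALL l. linear_functional C X Y l --> (EX! g. g : Hom C Y (S X) & (ALL f:Hom C X Y. et X Y f g = l f)))"
  using S unfolding serre_functor_def fst_conv by (elim conjE exE) (rule that)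
 have fh: "f : Hom C X Y" using f unfolding arr_def by blast
 have u: "EX! g. g : Hom C Y (S X) & (ALL f:Hom C X Y. et X Y f g = l f)" using et[rule_format, OF X Y] l by blast
 then obtain g where g: "g : Hom C Y (S X)" "et X Y f g = l f" using fh by blast
 have "g = Zer C Y (S X)" using van[of g] g(1) Y SX unfolding arr_def by blast
 moreover have "linear_functional C Y (S X) (et X Y f)" using et[rule_format, OF X Y] fh by blast
 ultimately show ?thesis using functional_zero[OF _ Y SX] g(2) by metis
qed

definition vanish where
 "vanish X Y <-> (ALL f. arr f X Y --> f = Zer C X Y)"

lemma vanish_iso: assumes "vanish X Y" "iso X X'" "iso Y Y'" shows "vanish X' Y'" unfolding vanish_def proof (intro allI impI)
 fix f assume f: "arr f X' Y'"
 obtain a b where a: "arr a X X'" "arr b X' X" "a ** b = Idn C X'" using assms(2) unfolding iso_def by blast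
 obtain c d where c: "arr c Y Y'" "arr d Y' Y" "c ** d = Idn C Y'" using assms(3) unfolding iso_def by blast
 note fa = arr_cmp[OF f a(1)]
 have "d ** (f ** a) = Zer C X Y" using assms(1) arr_cmp[OF c(2) fa] unfolding vanish_def by blast
 then have "(c ** (d ** (f ** a))) ** b = Zer C X' Y'" using zer_arr(2)[OF c(1) arr_ob(1)[OF a(1)]] zer_arr(1)[OF a(2) arr_ob(2)[OF f]] by simp
 moreover have "(c ** (d ** (f ** a))) ** b = f"
  unfolding assoc[OF c(1,2) fa, symmetric] c(3) id_arr(1)[OF fa] assoc[OF f a(1,2)] a(3) id_arr(2)[OF f] ..
 ultimately show "f = Zer C X' Y'" by simp
qed

lemma lauto_iso_reflect: assumes F: "lauto F G" and X: "X : Ob C" "Y : Ob C" and "iso (F X) (F Y)" shows "iso X Y"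
 using lauto_iso[OF lauto_inv[OF F] assms(4)] bij_betw_inv_into_left[OF lautoD(1)[OF F]] X by simp

end

text \<open>\<open>a\<close> climbs by 1 or 2, and \<open>b i\<close> marks that the step arriving
  at \<open>i\<close> is a double one. On its way from negative to positive values \<open>a\<close>
  either lands on 0 or jumps from -1 to 1, and these alternatives exclude each other.\<close>

lemma step_crossing: fixes a :: "int => int" assumes step: "!!i. a (i-1) = a i - (if b i then 2 else 1)"
 shows "i < j ==> a i + (j - i) <= a j" and "EX! i. a i = 0 \<or> a i = 1 & b i" proof -
 have mono: "a i + (j - i) <= a j" if "i < j" for i j using that proof (induction j rule: int_gr_induct)
  case base then show ?case using step[of "i + 1"] by (simp split: if_splits)
 next
  case (step j) then show ?case using assms[of "j + 1"] by (simp split: if_splits)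
 qed
 then show "i < j ==> a i + (j - i) <= a j" .
 \<comment> \<open>The slope is at least 1, so \<open>a\<close> is already negative here; searching
   upward from \<open>?m\<close> finds the first value that is at least 1.\<close>
 let ?m = "- \<bar>a 0\<bar> - 1"
 let ?P = "%k::nat. a (?m + int k) >= 1"
 have "a 0 + (\<bar>a 0\<bar> + 1 - 0) <= a (\<bar>a 0\<bar> + 1)" by (rule mono) simp
 then have "?P (nat (2*\<bar>a 0\<bar> + 2))" by (simp add: algebra_simps)
 then have P: "?P (LEAST k. ?P k)" by (rule LeastI)
 define k where "k = (LEAST k. ?P k)"
 have "a ?m + (0 - ?m) <= a 0" by (rule mono) simp
 then have "~ ?P 0" by simp
 then have "k ~= 0" using P unfolding k_def by metis
 then have "~ ?P (k-1)" using not_less_Least[of "k - 1" ?P] unfolding k_def by simp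
 moreover have "?m + int (k-1) = (?m + int k) - 1" using \<open>k ~= 0\<close> by simp
 ultimately have j: "a (?m + int k - 1) <= 0" "a (?m + int k) >= 1" using P unfolding k_def by simp_all
 define j where "j = ?m + int k"
 have j: "a (j-1) <= 0" "a j >= 1" using j unfolding j_def by simp_all
 have ex: "EX i. a i = 0 \<or> a i = 1 & b i" proof (cases "a j = 1 & b j")
  case False
  then have "a (j-1) = 0" using step[of j] j by (cases "b j") auto
  then show ?thesis by blast
 qed blast
 have no: False if "i < i'" "a i = 0 \<or> a i = 1 & b i" "a i' = 0 \<or> a i' = 1 & b i'" for i i' proof -
  have "a i < a i'" using mono[OF that(1)] that(1) by simp
  then have h: "a i = 0" "a i' = 1" "b i'" using that(2,3) by auto
  then have "a (i' - 1) = - 1" using step[of i'] by simp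
  moreover have "a i <= a (i' - 1)" using mono[of i "i' - 1"] that(1) by (cases "i = i' - 1") auto
  ultimately show False using h by simp
 qed
 show "EX! i. a i = 0 \<or> a i = 1 & b i" proof -
  obtain i where i: "a i = 0 \<or> a i = 1 & b i" using ex by blast
  show ?thesis proof (rule ex1I[of _ i])
   show "a i = 0 \<or> a i = 1 & b i" by (rule i)
   fix i' assume i': "a i' = 0 \<or> a i' = 1 & b i'"
   show "i' = i" using no[OF _ i i'] no[OF _ i' i] by (meson linorder_less_linear)
  qed
 qed
qed

context quiver begin

text \<open>A cocycle \<open>pz\<close> outside the image of \<open>cob\<close> is separated from it
  by a linear map. Since homotopies change the arrow component only by coboundaries, this descends
  to a functional on the derived Hom space.\<close>

lemma Ext_functional: fixes M N :: "('v, 'a, 'k::field) rep" assumes M: "M : Rep" and N: "N : Rep" and E: "~ Ext0 M N"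
 obtains l f where "linear_functional DQ (stk M m) (stk N (m+1)) l" "D.arr f (stk M m) (stk N (m+1))" "l f ~= 0" proof -
 let ?X = "stk M m" and ?Y = "stk N (m+1)"
 let ?S = "cob M N ` vhom M N"
 note X = stk_complex[OF M, of m] and Y = stk_complex[OF N, of "m + 1"]
 obtain pz where pz: "pz : ahom M N" "pz ~: ?S" using E Ext0_iff[OF M N] cob_ahom[OF M N] by blast
 have sub: "fam.subspace ?S" by (rule famp.linear_subspace_image[OF lin_cob subspace_vhom(1)])
 obtain B where B: "B <= ?S" "fam.independent B" "?S <= fam.span B" by (rule fam.basis_exists)
 have "pz ~: fam.span B" using fam.span_minimal[OF B(1) sub] pz(2) by blast
 then have i: "fam.independent (insert pz B)" "pz ~: B" using B(2) fam.independent_insertI fam.span_base by auto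
 obtain g :: "('a => 'k lop) => (unit => 'k lop)" where g: "lin g" "ALL x:insert pz B. g x = (if x = pz then (%_. E 1) else 0)"
  using famp.linear_independent_extend[OF i(1), of "%x. if x = pz then (%_. E 1) else 0"] by blast
 interpret g: Vector_Spaces.linear "%c f i. sm c (f i)" "%c f i. sm c (f i)" g by (rule g(1))
 have gS: "g x = 0" if "x : ?S" for x proof (rule g.eq_0_on_span[of B])
  show "g x = 0" if "x : B" for x using g(2) that i(2) by auto
  show "x : fam.span B" using that B(3) by blast
 qed
 define r where "r = (%w :: ('v, 'a, 'k) wmap. %a. if a : Q1 then snd w (- m) a else 0)"
 define lf where "lf = (%w. app (g (r w) ()) (uv 0) 0)"
 have hot: "lf w = lf w'" if ww': "Hot ?X ?Y w w'" for w w' proof -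
  obtain h where h: "!!i v. h i v : HV (fst (stf N (m+1) (i-1)) v) (fst (stf M m i) v)"
   "!!i a. a : Q1 ==> snd w i a - snd w' i a = h i (hd a)*ar (stf M m i) a - ar (stf N (m+1) (i-1)) a*h i (tl a)"
   using ww' unfolding stk_def hot_zc by blast
  have "h (- m) : vhom M N" unfolding vhom_iff[OF M N] using h(1)[of "- m"] by (simp add: stf_def)
  moreover have "r w - r w' = cob M N (h (- m))" using h(2)[of _ "- m"] by (auto simp: r_def cob_def stf_def fun_eq_iff)
  ultimately have "g (r w - r w') = 0" using gS by simp
  then show ?thesis unfolding lf_def g.diff by (simp add: fun_eq_iff)
 qed
 have add: "lf (wadd w w') = lf w + lf w'" for w w' proof -
  have "r (wadd w w') = r w + r w'" by (auto simp: r_def wadd_def)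
  then show ?thesis by (simp add: lf_def g.add)
 qed
 have scl: "lf (wscl c w) = c*lf w" for c w proof -
  have "r (wscl c w) = (%i. sm c (r w i))" by (auto simp: r_def wscl_def)
  then show ?thesis by (simp add: lf_def g.scale)
 qed
 \<comment> \<open>Any representing weak map gives the same value by \<open>hot\<close>, so the
   choice is immaterial.\<close>
 define l where "l = (%f. lf (SOME w. w : Wm ?X ?Y & f = wk ?X ?Y w))"
 have l: "l (wk ?X ?Y w) = lf w" if "w : Wm ?X ?Y" for w proof -
  have "EX w'. w' : Wm ?X ?Y & wk ?X ?Y w = wk ?X ?Y w'" using that by blast
  from someI_ex[OF this] have "Hot ?X ?Y w (SOME w'. w' : Wm ?X ?Y & wk ?X ?Y w = wk ?X ?Y w')" using wk_eq_iff[OF X Y that] by blast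
  from hot[OF this] show ?thesis unfolding l_def by simp
 qed
 have "linear_functional DQ ?X ?Y l" unfolding linear_functional_def proof (intro ballI allI)
  fix f f' a assume f: "f : Hom DQ ?X ?Y" and f': "f' : Hom DQ ?X ?Y"
  obtain w where w: "w : Wm ?X ?Y" "f = wk ?X ?Y w" by (rule Hom_DE[OF f X Y])
  obtain w' where w': "w' : Wm ?X ?Y" "f' = wk ?X ?Y w'" by (rule Hom_DE[OF f' X Y])
  show "l (Add DQ f f') = l f + l f' & l (Scl DQ a f) = a*l f"
   unfolding w(2) w'(2) Add_D[OF X Y w(1) w'(1)] Scl_D[OF X Y w(1)] l[OF w(1)] l[OF w'(1)] l[OF wadd_wm[OF w(1) w'(1)]] l[OF wscl_wm[OF w(1)]]
   using add scl by blast
 qed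
 moreover define w :: "('v, 'a, 'k) wmap" where "w = (%i v. 0, %i a. if i = - m then pz a else 0)"
 have w: "w : Wm ?X ?Y" unfolding stk_def wm_zc proof (intro conjI allI ballI)
  show "fst w i : rhm (stf M m i) (stf N (m+1) i)" for i unfolding w_def rhom_def by simp
  show "snd w i a : HV (fst (stf N (m+1) (i-1)) (hd a)) (fst (stf M m i) (tl a))" if "a : Q1" for i a
   using pz(1) that unfolding w_def ahom_def HVF_def by (auto simp: stf_def)
 qed
 have "r w = pz" using pz(1) unfolding r_def w_def ahom_def HVF_def by (auto simp: fun_eq_iff)
 then have "g (r w) = (%_. E 1)" using g(2) by simp
 then have "lf w = 1" unfolding lf_def by (simp add: app_E uv_def)
 then have "l (wk ?X ?Y w) ~= 0" using l[OF w] by simp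
 moreover have "D.arr (wk ?X ?Y w) ?X ?Y" unfolding D.arr_def using X Y Hom_D_wk[OF X Y w] by simp
 ultimately show thesis using that by blast
qed

definition ext_proj where
 "ext_proj M <-> (ALL N:Rep. Ext0 M N)"

lemma ext_projective_riso: assumes "riso Q M M'" "ext_proj M'" shows "ext_proj M" proof -
 obtain f g where f: "f : rhm M M'" "g : rhm M' M" "g*f = rid M" using assms(1) unfolding riso_def by blast
 show ?thesis unfolding ext_proj_def using Ext0_sub[OF _ f(1) rhom_VH[OF f(2)] f(3)] assms(2) unfolding ext_proj_def by blast
qed

end

section \<open>Degrees along orbits of the cluster functor\<close>

locale cluster = pos_quiver Q for Q :: "('v, 'a) pre_digraph" +
 fixes \<tau> :: "('v, 'a, 'k::alg_closed_field) D_functor" assumes AR: "AR_translation Q \<tau>"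
begin

abbreviation DC where "DC == derived_category Q :: (('v, 'a, 'k) cpx, ('v, 'a, 'k) D_mor, 'k) lincat"
abbreviation "tau == fst \<tau>"

lemma lauto_tau: "D.lauto tau (snd \<tau>)" using AR unfolding AR_translation_def D.lauto_def by simp

lemma serre: "serre_functor DC (shift_cpx \<circ> tau, shift_mor \<circ> snd \<tau>)" using AR unfolding AR_translation_def by blast

lemma lauto_serre: "D.lauto (shift_cpx \<circ> tau) (shift_mor \<circ> snd \<tau>)" using serre unfolding serre_functor_def D.lauto_def by blast

text \<open>\<open>[1]\<close> is the Serre functor followed by the inverse of \<open>\<tau>\<close>, hence an automorphism.\<close>

lemma lauto_shift: "D.lauto (shift_cpx :: ('v, 'a, 'k) cpx => _) shift_mor"
proof (rule D.lauto_cong[OF D.lauto_comp[OF lauto_serre D.lauto_inv[OF lauto_tau]]])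
 show "shift_cpx X = ((shift_cpx \<circ> tau) \<circ> inv_into (Ob DC) tau) X" if "X : Ob DC" for X
  using bij_betw_inv_into_right[OF D.lautoD(1)[OF lauto_tau] that] by simp
 show "shift_mor f = ((shift_mor \<circ> snd \<tau>) \<circ> inv_into (all_mors DC) (snd \<tau>)) f" if "f : all_mors DC" for f
  using bij_betw_inv_into_right[OF D.lauto_mors[OF lauto_tau] that] by simp
qed

lemma lauto_cluster: "D.lauto (fst (cluster_functor Q \<tau>)) (snd (cluster_functor Q \<tau>))"
 using D.lauto_comp[OF D.lauto_inv[OF lauto_tau] lauto_shift] by (simp add: cluster_functor_def)

sublocale O: orbit DC "fst (cluster_functor Q \<tau>)" "snd (cluster_functor Q \<tau>)" by unfold_locales (rule lauto_cluster)

lemma O_eq: "orbit_category DC (fst (cluster_functor Q \<tau>), snd (cluster_functor Q \<tau>)) = cluster_category Q \<tau>"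
 "functor_orbit DC (fst (cluster_functor Q \<tau>), snd (cluster_functor Q \<tau>)) = tilde Q \<tau>"
 by (simp_all add: cluster_category_def tilde_def)

lemma tau_F: "X : Cpx ==> tau (O.Fo 1 X) = shift_cpx X" unfolding O.Fo_def obj_pow_def unfolding cluster_functor_def
 using bij_betw_inv_into_right[OF D.lautoD(1)[OF lauto_tau]] D.lautoD(7)[OF lauto_shift] by simp

definition sits :: "('v, 'a, 'k) cpx => ('v, 'a, 'k) rep => int => bool" where
 "sits X M n <-> rindec Q M & D.iso X (stk M n)"

lemma rindecD: assumes "rindec Q M" shows "M : Rep" "EX v. fst M v ~= 0" using assms unfolding rindec_def by blast+

lemma brick_rindec: fixes M :: "('v, 'a, 'k) rep" assumes "rindec Q M" shows "D.brick (stk M n)" proof -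
 obtain v where "fst M v ~= 0" using rindecD(2)[OF assms] by blast
 from brick_stk[OF rindecD(1)[OF assms] this] show ?thesis using rindec_brick[OF assms] unfolding scalar_endos_def by blast
qed

lemma brick_sits: "D.brick X ==> EX M n. sits X M n" using indecomposable_stk[OF D.brick_indecomposable] unfolding sits_def by metis

lemma sits_brick: "sits X M n ==> D.brick X" unfolding sits_def using D.brick_iso[OF brick_rindec D.iso_sym] by blast

lemma indecomposable_brick: "indecomposable DC X <-> D.brick X" using indecomposable_stk sits_brick D.brick_indecomposable unfolding sits_def by metis

lemma sits_unique: assumes "sits X M n" "sits X' M' n'" "D.iso X X'" shows "n = n'" "riso Q M M'" proof -
 obtain v where v: "fst M v ~= 0" using assms(1) rindecD(2) unfolding sits_def by blast
 have "D.iso (stk M n) (stk M' n')" using assms D.iso_trans D.iso_sym unfolding sits_def by meson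
 from stk_isoD[OF this v] show "n = n'" "riso Q M M'" by blast+
qed

definition dg :: "('v, 'a, 'k) cpx => int" where "dg X = (SOME n. EX M. sits X M n)"
definition pj :: "('v, 'a, 'k) cpx => bool" where "pj X <-> (EX M n. sits X M n & ext_proj M)"

lemma sits_refl: assumes "sits X M n" shows "D.iso X X" using assms D.iso_refl D.iso_ob unfolding sits_def by blast

lemma dg_sits: assumes "sits X M n" shows "dg X = n" proof -
 have "EX M. sits X M (dg X)" unfolding dg_def by (rule someI[of _ n]) (use assms in blast)
 then show ?thesis using sits_unique(1)[OF _ assms sits_refl[OF assms]] by blast
qed

lemma pj_sits: assumes "sits X M n" shows "pj X <-> ext_proj M"
 unfolding pj_def using sits_unique(2)[OF assms _ sits_refl[OF assms]] ext_projective_riso assms by blast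

text \<open>SX is again a brick L[m]. If Hom(X, SX) were zero, duality would kill the identity of
  SX; so \<open>m\<close> is \<open>n\<close> or \<open>n + 1\<close>. For projective
  \<open>M\<close> the second case is excluded by vanishing Ext. Otherwise some \<open>N\<close> has
  a nonzero functional on Hom(M[n], N[n+1]), so Hom(N[n+1], SX) is nonzero and \<open>m = n\<close>
  is impossible.\<close>

lemma serre_sits: assumes X: "sits X M n" shows "dg (shift_cpx (tau X)) = (if ext_proj M then n else n + 1)" proof -
 let ?S = "shift_cpx \<circ> tau"
 note bX = sits_brick[OF X] and bS = D.lauto_brick[OF lauto_serre sits_brick[OF X]]
 obtain L m where L: "sits (?S X) L m" using brick_sits[OF bS] by blast
 have M: "rindec Q M" "M : Rep" "D.iso X (stk M n)" and Lr: "rindec Q L" "L : Rep" "D.iso (?S X) (stk L m)"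
  using X L rindecD(1) unfolding sits_def by blast+
 note oX = D.brickD(1)[OF bX] and oS = D.brickD(1)[OF bS]
 have nv: "~ D.vanish X (?S X)" proof
  assume "D.vanish X (?S X)"
  then have "f = Zer DC X (?S X)" if "D.arr f X (?S X)" for f using that unfolding D.vanish_def by blast
  from D.serre_vanish[OF serre oX oS this D.brickD(3)[OF bS]] show False using D.brickD(2)[OF bS] by blast
 qed
 then have nv: "~ D.vanish (stk M n) (stk L m)" using D.vanish_iso[OF _ D.iso_sym[OF M(3)] D.iso_sym[OF Lr(3)]] by blast
 have m: "m - n : {0, 1}" using nv Hom_stk_zero[OF M(2) Lr(2)] unfolding D.vanish_def by blast
 have "m = (if ext_proj M then n else n + 1)" proof (cases "ext_proj M")
  case True
  have "m ~= n + 1" proof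
   assume "m = n + 1"
   then show False using nv Hom_stk_Ext0[OF M(2) Lr(2)] True Lr(2) unfolding D.vanish_def ext_proj_def by blast
  qed
  then show ?thesis using m True by auto
 next
  case False
  then obtain N :: "('v, 'a, 'k) rep" where N: "N : Rep" "~ Ext0 M N" unfolding ext_proj_def by blast
  have "m ~= n" proof
   assume mn: "m = n"
   obtain l f where l: "linear_functional DC (stk M n) (stk N (n+1)) l" "D.arr f (stk M n) (stk N (n+1))" "l f ~= 0"
    by (rule Ext_functional[OF M(2) N])
   have oM: "stk M n : Ob DC" and oN: "stk N (n+1) : Ob DC" using stk_complex[OF M(2)] stk_complex[OF N(1)] by simp_all
   have "D.vanish (stk N (n+1)) (stk L m)" unfolding D.vanish_def using Hom_stk_zero[OF N(1) Lr(2), of _ "n + 1" m] mn by simp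
   moreover have "D.iso (stk L m) (?S (stk M n))" using D.iso_trans[OF D.iso_sym[OF Lr(3)] D.lauto_iso[OF lauto_serre M(3)]] .
   ultimately have "D.vanish (stk N (n+1)) (?S (stk M n))" using D.vanish_iso D.iso_refl[OF oN] by blast
   then have "g = Zer DC (stk N (n+1)) (?S (stk M n))" if "D.arr g (stk N (n+1)) (?S (stk M n))" for g using that unfolding D.vanish_def by blast
   from D.serre_vanish_functional[OF serre oM oN this l(1,2) D.lautoD(7)[OF lauto_serre oM]] l(3) show False by blast
  qed
  then show ?thesis using m False by auto
 qed
 then show ?thesis using dg_sits[OF L] by simp
qed

lemma sits_shift: assumes "sits X M n" shows "sits (shift_cpx X) M (n+1)"
 using assms D.lauto_iso[OF lauto_shift] shift_stk unfolding sits_def by metis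

text \<open>As F is the inverse of \<tau> after [1], the Serre functor takes FX to X[2]. Hence dg X
  + 2 equals the degree of FX if that is projective up to shift, and one more otherwise.\<close>

lemma dg_F: assumes X: "D.brick X" shows "dg X = dg (O.Fo 1 X) - (if pj (O.Fo 1 X) then 2 else 1)" proof -
 note oX = D.brickD(1)[OF X, unfolded Ob_D]
 obtain L m where L: "sits X L m" using brick_sits[OF X] by blast
 obtain M n where M: "sits (O.Fo 1 X) M n" using brick_sits[OF D.lauto_brick[OF O.lauto_F X]] by blast
 have "dg (shift_cpx (shift_cpx X)) = m + 2" using dg_sits[OF sits_shift[OF sits_shift[OF L]]] by simp
 moreover have "dg (shift_cpx (shift_cpx X)) = (if ext_proj M then n else n + 1)" using serre_sits[OF M] tau_F[OF oX] by simp
 ultimately show ?thesis using dg_sits[OF L] dg_sits[OF M] pj_sits[OF M] by (simp split: if_splits)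
qed

lemma brick_F: "D.brick X ==> D.brick (O.Fo i X)" by (rule D.lauto_brick[OF O.lauto_F])

lemma dg_step: assumes X: "D.brick X" shows "dg (O.Fo (i-1) X) = dg (O.Fo i X) - (if pj (O.Fo i X) then 2 else 1)"
 using dg_F[OF brick_F[OF X, of "i - 1"]] O.Fo_Fo[OF D.brickD(1)[OF X], of 1 "i - 1"] by simp

text \<open>The fundamental domain for F: representations in degree 0 and projectives in degree 1.
  With \<open>dg_step\<close>, the second case says that the degree jumps over 0 on arrival.\<close>

definition fund :: "('v, 'a, 'k) cpx => bool" where "fund X <-> dg X = 0 \<or> dg X = 1 & pj X"

lemma fund_unique: assumes "D.brick X" shows "EX! i. fund (O.Fo i X)" unfolding fund_def by (rule step_crossing(2)) (rule dg_step[OF assms])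

lemma dg_mono: assumes "D.brick X" "i > 0" shows "dg X < dg (O.Fo i X)"
 using step_crossing(1)[of "%i. dg (O.Fo i X)" "%i. pj (O.Fo i X)", OF dg_step[OF assms(1)] assms(2)] assms(2) by simp

text \<open>F strictly raises the degree, so such a morphism goes from M[n] to N[m] with
  \<open>m < n\<close>, where neither Hom nor Ext contributes.\<close>

lemma vanish_F: assumes X: "D.brick X" and i: "i > 0" and f: "D.arr f (O.Fo i X) X" shows "f = Zer DC (O.Fo i X) X" proof -
 obtain M n where M: "sits (O.Fo i X) M n" using brick_sits[OF brick_F[OF X]] by blast
 obtain N m where N: "sits X N m" using brick_sits[OF X] by blast
 have "m < n" using dg_mono[OF X i] dg_sits[OF M] dg_sits[OF N] by simp
 then have d: "m - n ~: {0, 1}" by simp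
 have MN: "M : Rep" "D.iso (O.Fo i X) (stk M n)" "N : Rep" "D.iso X (stk N m)" using M N rindecD(1) unfolding sits_def by blast+
 have "D.vanish (stk M n) (stk N m)" unfolding D.vanish_def using Hom_stk_zero[OF MN(1,3) _ d] by blast
 from D.vanish_iso[OF this D.iso_sym[OF MN(2)] D.iso_sym[OF MN(4)]] have "D.vanish (O.Fo i X) X" .
 then show ?thesis using f unfolding D.vanish_def by blast
qed

lemma tilde_rep: assumes "X : Cpx"
 obtains i where "rep_of (tilde Q \<tau> X) = O.Fo i X" using O.rep_of_orb[of X] assms unfolding O_eq by auto

lemma tilde_indecomposable: assumes X: "D.brick X" shows "indecomposable (cluster_category Q \<tau>) (tilde Q \<tau> X)" proof -
 note oX = D.brickD(1)[OF X]
 obtain i where i: "rep_of (tilde Q \<tau> X) = O.Fo i X" by (rule tilde_rep[OF oX[unfolded Ob_D]])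
 have b: "D.brick (rep_of (tilde Q \<tau> X))" unfolding i by (rule brick_F[OF X])
 show ?thesis using O.orbit_indecomposable[OF O.orb_ob[OF oX]] b vanish_F[OF b] unfolding O_eq by blast
qed

lemma tilde_iso_iff: assumes X: "D.brick X" and Y: "D.brick Y" shows "O.OC.iso (tilde Q \<tau> X) (tilde Q \<tau> Y) <-> (EX i. D.iso X (O.Fo i Y))"
proof
 note oX = D.brickD(1)[OF X] and oY = D.brickD(1)[OF Y]
 obtain i where i: "rep_of (tilde Q \<tau> X) = O.Fo i X" by (rule tilde_rep[OF oX[unfolded Ob_D]])
 obtain j where j: "rep_of (tilde Q \<tau> Y) = O.Fo j Y" by (rule tilde_rep[OF oY[unfolded Ob_D]])
 {
  assume iso: "O.OC.iso (tilde Q \<tau> X) (tilde Q \<tau> Y)"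
  obtain l where "D.iso (rep_of (tilde Q \<tau> X)) (O.Fo l (rep_of (tilde Q \<tau> Y)))"
   using O.orbit_iso_bricks[OF O.orb_ob[OF oX] O.orb_ob[OF oY]] iso brick_F[OF X, of i] brick_F[OF Y, of j] unfolding O_eq i j by blast
  then have "D.iso (O.Fo i X) (O.Fo i (O.Fo (- i + l + j) Y))" unfolding i j by (simp add: O.Fo_Fo[OF oY])
  from D.lauto_iso_reflect[OF O.lauto_F oX O.Fo_ob[OF oY] this] show "EX i. D.iso X (O.Fo i Y)" by blast
 }
 assume "EX i. D.iso X (O.Fo i Y)"
 then obtain l where l: "D.iso X (O.Fo l Y)" by blast
 from O.orb_iso[OF this] show "O.OC.iso (tilde Q \<tau> X) (tilde Q \<tau> Y)" unfolding O.orb_eq[OF oY] unfolding O_eq .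
qed

text \<open>An isomorphism of orbits makes \<open>X\<close> isomorphic to some power of F applied to
  \<open>Y\<close>. That object is then fundamental too, and uniqueness in the orbit of
  \<open>Y\<close> forces the power to be 0.\<close>

lemma fund_iso: assumes X: "sits X M n" "fund X" and Y: "sits Y N m" "fund Y"
 shows "O.OC.iso (tilde Q \<tau> X) (tilde Q \<tau> Y) <-> n = m & riso Q M N" proof
 note bX = sits_brick[OF X(1)] and bY = sits_brick[OF Y(1)]
 {
  assume "O.OC.iso (tilde Q \<tau> X) (tilde Q \<tau> Y)"
  then obtain i where i: "D.iso X (O.Fo i Y)" using tilde_iso_iff[OF bX bY] by blast
  then have a: "sits (O.Fo i Y) M n" using X(1) D.iso_trans D.iso_sym unfolding sits_def by blast
  have "fund (O.Fo i Y)" using X(2) dg_sits[OF a] dg_sits[OF X(1)] pj_sits[OF a] pj_sits[OF X(1)] unfolding fund_def by simp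
  moreover have "fund (O.Fo 0 Y)" using Y(2) by simp
  ultimately have "i = 0" using fund_unique[OF bY] by blast
  then show "n = m & riso Q M N" using sits_unique[OF X(1) Y(1)] i by simp
 }
 assume nm: "n = m & riso Q M N"
 have "D.iso (stk M n) (stk N n)" using nm X(1) Y(1) rindecD(1) unfolding sits_def by (intro stk_iso) blast+
 then have "D.iso X Y" using X(1) Y(1) nm D.iso_trans D.iso_sym unfolding sits_def by blast
 from O.orb_iso[OF this] show "O.OC.iso (tilde Q \<tau> X) (tilde Q \<tau> Y)" unfolding O_eq .
qed

lemma indecomposable_tilde: assumes U: "indecomposable (cluster_category Q \<tau>) U"
 obtains X where "D.brick X" "fund X" "U = tilde Q \<tau> X" proof -
 have ind: "D.brick (rep_of U)" using O.orbit_indecomposableD[of U] U unfolding O_eq indecomposable_brick by blast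
 have oU: "U : Ob (cluster_category Q \<tau>)" using U unfolding indecomposable_def by blast
 obtain i where i: "fund (O.Fo i (rep_of U))" using fund_unique[OF ind] by blast
 have "U = tilde Q \<tau> (O.Fo i (rep_of U))" using O.orb_eq[OF D.brickD(1)[OF ind], of i] O.orb_rep[of U] oU unfolding O_eq by simp
 then show thesis by (rule that[OF brick_F[OF ind] i])
qed

end

section \<open>Projective representations\<close>

lemma HV_one: assumes "f : HV 1 1" obtains c where "f = sm c (E 1)" proof -
 have "f = sm (app f (uv 0) 0) (rk1 (uv 0) 0)" using HV_expand[OF assms] by simp
 moreover have "E 1 = (rk1 (uv 0) 0 :: 'a lop)" using E_Suc[of 0] by simp
 ultimately show thesis using that by metis
qed

text \<open>For a generalised inverse \<open>g\<close>, the product \<open>f*g\<close> is a scalar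
  \<open>c\<close>, and \<open>f = c f\<close> with \<open>f\<close> nonzero gives
  \<open>c = 1\<close>.\<close>

lemma HV_row_section: assumes f: "f : HV 1 n" "f ~= 0"
 obtains g where "g : HV n 1" "f*g = E 1" proof -
 obtain g where g: "g : HV n 1" "f*(g*f) = f" by (rule gen_inverse[OF f(1)])
 obtain c where c: "f*g = sm c (E 1)" by (rule HV_one[OF HV_mult[OF f(1) g(1)]])
 have "f = (f*g)*f" using g(2) by (simp only: mult.assoc)
 then have fc: "f = sm c f" unfolding c using HVD(1)[OF f(1)] by simp
 have "c = 1" proof (rule ccontr)
  assume c1: "c ~= 1"
  have "sm (1 - c) f = 0" using fc sm_distrib(4)[of 1 c f] by simp
  then have "sm (inverse (1 - c)) (sm (1 - c) f) = 0" by simp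
  then show False using c1 f(2) by simp
 qed
 then show thesis using that[OF g(1)] c by simp
qed

lemma HV_one_idempotent: assumes e: "e : HV 1 1" "e*e = e" shows "e = 0 \<or> e = E 1" proof (cases "e = 0")
 case False
 obtain h where h: "h : HV 1 1" "e*h = E 1" by (rule HV_row_section[OF e(1) False])
 have "e*(e*h) = e*h" by (simp only: mult.assoc[symmetric] e(2))
 then show ?thesis unfolding h(2) using HVD(2)[OF e(1)] by simp
qed simp

context quiver begin

lemma rep_surj_iff: fixes M N :: "('v, 'a, 'k::field) rep" assumes f: "f : rep_maps Q M N"
 shows "rep_surj M N f <-> (EX p:VH N M. (%v. op (f v))*p = rid N)" proof
 have c: "f v : carrier_mat (fst N v) (fst M v)" for v using f unfolding rep_maps_def by blast
 {
  assume s: "rep_surj M N f"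
  have "EX g. g : HV (fst M v) (fst N v) & op (f v)*(g*op (f v)) = op (f v)" for v by (rule gen_inverse[OF op_carrier[OF c[of v]]]) blast
  then obtain g where g: "!!v. g v : HV (fst M v) (fst N v)" "!!v. op (f v)*(g v*op (f v)) = op (f v)" by metis
  have "op (f v)*g v = E (fst N v)" for v proof (rule lop_eqI)
   fix x :: "nat => 'k"
   have "app (E (fst N v)) (app (E (fst N v)) x) = app (E (fst N v)) x" by (metis E_idem app_times)
   then obtain y where y: "y : carrier_vec (fst N v)" "sq y = app (E (fst N v)) x" using sq_range by metis
   obtain u where u: "u : carrier_vec (fst M v)" "f v *\<^sub>v u = y" using s y(1) unfolding rep_surj_def by blast
   have yu: "sq y = app (op (f v)) (sq u)" using sq_mult_mat_vec[OF c u(1)] u(2) by simp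
   have "app (op (f v)*g v) x = app (op (f v)*(g v*E (fst N v))) x" using HVD(2)[OF g(1)] by simp
   also have "... = app (op (f v)*(g v*op (f v))) (sq u)" by (simp add: y(2)[symmetric] yu)
   also have "... = app (E (fst N v)) x" unfolding g(2) yu[symmetric] y(2) ..
   finally show "app (op (f v)*g v) x = app (E (fst N v)) x" .
  qed
  then show "EX p:VH N M. (%v. op (f v))*p = rid N" using g(1) by (intro bexI[of _ g]) (simp_all add: VH_def rid_def fun_eq_iff)
 }
 assume "EX p:VH N M. (%v. op (f v))*p = rid N"
 then obtain p where p: "p : VH N M" "!!v. op (f v)*p v = E (fst N v)" by (auto simp: rid_def fun_eq_iff)
 show "rep_surj M N f" unfolding rep_surj_def proof (intro allI ballI)
  fix v and y :: "'k vec" assume y: "y : carrier_vec (fst N v)"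
  have "app (E (fst M v)) (app (p v) (sq y)) = app (p v) (sq y)" using HVD(1)[OF VH_at[OF p(1)], of v] by (metis app_times)
  then obtain x where x: "x : carrier_vec (fst M v)" "sq x = app (p v) (sq y)" using sq_range by metis
  have "sq (f v *\<^sub>v x) = app (op (f v)*p v) (sq y)" using sq_mult_mat_vec[OF c x(1)] x(2) by simp
  also have "... = sq y" unfolding p(2) by (rule sq_carrier[OF y])
  finally have "f v *\<^sub>v x = y" using sq_inject[OF mult_mat_vec_carrier[OF c x(1)] y] by blast
  then show "EX x:carrier_vec (fst M v). f v *\<^sub>v x = y" using x(1) by blast
 qed
qed

text \<open>A vertexwise lift \<open>g\<close> fails to commute with arrows by a cocycle with values
  in the kernel \<open>K\<close> of \<open>p\<close>. Vanishing of Ext from \<open>P\<close> to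
  \<open>K\<close> provides the correction \<open>k*h\<close>.\<close>

lemma projective_lift: fixes P M N :: "('v, 'a, 'k::field) rep" assumes P: "P : Rep" "ext_proj P" and MN: "M : Rep" "N : Rep"
  and p: "p : rhm M N" "p' : VH N M" "p*p' = rid N" and f: "f : rhm P N"
 obtains g where "g : rhm P M" "p*g = f" proof -
 obtain K k k' where K: "K : Rep" "k : rhm K M" "k' : VH M K" "k'*k = rid K" "k*k' = rid M - p'*p" "p*k = 0" by (rule kernel_exists[OF MN p])
 have E: "Ext0 P K" using P(2) K(1) unfolding ext_proj_def by blast
 define g where "g = p'*f"
 have g: "g : VH P M" unfolding g_def by (rule VH_mult[OF p(2) rhom_VH[OF f]])
 define d where "d = (%a. ar M a*g (tl a) - g (hd a)*ar P a)"
 have d: "d a : HV (fst M (hd a)) (fst P (tl a))" if "a : Q1" for a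
  unfolding d_def by (rule HV_diff[OF HV_mult[OF ar_HV[OF MN(1) that] VH_at[OF g]] HV_mult[OF VH_at[OF g] ar_HV[OF P(1) that]]])
 obtain h where h: "h : VH P K" "!!a. a : Q1 ==> k' (hd a)*d a = h (hd a)*ar P a - ar K a*h (tl a)"
  by (rule Ext0E[OF E, of "%a. k' (hd a)*d a"]) (rule HV_mult[OF VH_at[OF K(3)] d], assumption, rule that)
 have pg: "p v*g v = f v" for v using fun_cong[OF p(3), of v] HVD(1)[OF rhom_HV[OF f], of v] by (simp add: g_def rid_def mult.assoc[symmetric])
 have kk: "k v*k' v = E (fst M v) - p' v*p v" for v using fun_cong[OF K(5), of v] by (simp add: rid_def)
 have pd: "p (hd a)*d a = 0" if "a : Q1" for a proof -
  have "p (hd a)*d a = (p (hd a)*ar M a)*g (tl a) - (p (hd a)*g (hd a))*ar P a" unfolding d_def by (simp add: right_diff_distrib mult.assoc)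
  also have "... = ar N a*(p (tl a)*g (tl a)) - f (hd a)*ar P a" unfolding rhom_ar[OF p(1) that] pg by (simp add: mult.assoc pg)
  also have "... = 0" unfolding pg rhom_ar[OF f that] by simp
  finally show ?thesis .
 qed
 have kd: "k (hd a)*(k' (hd a)*d a) = d a" if "a : Q1" for a
  unfolding mult.assoc[symmetric] kk left_diff_distrib HVD(1)[OF d[OF that]] by (simp add: mult.assoc pd[OF that])
 have "g + k*h : rhm P M" proof (rule rhomI)
  show "(g + k*h) v : HV (fst M v) (fst P v)" for v using VH_at[OF g, of v] HV_mult[OF rhom_HV[OF K(2)] VH_at[OF h(1)], of v] by auto
  fix a assume a: "a : Q1"
  have "k (hd a)*(h (hd a)*ar P a) - ar M a*(k (tl a)*h (tl a)) = d a" proof -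
   have "ar M a*(k (tl a)*h (tl a)) = k (hd a)*(ar K a*h (tl a))" by (simp add: mult.assoc[symmetric] rhom_ar[OF K(2) a])
   then show ?thesis using kd[OF a] unfolding h(2)[OF a] by (simp add: right_diff_distrib)
  qed
  then show "(g + k*h) (hd a)*ar P a = ar M a*(g + k*h) (tl a)" unfolding d_def by (simp add: distrib_left distrib_right mult.assoc algebra_simps)
 qed
 moreover have "p*(g + k*h) = f" proof
  fix v
  have "p v*(k v*h v) = 0" using fun_cong[OF K(6), of v] by (simp add: mult.assoc[symmetric])
  then show "(p*(g + k*h)) v = f v" using pg[of v] by (simp add: distrib_left)
 qed
 ultimately show thesis by (rule that)
qed

text \<open>One direction is \<open>projective_lift\<close>. For the other, lifting the identity of
  \<open>P\<close> along the extension built from a cocycle splits that extension and so exhibits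
  the cocycle as a coboundary.\<close>

lemma projective_rep_iff: fixes P :: "('v, 'a, 'k::field) rep" assumes P: "P : Rep" shows "projective_rep Q P <-> ext_proj P" proof
 assume E: "ext_proj P"
 show "projective_rep Q P" unfolding projective_rep_def proof (intro conjI ballI impI)
  show "P : Rep" by (rule P)
  fix M N :: "('v, 'a, 'k) rep" and p f
  assume MN: "M : Rep" "N : Rep" and p: "p : rep_maps Q M N" and f: "f : rep_maps Q P N" and s: "rep_surj M N p"
  obtain p' where p': "p' : VH N M" "(%v. op (p v))*p' = rid N" using s unfolding rep_surj_iff[OF p] by blast
  obtain g where g: "g : rhm P M" "(%v. op (p v))*g = (%v. op (f v))"
   by (rule projective_lift[OF P E MN rep_maps_op[OF MN p] p' rep_maps_op[OF P MN(2) f]])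
  have c: "p v : carrier_mat (fst N v) (fst M v)" "f v : carrier_mat (fst N v) (fst P v)" "mtf M P g v : carrier_mat (fst M v) (fst P v)" for v
   using p f unfolding rep_maps_def mtf_def by auto
  have "p v*mtf M P g v = f v" for v proof -
   have "op (p v*mtf M P g v) = op (f v)" unfolding op_times[OF c(1,3)] op_mtf[OF g(1)] using fun_cong[OF g(2), of v] by simp
   then show ?thesis using op_inject[OF mult_carrier_mat[OF c(1,3)] c(2)] by blast
  qed
  then show "EX g:rep_maps Q P M. (%v. p v*g v) = f" using mtf_maps[OF P MN(1) g(1)] by blast
 qed
next
 assume pr: "projective_rep Q P"
 show "ext_proj P" unfolding ext_proj_def proof
  fix N :: "('v, 'a, 'k) rep" assume N: "N : Rep"
  show "Ext0 P N" proof (rule Ext0I)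
   fix pz :: "'a => 'k lop" assume pz: "!!a. a : Q1 ==> pz a : HV (fst N (hd a)) (fst P (tl a))"
   obtain X s1 s2 p1 p2 where X: "X : Rep" "!!v. fst X v = fst N v + fst P v" "s1 : rhm N X" "p2 : rhm X P" "s2 : VH P X" "p1 : VH X N"
    "p1*s1 = rid N" "p2*s2 = rid P" "p1*s2 = 0" "p2*s1 = 0" "s1*p1 + s2*p2 = rid X"
    "!!a. a : Q1 ==> ar X a*s2 (tl a) = s1 (hd a)*pz a + s2 (hd a)*ar P a" "!!a. a : Q1 ==> p1 (hd a)*ar X a = pz a*p2 (tl a) + ar N a*p1 (tl a)"
    by (rule extension_exists[OF N P pz], assumption, rule that)
   let ?p = "mtf P X p2"
   have pm: "?p : rep_maps Q X P" by (rule mtf_maps[OF X(1) P X(4)])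
   have po: "(%v. op (?p v)) = p2" using op_mtf[OF X(4)] by (intro ext)
   have "rep_surj X P ?p" unfolding rep_surj_iff[OF pm] po using X(5,8) by blast
   moreover have im: "mtf P P (rid P) : rep_maps Q P P" by (rule mtf_maps[OF P P rid_rhom[OF P]])
   ultimately obtain g where g: "g : rep_maps Q P X" "(%v. ?p v*g v) = mtf P P (rid P)" using pr X(1) P pm unfolding projective_rep_def by blast
   let ?g = "%v. op (g v)"
   have gr: "?g : rhm P X" by (rule rep_maps_op[OF P X(1) g(1)])
   have c: "?p v : carrier_mat (fst P v) (fst X v)" "g v : carrier_mat (fst X v) (fst P v)" for v using pm g(1) unfolding rep_maps_def by blast+
   have pg: "p2 v*?g v = E (fst P v)" for v proof -
    have "op (?p v*g v) = op (mtf P P (rid P) v)" using fun_cong[OF g(2), of v] by simp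
    then show ?thesis unfolding op_times[OF c] op_mtf[OF X(4)] op_mtf[OF rid_rhom[OF P]] by (simp add: rid_def)
   qed
   show "EX h:VH P N. ALL a:Q1. pz a = h (hd a)*ar P a - ar N a*h (tl a)" proof (intro bexI ballI)
    show "p1*?g : VH P N" by (rule VH_mult[OF X(6) rhom_VH[OF gr]])
    fix a assume a: "a : Q1"
    have "p1 (hd a)*(?g (hd a)*ar P a) = (p1 (hd a)*ar X a)*?g (tl a)" unfolding rhom_ar[OF gr a] by (simp add: mult.assoc)
    also have "... = pz a*(p2 (tl a)*?g (tl a)) + ar N a*(p1 (tl a)*?g (tl a))" unfolding X(13)[OF a] by (simp add: distrib_right mult.assoc)
    also have "... = pz a + ar N a*(p1 (tl a)*?g (tl a))" unfolding pg HVD(2)[OF pz[OF a]] ..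
    finally show "pz a = (p1*?g) (hd a)*ar P a - ar N a*(p1*?g) (tl a)" by (simp add: mult.assoc)
   qed
  qed
 qed
qed

text \<open>The simple at \<open>i\<close> occurs in the top of \<open>P\<close>; by
  \<open>top_at_iff\<close> a nonzero component at \<open>i\<close> is the same as surjectivity onto
  the simple.\<close>

definition top_at where
 "top_at i P <-> (EX f:rhm P (simple_rep Q i). f i ~= 0)"

lemma simple_simps: "fst (simple_rep Q i) v = (if v = i then 1 else 0)" "a : Q1 ==> ar (simple_rep Q i) a = 0"
 by (simp_all add: simple_rep_def ar_def Let_def)

lemma simple_rep_reps: "i : Q0 ==> simple_rep Q i : Rep" by (auto simp: reps_def simple_rep_def Let_def)

lemma top_at_iff: fixes P :: "('v, 'a, 'k::field) rep" assumes P: "P : Rep" and i: "i : Q0"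
 shows "(EX f:rep_maps Q P (simple_rep Q i). rep_surj P (simple_rep Q i) f) <-> top_at i P" proof
 let ?S = "simple_rep Q i :: ('v, 'a, 'k) rep"
 note S = simple_rep_reps[OF i]
 {
  assume "EX f:rep_maps Q P ?S. rep_surj P ?S f"
  then obtain f where f: "f : rep_maps Q P ?S" "rep_surj P ?S f" by blast
  obtain p where p: "(%v. op (f v))*p = rid ?S" using f(2) unfolding rep_surj_iff[OF f(1)] by blast
  have "op (f i)*p i = E 1" using fun_cong[OF p, of i] by (simp add: rid_def simple_simps)
  then have "op (f i) ~= 0" by auto
  then show "top_at i P" unfolding top_at_def by (rule bexI[OF _ rep_maps_op[OF P S f(1)]])
 }
 assume "top_at i P"
 then obtain f where f: "f : rhm P ?S" "f i ~= 0" unfolding top_at_def by blast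
 have "f i : HV 1 (fst P i)" using rhom_HV[OF f(1), of i] by (simp add: simple_simps)
 then obtain g where g: "g : HV (fst P i) 1" "f i*g = E 1" using HV_row_section f(2) by metis
 let ?p = "%v. if v = i then g else 0"
 have p: "?p : VH ?S P" "f*?p = rid ?S" using g by (auto simp: VH_def simple_simps rid_def fun_eq_iff)
 let ?f = "mtf ?S P f"
 have m: "?f : rep_maps Q P ?S" by (rule mtf_maps[OF P S f(1)])
 have "(%v. op (?f v)) = f" using op_mtf[OF f(1)] by (intro ext)
 then have "rep_surj P ?S ?f" unfolding rep_surj_iff[OF m] using p by auto
 then show "EX f:rep_maps Q P ?S. rep_surj P ?S f" using m by blast
qed

lemma rhom_sum_simple: fixes P :: "('v, 'a, 'k::field) rep" assumes P: "P : Rep" and ij: "i : Q0" "j : Q0" "i ~= j" and top: "top_at i P" "top_at j P"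
 obtains S \<pi> \<pi>' f where "S : Rep" "\<pi> : rhm P S" "\<pi>' : VH S P" "\<pi>*\<pi>' = rid S" "f : rhm P S"
  "f i = \<pi> i" "\<pi> i ~= 0" "f j = 0" "\<pi> j ~= 0" proof -
 let ?d = "%v. if v = i \<or> v = j then 1 else 0"
 let ?S = "mkrep Q ?d (%a. 0 :: 'k lop)"
 have S: "?S : Rep" by (rule mkrep_reps) (use ij in auto)
 have ar: "ar ?S a = 0" if "a : Q1" for a by (rule ar_mkrep[OF that]) simp
 obtain f g where f: "f : rhm P (simple_rep Q i)" "f i ~= 0" and g: "g : rhm P (simple_rep Q j)" "g j ~= 0" using top unfolding top_at_def by blast
 have fv: "f v = 0" if "v ~= i" for v using rhom_HV[OF f(1), of v] that HV_0l by (simp add: simple_simps)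
 have gv: "g v = 0" if "v ~= j" for v using rhom_HV[OF g(1), of v] that HV_0l by (simp add: simple_simps)
 have fi: "f i : HV 1 (fst P i)" "g j : HV 1 (fst P j)" using rhom_HV[OF f(1), of i] rhom_HV[OF g(1), of j] by (simp_all add: simple_simps)
 have fr: "f : rhm P ?S" by (rule rhomI) (use fi fv ij(3) rhom_ar[OF f(1)] in \<open>auto simp: ar simple_simps\<close>)
 have gr: "g : rhm P ?S" by (rule rhomI) (use fi gv ij(3) rhom_ar[OF g(1)] in \<open>auto simp: ar simple_simps\<close>)
 obtain a where a: "a : HV (fst P i) 1" "f i*a = E 1" by (rule HV_row_section[OF fi(1) f(2)])
 obtain b where b: "b : HV (fst P j) 1" "g j*b = E 1" by (rule HV_row_section[OF fi(2) g(2)])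
 let ?p = "%v. if v = i then a else if v = j then b else 0"
 have p: "?p : VH ?S P" using a b by (auto simp: VH_def)
 have "(f + g)*?p = rid ?S" using a b ij(3) fv gv by (auto simp: fun_eq_iff rid_def)
 then show thesis by (rule that[OF S rhom_add[OF fr gr] p _ fr]) (use ij(3) fv gv f(2) g(2) in simp_all)
qed

end

section \<open>Indecomposable projectives and their tops\<close>

context pos_quiver begin

lemma indec_projective_at_iff: assumes "i : Q0" shows "is_indec_projective_at Q i P <-> rindec Q P & ext_proj P & top_at i P"
 unfolding is_indec_projective_at_def indec_rep_iff using projective_rep_iff[of P] top_at_iff[of P, OF _ assms] rindec_reps(1)[of P] by blast

text \<open>If two simples occurred, the projection of the top onto one of them would lift to an
  endomorphism of \<open>P\<close>, that is, a scalar. It would have to be 1 on the first simple and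
  0 on the second.\<close>

lemma top_at_unique: fixes P :: "('v, 'a, 'k::alg_closed_field) rep"
 assumes P: "rindec Q P" "ext_proj P" and ij: "i : Q0" "j : Q0" and top: "top_at i P" "top_at j P" shows "i = j" proof (rule ccontr)
 assume ne: "i ~= j"
 note Pr = rindec_reps(1)[OF P(1)]
 obtain S \<pi> \<pi>' f where S: "S : Rep" "\<pi> : rhm P S" "\<pi>' : VH S P" "\<pi>*\<pi>' = rid S" "f : rhm P S"
  "f i = \<pi> i" "\<pi> i ~= 0" "f j = 0" "\<pi> j ~= 0" by (rule rhom_sum_simple[OF Pr ij ne top])
 obtain g where g: "g : rhm P P" "\<pi>*g = f" by (rule projective_lift[OF Pr P(2) Pr S(1,2,3,4,5)])
 obtain c where c: "g = (%v. sm c (rid P v))" using rindec_brick[OF P(1)] g(1) unfolding scalar_endos_def by blast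
 have "f v = sm c (\<pi> v)" for v using fun_cong[OF g(2), of v] HVD(2)[OF rhom_HV[OF S(2)], of v] by (simp add: c rid_def)
 note fv = this
 have 1: "\<pi> i = sm c (\<pi> i)" using fv[of i] unfolding S(6) .
 have 0: "sm c (\<pi> j) = 0" using fv[of j] unfolding S(8) by (rule sym)
 have "c = 0" proof (rule ccontr)
  assume "c ~= 0"
  then have "\<pi> j = sm (inverse c) (sm c (\<pi> j))" by simp
  then show False using 0 S(9) by simp
 qed
 then show False using 1 S(7) by simp
qed

text \<open>Lifting the maps onto the simple against each other gives morphisms both ways. The
  composites are scalars compatible with a nonzero map to the simple, hence 1.\<close>

lemma projective_unique: fixes P P' :: "('v, 'a, 'k::alg_closed_field) rep"
 assumes P: "rindec Q P" "ext_proj P" and P': "rindec Q P'" "ext_proj P'" and i: "i : Q0" and top: "top_at i P" "top_at i P'" shows "riso Q P P'"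
proof -
 note Pr = rindec_reps(1)[OF P(1)] and Pr' = rindec_reps(1)[OF P'(1)]
 let ?S = "simple_rep Q i :: ('v, 'a, 'k) rep"
 note S = simple_rep_reps[OF i]
 have sec: "EX p:VH ?S R. f*p = rid ?S" if fR: "f : rhm R ?S" "f i ~= 0" for R :: "('v, 'a, 'k) rep" and f proof -
  have "f i : HV 1 (fst R i)" using rhom_HV[OF fR(1), of i] by (simp add: simple_simps)
  then obtain g where g: "g : HV (fst R i) 1" "f i*g = E 1" using HV_row_section fR(2) by metis
  then show ?thesis by (intro bexI[of _ "%v. if v = i then g else 0"]) (auto simp: VH_def simple_simps rid_def fun_eq_iff)
 qed
 obtain f f' where f: "f : rhm P ?S" "f i ~= 0" and f': "f' : rhm P' ?S" "f' i ~= 0" using top unfolding top_at_def by blast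
 obtain s where s: "s : VH ?S P" "f*s = rid ?S" using sec[OF f] by blast
 obtain s' where s': "s' : VH ?S P'" "f'*s' = rid ?S" using sec[OF f'] by blast
 obtain g where g: "g : rhm P P'" "f'*g = f" by (rule projective_lift[OF Pr P(2) Pr' S f'(1) s' f(1)])
 obtain g' where g': "g' : rhm P' P" "f*g' = f'" by (rule projective_lift[OF Pr' P'(2) Pr S f(1) s f'(1)])
 obtain c where c: "g'*g = (%v. sm c (rid P v))" using rindec_brick[OF P(1)] rhom_mult[OF g'(1) g(1)] unfolding scalar_endos_def by blast
 obtain d where d: "g*g' = (%v. sm d (rid P' v))" using rindec_brick[OF P'(1)] rhom_mult[OF g(1) g'(1)] unfolding scalar_endos_def by blast
 have ff: "f = f*(g'*g)" by (simp only: mult.assoc[symmetric] g'(2) g(2))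
 have fc: "f i = sm c (f i)" using fun_cong[OF ff, of i] unfolding c rid_def times_fun_apply sm_simps(2) HVD(2)[OF rhom_HV[OF f(1)]] .
 have ff': "f' = f'*(g*g')" by (simp only: mult.assoc[symmetric] g(2) g'(2))
 have fd: "f' i = sm d (f' i)" using fun_cong[OF ff', of i] unfolding d rid_def times_fun_apply sm_simps(2) HVD(2)[OF rhom_HV[OF f'(1)]] .
 have one: "b = 1" if "x = sm b x" "x ~= 0" for b and x :: "'k lop" proof (rule ccontr)
  assume b: "b ~= 1"
  have "sm (1 - b) x = 0" using that(1) sm_distrib(4)[of 1 b x] by simp
  then have "sm (inverse (1 - b)) (sm (1 - b) x) = 0" by simp
  then show False using b that(2) by simp
 qed
 have "g'*g = rid P" "g*g' = rid P'" using c d one[OF fc f(2)] one[OF fd f'(2)] by simp_all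
 then show ?thesis unfolding riso_def using g(1) g'(1) by blast
qed

text \<open>At a vertex \<open>i\<close> of the support that receives no arrow from the support,
  every incoming arrow acts as zero, so a coordinate functional at \<open>i\<close> is a morphism to
  the simple.\<close>

lemma top_exists: fixes P :: "('v, 'a, 'k::field) rep" assumes P: "P : Rep" "fst P u ~= 0"
 obtains i where "i : Q0" "top_at i P" proof -
 let ?C = "{v : Q0. fst P v ~= 0}"
 have "u : Q0" using P(2) dim_outside[OF P(1), of u] by (rule contrapos_np)
 then have C: "?C <= Q0" "?C ~= {}" using P(2) by auto
 obtain i where i: "i : ?C" "!!a. a : Q1 ==> hd a = i ==> tl a ~: ?C" by (rule source_in[OF C], rule that)
 let ?f = "%v. if v = i then E 1 else (0 :: 'k lop)"
 have "?f : rhm P (simple_rep Q i)" proof (rule rhomI)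
  have "(E 1 :: 'k lop) : HV 1 (fst P i)" using i(1) HV_mono[OF HV_E, of 1 1 "fst P i"] by auto
  then show "?f v : HV (fst (simple_rep Q i) v) (fst P v)" for v by (simp add: simple_simps)
  fix a assume a: "a : Q1"
  have "ar P a = 0" if "hd a = i" proof -
   have "fst P (tl a) = 0" using i(2)[OF a that] a by simp
   then show ?thesis using ar_HV[OF P(1) a] HV_0r by metis
  qed
  then show "?f (hd a)*ar P a = ar (simple_rep Q i) a*?f (tl a)" using a by (simp add: simple_simps)
 qed
 then have "top_at i P" unfolding top_at_def by (intro bexI[of _ ?f]) simp_all
 then show thesis using that i(1) by blast
qed

text \<open>In general P_i has the paths starting at \<open>i\<close> as basis. Here the reachable
  vertices \<open>R\<close> form a rooted tree, so P_i is one-dimensional on \<open>R\<close> with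
  identity arrows. Projectivity follows from the Euler form.\<close>

lemma projective_exists: assumes i: "i : Q0"
 obtains P :: "('v, 'a, 'k::field) rep" where "rindec Q P" "ext_proj P" "top_at i P" proof -
 define R where "R = {v. (i, v) : {(tl a, hd a) | a. a : Q1}\<^sup>*}"
 have iR: "i : R" by (simp add: R_def)
 have cl: "hd a : R" if "a : Q1" "tl a : R" for a using that unfolding R_def by (auto intro: rtrancl_into_rtrancl)
 have ind: "v : R ==> ph i ==> (!!a. a : Q1 ==> tl a : R ==> ph (tl a) ==> ph (hd a)) ==> ph v" for ph v proof -
  assume v: "v : R" and ph: "ph i" "!!a. a : Q1 ==> tl a : R ==> ph (tl a) ==> ph (hd a)"
  have "(i, v) : {(tl a, hd a) | a. a : Q1}\<^sup>*" using v by (simp add: R_def)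
  then show "ph v" proof (induction rule: rtrancl_induct)
   case (step y z) then show ?case using ph(2) unfolding R_def by auto
  qed (rule ph(1))
 qed
 have RV: "R <= Q0" proof
  fix v assume "v : R" then show "v : Q0" by (rule ind[of v "%v. v : Q0"]) (use i in auto)
 qed
 have fR: "finite R" using RV finite_subset finite_verts by blast
 let ?A = "{a : Q1. tl a : R & hd a : R}"
 have fA: "finite ?A" by simp
 have "ALL v:R - {i}. EX a. a : ?A & hd a = v" using ind[of _ "%v. v = i \<or> (EX a. a : ?A & hd a = v)"] cl by blast
 from bchoice[OF this] obtain g where g: "!!v. v : R - {i} ==> g v : ?A & head Q (g v) = v" by blast
 have gi: "inj_on g (R - {i})" by (rule inj_onI) (metis g)
 \<comment> \<open>Reachability gives each vertex of \<open>R\<close> other than \<open>i\<close> an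
   incoming arrow from \<open>R\<close>, and positivity allows at most \<open>card R - 1\<close>
   arrows inside \<open>R\<close>. So these chosen arrows are all of them.\<close>
 have "card (R - {i}) = card R - 1" using iR by simp
 moreover have "card ?A <= card R - 1" using arcs_within_less[OF RV] iR by force
 moreover have sub: "g ` (R - {i}) <= ?A" using g by blast
 ultimately have gA: "g ` (R - {i}) = ?A" using card_seteq[OF fA sub] card_image[OF gi] by simp
 have arc: "hd a ~= i & a = g (hd a)" if "a : Q1" "tl a : R" for a proof -
  have "a : g ` (R - {i})" unfolding gA using that cl by blast
  then obtain v where v: "v : R - {i}" "a = g v" by blast
  then show ?thesis using g[OF v(1)] by auto
 qed
 let ?d = "%v. if v : R then 1 else 0"
 let ?r = "%a. if tl a : R then E 1 else (0 :: 'k lop)"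
 define P :: "('v, 'a, 'k) rep" where "P = mkrep Q ?d ?r"
 have P: "P : Rep" unfolding P_def by (rule mkrep_reps) (use RV in auto)
 have dP: "fst P v = ?d v" for v by (simp add: P_def)
 have ar: "ar P a = ?r a" if "a : Q1" for a unfolding P_def by (rule ar_mkrep[OF that]) (use cl[OF that] in auto)
 have ri: "rindec Q P" unfolding rindec_def proof (intro conjI ballI impI)
  show "P : Rep" by (rule P)
  show "EX v. fst P v ~= 0" using iR by (intro exI[of _ i]) (simp add: dP)
  fix e assume e: "e : rhm P P" "e*e = e"
  have eH: "e v : HV (?d v) (?d v)" for v using rhom_HV[OF e(1), of v] by (simp add: dP)
  have const: "e v = e i" if "v : R" for v proof (rule ind[OF that, of "%v. e v = e i"])
   fix a assume a: "a : Q1" "tl a : R" "e (tl a) = e i"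
   have "e (hd a)*E 1 = E 1*e (tl a)" using rhom_ar[OF e(1) a(1)] ar[OF a(1)] a(2) by simp
   moreover have "e (hd a) : HV 1 1" "e (tl a) : HV 1 1" using eH[of "hd a"] eH[of "tl a"] a(2) cl[OF a(1,2)] by simp_all
   ultimately show "e (hd a) = e i" using HVD(1,2) a(3) by metis
  qed simp
  have out: "e v = 0" if "v ~: R" for v using eH[of v] that HV_0l by simp
  have "e i : HV 1 1" using eH[of i] iR by simp
  moreover have "e i*e i = e i" using fun_cong[OF e(2), of i] by simp
  ultimately have "e i = 0 \<or> e i = E 1" by (rule HV_one_idempotent)
  then show "e = 0 \<or> e = rid P" proof
   assume "e i = 0" then show ?thesis using const out by (auto simp: fun_eq_iff)
  next
   assume "e i = E 1"
   then have "e v = rid P v" for v using const[of v] out[of v] by (simp add: rid_def dP)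
   then show ?thesis by blast
  qed
 qed
 have top: "top_at i P" unfolding top_at_def proof (intro bexI[of _ "%v. if v = i then E 1 else (0 :: 'k lop)"])
  let ?f = "%v. if v = i then E 1 else (0 :: 'k lop)"
  show "?f i ~= 0" by simp
  show "?f : rhm P (simple_rep Q i)" proof (rule rhomI)
   show "?f v : HV (fst (simple_rep Q i) v) (fst P v)" for v using iR by (simp add: simple_simps dP)
   show "?f (hd a)*ar P a = ar (simple_rep Q i) a*?f (tl a)" if "a : Q1" for a using arc[OF that] ar[OF that] that by (simp add: simple_simps)
  qed
 qed
 have "ext_proj P" unfolding ext_proj_def proof
  fix N :: "('v, 'a, 'k) rep" assume N: "N : Rep"
  let ?F = "%f v. if v = i then f v else (0 :: 'k lop)" and ?T = "HVF {i} (fst N) (%_. 1) :: ('v => 'k lop) set"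
  \<comment> \<open>A morphism from \<open>P\<close> is determined by its value at the root
    \<open>i\<close>, which bounds \<open>hom P N\<close> by the dimension of \<open>N\<close> at
    \<open>i\<close>. The Euler form has exactly this value, so \<open>ext P N\<close> is
    zero.\<close>
  have "fam.dim (rhm P N) <= fam.dim ?T" proof (rule dim_le_of_inj[of ?F])
   show "lin ?F" by (rule linI) (auto simp: fun_eq_iff)
   show "?F ` rhm P N <= ?T" using rhom_HV[of _ Q P N i] iR by (auto simp: HVF_def dP)
   fix f assume f: "f : rhm P N" "?F f = 0"
   have fH: "f v : HV (fst N v) (?d v)" for v using rhom_HV[OF f(1), of v] by (simp add: dP)
   have "f v = 0" if "v : R" for v proof (rule ind[OF that, of "%v. f v = 0"])
    show "f i = 0" using fun_cong[OF f(2), of i] by simp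
    fix a assume a: "a : Q1" "tl a : R" "f (tl a) = 0"
    then show "f (hd a) = 0" using rhom_ar[OF f(1) a(1)] ar[OF a(1)] HVD(2)[OF fH, of "hd a"] cl[OF a(1,2)] by simp
   qed
   moreover have "f v = 0" if "v ~: R" for v using fH[of v] that HV_0r by simp
   ultimately show "f = 0" by (auto simp: fun_eq_iff)
  qed (rule subspace_rhom findim_rhom[OF P N] dim_HVF; simp)+
  then have "hom P N <= fst N i" by (simp add: hom_def dim_HVF)
  moreover have "eform (dv P) (dv N) = int (fst N i)" proof -
   have "(\<Sum>v\<in>Q0. dv P v*dv N v) = (\<Sum>v\<in>R. dv N v)"
    by (rule sum.mono_neutral_cong_right) (use RV in \<open>auto simp: dv_def dP\<close>)
   also have "... = dv N i + (\<Sum>v\<in>R - {i}. dv N v)" by (rule sum.remove[OF fR iR])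
   also have "(\<Sum>v\<in>R - {i}. dv N v) = (\<Sum>a\<in>?A. dv N (hd a))"
    unfolding gA[symmetric] sum.reindex[OF gi] using g by (intro sum.cong) auto
   also have "... = (\<Sum>a\<in>Q1. dv P (tl a)*dv N (hd a))" by (rule sum.mono_neutral_cong_left) (use cl in \<open>auto simp: dv_def dP\<close>)
   finally show ?thesis by (simp add: eform_def dv_def)
  qed
  ultimately have "ext P N = 0" using euler_form[OF P N] by simp
  then show "Ext0 P N" using ext_eq_0_iff[OF P N] by simp
 qed
 with ri show thesis using top by (rule that)
qed

end

section \<open>Decorated representations\<close>

context quiver begin

lemma rindec_idempotent: "rindec R M ==> e : rhom R M M ==> e*e = e ==> e = 0 \<or> e = rid M" unfolding rindec_def by blast

abbreviation "QD == decorated_quiver Q"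

lemma decorated_simps [simp]: "arcs QD = Q1" "tail QD a = Inl (tl a)" "head QD a = Inl (hd a)"
 "Inl v : verts QD <-> v : Q0" "Inr v : verts QD <-> v : Q0" by (auto simp: decorated_quiver_def)

lemma as_decorated_simps [simp]: "fst (as_decorated M) = case_sum (fst M) (%_. 0)" "ar (as_decorated M) a = ar M a"
 by (simp_all add: as_decorated_def ar_def)

lemma decorated_reps: "N : reps QD <-> (ALL v. v ~: Q0 --> fst N (Inl v) = 0 & fst N (Inr v) = 0) & snd N : extensional (Q1) &
  (ALL a:Q1. snd N a : carrier_mat (fst N (Inl (hd a))) (fst N (Inl (tl a))))" unfolding reps_def by (auto simp: split_sum_all)

lemma as_decorated_reps: "M : Rep ==> as_decorated M : reps QD" unfolding decorated_reps by (auto simp: reps_def as_decorated_def)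

lemma decorated_rhom: "f : rhm M N ==> case_sum f (%_. 0) : rhom QD (as_decorated M) (as_decorated N)"
 by (rule rhomI) (auto simp: rhom_HV rhom_ar split: sum.split)

lemma decorated_rhomD: assumes "f : rhom QD (as_decorated M) (as_decorated N)" shows "f \<circ> Inl : rhm M N" "f (Inr v) = 0" proof -
 show "f \<circ> Inl : rhm M N" by (rule rhomI) (use rhom_HV[OF assms, of "Inl _"] rhom_ar[OF assms] in auto)
 show "f (Inr v) = 0" using rhom_HV[OF assms, of "Inr v"] HV_0l by simp
qed

lemma sum_fun_eqI: "(!!v. f (Inl v) = g (Inl v)) ==> (!!v. f (Inr v) = g (Inr v)) ==> f = g" by (rule ext) (metis sum.exhaust)

lemma as_decorated_riso: "riso QD (as_decorated M) (as_decorated N) <-> riso Q M N" proof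
 assume "riso QD (as_decorated M) (as_decorated N)"
 then obtain f g where f: "f : rhom QD (as_decorated M) (as_decorated N)" "g : rhom QD (as_decorated N) (as_decorated M)"
  "g*f = rid (as_decorated M)" "f*g = rid (as_decorated N)" unfolding riso_def by blast
 show "riso Q M N" unfolding riso_def proof (intro bexI conjI)
  show "f \<circ> Inl : rhm M N" "g \<circ> Inl : rhm N M" by (rule decorated_rhomD(1)[OF f(1)] decorated_rhomD(1)[OF f(2)])+
  show "(g \<circ> Inl)*(f \<circ> Inl) = rid M" using fun_cong[OF f(3), of "Inl _"] by (simp add: fun_eq_iff rid_def)
  show "(f \<circ> Inl)*(g \<circ> Inl) = rid N" using fun_cong[OF f(4), of "Inl _"] by (simp add: fun_eq_iff rid_def)
 qed
next
 assume "riso Q M N"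
 then obtain f g where f: "f : rhm M N" "g : rhm N M" "g*f = rid M" "f*g = rid N" unfolding riso_def by blast
 show "riso QD (as_decorated M) (as_decorated N)" unfolding riso_def proof (intro bexI conjI)
  show "case_sum f (%_. 0) : rhom QD (as_decorated M) (as_decorated N)" "case_sum g (%_. 0) : rhom QD (as_decorated N) (as_decorated M)"
   by (rule decorated_rhom[OF f(1)] decorated_rhom[OF f(2)])+
  show "case_sum g (%_. 0)*case_sum f (%_. 0) = rid (as_decorated M)"
   by (rule sum_fun_eqI) (use fun_cong[OF f(3)] in \<open>simp_all add: rid_def\<close>)
  show "case_sum f (%_. 0)*case_sum g (%_. 0) = rid (as_decorated N)"
   by (rule sum_fun_eqI) (use fun_cong[OF f(4)] in \<open>simp_all add: rid_def\<close>)
 qed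
qed

lemma as_decorated_rindec: "rindec QD (as_decorated M) <-> rindec Q M" if "M : Rep" proof
 assume R: "rindec Q M"
 show "rindec QD (as_decorated M)" unfolding rindec_def proof (intro conjI ballI impI)
  show "as_decorated M : reps QD" by (rule as_decorated_reps[OF that])
  obtain v where "fst M v ~= 0" using R unfolding rindec_def by blast
  then show "EX v. fst (as_decorated M) v ~= 0" by (intro exI[of _ "Inl v"]) simp
  fix e assume e: "e : rhom QD (as_decorated M) (as_decorated M)" "e*e = e"
  note d = decorated_rhomD[OF e(1)]
  have "(e \<circ> Inl)*(e \<circ> Inl) = e \<circ> Inl" using fun_cong[OF e(2), of "Inl _"] by (simp add: fun_eq_iff)
  then have "e \<circ> Inl = 0 \<or> e \<circ> Inl = rid M" using R d(1) unfolding rindec_def by blast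
  then show "e = 0 \<or> e = rid (as_decorated M)" proof
   assume "e \<circ> Inl = 0"
   then have "e = 0" by (intro sum_fun_eqI) (simp_all add: d(2) fun_eq_iff)
   then show ?thesis ..
  next
   assume "e \<circ> Inl = rid M"
   then have "e = rid (as_decorated M)" by (intro sum_fun_eqI) (simp_all add: d(2) fun_eq_iff rid_def)
   then show ?thesis ..
  qed
 qed
next
 assume R: "rindec QD (as_decorated M)"
 show "rindec Q M" unfolding rindec_def proof (intro conjI ballI impI)
  show "M : Rep" by (rule that)
  obtain u where "fst (as_decorated M) u ~= 0" using R unfolding rindec_def by blast
  then show "EX v. fst M v ~= 0" by (cases u) auto
  fix e assume e: "e : rhm M M" "e*e = e"
  have "case_sum e (%_ :: 'v. 0)*case_sum e (%_. 0) = case_sum e (%_. 0)" by (rule sum_fun_eqI) (use fun_cong[OF e(2)] in simp_all)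
  with decorated_rhom[OF e(1)] have "case_sum e (%_ :: 'v. 0) = 0 \<or> case_sum e (%_. 0) = rid (as_decorated M)" by (rule rindec_idempotent[OF R])
  then show "e = 0 \<or> e = rid M" proof
   assume z: "case_sum e (%_ :: 'v. 0) = 0"
   have "e v = 0" for v using fun_cong[OF z, of "Inl v"] by simp
   then show ?thesis by (simp add: fun_eq_iff)
  next
   assume z: "case_sum e (%_. 0) = rid (as_decorated M)"
   have "e v = rid M v" for v using fun_cong[OF z, of "Inl v"] by (simp add: rid_def)
   then show ?thesis by (simp add: fun_eq_iff)
  qed
 qed
qed

lemma neg_simps: "fst (neg_simple Q i) v = (if v = Inr i then 1 else 0)" "a : Q1 ==> ar (neg_simple Q i) a = 0"
 by (simp_all add: neg_simple_def simple_rep_def ar_def Let_def)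

lemma neg_simple_reps: "i : Q0 ==> neg_simple Q i : reps QD"
 unfolding decorated_reps by (auto simp: neg_simps) (auto simp: neg_simple_def simple_rep_def Let_def)

lemma neg_simple_rindec: assumes "i : Q0" shows "rindec QD (neg_simple Q i :: ('v + 'v, 'a, 'k::field) rep)" unfolding rindec_def
proof (intro conjI ballI impI)
 let ?S = "neg_simple Q i :: ('v + 'v, 'a, 'k) rep"
 show "?S : reps QD" by (rule neg_simple_reps[OF assms])
 show "EX v. fst ?S v ~= 0" by (intro exI[of _ "Inr i"]) (simp add: neg_simps)
 fix e assume e: "e : rhom QD ?S ?S" "e*e = e"
 have "e (Inr i) : HV 1 1" using rhom_HV[OF e(1), of "Inr i"] by (simp add: neg_simps)
 moreover have "e (Inr i)*e (Inr i) = e (Inr i)" using fun_cong[OF e(2), of "Inr i"] by simp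
 ultimately have "e (Inr i) = 0 \<or> e (Inr i) = E 1" by (rule HV_one_idempotent)
 moreover have "e v = 0" if "v ~= Inr i" for v using rhom_HV[OF e(1), of v] that HV_0l by (simp add: neg_simps)
 ultimately show "e = 0 \<or> e = rid ?S" by (elim disjE) (auto simp: fun_eq_iff rid_def neg_simps, metis)
qed

text \<open>No arrow meets a new vertex, so a coordinate projection at such a vertex is an
  idempotent endomorphism. If the space there is nonzero, indecomposability makes this projection
  the identity.\<close>

lemma decorated_cases: fixes N :: "('v + 'v, 'a, 'k::field) rep" assumes N: "rindec QD N"
 obtains M where "rindec Q M" "N = as_decorated M" | i where "i : Q0" "riso QD N (neg_simple Q i)" proof (cases "EX i. fst N (Inr i) ~= 0")
 case False
 let ?M = "(%v. fst N (Inl v), snd N)"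
 have eq: "N = as_decorated ?M" proof (rule prod_eqI)
  show "fst N = fst (as_decorated ?M)" by (rule sum_fun_eqI) (use False in simp_all)
 qed (simp add: as_decorated_def)
 have "?M : Rep" using N unfolding rindec_def decorated_reps by (auto simp: reps_def)
 from as_decorated_rindec[OF this] have "rindec Q ?M" using N unfolding eq[symmetric] by blast
 then show thesis by (rule that(1)[OF _ eq])
next
 case True
 then obtain i where i: "fst N (Inr i) ~= 0" by blast
 have Nr: "N : reps QD" using N unfolding rindec_def by blast
 have iQ: "i : Q0" proof (rule ccontr)
  assume "i ~: Q0"
  then have "fst N (Inr i) = 0" using Nr unfolding decorated_reps by simp
  then show False using i by simp
 qed
 \<comment> \<open>Projection onto the first coordinate only, so that equality with
   \<open>rid N\<close> also yields dimension 1 at this vertex and 0 at all others.\<close>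
 define e :: "'v + 'v => 'k lop" where "e = (%v. if v = Inr i then E 1 else (0 :: 'k lop))"
 have "e : rhom QD N N" proof (rule rhomI)
  show "e v : HV (fst N v) (fst N v)" for v using i HV_mono[OF HV_E[of 1], of "fst N v" "fst N v"] by (auto simp: e_def)
 qed (simp add: e_def)
 moreover have "e*e = e" by (auto simp: e_def fun_eq_iff)
 ultimately have "e = 0 \<or> e = rid N" using N unfolding rindec_def by blast
 moreover have "e ~= 0" by (auto simp: e_def fun_eq_iff)
 ultimately have er: "e = rid N" by blast
 have "E (fst N v) = (E (if v = Inr i then 1 else 0) :: 'k lop)" for v
  using fun_cong[OF er[symmetric], of v] by (cases "v = Inr i") (simp_all add: rid_def e_def)
 then have d: "fst N v = (if v = Inr i then 1 else 0)" for v by simp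
 have "ar N a = 0" if "a : Q1" for a using ar_HV[OF Nr, of a] that HV_0l by (simp add: d)
 then have "rid N : rhom QD N (neg_simple Q i)" "rid N : rhom QD (neg_simple Q i) N" by (auto intro!: rhomI simp: rid_def d neg_simps)
 moreover have "rid N = rid (neg_simple Q i)" by (simp add: rid_def fun_eq_iff d neg_simps)
 ultimately have "riso QD N (neg_simple Q i)" unfolding riso_def by (metis rid_idem)
 then show thesis by (rule that(2)[OF iQ])
qed

lemma neg_simple_not_as_decorated: "~ riso QD (neg_simple Q i) (as_decorated M)"
 using fun_cong[OF riso_dim[of QD "neg_simple Q i" "as_decorated M"], of "Inr i"] by (auto simp: neg_simps)

lemma neg_simple_riso: assumes "riso QD (neg_simple Q i) (neg_simple Q j)" shows "i = j"
 using fun_cong[OF riso_dim[OF assms], of "Inr i"] by (simp add: neg_simps split: if_splits)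

lemma sdim_as_decorated: "sdim (as_decorated (M :: ('v, 'a, 'k::field) rep)) = dv M" by (simp add: sdim_def dv_def fun_eq_iff)

lemma sdim_neg_simple: "sdim (neg_simple Q i :: ('v + 'v, 'a, 'k::field) rep) = (%v. - simple_root i v)"
 by (auto simp: sdim_def fun_eq_iff neg_simps simple_root_def)

lemma sdim_class_iso: assumes "N : reps QD" shows "sdim_class (iso_class (rep_category QD) N) = sdim N" proof -
 have "N : iso_class (rep_category QD) N" unfolding iso_class_rep[OF assms] using assms riso_refl by blast
 then have "(SOME M. M : iso_class (rep_category QD) N) : iso_class (rep_category QD) N" by (rule someI)
 then have "fst N = fst (SOME M. M : iso_class (rep_category QD) N)" unfolding iso_class_rep[OF assms] using riso_dim by blast
 then show ?thesis unfolding sdim_class_def sdim_def by simp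
qed

end

section \<open>The bijections\<close>

context cluster begin

abbreviation "cls X == iso_class (cluster_category Q \<tau>) (tilde Q \<tau> X)"
abbreviation "dcls N == iso_class (rep_category QD :: (('v + 'v, 'a, 'k) rep, ('v + 'v, 'a, 'k) rep_mor, 'k) lincat) N"
abbreviation "prj i P == rindec Q P & ext_proj P & top_at i P"

lemma stk_sits: "rindec Q M ==> sits (stk M n) M n" unfolding sits_def using D.iso_refl[of "stk M n"] stk_complex[of M n] rindecD(1)[of M] by simp

lemma stk_fund: "rindec Q M ==> fund (stk M 0)" "rindec Q M ==> ext_proj M ==> fund (stk M 1)"
 unfolding fund_def using dg_sits[OF stk_sits] pj_sits[OF stk_sits] by blast+

lemma cls_eq_iff: assumes X: "sits X M n" "fund X" and Y: "sits Y N m" "fund Y" shows "cls X = cls Y <-> n = m & riso Q M N" proof -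
 have "tilde Q \<tau> X : Ob (cluster_category Q \<tau>)" "tilde Q \<tau> Y : Ob (cluster_category Q \<tau>)"
  using O.orb_ob[OF D.brickD(1)[OF sits_brick[OF X(1)]]] O.orb_ob[OF D.brickD(1)[OF sits_brick[OF Y(1)]]] unfolding O_eq .
 then show ?thesis using O.OC.iso_class_eq_iff fund_iso[OF assms] unfolding O_eq by blast
qed

lemma psi_rel_iff: "psi_rel Q \<tau> c m <-> (EX M. rindec Q M & c = cls (stk M 0) & m = dcls (as_decorated M)) \<or>
   (EX i:Q0. EX P. prj i P & c = cls (stk P 1) & m = dcls (neg_simple Q i))"
 unfolding psi_rel_def stalk_stk indec_rep_iff shift_stk by (simp add: indec_projective_at_iff cong: bex_cong)

lemma dcls_eq: "rindec Q M ==> rindec Q M' ==> dcls (as_decorated M) = dcls (as_decorated M') <-> riso Q M M'"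
 "rindec Q M ==> i : Q0 ==> dcls (as_decorated M) ~= dcls (neg_simple Q i)"
 "i : Q0 ==> j : Q0 ==> dcls (neg_simple Q i) = dcls (neg_simple Q j) <-> i = j" proof -
 note M = as_decorated_reps[OF rindecD(1)] and S = neg_simple_reps
 show "dcls (as_decorated M) = dcls (as_decorated M') <-> riso Q M M'" if "rindec Q M" "rindec Q M'"
  unfolding iso_class_rep_iff[OF M[OF that(1)] M[OF that(2)]] by (rule as_decorated_riso)
 show "dcls (as_decorated M) ~= dcls (neg_simple Q i)" if "rindec Q M" "i : Q0"
  unfolding iso_class_rep_iff[OF M[OF that(1)] S[OF that(2)]] using neg_simple_not_as_decorated riso_sym by blast
 show "dcls (neg_simple Q i) = dcls (neg_simple Q j) <-> i = j" if "i : Q0" "j : Q0"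
  unfolding iso_class_rep_iff[OF S[OF that(1)] S[OF that(2)]] using neg_simple_riso riso_refl[OF S[OF that(1)]] by blast
qed

text \<open>Read from left to right this says that the prescription does not depend on
  representatives, and from right to left that it is injective. In the projective case it combines
  uniqueness of P_i with uniqueness of its top.\<close>

lemma psi_rel_unique: assumes "psi_rel Q \<tau> c m" "psi_rel Q \<tau> c' m'" shows "c = c' <-> m = m'" proof -
 note eq = cls_eq_iff[OF stk_sits _ stk_sits]
 have 1: "cls (stk M 0) = cls (stk M' 0) <-> riso Q M M'" if "rindec Q M" "rindec Q M'" for M M'
  using eq[OF that(1) stk_fund(1)[OF that(1)] that(2) stk_fund(1)[OF that(2)]] by simp
 have 2: "cls (stk M 0) ~= cls (stk P 1)" if "rindec Q M" "prj i P" for M P i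
  using eq[OF that(1) stk_fund(1)[OF that(1)], of P 1] stk_fund(2)[of P] that(2) by simp
 have 3: "cls (stk P 1) = cls (stk P' 1) <-> i = j" if ij: "i : Q0" "j : Q0" and P: "prj i P" "prj j P'" for P P' i j proof -
  have "cls (stk P 1) = cls (stk P' 1) <-> riso Q P P'" using eq[of P 1 P' 1] stk_fund(2) P by blast
  moreover have "riso Q P P'" if "i = j" using projective_unique[of P P' i] P ij that by blast
  \<comment> \<open>An isomorphism carries the map onto the simple at \<open>j\<close> back to
    \<open>P\<close>, so \<open>P\<close> has both \<open>i\<close> and \<open>j\<close> in its
    top.\<close>
  moreover have "i = j" if iso: "riso Q P P'" proof -
   obtain f g where f: "f : rhm P P'" "g : rhm P' P" "g*f = rid P" "f*g = rid P'" using iso unfolding riso_def by blast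
   obtain h where h: "h : rhm P' (simple_rep Q j)" "h j ~= 0" using P(2) unfolding top_at_def by blast
   have "h = (h*f)*g" unfolding mult.assoc f(4) rid_right[OF h(1)] ..
   then have "(h*f) j ~= 0" using h(2) by (metis mult_zero_left times_fun_apply)
   then have "top_at j P" unfolding top_at_def using rhom_mult[OF h(1) f(1)] by blast
   then show ?thesis using top_at_unique[of P i j] P(1) ij by blast
  qed
  ultimately show ?thesis by blast
 qed
 show ?thesis using assms unfolding psi_rel_iff proof (elim disjE exE bexE conjE)
  fix M M' assume M: "rindec Q M" "c = cls (stk M 0)" "m = dcls (as_decorated M)" "rindec Q M'" "c' = cls (stk M' 0)" "m' = dcls (as_decorated M')"
  show ?thesis unfolding M(2,3,5,6) 1[OF M(1,4)] dcls_eq(1)[OF M(1,4)] ..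
 next
  fix M i P assume M: "rindec Q M" "c = cls (stk M 0)" "m = dcls (as_decorated M)"
   and P: "i : Q0" "rindec Q P" "ext_proj P" "top_at i P" "c' = cls (stk P 1)" "m' = dcls (neg_simple Q i)"
  show ?thesis unfolding M(2,3) P(5,6) using 2[OF M(1)] P(2-4) dcls_eq(2)[OF M(1) P(1)] by blast
 next
  fix M i P assume P: "i : Q0" "rindec Q P" "ext_proj P" "top_at i P" "c = cls (stk P 1)" "m = dcls (neg_simple Q i)"
   and M: "rindec Q M" "c' = cls (stk M 0)" "m' = dcls (as_decorated M)"
  show ?thesis unfolding M(2,3) P(5,6) using 2[OF M(1)] P(2-4) dcls_eq(2)[OF M(1) P(1)] by metis
 next
  fix i P j P' assume P: "i : Q0" "rindec Q P" "ext_proj P" "top_at i P" "c = cls (stk P 1)" "m = dcls (neg_simple Q i)"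
   and P': "j : Q0" "rindec Q P'" "ext_proj P'" "top_at j P'" "c' = cls (stk P' 1)" "m' = dcls (neg_simple Q j)"
  show ?thesis unfolding P(5,6) P'(5,6) using 3[OF P(1) P'(1)] P(2-4) P'(2-4) dcls_eq(3)[OF P(1) P'(1)] by blast
 qed
qed

lemma psi_rel_ind: assumes "psi_rel Q \<tau> c m" shows "c : ind (cluster_category Q \<tau>)" "m : ind (rep_category QD)" proof -
 have t: "cls (stk M n) : ind (cluster_category Q \<tau>)" if "rindec Q M" for M n
  unfolding ind_def using tilde_indecomposable[OF brick_rindec[OF that]] by blast
 have d: "dcls N : ind (rep_category QD)" if "rindec QD N" for N unfolding ind_def using that indec_rep_iff by blast
 have a: "rindec QD (as_decorated M)" if "rindec Q M" for M :: "('v, 'a, 'k) rep" using as_decorated_rindec[OF rindecD(1)[OF that]] that by blast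
 show "c : ind (cluster_category Q \<tau>)" using assms t unfolding psi_rel_iff by blast
 show "m : ind (rep_category QD)" using assms d a neg_simple_rindec unfolding psi_rel_iff by blast
qed

lemma psi_rel_left_total: assumes "c : ind (cluster_category Q \<tau>)" shows "EX m. psi_rel Q \<tau> c m" proof -
 obtain U where U: "indecomposable (cluster_category Q \<tau>) U" "c = iso_class (cluster_category Q \<tau>) U" using assms unfolding ind_def by blast
 obtain X where X: "D.brick X" "fund X" "U = tilde Q \<tau> X" by (rule indecomposable_tilde[OF U(1)])
 obtain M n where M: "sits X M n" using brick_sits[OF X(1)] by blast
 have R: "rindec Q M" using M unfolding sits_def by blast
 have c: "c = cls X" using U(2) X(3) by simp
 have cc: "c = cls (stk M n)" if "fund (stk M n)" unfolding c using cls_eq_iff[OF M X(2) stk_sits[OF R] that] riso_refl[OF rindecD(1)[OF R]] by blast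
 have "n = 0 \<or> n = 1 & ext_proj M" using X(2) dg_sits[OF M] pj_sits[OF M] unfolding fund_def by simp
 then show ?thesis proof
  assume "n = 0"
  then show ?thesis unfolding psi_rel_iff using cc stk_fund(1)[OF R] R by blast
 next
  assume n: "n = 1 & ext_proj M"
  obtain v where "fst M v ~= 0" using rindecD(2)[OF R] by blast
  then obtain i where i: "i : Q0" "top_at i M" by (rule top_exists[OF rindecD(1)[OF R]])
  have "c = cls (stk M 1)" using cc n stk_fund(2)[OF R] by blast
  then show ?thesis unfolding psi_rel_iff using R n i by blast
 qed
qed

lemma psi_rel_right_total: assumes "m : ind (rep_category QD :: (('v + 'v, 'a, 'k) rep, ('v + 'v, 'a, 'k) rep_mor, 'k) lincat)"
 shows "EX c. psi_rel Q \<tau> c m" proof -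
 obtain N where N: "rindec QD N" "m = dcls N" using assms unfolding ind_def indec_rep_iff by blast
 show ?thesis using N(1) proof (rule decorated_cases)
  fix M assume "rindec Q M" "N = as_decorated M"
  then show ?thesis unfolding psi_rel_iff using N(2) by blast
 next
  fix i assume i: "i : Q0" "riso QD N (neg_simple Q i)"
  have "m = dcls (neg_simple Q i)" using iso_class_rep_iff[OF _ neg_simple_reps[OF i(1)], of N] i(2) N unfolding rindec_def by blast
  moreover obtain P :: "('v, 'a, 'k) rep" where "rindec Q P" "ext_proj P" "top_at i P" by (rule projective_exists[OF i(1)])
  ultimately show ?thesis unfolding psi_rel_iff using i(1) by blast
 qed
qed

lemma psi_eq: "psi_rel Q \<tau> c m ==> psi Q \<tau> c = m" unfolding psi_def by (rule the_equality) (use psi_rel_unique in blast)+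

lemma psi_bij: "bij_betw (psi Q \<tau>) (ind (cluster_category Q \<tau>)) (ind (rep_category QD))" proof (rule bij_betwI')
 fix c c' assume "c : ind (cluster_category Q \<tau>)" "c' : ind (cluster_category Q \<tau>)"
 then obtain m m' where m: "psi_rel Q \<tau> c m" "psi_rel Q \<tau> c' m'" using psi_rel_left_total by meson
 show "psi Q \<tau> c = psi Q \<tau> c' <-> c = c'" unfolding psi_eq[OF m(1)] psi_eq[OF m(2)] using psi_rel_unique[OF m] by blast
next
 fix c assume "c : ind (cluster_category Q \<tau>)"
 then obtain m where m: "psi_rel Q \<tau> c m" using psi_rel_left_total by meson
 show "psi Q \<tau> c : ind (rep_category QD)" unfolding psi_eq[OF m] by (rule psi_rel_ind(2)[OF m])
next
 fix m :: "('v + 'v, 'a, 'k) rep set" assume "m : ind (rep_category QD)"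
 then obtain c where "psi_rel Q \<tau> c m" using psi_rel_right_total by meson
 then show "EX c:ind (cluster_category Q \<tau>). m = psi Q \<tau> c" using psi_eq psi_rel_ind(1) by metis
qed

lemma sdim_dcls: "rindec Q M ==> sdim_class (dcls (as_decorated M)) = dv M" "i : Q0 ==> sdim_class (dcls (neg_simple Q i)) = (%v. - simple_root i v)"
 using sdim_class_iso[OF as_decorated_reps[OF rindecD(1)]] sdim_class_iso[OF neg_simple_reps] by (simp_all add: sdim_as_decorated sdim_neg_simple)

lemma rindec_root: assumes "rindec Q (M :: ('v, 'a, 'k) rep)" shows "dv M : roots Q" "ALL v. dv M v >= 0" proof -
 show "ALL v. dv M v >= 0" by (simp add: dv_def)
 show "dv M : roots Q" proof (rule root_if_eform)
  show "eform (dv M) (dv M) = 1" by (rule brick_rigid(2)[OF rindecD[OF assms] rindec_brick[OF assms]])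
 qed (simp_all add: dv_def dim_outside[OF rindecD(1)[OF assms]])
qed

lemma ind_decorated: assumes "m : ind (rep_category QD :: (('v + 'v, 'a, 'k) rep, ('v + 'v, 'a, 'k) rep_mor, 'k) lincat)"
 obtains M where "rindec Q M" "m = dcls (as_decorated M)" | i where "i : Q0" "m = dcls (neg_simple Q i)"
 using psi_rel_right_total[OF assms] unfolding psi_rel_iff by blast

text \<open>A nonnegative vector is never a negated simple root, so the two kinds of modules do not
  interfere. On the nonnegative part injectivity is \<open>rindec_unique\<close>, and surjectivity
  is \<open>rindec_exists\<close>, since every root has Euler form 1.\<close>

lemma sdim_bij: "bij_betw sdim_class (ind (rep_category QD :: (('v + 'v, 'a, 'k) rep, ('v + 'v, 'a, 'k) rep_mor, 'k) lincat)) (almost_positive_roots Q)"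
proof (rule bij_betwI')
 let ?I = "ind (rep_category QD :: (('v + 'v, 'a, 'k) rep, ('v + 'v, 'a, 'k) rep_mor, 'k) lincat)"
 have pn: "dv M ~= (%v. - simple_root i v)" for M :: "('v, 'a, 'k) rep" and i by (auto simp: dv_def simple_root_def fun_eq_iff intro!: exI[of _ i])
 {
  fix m m' assume m: "m : ?I" "m' : ?I"
  have "m = m'" if eq: "sdim_class m = sdim_class m'" proof (rule ind_decorated[OF m(1)])
   fix M assume M: "rindec Q M" "m = dcls (as_decorated M)"
   show ?thesis proof (rule ind_decorated[OF m(2)])
    fix M' assume M': "rindec Q M'" "m' = dcls (as_decorated M')"
    have "dv M = dv M'" using eq M(2) M'(2) sdim_dcls(1)[OF M(1)] sdim_dcls(1)[OF M'(1)] by simp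
    then have "fst M = fst M'" by (auto simp: dv_def fun_eq_iff)
    from rindec_unique[OF M(1) M'(1) this] show ?thesis unfolding M(2) M'(2) dcls_eq(1)[OF M(1) M'(1)] .
   next
    fix i assume "i : Q0" "m' = dcls (neg_simple Q i)"
    then show ?thesis using eq M sdim_dcls pn by metis
   qed
  next
   fix i assume i: "i : Q0" "m = dcls (neg_simple Q i)"
   show ?thesis proof (rule ind_decorated[OF m(2)])
    fix M' assume "rindec Q M'" "m' = dcls (as_decorated M')"
    then show ?thesis using eq i sdim_dcls pn by metis
   next
    fix j assume j: "j : Q0" "m' = dcls (neg_simple Q j)"
    have "(%v. - simple_root i v) = (%v. - simple_root j v)" using eq sdim_dcls(2)[OF i(1)] sdim_dcls(2)[OF j(1)] i(2) j(2) by simp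
    then have "i = j" by (auto simp: simple_root_def fun_eq_iff split: if_splits)
    then show ?thesis using i(2) j(2) by simp
   qed
  qed
  then show "sdim_class m = sdim_class m' <-> m = m'" by blast
 }
 fix m assume m: "m : ?I"
 show "sdim_class m : almost_positive_roots Q"
  by (rule ind_decorated[OF m]) (use sdim_dcls rindec_root in \<open>auto simp: almost_positive_roots_def\<close>)
next
 fix c assume "c : almost_positive_roots Q"
 then consider "c : roots Q" "ALL v. c v >= 0" | i where "i : Q0" "c = (%v. - simple_root i v)" unfolding almost_positive_roots_def by blast
 then show "EX m:ind (rep_category QD :: (('v + 'v, 'a, 'k) rep, ('v + 'v, 'a, 'k) rep_mor, 'k) lincat). c = sdim_class m" proof cases
  case 1
  obtain M :: "('v, 'a, 'k) rep" where M: "rindec Q M" "dv M = c" using rindec_exists[of c] root_eform[OF 1(1)] 1(2) by metis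
  have "psi_rel Q \<tau> (cls (stk M 0)) (dcls (as_decorated M))" unfolding psi_rel_iff using M(1) by blast
  then show ?thesis using psi_rel_ind(2) sdim_dcls(1)[OF M(1)] M(2) by metis
 next
  case (2 i)
  have "dcls (neg_simple Q i) : ind (rep_category QD)" unfolding ind_def indec_rep_iff using neg_simple_rindec[OF 2(1)] by blast
  then show ?thesis using sdim_dcls(2)[OF 2(1)] 2(2) by metis
 qed
qed

lemma gamma_bij: "bij_betw (gamma Q \<tau>) (ind (cluster_category Q \<tau>)) (almost_positive_roots Q)"
 unfolding gamma_def by (rule bij_betw_trans[OF psi_bij sdim_bij])

end

theorem proposition4p1:
  fixes Q :: "('v, 'a) pre_digraph"
    and \<Delta> :: dynkin
    and \<tau> :: "('v, 'a, 'k::alg_closed_field) D_functor"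
  assumes "fin_digraph Q"
    and "valid_dynkin \<Delta>"
    and "underlying_graph_is Q \<Delta>"
    and "AR_translation Q \<tau>"
  shows "(\<forall>c\<in>ind (cluster_category Q \<tau>). \<exists>!m. psi_rel Q \<tau> c m) \<and>
    bij_betw (psi Q \<tau>) (ind (cluster_category Q \<tau>))
      (ind (rep_category (decorated_quiver Q)
         :: (('v + 'v, 'a, 'k) rep, ('v + 'v, 'a, 'k) rep_mor, 'k) lincat)) \<and>
    bij_betw (gamma Q \<tau>) (ind (cluster_category Q \<tau>)) (almost_positive_roots Q) \<and>
    (\<forall>(S :: ('v, 'f::field_char_0) seed) \<kappa>.
       FZ_initial_seed Q S \<longrightarrow> FZ_correspondence Q S \<kappa> \<longrightarrow>
       bij_betw (\<kappa> \<circ> gamma Q \<tau>) (ind (cluster_category Q \<tau>))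
         (cluster_variables (verts Q) S))"
proof -
 interpret pos_quiver Q by (rule dynkin_pos_quiver[OF assms(1-3)])
 interpret cluster Q \<tau> by unfold_locales (rule assms(4))
 show ?thesis proof (intro conjI ballI allI impI)
  show "EX! m. psi_rel Q \<tau> c m" if "c : ind (cluster_category Q \<tau>)" for c using psi_rel_left_total[OF that] psi_rel_unique by blast
  show "bij_betw (\<kappa> \<circ> gamma Q \<tau>) (ind (cluster_category Q \<tau>)) (cluster_variables (verts Q) S)"
   if "FZ_correspondence Q S \<kappa>" for S :: "('v, 'f) seed" and \<kappa>
   using bij_betw_trans[OF gamma_bij] that unfolding FZ_correspondence_def by blast
 qed (rule psi_bij gamma_bij)+
qed

end
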